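(* Let $G\subset\mathrm{Aut}(Q_{2,2})$ be a finite subgroup such that $\mathrm{Pic}(Q_{2,2})^G\cong\mathbb{Z}$. Then $G$ is isomorphic to one of the following groups (which are all strongly minimal): $$(\mathbb{Z}/n\,\triangle_D\,\mathbb{Z}/n)_\bullet 2\;\cong\;(\mathbb{Z}/m\times\mathbb{Z}/k)_\bullet\,\mathbb{Z}/2,\qquad (\mathrm{D}_n\,\triangle_D\,\mathrm{D}_n)_\bullet 2 .$$
   Context: $Q_{2,2}=\{x_1^2+x_2^2-x_3^2-x_4^2=0\}\subset\mathbb{P}^3_{\mathbb{R}}$ is the real quadric surface isomorphic to $\mathbb{P}^1_{\mathbb{R}}\times\mathbb{P}^1_{\mathbb{R}}$. A finite group $G$ acting on a real del Pezzo surface $X$ is called strongly minimal if $\mathrm{rk}\,\mathrm{Pic}(X)^G=1$. $\mathbb{Z}/n$ is the cyclic group of order $n$ (also written simply $n$, so $2$ denotes $\mathbb{Z}/2$), and $\mathrm{D}_n$ is the dihedral group of order $2n$; $n,m,k$ are positive integers. $A\triangle_D B$ is the diagonal product of $A$ and $B$ over their common homomorphic image $D$, i.e. the subgroup of $A\times B$ of pairs $(a,b)$ such that $\alpha(a)=\beta(b)$ for some epimorphisms $\alpha:A\to D$, $\beta:B\to D$. $A_\bullet B$ denotes an extension of $B$ by $A$ (normal subgroup $A$, quotient $B$). *)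

theory Defs
  imports
    "HOL-Analysis.Finite_Cartesian_Product"
    "HOL-Algebra.Elementary_Groups"
    "HOL-Algebra.Bij"
    "HOL-Algebra.FiniteProduct"
    "HOL-Library.Extended_Nat"
begin

section \<open>The real quadric surface\<close>

text \<open>
  A geometrically integral real projective variety is modelled by its set of complex points.
  The real structure is carried by the polynomials: everything below (Zariski-open sets,
  rational functions, regular maps) is given by homogeneous polynomials with \<^emph>\<open>real\<close> coefficients,
  evaluated at complex points. A closed point of the real scheme is a pair of conjugate
  complex points (or one real point), and polynomials with real coefficients do not
  distinguish the two members of such a pair.

  A point of complex projective 3-space is the set of its homogeneous coordinate vectors.
\<close>

definition proj_pt :: "complex^4 \<Rightarrow> (complex^4) set" where
  "proj_pt v = {c *s v | c. c \<noteq> 0}"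

definition Q22 :: "(complex^4) set set" where
  "Q22 = {proj_pt v | v. v \<noteq> 0 \<and> (v$1)\<^sup>2 + (v$2)\<^sup>2 - (v$3)\<^sup>2 - (v$4)\<^sup>2 = 0}"

definition real_form :: "nat \<Rightarrow> (complex^4 \<Rightarrow> complex) \<Rightarrow> bool" where
  "real_form d F \<longleftrightarrow> (\<exists>c :: (4 \<Rightarrow> nat) \<Rightarrow> real. \<forall>x.
     F x = (\<Sum>\<alpha> | (\<Sum>i\<in>UNIV. \<alpha> i) = d. of_real (c \<alpha>) * (\<Prod>i\<in>UNIV. (x$i) ^ \<alpha> i)))"

text \<open>For a form \<open>F\<close>, being nonzero at one coordinate vector of \<open>p\<close> or at all of them is the same.\<close>

definition nonvanishing_at :: "(complex^4 \<Rightarrow> complex) \<Rightarrow> (complex^4) set \<Rightarrow> bool" where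
  "nonvanishing_at F p \<longleftrightarrow> (\<forall>x\<in>p. F x \<noteq> 0)"

section \<open>Automorphisms\<close>

text \<open>
  A map is regular over the reals if near every point it is given by four real forms of equal
  degree without common zero.
\<close>

definition regular_map :: "((complex^4) set \<Rightarrow> (complex^4) set) \<Rightarrow> bool" where
  "regular_map f \<longleftrightarrow> f \<in> Q22 \<rightarrow> Q22 \<and>
     (\<forall>p\<in>Q22. \<exists>d. \<exists>F :: 4 \<Rightarrow> complex^4 \<Rightarrow> complex.
        (\<forall>i. real_form d (F i)) \<and> (\<exists>i. nonvanishing_at (F i) p) \<and>
        (\<forall>q\<in>Q22. \<forall>x\<in>q. (\<exists>i. F i x \<noteq> 0) \<longrightarrow> f q = proj_pt (\<chi> i. F i x)))"

definition Aut_Q22 :: "((complex^4) set \<Rightarrow> (complex^4) set) monoid" where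
  "Aut_Q22 = BijGroup Q22
     \<lparr>carrier := {f \<in> Bij Q22. regular_map f \<and> regular_map (restrict (inv_into Q22 f) Q22)}\<rparr>"

section \<open>The multiplicative group of the function field\<close>

text \<open>
  A nonzero rational function is a class of fractions \<open>F/G\<close> of real forms of equal degree, neither of
  which vanishes identically on the surface.
\<close>

definition fractions :: "((complex^4 \<Rightarrow> complex) \<times> (complex^4 \<Rightarrow> complex)) set" where
  "fractions = {(F, G). \<exists>d. real_form d F \<and> real_form d G \<and>
     (\<exists>p\<in>Q22. nonvanishing_at F p) \<and> (\<exists>p\<in>Q22. nonvanishing_at G p)}"

definition fraction_rel ::
  "(((complex^4 \<Rightarrow> complex) \<times> (complex^4 \<Rightarrow> complex)) \<times>
    ((complex^4 \<Rightarrow> complex) \<times> (complex^4 \<Rightarrow> complex))) set" where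
  "fraction_rel = {((F, G), (F', G')). (F, G) \<in> fractions \<and> (F', G') \<in> fractions \<and>
     (\<forall>p\<in>Q22. \<forall>x\<in>p. F x * G' x = F' x * G x)}"

type_synonym ratfun = "((complex^4 \<Rightarrow> complex) \<times> (complex^4 \<Rightarrow> complex)) set"

definition ratfun_group :: "ratfun monoid" where
  "ratfun_group =
     \<lparr>carrier = fractions // fraction_rel,
      monoid.mult = (\<lambda>A B. fraction_rel ``
        {(\<lambda>x. F x * F' x, \<lambda>x. G x * G' x) | F G F' G'. (F, G) \<in> A \<and> (F', G') \<in> B}),
      one = fraction_rel `` {(\<lambda>_. 1, \<lambda>_. 1)}\<rparr>"

text \<open>The units of the local ring at \<open>p\<close>.\<close>

definition local_units :: "(complex^4) set \<Rightarrow> ratfun set" where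
  "local_units p = {A \<in> carrier ratfun_group.
     \<exists>(F, G)\<in>A. nonvanishing_at F p \<and> nonvanishing_at G p}"

definition pullback_ratfun :: "((complex^4) set \<Rightarrow> (complex^4) set) \<Rightarrow> ratfun \<Rightarrow> ratfun" where
  "pullback_ratfun g A = {(F', G') \<in> fractions.
     \<forall>(F, G)\<in>A. \<forall>p\<in>Q22. \<forall>x\<in>p. \<forall>y\<in>g p. F' x * G y = F y * G' x}"

section \<open>The Picard group\<close>

text \<open>
  Locally principal (Cartier) divisors modulo principal ones. A Cartier divisor is a global section
  of the sheaf \<open>K\<^sup>*/O\<^sup>*\<close>, i.e. a choice at every point \<open>p\<close> of a coset of the local units
  at \<open>p\<close> (the local equations of the divisor at \<open>p\<close>), such that locally (on the basic open set
  where some form \<open>H\<close> does not vanish) all these cosets are represented by one rational function.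
\<close>

definition cartier_group :: "((complex^4) set \<Rightarrow> ratfun set) monoid" where
  "cartier_group =
     \<lparr>carrier = {L \<in> (\<Pi>\<^sub>E p\<in>Q22. rcosets\<^bsub>ratfun_group\<^esub> (local_units p)).
        \<forall>p\<in>Q22. \<exists>d H. real_form d H \<and> nonvanishing_at H p \<and>
          (\<exists>A\<in>carrier ratfun_group. \<forall>q\<in>Q22. nonvanishing_at H q \<longrightarrow>
             L q = local_units q #>\<^bsub>ratfun_group\<^esub> A)},
      monoid.mult = (\<lambda>L M. \<lambda>p\<in>Q22. L p <#>\<^bsub>ratfun_group\<^esub> M p),
      one = (\<lambda>p\<in>Q22. local_units p)\<rparr>"

definition principal_divisors :: "((complex^4) set \<Rightarrow> ratfun set) set" where
  "principal_divisors =
     {(\<lambda>p\<in>Q22. local_units p #>\<^bsub>ratfun_group\<^esub> A) | A. A \<in> carrier ratfun_group}"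

definition Pic_Q22 :: "((complex^4) set \<Rightarrow> ratfun set) set monoid" where
  "Pic_Q22 = cartier_group Mod principal_divisors"

definition pullback_divisor ::
  "((complex^4) set \<Rightarrow> (complex^4) set) \<Rightarrow> ((complex^4) set \<Rightarrow> ratfun set)
     \<Rightarrow> ((complex^4) set \<Rightarrow> ratfun set)" where
  "pullback_divisor g L = (\<lambda>p\<in>Q22. pullback_ratfun g ` L (g p))"

text \<open>
  The action on divisor classes is by pullback, so it is a right action; passing to inverses makes
  it a left action and does not change the invariants.
\<close>

definition Pic_invariants ::
  "((complex^4) set \<Rightarrow> (complex^4) set) set \<Rightarrow> ((complex^4) set \<Rightarrow> ratfun set) set monoid" where
  "Pic_invariants G = Pic_Q22
     \<lparr>carrier := {c \<in> carrier Pic_Q22. \<forall>g\<in>G. pullback_divisor g ` c = c}\<rparr>"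

definition int_independent :: "('a, 'b) monoid_scheme \<Rightarrow> 'a set \<Rightarrow> bool" where
  "int_independent A S \<longleftrightarrow> S \<subseteq> carrier A \<and> finite S \<and>
     (\<forall>c :: 'a \<Rightarrow> int. finprod A (\<lambda>s. s [^]\<^bsub>A\<^esub> c s) S = \<one>\<^bsub>A\<^esub> \<longrightarrow> (\<forall>s\<in>S. c s = 0))"

definition group_rank :: "('a, 'b) monoid_scheme \<Rightarrow> enat" where
  "group_rank A = (SUP S\<in>{S. int_independent A S}. enat (card S))"

definition strongly_minimal :: "((complex^4) set \<Rightarrow> (complex^4) set) set \<Rightarrow> bool" where
  "strongly_minimal G \<longleftrightarrow>
     subgroup G Aut_Q22 \<and> finite G \<and> group_rank (Pic_invariants G) = 1"

section \<open>Finite groups\<close>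

text \<open>
  The dihedral group of order \<open>2n\<close>, for positive \<open>n\<close>: with a rotation \<open>r\<close> of order \<open>n\<close> and a reflection \<open>t\<close>,
  the pair \<open>(a, False)\<close> stands for \<open>r\<^sup>a\<close> and \<open>(a, True)\<close> for \<open>r\<^sup>a t\<close>.
\<close>

definition dihedral_group :: "nat \<Rightarrow> (int \<times> bool) monoid" where
  "dihedral_group n =
     \<lparr>carrier = {0..<int n} \<times> UNIV,
      monoid.mult = (\<lambda>(a, s) (b, t). ((if s then a - b else a + b) mod int n, s \<noteq> t)),
      one = (0, False)\<rparr>"

definition diagonal_product ::
  "'a monoid \<Rightarrow> 'b monoid \<Rightarrow> ('a \<Rightarrow> 'd) \<Rightarrow> ('b \<Rightarrow> 'd) \<Rightarrow> ('a \<times> 'b) monoid" where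
  "diagonal_product A B \<alpha> \<beta> =
     (A \<times>\<times> B)\<lparr>carrier := {(a, b) \<in> carrier A \<times> carrier B. \<alpha> a = \<beta> b}\<rparr>"

definition is_extension :: "'a monoid \<Rightarrow> 'b monoid \<Rightarrow> 'e monoid \<Rightarrow> bool" where
  "is_extension A B E \<longleftrightarrow> (\<exists>N. N \<lhd> E \<and> E\<lparr>carrier := N\<rparr> \<cong> A \<and> E Mod N \<cong> B)"

text \<open>
  \<open>E\<close> is an extension of the group of order two by a diagonal product of two copies of \<open>A\<close> over \<open>D\<close>.
  As the notation for the diagonal product does not mention the two epimorphisms, they are
  quantified existentially.
\<close>

definition diagonal_square_by_2 :: "'a monoid \<Rightarrow> 'd monoid \<Rightarrow> 'e monoid \<Rightarrow> bool" where
  "diagonal_square_by_2 A D E \<longleftrightarrow>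
     (\<exists>\<alpha>\<in>epi A D. \<exists>\<beta>\<in>epi A D. is_extension (diagonal_product A A \<alpha> \<beta>) (integer_mod_group 2) E)"

text \<open>
  The groups \<open>D\<close> occurring here are finite, so nothing is lost by taking their elements to be
  natural numbers.
\<close>

definition cyclic_family :: "nat \<Rightarrow> nat monoid \<Rightarrow> 'e monoid \<Rightarrow> bool" where
  "cyclic_family n D E \<longleftrightarrow> n \<ge> 1 \<and> group D \<and> diagonal_square_by_2 (integer_mod_group n) D E"

definition dihedral_family :: "nat \<Rightarrow> nat monoid \<Rightarrow> 'e monoid \<Rightarrow> bool" where
  "dihedral_family n D E \<longleftrightarrow> n \<ge> 1 \<and> group D \<and> diagonal_square_by_2 (dihedral_group n) D E"

definition abelian_family :: "nat \<Rightarrow> nat \<Rightarrow> 'e monoid \<Rightarrow> bool" where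
  "abelian_family m k E \<longleftrightarrow> m \<ge> 1 \<and> k \<ge> 1 \<and>
     is_extension (integer_mod_group m \<times>\<times> integer_mod_group k) (integer_mod_group 2) E"

end

theory Submission
  imports
    Defs
    "HOL-Analysis.Cartesian_Euclidean_Space"
    "HOL-Computational_Algebra.Polynomial_Factorial"
    "HOL-Computational_Algebra.Fundamental_Theorem_Algebra"
    "HOL-Computational_Algebra.Field_as_Ring"
begin

text \<open>
  In the coordinates \<open>a = x\<^sub>1 - x\<^sub>3\<close>, \<open>b = x\<^sub>4 - x\<^sub>2\<close>, \<open>c = x\<^sub>4 + x\<^sub>2\<close>, \<open>d = x\<^sub>1 + x\<^sub>3\<close> the equation of the quadric is \<open>a d = b c\<close>.
  So it is the image of the Segre embedding of a product of two projective lines, and everything about it can be said in terms of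
  polynomials in two real variables: forms of degree \<open>d\<close> become polynomials of bidegree \<open>(d, d)\<close>, and the
  function field is the field of fractions of \<open>\<real>[x, y]\<close>.

  The Picard group is \<open>\<int>\<^sup>2\<close>, generated by the lines of the two rulings. The reason is that \<open>\<real>[x, y]\<close> is factorial and that
  a real prime has a complex zero off the zeros of each polynomial that it does not divide (\<open>prime_has_zero_off\<close>). So a Cartier divisor
  has a well-defined multiplicity along each prime, and subtracting the corresponding principal divisor leaves a combination
  of the lines at infinity of the two factors (\<open>divisor_equivalent_to_lines\<close>, \<open>lines_independent\<close>).

  By the same unique factorisation both components of an automorphism are given by pairs of coprime polynomials of a certain bidegree. The two
  bidegrees form a matrix over the natural numbers, whose inverse belongs to the inverse automorphism and has natural entries, too. Hence it is a
  permutation matrix, and an automorphism is a pair of real projective transformations of the line, possibly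
  followed by the exchange of the factors (\<open>carrier_Aut_Q22\<close>). The automorphisms that exchange the factors exchange the two generators of the
  Picard group, the others fix them (\<open>pullback_line_class\<close>). Therefore the invariant classes are isomorphic to \<open>\<int>\<close> exactly if \<open>G\<close>
  contains an exchange.

  Let \<open>w \<in> G\<close> be an exchange and \<open>N\<close> the subgroup of index two that preserves the factors. The image of \<open>N\<close> in the first
  factor is a finite group of real projective transformations. It preserves a positive definite quadratic form up to scalars
  (\<open>orthogonal_representation\<close>), so it is cyclic or dihedral (\<open>cyclic_or_dihedral_image\<close>). Conjugation with \<open>w\<close> turns the projection of \<open>N\<close> to the first
  factor into the one to the second factor, so both images are the same group \<open>A\<close>, and by Goursat's lemma \<open>N\<close> is a diagonal product
  of two copies of \<open>A\<close> (\<open>diagonal_square_if_conjugate_projections\<close>).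

  Conversely let \<open>A\<close> be a cyclic or dihedral group, realised by the isometries of a regular polygon, and \<open>\<alpha>\<close> an epimorphism from \<open>A\<close> to
  \<open>D\<close>. The pairs \<open>(a, b)\<close> with \<open>\<alpha> a = \<alpha> b\<close>, together with their products with the exchange, form a finite group of automorphisms
  (\<open>diagonal_square_realised\<close>). The two descriptions of the cyclic family agree since a diagonal product of two cyclic groups of order \<open>n\<close> is isomorphic to
  \<open>\<int>/n \<times> \<int>/l\<close> for some \<open>l\<close>, and \<open>\<int>/m \<times> \<int>/k\<close> to \<open>\<int>/lcm(m, k) \<times> \<int>/gcd(m, k)\<close>.
\<close>

section \<open>Real forms\<close>

definition coord_monomial :: "(4 \<Rightarrow> nat) \<Rightarrow> complex^4 \<Rightarrow> complex" where
  "coord_monomial \<alpha> x = (\<Prod>i\<in>UNIV. (x$i) ^ \<alpha> i)"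

lemma finite_exponents: "finite {\<alpha> :: 4 \<Rightarrow> nat. (\<Sum>i\<in>UNIV. \<alpha> i) = d}"
proof (rule finite_subset)
  show "{\<alpha> :: 4 \<Rightarrow> nat. (\<Sum>i\<in>UNIV. \<alpha> i) = d} \<subseteq> PiE UNIV (\<lambda>_. {..d})"
    by (auto intro: member_le_sum)
  show "finite (PiE (UNIV :: 4 set) (\<lambda>_. {..d}))"
    by (intro finite_PiE) auto
qed

lemma real_form_iff:
  "real_form d F \<longleftrightarrow> (\<exists>c :: (4 \<Rightarrow> nat) \<Rightarrow> real. \<forall>x.
     F x = (\<Sum>\<alpha> | (\<Sum>i\<in>UNIV. \<alpha> i) = d. of_real (c \<alpha>) * coord_monomial \<alpha> x))"
  by (simp add: real_form_def coord_monomial_def)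

lemma real_formE:
  assumes "real_form d F"
  obtains c :: "(4 \<Rightarrow> nat) \<Rightarrow> real"
    where "\<And>x. F x = (\<Sum>\<alpha> | (\<Sum>i\<in>UNIV. \<alpha> i) = d. of_real (c \<alpha>) * coord_monomial \<alpha> x)"
  using assms unfolding real_form_iff by (elim exE) (rule that, erule spec)

lemma real_form_zero: "real_form d (\<lambda>_. 0)"
  unfolding real_form_iff by (rule exI[of _ "\<lambda>_. 0"]) simp

lemma real_form_add:
  assumes "real_form d F" "real_form d G"
  shows "real_form d (\<lambda>x. F x + G x)"
proof -
  obtain c c' where "\<And>x. F x = (\<Sum>\<alpha> | (\<Sum>i\<in>UNIV. \<alpha> i) = d. of_real (c \<alpha>) * coord_monomial \<alpha> x)"
    "\<And>x. G x = (\<Sum>\<alpha> | (\<Sum>i\<in>UNIV. \<alpha> i) = d. of_real (c' \<alpha>) * coord_monomial \<alpha> x)"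
    by (rule real_formE[OF assms(1)], rule real_formE[OF assms(2)]) blast
  then have "\<forall>x. F x + G x = (\<Sum>\<alpha> | (\<Sum>i\<in>UNIV. \<alpha> i) = d. of_real (c \<alpha> + c' \<alpha>) * coord_monomial \<alpha> x)"
    by (simp add: sum.distrib distrib_right)
  then show ?thesis unfolding real_form_iff by (intro exI)
qed

lemma real_form_scale:
  assumes "real_form d F"
  shows "real_form d (\<lambda>x. of_real r * F x)"
proof -
  obtain c where "\<And>x. F x = (\<Sum>\<alpha> | (\<Sum>i\<in>UNIV. \<alpha> i) = d. of_real (c \<alpha>) * coord_monomial \<alpha> x)"
    by (rule real_formE[OF assms]) blast
  then have "\<forall>x. of_real r * F x = (\<Sum>\<alpha> | (\<Sum>i\<in>UNIV. \<alpha> i) = d. of_real (r * c \<alpha>) * coord_monomial \<alpha> x)"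
    by (simp add: sum_distrib_left mult.assoc)
  then show ?thesis unfolding real_form_iff by (intro exI)
qed

lemma real_form_monomial:
  assumes "(\<Sum>i\<in>UNIV. \<alpha> i) = d"
  shows "real_form d (coord_monomial \<alpha>)"
proof -
  have "coord_monomial \<alpha> x = (\<Sum>\<beta> | (\<Sum>i\<in>UNIV. \<beta> i) = d.
      of_real (if \<beta> = \<alpha> then 1 else 0) * coord_monomial \<beta> x)" for x
  proof -
    have "(\<Sum>\<beta> | (\<Sum>i\<in>UNIV. \<beta> i) = d. of_real (if \<beta> = \<alpha> then 1 else 0) * coord_monomial \<beta> x)
        = (\<Sum>\<beta> | (\<Sum>i\<in>UNIV. \<beta> i) = d. if \<beta> = \<alpha> then coord_monomial \<beta> x else 0)"
      by (intro sum.cong) auto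
    also have "\<dots> = coord_monomial \<alpha> x"
      using assms by (subst sum.delta) (auto intro: finite_exponents)
    finally show ?thesis by simp
  qed
  then show ?thesis unfolding real_form_iff by (intro exI allI)
qed

lemma real_form_span:
  assumes "real_form d F"
    and zero: "P (\<lambda>_. 0)"
    and add: "\<And>F G. P F \<Longrightarrow> P G \<Longrightarrow> P (\<lambda>x. F x + G x)"
    and scale: "\<And>r F. P F \<Longrightarrow> P (\<lambda>x. complex_of_real r * F x)"
    and mono: "\<And>\<alpha>. (\<Sum>i\<in>UNIV. \<alpha> i) = d \<Longrightarrow> P (coord_monomial \<alpha>)"
  shows "P F"
proof -
  obtain c where c: "\<And>x. F x = (\<Sum>\<alpha> | (\<Sum>i\<in>UNIV. \<alpha> i) = d. of_real (c \<alpha>) * coord_monomial \<alpha> x)"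
    by (rule real_formE[OF assms(1)]) blast
  have "P (\<lambda>x. \<Sum>\<alpha>\<in>S. of_real (c \<alpha>) * coord_monomial \<alpha> x)"
    if "finite S" "S \<subseteq> {\<alpha>. (\<Sum>i\<in>UNIV. \<alpha> i) = d}" for S
    using that
  proof (induction S)
    case empty
    then show ?case using zero by simp
  next
    case (insert a S)
    then show ?case by (simp add: add scale mono)
  qed
  from this[OF finite_exponents order_refl] show ?thesis
    by (simp add: c[abs_def])
qed

lemma real_form_mult:
  assumes "real_form d F" "real_form e G"
  shows "real_form (d + e) (\<lambda>x. F x * G x)"
  using assms(1)
proof (rule real_form_span)
  show "real_form (d + e) (\<lambda>x. 0 * G x)" by (simp add: real_form_zero)
next
  fix F F' assume "real_form (d + e) (\<lambda>x. F x * G x)" "real_form (d + e) (\<lambda>x. F' x * G x)"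
  from real_form_add[OF this] show "real_form (d + e) (\<lambda>x. (F x + F' x) * G x)"
    by (simp add: distrib_right)
next
  fix r F assume "real_form (d + e) (\<lambda>x. F x * G x)"
  from real_form_scale[OF this, of r] show "real_form (d + e) (\<lambda>x. complex_of_real r * F x * G x)"
    by (simp add: mult.assoc)
next
  fix \<alpha> :: "4 \<Rightarrow> nat" assume \<alpha>: "(\<Sum>i\<in>UNIV. \<alpha> i) = d"
  show "real_form (d + e) (\<lambda>x. coord_monomial \<alpha> x * G x)"
    using assms(2)
  proof (rule real_form_span)
    show "real_form (d + e) (\<lambda>x. coord_monomial \<alpha> x * 0)" by (simp add: real_form_zero)
  next
    fix F F' assume "real_form (d + e) (\<lambda>x. coord_monomial \<alpha> x * F x)"
      "real_form (d + e) (\<lambda>x. coord_monomial \<alpha> x * F' x)"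
    from real_form_add[OF this] show "real_form (d + e) (\<lambda>x. coord_monomial \<alpha> x * (F x + F' x))"
      by (simp add: distrib_left)
  next
    fix r F assume "real_form (d + e) (\<lambda>x. coord_monomial \<alpha> x * F x)"
    from real_form_scale[OF this, of r]
    show "real_form (d + e) (\<lambda>x. coord_monomial \<alpha> x * (complex_of_real r * F x))"
      by (simp add: mult_ac)
  next
    fix \<beta> :: "4 \<Rightarrow> nat" assume \<beta>: "(\<Sum>i\<in>UNIV. \<beta> i) = e"
    have "(\<lambda>x. coord_monomial \<alpha> x * coord_monomial \<beta> x) = coord_monomial (\<lambda>i. \<alpha> i + \<beta> i)"
      by (simp add: coord_monomial_def fun_eq_iff power_add prod.distrib)
    then show "real_form (d + e) (\<lambda>x. coord_monomial \<alpha> x * coord_monomial \<beta> x)"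
      using \<alpha> \<beta> by (simp add: real_form_monomial sum.distrib)
  qed
qed

text \<open>
  Real forms are what coordinates generate under sums, real multiples and products. Everything that
  is needed about forms (their pullback to the product of two lines, substitution of linear maps,
  homogeneity, continuity) is closed under these operations, so it follows by this induction.
\<close>

lemma real_form_induct:
  assumes "real_form d F"
    and zero: "\<And>d. P d (\<lambda>_. 0)"
    and one: "P 0 (\<lambda>_. 1)"
    and coord: "\<And>i. P 1 (\<lambda>x. x$i)"
    and mult: "\<And>d e F G. P d F \<Longrightarrow> P e G \<Longrightarrow> P (d + e) (\<lambda>x. F x * G x)"
    and add: "\<And>d F G. P d F \<Longrightarrow> P d G \<Longrightarrow> P d (\<lambda>x. F x + G x)"
    and scale: "\<And>d r F. P d F \<Longrightarrow> P d (\<lambda>x. complex_of_real r * F x)"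
  shows "P d F"
  using assms(1)
proof (rule real_form_span)
  fix \<alpha> :: "4 \<Rightarrow> nat" assume \<alpha>: "(\<Sum>i\<in>UNIV. \<alpha> i) = d"
  have pow: "P n (\<lambda>x. (x$i) ^ n)" for i n
  proof (induction n)
    case (Suc n)
    from mult[OF coord this] show ?case by simp
  qed (simp add: one)
  have "P (\<Sum>i\<in>A. \<alpha> i) (\<lambda>x. \<Prod>i\<in>A. (x$i) ^ \<alpha> i)" if "finite A" for A
    using that
  proof (induction A)
    case (insert a A)
    from mult[OF pow[of "\<alpha> a" a] insert.IH] insert.hyps show ?case by simp
  qed (simp add: one)
  from this[of UNIV] \<alpha> show "P d (coord_monomial \<alpha>)"
    by (simp add: coord_monomial_def[abs_def])
qed (simp_all add: zero add scale)

lemma real_form_const: "real_form 0 (\<lambda>_. of_real r)"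
proof -
  have "coord_monomial (\<lambda>_. 0) = (\<lambda>_. 1)" by (simp add: coord_monomial_def fun_eq_iff)
  then have "real_form 0 (\<lambda>_. 1)" using real_form_monomial[of "\<lambda>_. 0" 0] by simp
  from real_form_scale[OF this, of r] show ?thesis by simp
qed

lemma real_form_coord: "real_form 1 (\<lambda>x. x$i)"
proof -
  have "coord_monomial (\<lambda>j. if j = i then 1 else 0) x = x$i" for x
  proof -
    have "coord_monomial (\<lambda>j. if j = i then 1 else 0) x = (\<Prod>j\<in>UNIV. if j = i then x$j else 1)"
      unfolding coord_monomial_def by (intro prod.cong) auto
    also have "\<dots> = x$i" by (subst prod.delta) auto
    finally show ?thesis .
  qed
  then have *: "coord_monomial (\<lambda>j. if j = i then 1 else 0) = (\<lambda>x. x$i)" by (rule ext)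
  have "(\<Sum>j\<in>UNIV. if j = i then 1 else 0 :: nat) = 1" by (subst sum.delta) auto
  from real_form_monomial[OF this] show ?thesis unfolding * .
qed

lemma real_form_minus:
  assumes "real_form d F" "real_form d G"
  shows "real_form d (\<lambda>x. F x - G x)"
  using real_form_add[OF assms(1) real_form_scale[OF assms(2), of "-1"]] by simp

lemma real_form_power:
  assumes "real_form d F"
  shows "real_form (d * n) (\<lambda>x. F x ^ n)"
proof (induction n)
  case 0
  show ?case using real_form_const[of 1] by simp
next
  case (Suc n)
  from real_form_mult[OF assms Suc] show ?case by simp
qed

lemma real_form_subst:
  assumes "real_form d F" and L: "\<And>i. real_form 1 (\<lambda>x. L x $ i)"
  shows "real_form d (\<lambda>x. F (L x))"
  using assms(1)
proof (rule real_form_induct)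
  show "real_form 0 (\<lambda>x. 1)" using real_form_const[of 1] by simp
qed (auto intro: real_form_zero real_form_add real_form_mult real_form_scale L[unfolded One_nat_def])

lemma real_form_homogeneous:
  assumes "real_form d F"
  shows "F (c *s x) = c ^ d * F x"
  using assms
  by (rule real_form_induct[where P = "\<lambda>d F. F (c *s x) = c ^ d * F x"])
    (auto simp: power_add algebra_simps)

lemma real_form_continuous:
  assumes "real_form d F"
  shows "continuous_on UNIV F"
  using assms
  by (rule real_form_induct[where P = "\<lambda>d F. continuous_on UNIV F"])
    (auto intro!: continuous_intros)

section \<open>Polynomials in two variables and their bihomogenisations\<close>

lemma poly_map_poly_hom:
  fixes h :: "'a :: comm_ring_1 \<Rightarrow> 'b :: comm_ring_1"
  assumes h: "h 0 = 0" "\<And>a b. h (a + b) = h a + h b" "\<And>a b. h (a * b) = h a * h b"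
  shows "poly (map_poly h (P + Q)) y = poly (map_poly h P) y + poly (map_poly h Q) y"
    and "poly (map_poly h (P * Q)) y = poly (map_poly h P) y * poly (map_poly h Q) y"
proof -
  have add: "poly (map_poly h (P + Q)) y = poly (map_poly h P) y + poly (map_poly h Q) y" for P Q
  proof -
    have "map_poly h (P + Q) = map_poly h P + map_poly h Q"
      by (rule poly_eqI) (simp add: coeff_map_poly h)
    then show ?thesis by simp
  qed
  have smult: "poly (map_poly h (smult c P)) y = h c * poly (map_poly h P) y" for c P
  proof -
    have "map_poly h (smult c P) = smult (h c) (map_poly h P)"
      by (rule poly_eqI) (simp add: coeff_map_poly h)
    then show ?thesis by simp
  qed
  show "poly (map_poly h (P + Q)) y = poly (map_poly h P) y + poly (map_poly h Q) y"
    by (rule add)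
  show "poly (map_poly h (P * Q)) y = poly (map_poly h P) y * poly (map_poly h Q) y"
  proof (induction P)
    case 0
    then show ?case by simp
  next
    case (pCons a p)
    have "pCons a p * Q = smult a Q + pCons 0 (p * Q)" by simp
    then show ?case
      by (simp add: add smult map_poly_pCons h pCons.IH distrib_right mult.assoc)
  qed
qed

definition cpoly :: "real poly \<Rightarrow> complex \<Rightarrow> complex" where
  "cpoly p x = poly (map_poly of_real p) x"

lemma cpoly_simps [simp]:
  "cpoly 0 x = 0" "cpoly 1 x = 1" "cpoly [:r:] x = of_real r"
  "cpoly (p + q) x = cpoly p x + cpoly q x" "cpoly (p * q) x = cpoly p x * cpoly q x"
  "cpoly (pCons r p) x = of_real r + x * cpoly p x"
  using poly_map_poly_hom[of "of_real :: real \<Rightarrow> complex"]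
  by (simp_all add: cpoly_def map_poly_pCons)

lemma poly_sum_le:
  fixes p :: "'a :: comm_semiring_1 poly"
  assumes "degree p \<le> m"
  shows "poly p x = (\<Sum>k\<le>m. coeff p k * x ^ k)"
  unfolding poly_altdef
  by (rule sum.mono_neutral_left) (use assms in \<open>auto simp: coeff_eq_0\<close>)

lemma cpoly_sum_le:
  assumes "degree p \<le> m"
  shows "cpoly p x = (\<Sum>k\<le>m. of_real (coeff p k) * x ^ k)"
proof -
  have "degree (map_poly complex_of_real p) \<le> m"
    using map_poly_degree_leq[of complex_of_real p] assms by simp
  from poly_sum_le[OF this] show ?thesis by (simp add: cpoly_def coeff_map_poly)
qed

lemma cpoly_eq_0_iff: "(\<forall>x. cpoly p x = 0) \<longleftrightarrow> p = 0"
proof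
  assume "\<forall>x. cpoly p x = 0"
  then have "map_poly complex_of_real p = 0"
    by (simp add: cpoly_def poly_all_0_iff_0)
  then have "complex_of_real (coeff p n) = 0" for n
    by (metis coeff_map_poly coeff_0 of_real_0)
  then show "p = 0" by (intro poly_eqI) simp
qed simp

text \<open>
  A polynomial in \<open>x\<close> and \<open>y\<close> is represented as a polynomial in \<open>y\<close> whose coefficients are polynomials in \<open>x\<close>. So
  \<open>degree\<close> is its degree in \<open>y\<close>.
\<close>

definition eval2 :: "real poly poly \<Rightarrow> complex \<Rightarrow> complex \<Rightarrow> complex" where
  "eval2 P x y = poly (map_poly (\<lambda>p. cpoly p x) P) y"

lemma eval2_simps [simp]:
  "eval2 0 x y = 0" "eval2 1 x y = 1"
  "eval2 (P + Q) x y = eval2 P x y + eval2 Q x y"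
  "eval2 (P * Q) x y = eval2 P x y * eval2 Q x y"
  "eval2 (pCons p P) x y = cpoly p x + y * eval2 P x y"
  using poly_map_poly_hom[of "\<lambda>p. cpoly p x"]
  by (simp_all add: eval2_def map_poly_pCons)

lemma eval2_sum_le:
  assumes "degree P \<le> n"
  shows "eval2 P x y = (\<Sum>l\<le>n. cpoly (coeff P l) x * y ^ l)"
proof -
  have "degree (map_poly (\<lambda>p. cpoly p x) P) \<le> n"
    using map_poly_degree_leq[of "\<lambda>p. cpoly p x" P] assms by simp
  from poly_sum_le[OF this] show ?thesis by (simp add: eval2_def coeff_map_poly)
qed

lemma finite_zeros_eval2:
  assumes "cpoly (coeff P l) x \<noteq> 0"
  shows "finite {y. eval2 P x y = 0}"
proof -
  have "coeff (map_poly (\<lambda>p. cpoly p x) P) l \<noteq> 0" using assms by (simp add: coeff_map_poly)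
  then have "map_poly (\<lambda>p. cpoly p x) P \<noteq> 0" by (metis coeff_0)
  from poly_roots_finite[OF this] show ?thesis by (simp add: eval2_def)
qed

lemma finite_zeros_cpoly:
  assumes "p \<noteq> 0"
  shows "finite {x. cpoly p x = 0}"
proof -
  have "map_poly complex_of_real p \<noteq> 0"
    using assms cpoly_eq_0_iff[of p] by (auto simp: cpoly_def)
  from poly_roots_finite[OF this] show ?thesis by (simp add: cpoly_def)
qed

lemma avoid_finite:
  assumes "finite (A :: complex set)"
  obtains z where "z \<notin> A"
  using assms ex_new_if_finite infinite_UNIV_char_0 by blast

lemma eval2_nonzero:
  assumes "P \<noteq> 0"
  obtains x y where "eval2 P x y \<noteq> 0"
proof -
  obtain l where "coeff P l \<noteq> 0" using assms by (metis leading_coeff_0_iff)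
  from finite_zeros_cpoly[OF this] obtain x where x: "cpoly (coeff P l) x \<noteq> 0"
    using avoid_finite by blast
  from finite_zeros_eval2[OF this] obtain y where "eval2 P x y \<noteq> 0"
    using avoid_finite by blast
  then show ?thesis by (rule that)
qed

lemma eval2_eqI:
  assumes "\<And>x y. eval2 P x y = eval2 Q x y"
  shows "P = Q"
proof (rule ccontr)
  assume "P \<noteq> Q"
  then have "P - Q \<noteq> 0" by simp
  then obtain x y where "eval2 (P - Q) x y \<noteq> 0" by (rule eval2_nonzero)
  moreover have "eval2 P x y = eval2 (P - Q) x y + eval2 Q x y"
    by (simp flip: eval2_simps)
  ultimately show False using assms[of x y] by simp
qed

lemma complex_root_exists:
  assumes "coeff p k \<noteq> 0" "k > 0"
  shows "\<exists>z. poly (p :: complex poly) z = 0"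
proof -
  have "degree p > 0" using assms le_degree by fastforce
  then have "\<not> constant (poly p)" by (simp add: constant_degree)
  then show ?thesis by (rule fundamental_theorem_of_algebra)
qed

text \<open>
  If \<open>P\<close> involves \<open>y\<close>, it has a zero over each \<open>x\<close> at which its leading coefficient does not vanish.
\<close>

lemma eval2_no_zero_imp_constant:
  assumes "\<And>x y. eval2 P x y \<noteq> 0"
  obtains r where "r \<noteq> 0" "P = [:[:r:]:]"
proof -
  have P0: "P \<noteq> 0" using assms by auto
  have deg: "degree P = 0"
  proof (rule ccontr)
    assume d: "degree P \<noteq> 0"
    have "coeff P (degree P) \<noteq> 0" using P0 by simp
    from finite_zeros_cpoly[OF this] obtain x where "cpoly (coeff P (degree P)) x \<noteq> 0"
      using avoid_finite by blast
    then have "coeff (map_poly (\<lambda>p. cpoly p x) P) (degree P) \<noteq> 0" by (simp add: coeff_map_poly)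
    with complex_root_exists[OF this] d assms show False by (auto simp: eval2_def)
  qed
  then obtain p where p: "P = [:p:]" using degree_eq_zeroE by blast
  have "p \<noteq> 0" using P0 p by auto
  have "degree p = 0"
  proof (rule ccontr)
    assume d: "degree p \<noteq> 0"
    have "coeff (map_poly complex_of_real p) (degree p) \<noteq> 0"
      using \<open>p \<noteq> 0\<close> by (simp add: coeff_map_poly)
    with complex_root_exists[OF this] d obtain z where "cpoly p z = 0" by (auto simp: cpoly_def)
    with assms[of z 0] p show False by simp
  qed
  then obtain r where "p = [:r:]" using degree_eq_zeroE by blast
  with p \<open>p \<noteq> 0\<close> that show ?thesis by auto
qed

lemma ex_prime_factor_degree_pos:
  fixes f :: "real poly poly"
  assumes "f \<noteq> 0" "degree f > 0"
  shows "\<exists>\<rho>. prime \<rho> \<and> \<rho> dvd f \<and> degree \<rho> > 0"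
  using assms
proof (induction f rule: prime_divisors_induct)
  case (unit x)
  then obtain y where "1 = x * y" by (auto elim: dvdE)
  then have "degree (x * y) = 0" by simp
  moreover have "x \<noteq> 0" "y \<noteq> 0" using \<open>1 = x * y\<close> by auto
  ultimately show ?case using unit by (simp add: degree_mult_eq)
next
  case (factor p x)
  show ?case
  proof (cases "degree p > 0")
    case True
    then show ?thesis using factor by auto
  next
    case False
    with factor have "degree x > 0" "x \<noteq> 0" by (auto simp: degree_mult_eq)
    with factor show ?thesis by (meson dvd_mult)
  qed
qed simp

text \<open>
  Elimination of one variable: a polynomial of least degree in the ideal of two polynomials
  pseudo-divides both of them, so a prime factor of it that involves the eliminated variable would
  divide both.
\<close>

lemma eliminate_variable:
  fixes \<pi> h :: "real poly poly"
  assumes \<pi>: "prime \<pi>" and h: "\<not> \<pi> dvd h"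
  shows "\<exists>u v r. r \<noteq> 0 \<and> u * \<pi> + v * h = [:r:]"
proof -
  define I where "I = {f. f \<noteq> 0 \<and> (\<exists>u v. f = u * \<pi> + v * h)}"
  have "\<pi> \<in> I" using \<pi> unfolding I_def by (auto intro: exI[of _ 1] exI[of _ 0])
  then obtain f where f: "f \<in> I" and least: "\<And>g. g \<in> I \<Longrightarrow> degree f \<le> degree g"
    using ex_has_least_nat[of "\<lambda>f. f \<in> I" \<pi> degree] by blast
  obtain u v where uv: "f = u * \<pi> + v * h" and f0: "f \<noteq> 0" using f by (auto simp: I_def)
  have divides: "\<exists>a q. a \<noteq> 0 \<and> smult a g = f * q" if g: "g = u' * \<pi> + v' * h" for g u' v'
  proof -
    obtain a q where a: "a \<noteq> 0" "smult a g = f * q + pseudo_mod g f"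
      using pseudo_mod(1)[OF f0] by blast
    have "pseudo_mod g f = smult a g - f * q" using a by simp
    also have "\<dots> = (smult a u' - u * q) * \<pi> + (smult a v' - v * q) * h"
      unfolding g uv by (simp add: algebra_simps smult_add_right)
    finally have "pseudo_mod g f \<in> I" if "pseudo_mod g f \<noteq> 0" using that unfolding I_def by blast
    with least pseudo_mod(2)[OF f0, of g] have "pseudo_mod g f = 0" by fastforce
    with a show ?thesis by auto
  qed
  show ?thesis
  proof (cases "degree f = 0")
    case True
    then obtain r where "f = [:r:]" by (rule degree_eq_zeroE)
    with f0 uv show ?thesis by (intro exI[of _ u] exI[of _ v] exI[of _ r]) auto
  next
    case False
    then obtain \<rho> where \<rho>: "prime \<rho>" "\<rho> dvd f" "degree \<rho> > 0"
      using ex_prime_factor_degree_pos[OF f0] by auto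
    have dvd: "\<rho> dvd g" if g: "g = u' * \<pi> + v' * h" for g u' v'
    proof -
      obtain a q where a: "a \<noteq> 0" "smult a g = f * q" using divides[OF g] by blast
      then have "[:a:] * g = f * q" by simp
      then have "\<rho> dvd [:a:] * g" using \<rho>(2) by simp
      moreover have "\<not> \<rho> dvd [:a:]"
        using dvd_imp_degree_le[of \<rho> "[:a:]"] a(1) \<rho>(3) by auto
      ultimately show ?thesis using \<rho>(1) by (meson prime_dvd_mult_iff)
    qed
    have "\<rho> dvd \<pi>" by (rule dvd[of _ 1 0]) simp
    then have "\<rho> = \<pi>" using \<rho>(1) \<pi> by (simp add: primes_dvd_imp_eq)
    moreover have "\<rho> dvd h" by (rule dvd[of _ 0 1]) simp
    ultimately show ?thesis using h by simp
  qed
qed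

text \<open>
  This is how unique factorisation is used in geometry: rational functions that agree up to units near all complex points of an
  open set have the same multiplicity at every real prime whose zeros meet the open set. If the prime \<open>\<pi>\<close> involves \<open>y\<close>, the elimination of
  \<open>y\<close> gives \<open>r(x)\<close> in the ideal of \<open>\<pi>\<close> and \<open>h\<close>, and it suffices to take a zero of \<open>\<pi>\<close> at which \<open>r\<close> does not vanish.
\<close>

lemma prime_has_zero_off:
  fixes \<pi> h :: "real poly poly"
  assumes \<pi>: "prime \<pi>" and h: "\<not> \<pi> dvd h"
  obtains x y where "eval2 \<pi> x y = 0" "eval2 h x y \<noteq> 0"
proof (cases "degree \<pi> = 0")
  case True
  then obtain q where q: "\<pi> = [:q:]" by (rule degree_eq_zeroE)
  have "q \<noteq> 0" using \<pi> q by auto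
  have "\<not> is_unit [:q:]" using \<pi> q by (auto simp: prime_def prime_elem_def)
  then have "\<not> is_unit q" by (simp add: is_unit_const_poly_iff)
  then have "degree q \<noteq> 0" using \<open>q \<noteq> 0\<close> by (auto simp: is_unit_iff_degree)
  moreover have "coeff (map_poly complex_of_real q) (degree q) \<noteq> 0"
    using \<open>q \<noteq> 0\<close> by (simp add: coeff_map_poly)
  ultimately obtain x where x: "cpoly q x = 0"
    using complex_root_exists[of "map_poly complex_of_real q" "degree q"] by (auto simp: cpoly_def)
  obtain l where l: "\<not> q dvd coeff h l" using h q by (auto simp: const_poly_dvd_iff)
  have "prime_elem q" using \<pi> q by (metis prime_elem_const_poly_iff prime_def)
  then have "coprime q (coeff h l)" using l by (rule prime_elem_imp_coprime)
  then obtain u v where uv: "u * q + v * coeff h l = 1"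
    by (metis bezout_coefficients_fst_snd coprime_iff_gcd_eq_1)
  then have "cpoly (u * q + v * coeff h l) x = 1" by simp
  then have "cpoly (coeff h l) x \<noteq> 0" using x by auto
  from finite_zeros_eval2[OF this] obtain y where "eval2 h x y \<noteq> 0"
    using avoid_finite by blast
  moreover have "eval2 \<pi> x y = 0" using q x by simp
  ultimately show ?thesis using that by blast
next
  case False
  obtain u v r where r: "r \<noteq> 0" "u * \<pi> + v * h = [:r:]"
    using eliminate_variable[OF assms] by blast
  have "coeff \<pi> (degree \<pi>) \<noteq> 0" using \<pi> by auto
  from finite_zeros_cpoly[OF this] finite_zeros_cpoly[OF r(1)]
  have fin: "finite ({x. cpoly (coeff \<pi> (degree \<pi>)) x = 0} \<union> {x. cpoly r x = 0})" by simp
  obtain x where "x \<notin> {x. cpoly (coeff \<pi> (degree \<pi>)) x = 0} \<union> {x. cpoly r x = 0}"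
    using avoid_finite[OF fin] .
  then have x: "cpoly (coeff \<pi> (degree \<pi>)) x \<noteq> 0" "cpoly r x \<noteq> 0" by auto
  have "coeff (map_poly (\<lambda>p. cpoly p x) \<pi>) (degree \<pi>) \<noteq> 0" using x by (simp add: coeff_map_poly)
  from complex_root_exists[OF this] False obtain y where y: "eval2 \<pi> x y = 0"
    by (auto simp: eval2_def)
  have "eval2 (u * \<pi> + v * h) x y = cpoly r x" using r by simp
  then have "eval2 h x y \<noteq> 0" using y x by auto
  with y that show ?thesis by blast
qed

definition bidegree_le :: "nat \<Rightarrow> nat \<Rightarrow> real poly poly \<Rightarrow> bool" where
  "bidegree_le m n P \<longleftrightarrow> degree P \<le> n \<and> (\<forall>l. degree (coeff P l) \<le> m)"

text \<open>The form of bidegree \<open>(m, n)\<close> on \<open>\<complex>\<^sup>2 \<times> \<complex>\<^sup>2\<close> whose restriction to \<open>s\<^sub>0 = t\<^sub>0 = 1\<close> is \<open>P\<close>.\<close>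

definition bihom :: "nat \<Rightarrow> nat \<Rightarrow> real poly poly \<Rightarrow> complex \<times> complex \<Rightarrow> complex \<times> complex \<Rightarrow> complex" where
  "bihom m n P s t = (\<Sum>l\<le>n. \<Sum>k\<le>m. of_real (coeff (coeff P l) k) *
     (fst s ^ (m - k) * snd s ^ k) * (fst t ^ (n - l) * snd t ^ l))"

lemma bihom_affine:
  assumes "bidegree_le m n P" "a \<noteq> 0" "c \<noteq> 0"
  shows "bihom m n P (a, b) (c, d) = a ^ m * c ^ n * eval2 P (b / a) (d / c)"
proof -
  have pow: "x ^ (m - k) * y ^ k = x ^ m * (y / x) ^ k" if "k \<le> m" "x \<noteq> 0" for x y :: complex and m k
    using that by (simp add: power_diff power_divide)
  have "a ^ m * c ^ n * eval2 P (b / a) (d / c)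
      = a ^ m * c ^ n * (\<Sum>l\<le>n. (\<Sum>k\<le>m. of_real (coeff (coeff P l) k) * (b / a) ^ k) * (d / c) ^ l)"
    using assms by (simp add: eval2_sum_le[of P n] cpoly_sum_le[of _ m] bidegree_le_def)
  also have "\<dots> = (\<Sum>l\<le>n. \<Sum>k\<le>m. of_real (coeff (coeff P l) k) * (a ^ m * (b / a) ^ k) * (c ^ n * (d / c) ^ l))"
    unfolding sum_distrib_left sum_distrib_right by (intro sum.cong refl) (simp add: mult_ac)
  also have "\<dots> = bihom m n P (a, b) (c, d)"
    unfolding bihom_def using assms by (intro sum.cong refl) (simp add: pow)
  finally show ?thesis by simp
qed

lemma eval2_bihom: "bidegree_le m n P \<Longrightarrow> eval2 P x y = bihom m n P (1, x) (1, y)"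
  by (simp add: bihom_affine)

lemma continuous_bihom:
  assumes "continuous_on UNIV f" "continuous_on UNIV g"
  shows "continuous_on UNIV (\<lambda>z :: complex. bihom m n P (f z) (g z))"
  unfolding bihom_def by (intro continuous_intros assms)

lemma continuous_eq_at_0:
  fixes f g :: "complex \<Rightarrow> complex"
  assumes f: "continuous_on UNIV f" and g: "continuous_on UNIV g"
    and S: "finite S" and eq: "\<And>z. z \<notin> S \<Longrightarrow> f z = g z"
  shows "f 0 = g 0"
proof -
  have "(\<lambda>z. f z - g z) \<midarrow>0\<rightarrow> f 0 - g 0"
    using f g by (intro tendsto_diff) (auto simp: continuous_on_def)
  moreover have "(\<lambda>z. f z - g z) \<midarrow>0\<rightarrow> 0"
  proof (rule tendsto_eventually)
    have "open (- (S - {0}))" using S by (intro open_Compl finite_imp_closed) auto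
    then have "\<forall>\<^sub>F z in at 0. z \<in> - (S - {0}) - {0}"
      by (auto simp: eventually_at_topological)
    then show "\<forall>\<^sub>F z in at 0. f z - g z = 0"
      by eventually_elim (use eq in auto)
  qed
  ultimately have "f 0 - g 0 = 0" by (rule tendsto_unique[rotated]) simp
  then show ?thesis by simp
qed

text \<open>
  An identity of continuous functions on \<open>\<complex>\<^sup>2 \<times> \<complex>\<^sup>2\<close> may be checked where \<open>s\<^sub>0\<close> and \<open>t\<^sub>0\<close> do not vanish. It is enough to know continuity
  along curves, here along the lines on which \<open>s\<^sub>0\<close> or \<open>t\<^sub>0\<close> varies.
\<close>

lemma eq_by_density:
  fixes f g :: "complex \<times> complex \<Rightarrow> complex \<times> complex \<Rightarrow> complex"
  assumes f: "\<And>u v. continuous_on UNIV u \<Longrightarrow> continuous_on UNIV v \<Longrightarrow> continuous_on UNIV (\<lambda>z :: complex. f (u z) (v z))"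
    and g: "\<And>u v. continuous_on UNIV u \<Longrightarrow> continuous_on UNIV v \<Longrightarrow> continuous_on UNIV (\<lambda>z :: complex. g (u z) (v z))"
    and eq: "\<And>a b c d. a \<noteq> 0 \<Longrightarrow> c \<noteq> 0 \<Longrightarrow> f (a, b) (c, d) = g (a, b) (c, d)"
  shows "f s t = g s t"
proof -
  have "f (fst s + 0, snd s) (fst t + 0, snd t) = g (fst s + 0, snd s) (fst t + 0, snd t)"
  proof (rule continuous_eq_at_0)
    show "continuous_on UNIV (\<lambda>z. f (fst s + z, snd s) (fst t + z, snd t))"
      by (intro f continuous_intros)
    show "continuous_on UNIV (\<lambda>z. g (fst s + z, snd s) (fst t + z, snd t))"
      by (intro g continuous_intros)
    show "finite {- fst s, - fst t}" by simp
    show "f (fst s + z, snd s) (fst t + z, snd t) = g (fst s + z, snd s) (fst t + z, snd t)"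
      if "z \<notin> {- fst s, - fst t}" for z
      using that by (intro eq) (auto simp: add_eq_0_iff)
  qed
  then show ?thesis by simp
qed

lemma bidegree_le_mult:
  assumes "bidegree_le m n P" "bidegree_le m' n' Q"
  shows "bidegree_le (m + m') (n + n') (P * Q)"
  unfolding bidegree_le_def
proof (intro conjI allI)
  show "degree (P * Q) \<le> n + n'"
    using assms degree_mult_le[of P Q] by (simp add: bidegree_le_def)
  fix l
  have "degree (coeff P i * coeff Q (l - i)) \<le> m + m'" for i
    using assms degree_mult_le[of "coeff P i" "coeff Q (l - i)"]
    by (meson add_mono bidegree_le_def order_trans)
  then show "degree (coeff (P * Q) l) \<le> m + m'"
    unfolding coeff_mult by (intro degree_sum_le) auto
qed

lemma bidegree_le_add: "bidegree_le m n P \<Longrightarrow> bidegree_le m n Q \<Longrightarrow> bidegree_le m n (P + Q)"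
  unfolding bidegree_le_def by (simp add: degree_add_le)

lemma bidegree_le_zero: "bidegree_le m n 0"
  by (simp add: bidegree_le_def)

lemma bidegree_le_const: "bidegree_le m n [:[:r:]:]"
  by (auto simp: bidegree_le_def coeff_pCons split: nat.splits)

lemma bihom_mult:
  assumes "bidegree_le m n P" "bidegree_le m' n' Q"
  shows "bihom (m + m') (n + n') (P * Q) s t = bihom m n P s t * bihom m' n' Q s t"
proof (rule eq_by_density)
  fix a b c d :: complex assume "a \<noteq> 0" "c \<noteq> 0"
  then show "bihom (m + m') (n + n') (P * Q) (a, b) (c, d) = bihom m n P (a, b) (c, d) * bihom m' n' Q (a, b) (c, d)"
    using assms bidegree_le_mult[OF assms] by (simp add: bihom_affine power_add)
qed (intro continuous_intros continuous_bihom; assumption)+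

lemma bihom_add: "bihom m n (P + Q) s t = bihom m n P s t + bihom m n Q s t"
  unfolding bihom_def by (simp add: sum.distrib distrib_right)

lemma bihom_zero [simp]: "bihom m n 0 s t = 0"
  by (simp add: bihom_def)

lemma bihom_const00: "bihom 0 0 [:[:r:]:] s t = of_real r"
  by (simp add: bihom_def)

lemma bihom_power:
  assumes "bidegree_le m n P"
  shows "bidegree_le (i * m) (i * n) (P ^ i)" "bihom (i * m) (i * n) (P ^ i) s t = bihom m n P s t ^ i"
proof -
  have "bidegree_le (i * m) (i * n) (P ^ i) \<and> bihom (i * m) (i * n) (P ^ i) s t = bihom m n P s t ^ i"
  proof (induction i)
    case 0
    then show ?case using bidegree_le_const[of 0 0 1] bihom_const00[of 1] by (simp add: one_pCons)
  next
    case (Suc i)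
    then show ?case using bidegree_le_mult[OF assms, of "i * m" "i * n" "P ^ i"]
        bihom_mult[OF assms, of "i * m" "i * n" "P ^ i" s t] by simp
  qed
  then show "bidegree_le (i * m) (i * n) (P ^ i)" "bihom (i * m) (i * n) (P ^ i) s t = bihom m n P s t ^ i" by simp_all
qed

lemma bihom_scale: "bidegree_le m n P \<Longrightarrow> bihom m n (smult [:r:] P) s t = of_real r * bihom m n P s t"
  by (simp add: bihom_def sum_distrib_left mult_ac)

lemma bidegree_le_scale: "bidegree_le m n P \<Longrightarrow> bidegree_le m n (smult [:r:] P)"
  using bidegree_le_mult[OF bidegree_le_const[of 0 0 r]] by simp

text \<open>The degree in the inner variable \<open>x\<close>.\<close>

definition degx :: "real poly poly \<Rightarrow> nat" where
  "degx P = Max ((\<lambda>l. degree (coeff P l)) ` {..degree P})"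

lemma degree_coeff_le_degx: "degree (coeff P l) \<le> degx P"
proof (cases "l \<le> degree P")
  case True
  then show ?thesis unfolding degx_def by (intro Max_ge) auto
next
  case False
  then show ?thesis by (simp add: coeff_eq_0)
qed

lemma bidegree_le_degx: "bidegree_le (degx P) (degree P) P"
  by (simp add: bidegree_le_def degree_coeff_le_degx)

lemma degx_le_iff: "degx P \<le> m \<longleftrightarrow> (\<forall>l. degree (coeff P l) \<le> m)"
proof
  show "degx P \<le> m \<Longrightarrow> \<forall>l. degree (coeff P l) \<le> m"
    using degree_coeff_le_degx order_trans by blast
  show "\<forall>l. degree (coeff P l) \<le> m \<Longrightarrow> degx P \<le> m"
    unfolding degx_def by (intro Max.boundedI) auto
qed

lemma bidegree_le_iff: "bidegree_le m n P \<longleftrightarrow> degx P \<le> m \<and> degree P \<le> n"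
  by (auto simp: bidegree_le_def degx_le_iff)

lemma bihom_at_infinity_x:
  assumes "bidegree_le m n P"
  shows "bihom m n P (0, 1) (1, y) = poly (map_poly (\<lambda>p. complex_of_real (coeff p m)) P) y"
proof -
  have "degree (map_poly (\<lambda>p. complex_of_real (coeff p m)) P) \<le> n"
    using map_poly_degree_leq[of "\<lambda>p. complex_of_real (coeff p m)" P] assms
    by (simp add: bidegree_le_def)
  then have "poly (map_poly (\<lambda>p. complex_of_real (coeff p m)) P) y
      = (\<Sum>l\<le>n. of_real (coeff (coeff P l) m) * y ^ l)"
    by (simp add: poly_sum_le coeff_map_poly)
  also have "\<dots> = bihom m n P (0, 1) (1, y)"
  proof -
    have "(\<Sum>k\<le>m. of_real (coeff (coeff P l) k) * (0 ^ (m - k)) * y ^ l)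
        = of_real (coeff (coeff P l) m) * y ^ l" for l
    proof -
      have "(\<Sum>k\<le>m. of_real (coeff (coeff P l) k) * (0 ^ (m - k)) * y ^ l)
          = (\<Sum>k\<le>m. if k = m then of_real (coeff (coeff P l) k) * y ^ l else 0)"
        by (intro sum.cong refl) (auto simp: power_0_left)
      also have "\<dots> = of_real (coeff (coeff P l) m) * y ^ l" by (subst sum.delta) auto
      finally show ?thesis .
    qed
    then show ?thesis by (simp add: bihom_def)
  qed
  finally show ?thesis by simp
qed

text \<open>
  If \<open>m\<close> is the exact degree of \<open>P\<close> in \<open>x\<close>, the form of bidegree \<open>(m, n)\<close> that belongs to \<open>P\<close> does not contain the line \<open>s\<^sub>0 = 0\<close>. It restricts
  on this line to the leading coefficient of \<open>P\<close> with respect to \<open>x\<close>. For larger \<open>m\<close> the form is a multiple of \<open>s\<^sub>0\<close>. So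
  the exact degree can be read off from a point at infinity at which the form does not vanish.
\<close>

lemma finite_zeros_at_infinity_x:
  assumes "P \<noteq> 0" "degree P \<le> n"
  shows "finite {y. bihom (degx P) n P (0, 1) (1, y) = 0}"
proof -
  have "\<exists>l. degree (coeff P l) = degx P \<and> coeff P l \<noteq> 0"
  proof -
    have "degx P \<in> (\<lambda>l. degree (coeff P l)) ` {..degree P}"
      unfolding degx_def by (intro Max_in) auto
    then obtain l where l: "degree (coeff P l) = degx P" by auto
    show ?thesis
    proof (cases "coeff P l = 0")
      case True
      then have "degx P = 0" using l by simp
      then have "degree (lead_coeff P) = degx P" using degree_coeff_le_degx[of P "degree P"] by simp
      then show ?thesis using assms(1) by (intro exI[of _ "degree P"]) simp
    qed (use l in auto)
  qed
  then obtain l where "coeff (coeff P l) (degx P) \<noteq> 0" by (metis leading_coeff_0_iff)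
  then have "coeff (map_poly (\<lambda>p. complex_of_real (coeff p (degx P))) P) l \<noteq> 0"
    by (simp add: coeff_map_poly)
  then have "map_poly (\<lambda>p. complex_of_real (coeff p (degx P))) P \<noteq> 0" by (metis coeff_0)
  moreover have "bidegree_le (degx P) n P" using assms by (simp add: bidegree_le_iff)
  ultimately show ?thesis by (simp add: bihom_at_infinity_x poly_roots_finite)
qed

lemma bihom_infinity_x_vanishes:
  assumes "degx P < m"
  shows "bihom m n P (0, b) t = 0"
proof -
  have "coeff (coeff P l) m = 0" for l
    using assms degree_coeff_le_degx[of P l] by (intro coeff_eq_0) simp
  then show ?thesis unfolding bihom_def
    by (intro sum.neutral ballI) (auto simp: power_0_left)
qed

lemma bihom_infinity_y_vanishes:
  assumes "degree P < n"
  shows "bihom m n P s (0, b) = 0"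
  unfolding bihom_def using assms
  by (intro sum.neutral ballI) (auto simp: power_0_left coeff_eq_0)

lemma degx_mult:
  assumes "P \<noteq> 0" "Q \<noteq> 0"
  shows "degx (P * Q) = degx P + degx Q"
proof (rule antisym)
  have bid: "bidegree_le (degx P + degx Q) (degree P + degree Q) (P * Q)"
    by (intro bidegree_le_mult bidegree_le_degx)
  then show "degx (P * Q) \<le> degx P + degx Q" by (simp add: bidegree_le_iff)
  have fin: "finite ({y. bihom (degx P) (degree P) P (0, 1) (1, y) = 0} \<union>
      {y. bihom (degx Q) (degree Q) Q (0, 1) (1, y) = 0})"
    using assms by (simp add: finite_zeros_at_infinity_x)
  obtain y where "y \<notin> {y. bihom (degx P) (degree P) P (0, 1) (1, y) = 0} \<union>
      {y. bihom (degx Q) (degree Q) Q (0, 1) (1, y) = 0}"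
    using avoid_finite[OF fin] .
  then have "bihom (degx P) (degree P) P (0, 1) (1, y) \<noteq> 0"
    "bihom (degx Q) (degree Q) Q (0, 1) (1, y) \<noteq> 0" by auto
  then have "bihom (degx P + degx Q) (degree P + degree Q) (P * Q) (0, 1) (1, y) \<noteq> 0"
    by (simp add: bihom_mult bidegree_le_degx)
  then show "degx P + degx Q \<le> degx (P * Q)"
    using bihom_infinity_x_vanishes by (meson not_le)
qed

section \<open>Finite groups\<close>

subsection \<open>Cyclic groups and their products\<close>

lemma carrier_cyclic: "n \<ge> 1 \<Longrightarrow> carrier (integer_mod_group n) = {0..<int n}"
  by (simp add: carrier_integer_mod_group)

lemma eq_if_cong_in_range:
  fixes a b :: int
  assumes "int n dvd a - b" "a \<in> {0..<int n}" "b \<in> {0..<int n}"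
  shows "a = b"
proof -
  have "a mod int n = b mod int n" using assms(1) by (simp add: mod_eq_dvd_iff)
  with assms(2,3) show ?thesis by simp
qed

lemma hom_bij_is_iso:
  assumes "f \<in> hom G H" "inj_on f (carrier G)" "carrier H \<subseteq> f ` carrier G"
  shows "G \<cong> H"
  using assms unfolding is_iso_def iso_def bij_betw_def hom_def by blast

text \<open>
  The Smith normal form of \<open>diag(m, k)\<close>: with \<open>m = g m'\<close>, \<open>k = g k'\<close> and \<open>x m' + y k' = 1\<close> the matrix
  with rows \<open>(k', m')\<close> and \<open>(-x, y)\<close> is unimodular and induces the isomorphism.
\<close>

lemma prod_cyclic_iso_lcm_gcd:
  assumes "m \<ge> 1" "k \<ge> 1"
  shows "integer_mod_group m \<times>\<times> integer_mod_group k \<cong>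
    integer_mod_group (lcm m k) \<times>\<times> integer_mod_group (gcd m k)"
proof -
  define g L where "g = gcd m k" and "L = lcm m k"
  define m' k' where "m' = m div g" and "k' = k div g"
  have g: "g \<ge> 1" "m = g * m'" "k = g * k'"
  proof -
    show "g \<ge> 1" using assms by (simp add: g_def Suc_le_eq)
    show "m = g * m'" "k = g * k'" by (auto simp only: g_def m'_def k'_def dvd_mult_div_cancel gcd_dvd1 gcd_dvd2)
  qed
  have "L > 0" unfolding L_def using assms by (intro lcm_pos_nat) linarith+
  then have L: "L \<ge> 1" by linarith
  have mk: "m * k = g * L" unfolding g_def L_def by (rule prod_gcd_lcm_nat)
  then have "g * (m' * k) = g * L" using g(2) by (metis mult.assoc)
  then have "L = m' * k" using g(1) by simp
  then have Leq: "L = g * m' * k'" using g(3) by (metis mult.assoc mult.commute)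
  have "coprime m' k'"
    using assms unfolding m'_def k'_def g_def by (intro div_gcd_coprime) auto
  then have "gcd (int m') (int k') = 1" by simp
  then obtain x y where xy: "x * int m' + y * int k' = 1"
    using bezout_int[of "int m'" "int k'"] by auto
  define f where "f = (\<lambda>(a, b). ((a * int k' + b * int m') mod int L, (y * b - x * a) mod int g))"
  have f_cong: "f (a, b) = f (a', b')" if "int m dvd a - a'" "int k dvd b - b'" for a b a' b'
  proof -
    have "int L dvd (a - a') * int k'"
      using mult_dvd_mono[OF that(1), of "int k'" "int k'"] by (simp add: g(2) Leq)
    moreover have "int L dvd (b - b') * int m'"
      using mult_dvd_mono[OF that(2), of "int m'" "int m'"] by (simp add: g(3) Leq mult_ac)
    ultimately have "int L dvd (a - a') * int k' + (b - b') * int m'" by (rule dvd_add)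
    moreover have "int g dvd y * (b - b') - x * (a - a')"
    proof -
      have "int g dvd int m" "int g dvd int k" by (simp_all add: g(2,3))
      then have "int g dvd b - b'" "int g dvd a - a'" using that dvd_trans by blast+
      then show ?thesis by (metis dvd_diff dvd_mult)
    qed
    ultimately show ?thesis
      by (simp add: f_def mod_eq_dvd_iff algebra_simps)
  qed
  let ?A = "integer_mod_group m \<times>\<times> integer_mod_group k"
  let ?B = "integer_mod_group L \<times>\<times> integer_mod_group g"
  have cA: "carrier ?A = {0..<int m} \<times> {0..<int k}"
    and cB: "carrier ?B = {0..<int L} \<times> {0..<int g}"
    using assms g(1) L by (simp_all add: DirProd_def carrier_cyclic)
  have hom: "f \<in> hom ?A ?B"
  proof (rule homI)
    fix p assume "p \<in> carrier ?A"
    show "f p \<in> carrier ?B" unfolding cB using g(1) L by (auto simp: f_def split: prod.split)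
  next
    fix p q assume "p \<in> carrier ?A" "q \<in> carrier ?A"
    obtain a b a' b' where pq: "p = (a, b)" "q = (a', b')" by (metis surj_pair)
    have "f (p \<otimes>\<^bsub>?A\<^esub> q) = f ((a + a') mod int m, (b + b') mod int k)"
      by (simp add: pq DirProd_def)
    also have "\<dots> = f (a + a', b + b')"
      by (rule f_cong) (simp_all flip: mod_eq_dvd_iff)
    also have "\<dots> = f p \<otimes>\<^bsub>?B\<^esub> f q"
    proof -
      have "((a + a') * int k' + (b + b') * int m') mod int L
          = ((a * int k' + b * int m') mod int L + (a' * int k' + b' * int m') mod int L) mod int L"
        unfolding mod_add_eq by (simp add: algebra_simps)
      moreover have "(y * (b + b') - x * (a + a')) mod int g
          = ((y * b - x * a) mod int g + (y * b' - x * a') mod int g) mod int g"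
        unfolding mod_add_eq by (simp add: algebra_simps)
      ultimately show ?thesis by (simp add: pq f_def DirProd_def)
    qed
    finally show "f (p \<otimes>\<^bsub>?A\<^esub> q) = f p \<otimes>\<^bsub>?B\<^esub> f q" .
  qed
  have inj: "inj_on f (carrier ?A)"
  proof (rule inj_onI)
    fix p q assume p: "p \<in> carrier ?A" "q \<in> carrier ?A" "f p = f q"
    obtain a b a' b' where pq: "p = (a, b)" "q = (a', b')" by (metis surj_pair)
    define u v where "u = a - a'" and "v = b - b'"
    have d: "int L dvd u * int k' + v * int m'" "int g dvd y * v - x * u"
      using p(3) by (auto simp: pq f_def mod_eq_dvd_iff u_def v_def algebra_simps)
    have "int m' dvd int L" "int k' dvd int L" by (simp_all add: Leq)
    then have dd: "int m' dvd u * int k' + v * int m'" "int k' dvd u * int k' + v * int m'"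
      using d(1) by (blast intro: dvd_trans)+
    have "int m' dvd u * int k'" "int k' dvd v * int m'"
      using dvd_diff[OF dd(1), of "v * int m'"] dvd_diff[OF dd(2), of "u * int k'"] by simp_all
    then have "int m' dvd u" "int k' dvd v"
      using \<open>coprime m' k'\<close> by (auto simp: coprime_dvd_mult_left_iff coprime_commute)
    then obtain u' v' where uv: "u = int m' * u'" "v = int k' * v'" by (auto elim!: dvdE)
    have "int m' * int k' * int g dvd int m' * int k' * (u' + v')"
      using d(1) by (simp add: Leq uv algebra_simps)
    then have s: "int g dvd u' + v'" using g assms by (auto simp: Leq)
    have *: "y * v - x * u = y * int k' * (u' + v') - u'"
      and **: "y * v - x * u = v' - x * int m' * (u' + v')"
    proof -
      have "y * v - x * u - (y * int k' * (u' + v') - u') = u' * (1 - (x * int m' + y * int k'))"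
        by (simp add: uv algebra_simps)
      then show "y * v - x * u = y * int k' * (u' + v') - u'" using xy by simp
      have "y * v - x * u - (v' - x * int m' * (u' + v')) = v' * ((x * int m' + y * int k') - 1)"
        by (simp add: uv algebra_simps)
      then show "y * v - x * u = v' - x * int m' * (u' + v')" using xy by simp
    qed
    have "int g dvd u'"
      using dvd_diff[OF dvd_mult[OF s, of "y * int k'"] d(2)] by (simp add: *)
    moreover have "int g dvd v'"
      using dvd_add[OF d(2) dvd_mult[OF s, of "x * int m'"]] by (simp add: **)
    ultimately have "int m dvd u" "int k dvd v" by (auto simp: uv g(2,3))
    then show "p = q"
      using p eq_if_cong_in_range[of m a a'] eq_if_cong_in_range[of k b b'] unfolding cA pq u_def v_def
      by auto
  qed
  have "f ` carrier ?A = carrier ?B"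
  proof (rule card_subset_eq)
    show "finite (carrier ?B)" unfolding cB by simp
    show "f ` carrier ?A \<subseteq> carrier ?B" by (rule hom_carrier[OF hom])
    have "card (f ` carrier ?A) = card (carrier ?A)" by (rule card_image[OF inj])
    also have "\<dots> = m * k" unfolding cA by simp
    finally have "card (f ` carrier ?A) = m * k" .
    moreover have "card (carrier ?B) = L * g" unfolding cB by simp
    ultimately show "card (f ` carrier ?A) = card (carrier ?B)" using mk by simp
  qed
  with hom inj show ?thesis unfolding g_def[symmetric] L_def[symmetric]
    by (intro hom_bij_is_iso) auto
qed

text \<open>
  The elements of the diagonal product are the pairs \<open>(u b + d c, b)\<close>, where \<open>c\<close> only matters modulo \<open>n / d\<close>.
\<close>

lemma diagonal_product_cyclic_iso:
  assumes n: "n \<ge> 1" and d: "d dvd n"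
    and ab: "\<And>a b. a \<in> {0..<int n} \<Longrightarrow> b \<in> {0..<int n} \<Longrightarrow> \<alpha> a = \<beta> b \<longleftrightarrow> int d dvd a - u * b"
  shows "integer_mod_group n \<times>\<times> integer_mod_group (n div d) \<cong>
    diagonal_product (integer_mod_group n) (integer_mod_group n) \<alpha> \<beta>"
proof -
  define l where "l = n div d"
  have nl: "n = d * l" using d by (simp add: l_def)
  have l: "l \<ge> 1" using n nl by (cases l) auto
  have d0: "d \<ge> 1" using n nl by (cases d) auto
  define f where "f = (\<lambda>(b, c). ((u * b + int d * c) mod int n, b :: int))"
  let ?A = "integer_mod_group n \<times>\<times> integer_mod_group l"
  let ?B = "diagonal_product (integer_mod_group n) (integer_mod_group n) \<alpha> \<beta>"
  have cA: "carrier ?A = {0..<int n} \<times> {0..<int l}"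
    using n l by (simp add: DirProd_def carrier_cyclic)
  have cB: "carrier ?B = {(a, b) \<in> {0..<int n} \<times> {0..<int n}. int d dvd a - u * b}"
    using n ab by (auto simp: diagonal_product_def carrier_cyclic)
  have hom: "f \<in> hom ?A ?B"
  proof (rule homI)
    fix p assume "p \<in> carrier ?A"
    then obtain b c where p: "p = (b, c)" "b \<in> {0..<int n}" unfolding cA by auto
    have "int d dvd (u * b + int d * c) mod int n - u * b"
    proof -
      have "int n dvd (u * b + int d * c) mod int n - (u * b + int d * c)"
        by (simp flip: mod_eq_dvd_iff)
      then have "int d dvd (u * b + int d * c) mod int n - (u * b + int d * c)"
        using d by (meson dvd_trans int_dvd_int_iff)
      from dvd_add[OF this, of "int d * c"] show ?thesis by simp
    qed
    then show "f p \<in> carrier ?B" unfolding cB using p n by (auto simp: f_def)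
  next
    fix p q assume "p \<in> carrier ?A" "q \<in> carrier ?A"
    obtain b c b' c' where pq: "p = (b, c)" "q = (b', c')" by (metis surj_pair)
    have dl: "int d * ((c + c') mod int l) = (int d * (c + c')) mod int n"
      unfolding nl of_nat_mult by (rule mult_mod_right)
    show "f (p \<otimes>\<^bsub>?A\<^esub> q) = f p \<otimes>\<^bsub>?B\<^esub> f q"
    proof -
      have "(u * ((b + b') mod int n) + int d * ((c + c') mod int l)) mod int n
          = (u * (b + b') + int d * (c + c')) mod int n"
        unfolding dl mod_add_right_eq by (metis mod_add_left_eq mod_mult_right_eq)
      also have "\<dots> = ((u * b + int d * c) mod int n + (u * b' + int d * c') mod int n) mod int n"
        unfolding mod_add_eq by (simp add: algebra_simps)
      finally show ?thesis by (simp add: pq f_def DirProd_def diagonal_product_def)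
    qed
  qed
  have inj: "inj_on f (carrier ?A)"
  proof (rule inj_onI)
    fix p q assume p: "p \<in> carrier ?A" "q \<in> carrier ?A" "f p = f q"
    obtain b c b' c' where pq: "p = (b, c)" "q = (b', c')" by (metis surj_pair)
    have "b = b'" "int n dvd (u * b + int d * c) - (u * b' + int d * c')"
      using p(3) by (auto simp: pq f_def mod_eq_dvd_iff)
    then have "int d * int l dvd int d * (c - c')" by (simp add: nl algebra_simps)
    then have "int l dvd c - c'" using d0 by simp
    then show "p = q" using p \<open>b = b'\<close> eq_if_cong_in_range[of l c c'] unfolding cA pq by auto
  qed
  have "carrier ?B \<subseteq> f ` carrier ?A"
  proof
    fix p assume "p \<in> carrier ?B"
    then obtain a b e where p: "p = (a, b)" "a \<in> {0..<int n}" "b \<in> {0..<int n}" "a - u * b = int d * e"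
      unfolding cB by (auto elim!: dvdE)
    have "int d * (e mod int l) = (int d * e) mod int n" unfolding nl of_nat_mult by (rule mult_mod_right)
    then have "(u * b + int d * (e mod int l)) mod int n = (u * b + int d * e) mod int n"
      by (simp add: mod_simps)
    also have "u * b + int d * e = a" using p(4) by simp
    finally have "f (b, e mod int l) = p" using p by (simp add: f_def)
    moreover have "(b, e mod int l) \<in> carrier ?A" unfolding cA using p l by auto
    ultimately show "p \<in> f ` carrier ?A" by blast
  qed
  with hom inj show ?thesis unfolding l_def by (rule hom_bij_is_iso)
qed

lemma subgroup_of_int_eq_multiples:
  fixes K :: "int set"
  assumes "int n \<in> K" "n \<ge> 1" and diff: "\<And>x y. x \<in> K \<Longrightarrow> y \<in> K \<Longrightarrow> x - y \<in> K"
  shows "\<exists>d. \<forall>x. x \<in> K \<longleftrightarrow> int d dvd x"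
proof -
  have zero: "0 \<in> K" using diff[OF assms(1) assms(1)] by simp
  have neg: "- x \<in> K" if "x \<in> K" for x using diff[OF zero that] by simp
  have add: "x + y \<in> K" if "x \<in> K" "y \<in> K" for x y using diff[OF that(1) neg[OF that(2)]] by simp
  define d where "d = (LEAST d. d \<ge> 1 \<and> int d \<in> K)"
  have d: "d \<ge> 1" "int d \<in> K" and least: "\<And>e. e \<ge> 1 \<Longrightarrow> int e \<in> K \<Longrightarrow> d \<le> e"
    unfolding d_def using assms(1,2) LeastI[of "\<lambda>d. d \<ge> 1 \<and> int d \<in> K" n]
    by (auto intro: Least_le)
  have mult: "int d * q \<in> K" for q :: int
  proof (induction q rule: int_induct[where k = 0])
    case base
    then show ?case using zero by simp
  next
    case (step1 i)
    from add[OF step1(2) d(2)] show ?case by (simp add: algebra_simps)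
  next
    case (step2 i)
    from diff[OF step2(2) d(2)] show ?case by (simp add: algebra_simps)
  qed
  have "x \<in> K \<longleftrightarrow> int d dvd x" for x
  proof
    assume x: "x \<in> K"
    have "x mod int d = x - int d * (x div int d)" by (simp add: minus_mult_div_eq_mod)
    then have "x mod int d \<in> K" using diff[OF x mult] by simp
    moreover have "0 \<le> x mod int d" "x mod int d < int d" using d(1) by simp_all
    ultimately have "x mod int d = 0" using least[of "nat (x mod int d)"] by fastforce
    then show "int d dvd x" by auto
  next
    assume "int d dvd x"
    then show "x \<in> K" using mult by (auto elim: dvdE)
  qed
  then show ?thesis by blast
qed

text \<open>
  The kernel of \<open>\<alpha>\<close> consists of the multiples of a divisor \<open>d\<close> of \<open>n\<close>, and \<open>\<beta> 1 = \<alpha> u\<close> for some \<open>u\<close>. Therefore \<open>\<alpha> a = \<beta> b\<close> if and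
  only if \<open>d\<close> divides \<open>a - u b\<close>.
\<close>

lemma cyclic_diagonal_product_is_product:
  fixes D :: "'d monoid"
  assumes n: "n \<ge> 1" and D: "group D"
    and \<alpha>: "\<alpha> \<in> epi (integer_mod_group n) D" and \<beta>: "\<beta> \<in> epi (integer_mod_group n) D"
  shows "\<exists>l \<ge> 1. integer_mod_group n \<times>\<times> integer_mod_group l \<cong>
    diagonal_product (integer_mod_group n) (integer_mod_group n) \<alpha> \<beta>"
proof -
  interpret D: group D by (rule D)
  define A where "A = (\<lambda>(\<gamma> :: int \<Rightarrow> 'd) x. \<gamma> (x mod int n))"
  have closed: "A \<gamma> x \<in> carrier D" and add: "A \<gamma> (x + y) = A \<gamma> x \<otimes>\<^bsub>D\<^esub> A \<gamma> y"
    if "\<gamma> \<in> hom (integer_mod_group n) D" for \<gamma> x y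
  proof -
    have r: "x mod int n \<in> carrier (integer_mod_group n)" for x
      using n by (simp add: carrier_cyclic)
    show "A \<gamma> x \<in> carrier D" unfolding A_def using that r by (rule hom_in_carrier)
    show "A \<gamma> (x + y) = A \<gamma> x \<otimes>\<^bsub>D\<^esub> A \<gamma> y"
      unfolding A_def using hom_mult[OF that r[of x] r[of y]] by (simp add: mod_simps)
  qed
  have h: "\<alpha> \<in> hom (integer_mod_group n) D" "\<beta> \<in> hom (integer_mod_group n) D"
    using \<alpha> \<beta> by (auto simp: epi_def)
  have zero: "A \<gamma> 0 = \<one>\<^bsub>D\<^esub>" if "\<gamma> \<in> hom (integer_mod_group n) D" for \<gamma>
    using add[OF that, of 0 0] closed[OF that, of 0] by (metis D.l_cancel_one add_0)
  define K where "K = {x. A \<alpha> x = \<one>\<^bsub>D\<^esub>}"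
  have eq_iff: "A \<alpha> x = A \<alpha> y \<longleftrightarrow> x - y \<in> K" for x y
  proof -
    have "A \<alpha> x = A \<alpha> (x - y) \<otimes>\<^bsub>D\<^esub> A \<alpha> y" using add[OF h(1), of "x - y" y] by simp
    then have "A \<alpha> x = A \<alpha> y \<longleftrightarrow> A \<alpha> (x - y) = \<one>\<^bsub>D\<^esub>"
      using closed[OF h(1), of "x - y"] closed[OF h(1), of y] by simp
    then show ?thesis by (simp add: K_def)
  qed
  have "\<exists>d. \<forall>x. x \<in> K \<longleftrightarrow> int d dvd x"
  proof (rule subgroup_of_int_eq_multiples)
    have "A \<alpha> (int n) = A \<alpha> 0" by (simp add: A_def)
    then show "int n \<in> K" by (simp add: K_def zero[OF h(1)])
    show "n \<ge> 1" by (rule n)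
    fix x y assume "x \<in> K" "y \<in> K"
    then have "A \<alpha> x = A \<alpha> y" by (simp add: K_def)
    then show "x - y \<in> K" by (simp add: eq_iff)
  qed
  then obtain d where d: "\<And>x. x \<in> K \<longleftrightarrow> int d dvd x" by blast
  have "A \<alpha> (int n) = A \<alpha> 0" by (simp add: A_def)
  then have "int n \<in> K" by (simp add: K_def zero[OF h(1)])
  then have dn: "d dvd n" by (simp add: d)
  have "A \<beta> 1 \<in> \<alpha> ` carrier (integer_mod_group n)"
    using closed[OF h(2), of 1] \<alpha> by (simp add: epi_def)
  then obtain u where u: "u \<in> {0..<int n}" "A \<beta> 1 = \<alpha> u" using n by (auto simp: carrier_cyclic)
  have u': "A \<beta> 1 = A \<alpha> u" using u by (simp add: A_def)
  have \<beta>u: "A \<beta> (int b) = A \<alpha> (u * int b)" for b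
  proof (induction b)
    case 0
    then show ?case by (simp add: zero[OF h(1)] zero[OF h(2)])
  next
    case (Suc b)
    have "A \<beta> (int (Suc b)) = A \<beta> (int b) \<otimes>\<^bsub>D\<^esub> A \<beta> 1"
      using add[OF h(2), of "int b" 1] by (simp add: add.commute)
    also have "\<dots> = A \<alpha> (u * int b + u)" using add[OF h(1), of "u * int b" u] u' Suc by simp
    finally show ?case by (simp add: algebra_simps)
  qed
  have ab: "\<alpha> a = \<beta> b \<longleftrightarrow> int d dvd a - u * b" if "a \<in> {0..<int n}" "b \<in> {0..<int n}" for a b
  proof -
    have "\<alpha> a = A \<alpha> a" "\<beta> b = A \<beta> b" using that by (simp_all add: A_def)
    moreover have "A \<beta> b = A \<alpha> (u * b)" using \<beta>u[of "nat b"] that by simp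
    ultimately show ?thesis by (simp add: eq_iff d)
  qed
  have "n div d \<ge> 1" using dn n by (auto elim!: dvdE)
  with diagonal_product_cyclic_iso[where \<alpha> = \<alpha> and \<beta> = \<beta> and u = u, OF n dn ab] show ?thesis by blast
qed

lemma is_extension_iso:
  assumes "is_extension A B E" "A \<cong> A'"
  shows "is_extension A' B E"
  using assms iso_trans unfolding is_extension_def by metis

text \<open>
  It provides the common quotient of the two factors of a diagonal product, which arises as a group of cosets, with natural numbers as elements.
\<close>

lemma finite_group_copy_nat:
  assumes "group G" "finite (carrier G)"
  shows "\<exists>(D :: nat monoid) e. group D \<and> e \<in> iso G D"
proof -
  obtain e :: "'a \<Rightarrow> nat" where e: "inj_on e (carrier G)"
    using finite_imp_inj_to_nat_seg[OF assms(2)] by blast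
  let ?G = "\<lparr>carrier = carrier G, monoid.mult = monoid.mult G, one = monoid.one G\<rparr>"
  define D where "D = \<lparr>carrier = e ` carrier G,
     monoid.mult = (\<lambda>x y. e (inv_into (carrier G) e x \<otimes>\<^bsub>G\<^esub> inv_into (carrier G) e y)),
     one = e \<one>\<^bsub>G\<^esub>\<rparr>"
  have iso: "e \<in> iso G D"
    using e by (auto simp: iso_def hom_def D_def bij_betw_def)
  have "group D"
    using group.iso_imp_img_group[OF assms(1) iso] by (simp add: D_def)
  with iso show ?thesis by blast
qed

text \<open>
  For the converse, \<open>\<int>/m \<times> \<int>/k\<close> is isomorphic to \<open>\<int>/n \<times> \<int>/l\<close> with \<open>n = lcm(m, k)\<close> and \<open>l = gcd(m, k)\<close>, which is the diagonal product of
  two copies of \<open>\<int>/n\<close> over \<open>\<int>/d\<close> with \<open>d = n / l\<close>.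
\<close>

theorem cyclic_family_iff_abelian_family:
  "(\<exists>n D. cyclic_family n D E) \<longleftrightarrow> (\<exists>m k. abelian_family m k E)"
proof
  assume "\<exists>n D. cyclic_family n D E"
  then obtain n and D :: "nat monoid" and \<alpha> \<beta> where n: "n \<ge> 1" "group D"
    "\<alpha> \<in> epi (integer_mod_group n) D" "\<beta> \<in> epi (integer_mod_group n) D"
    and ext: "is_extension (diagonal_product (integer_mod_group n) (integer_mod_group n) \<alpha> \<beta>)
      (integer_mod_group 2) E"
    by (auto simp: cyclic_family_def diagonal_square_by_2_def)
  from cyclic_diagonal_product_is_product[OF n] obtain l where l: "l \<ge> 1"
    "integer_mod_group n \<times>\<times> integer_mod_group l \<cong>
      diagonal_product (integer_mod_group n) (integer_mod_group n) \<alpha> \<beta>" by blast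
  have "group (integer_mod_group n \<times>\<times> integer_mod_group l)" by (simp add: DirProd_group)
  from is_extension_iso[OF ext group.iso_sym[OF this l(2)]] n l
  show "\<exists>m k. abelian_family m k E" by (auto simp: abelian_family_def)
next
  assume "\<exists>m k. abelian_family m k E"
  then obtain m k where mk: "m \<ge> 1" "k \<ge> 1"
    and ext: "is_extension (integer_mod_group m \<times>\<times> integer_mod_group k) (integer_mod_group 2) E"
    by (auto simp: abelian_family_def)
  define n l d where "n = lcm m k" and "l = gcd m k" and "d = n div l"
  have "n > 0" unfolding n_def using mk by (intro lcm_pos_nat) linarith+
  then have n: "n \<ge> 1" by linarith
  have l: "l \<ge> 1" using mk by (simp add: l_def Suc_le_eq)
  have ln: "l dvd n" unfolding l_def n_def by (meson dvd_lcm1 dvd_trans gcd_dvd1)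
  then have nd: "n = l * d" by (simp add: d_def)
  have d: "d \<ge> 1" using n nd by (cases d) auto
  have dn: "d dvd n" and ndd: "n div d = l" using nd d by simp_all
  obtain D :: "nat monoid" and e where D: "group D" "e \<in> iso (integer_mod_group d) D"
    using finite_group_copy_nat[of "integer_mod_group d"] d by (auto simp: carrier_cyclic)
  have r: "(\<lambda>x. x mod int d) \<in> epi (integer_mod_group n) (integer_mod_group d)"
    unfolding epi_iff_subset
  proof (intro conjI homI)
    show "x mod int d \<in> carrier (integer_mod_group d)" for x
      using d by (simp add: carrier_cyclic)
    show "(x \<otimes>\<^bsub>integer_mod_group n\<^esub> y) mod int d = (x mod int d) \<otimes>\<^bsub>integer_mod_group d\<^esub> (y mod int d)" for x y
      using dn by (simp add: mod_mod_cancel mod_simps)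
    show "carrier (integer_mod_group d) \<subseteq> (\<lambda>x. x mod int d) ` carrier (integer_mod_group n)"
    proof
      fix x assume "x \<in> carrier (integer_mod_group d)"
      moreover have "int d \<le> int n" using dn n by (simp add: dvd_imp_le)
      ultimately show "x \<in> (\<lambda>x. x mod int d) ` carrier (integer_mod_group n)"
        using d n by (intro image_eqI[of _ _ x]) (auto simp: carrier_cyclic)
    qed
  qed
  define \<alpha> where "\<alpha> = e \<circ> (\<lambda>x. x mod int d)"
  have \<alpha>: "\<alpha> \<in> epi (integer_mod_group n) D"
    unfolding \<alpha>_def using r D(2) by (intro epi_compose) (auto simp: iso_iff_mon_epi)
  have ab: "\<alpha> a = \<alpha> b \<longleftrightarrow> int d dvd a - 1 * b" for a b
  proof -
    have "inj_on e {0..<int d}" using D(2) d by (simp add: iso_def bij_betw_def carrier_cyclic)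
    moreover have "a mod int d \<in> {0..<int d}" "b mod int d \<in> {0..<int d}" using d by auto
    ultimately have "\<alpha> a = \<alpha> b \<longleftrightarrow> a mod int d = b mod int d"
      unfolding \<alpha>_def by (simp add: inj_on_eq_iff)
    then show ?thesis by (simp add: mod_eq_dvd_iff)
  qed
  have "integer_mod_group n \<times>\<times> integer_mod_group l \<cong>
      diagonal_product (integer_mod_group n) (integer_mod_group n) \<alpha> \<alpha>"
    using diagonal_product_cyclic_iso[where \<alpha> = \<alpha> and \<beta> = \<alpha> and u = 1, OF n dn ab] ndd by simp
  with prod_cyclic_iso_lcm_gcd[OF mk]
  have "integer_mod_group m \<times>\<times> integer_mod_group k \<cong>
      diagonal_product (integer_mod_group n) (integer_mod_group n) \<alpha> \<alpha>"
    unfolding n_def[symmetric] l_def[symmetric] by (rule iso_trans)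
  from is_extension_iso[OF ext this] \<alpha> D n show "\<exists>n D. cyclic_family n D E"
    by (auto simp: cyclic_family_def diagonal_square_by_2_def)
qed

subsection \<open>Extensions of the group of order two\<close>

lemma index_two:
  fixes G :: "'g monoid"
  assumes "group G" and sw: "\<And>x y. x \<in> carrier G \<Longrightarrow> y \<in> carrier G \<Longrightarrow> sw (x \<otimes>\<^bsub>G\<^esub> y) \<longleftrightarrow> sw x \<noteq> sw y"
    and w: "w \<in> carrier G" "sw w"
  shows "{x \<in> carrier G. \<not> sw x} \<lhd> G" "G Mod {x \<in> carrier G. \<not> sw x} \<cong> integer_mod_group 2"
proof -
  interpret group G by fact
  define s :: "'g \<Rightarrow> int" where "s = (\<lambda>x. if sw x then 1 else 0)"
  have hom: "s \<in> hom G (integer_mod_group 2)"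
    by (rule homI) (auto simp: s_def sw carrier_cyclic)
  interpret s: group_hom G "integer_mod_group 2" s
    using hom assms(1) by (simp add: group_hom_def group_hom_axioms_def)
  have ker: "kernel G (integer_mod_group 2) s = {x \<in> carrier G. \<not> sw x}"
    by (auto simp: kernel_def s_def)
  have "\<not> sw \<one>\<^bsub>G\<^esub>" using sw[of "\<one>\<^bsub>G\<^esub>" "\<one>\<^bsub>G\<^esub>"] by simp
  have "s ` carrier G = {0, 1}"
  proof
    show "s ` carrier G \<subseteq> {0, 1}" by (auto simp: s_def)
    have "s w = 1" "s \<one>\<^bsub>G\<^esub> = 0" using w \<open>\<not> sw \<one>\<^bsub>G\<^esub>\<close> by (auto simp: s_def)
    then show "{0, 1} \<subseteq> s ` carrier G" using w by (metis empty_subsetI image_eqI insert_subset one_closed)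
  qed
  also have "{0, 1 :: int} = carrier (integer_mod_group 2)" by (auto simp: carrier_cyclic)
  finally have surj: "s ` carrier G = carrier (integer_mod_group 2)" .
  show "{x \<in> carrier G. \<not> sw x} \<lhd> G" using s.normal_kernel by (simp add: ker)
  show "G Mod {x \<in> carrier G. \<not> sw x} \<cong> integer_mod_group 2"
    using s.FactGroup_iso[OF surj] by (simp add: ker)
qed

text \<open>
  Goursat's lemma for a group \<open>N\<close> of index two whose two projections are exchanged by an element
  \<open>w\<close> outside \<open>N\<close>: if \<open>p\<close> is the first projection, the second one is \<open>p\<close> after conjugation with \<open>w\<close>,
  and \<open>N\<close> is the fibre product of its two images over \<open>N / (ker p * ker p\<^sub>2)\<close>.
\<close>

lemma diagonal_square_if_conjugate_projections:
  fixes G :: "'g monoid" and A :: "'a monoid"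
  assumes G: "group G" "finite (carrier G)" and A: "group A"
    and sw: "\<And>x y. x \<in> carrier G \<Longrightarrow> y \<in> carrier G \<Longrightarrow> sw (x \<otimes>\<^bsub>G\<^esub> y) \<longleftrightarrow> sw x \<noteq> sw y"
    and w: "w \<in> carrier G" "sw w"
    and p: "p \<in> epi (G\<lparr>carrier := {x \<in> carrier G. \<not> sw x}\<rparr>) A"
    and inj: "\<And>x. x \<in> carrier G \<Longrightarrow> \<not> sw x \<Longrightarrow> p x = \<one>\<^bsub>A\<^esub> \<Longrightarrow>
      p (w \<otimes>\<^bsub>G\<^esub> x \<otimes>\<^bsub>G\<^esub> inv\<^bsub>G\<^esub> w) = \<one>\<^bsub>A\<^esub> \<Longrightarrow> x = \<one>\<^bsub>G\<^esub>"
  shows "\<exists>D :: nat monoid. group D \<and> diagonal_square_by_2 A D G"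
proof -
  interpret G: group G by fact
  interpret A: group A by fact
  note index = index_two[OF G(1), of sw, OF sw w]
  define N where "N = {x \<in> carrier G. \<not> sw x}"
  interpret N: normal N G using index(1) by (simp add: N_def)
  have N_sub: "x \<in> carrier G" if "x \<in> N" for x
    using that unfolding N_def by simp
  let ?N = "G\<lparr>carrier := N\<rparr>"
  have grpN: "group ?N" using N.subgroup_is_group[OF G(1)] .
  have p_hom: "p \<in> hom ?N A" and p_surj: "p ` N = carrier A"
    using p unfolding N_def epi_def by simp_all
  have p_mult: "p (x \<otimes>\<^bsub>G\<^esub> y) = p x \<otimes>\<^bsub>A\<^esub> p y" if "x \<in> N" "y \<in> N" for x y
    using hom_mult[OF p_hom] that by simp
  have p_closed: "p x \<in> carrier A" if "x \<in> N" for x using p_surj that by blast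
  define c where "c = (\<lambda>x. w \<otimes>\<^bsub>G\<^esub> x \<otimes>\<^bsub>G\<^esub> inv\<^bsub>G\<^esub> w)"
  have cancel: "inv\<^bsub>G\<^esub> w \<otimes>\<^bsub>G\<^esub> (w \<otimes>\<^bsub>G\<^esub> z) = z" "w \<otimes>\<^bsub>G\<^esub> (inv\<^bsub>G\<^esub> w \<otimes>\<^bsub>G\<^esub> z) = z"
    if "z \<in> carrier G" for z
    using w(1) that by (simp_all flip: G.m_assoc)
  have cN: "c x \<in> N" if "x \<in> N" for x
    unfolding c_def using N.inv_op_closed2 w(1) that by simp
  have c_mult: "c (x \<otimes>\<^bsub>G\<^esub> y) = c x \<otimes>\<^bsub>G\<^esub> c y" if "x \<in> N" "y \<in> N" for x y
    unfolding c_def using w(1) that[THEN N_sub] by (simp add: G.m_assoc cancel)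
  have c_surj: "\<exists>x\<in>N. c x = y" if "y \<in> N" for y
  proof
    show "inv\<^bsub>G\<^esub> w \<otimes>\<^bsub>G\<^esub> y \<otimes>\<^bsub>G\<^esub> w \<in> N" using N.inv_op_closed1 w(1) that by simp
    show "c (inv\<^bsub>G\<^esub> w \<otimes>\<^bsub>G\<^esub> y \<otimes>\<^bsub>G\<^esub> w) = y"
      unfolding c_def using w(1) N_sub[OF that] by (simp add: G.m_assoc cancel)
  qed
  define q where "q = (\<lambda>x. p (c x))"
  have q_mult: "q (x \<otimes>\<^bsub>G\<^esub> y) = q x \<otimes>\<^bsub>A\<^esub> q y" if "x \<in> N" "y \<in> N" for x y
    using that by (simp add: q_def c_mult p_mult cN)
  have q_closed: "q x \<in> carrier A" if "x \<in> N" for x using that by (simp add: q_def p_closed cN)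
  have q_surj: "\<exists>x\<in>N. q x = a" if a: "a \<in> carrier A" for a
  proof -
    obtain y where "y \<in> N" "p y = a" using p_surj a by (metis imageE)
    then show ?thesis using c_surj unfolding q_def by blast
  qed
  have q_hom: "q \<in> hom ?N A" by (rule homI) (simp_all add: q_closed q_mult)
  define K where "K = {x \<in> N. q x = \<one>\<^bsub>A\<^esub>}"
  define B where "B = p ` K"
  interpret pN: group_hom ?N A p using grpN A p_hom by (simp add: group_hom_def group_hom_axioms_def)
  interpret qN: group_hom ?N A q using grpN A q_hom by (simp add: group_hom_def group_hom_axioms_def)
  have K_ker: "K = kernel ?N A q" by (simp add: K_def kernel_def)
  have K_normal: "K \<lhd> ?N" unfolding K_ker by (rule qN.normal_kernel)
  have K_sub: "subgroup K ?N" using K_normal by (simp add: normal_def)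
  have B_sub: "subgroup B A" unfolding B_def by (rule pN.subgroup_img_is_subgroup[OF K_sub])
  have invN: "inv\<^bsub>?N\<^esub> x = inv\<^bsub>G\<^esub> x" if "x \<in> N" for x
    using G.m_inv_consistent[OF N.subgroup_axioms that] .
  have B_normal: "B \<lhd> A"
    unfolding A.normal_inv_iff
  proof (intro conjI ballI)
    show "subgroup B A" by (rule B_sub)
    fix a b assume a: "a \<in> carrier A" and b: "b \<in> B"
    obtain x where x: "x \<in> N" "p x = a" using p_surj a by (metis imageE)
    obtain k where k: "k \<in> K" "p k = b" using b by (auto simp: B_def)
    then have kN: "k \<in> N" by (simp add: K_def)
    have "x \<otimes>\<^bsub>?N\<^esub> k \<otimes>\<^bsub>?N\<^esub> inv\<^bsub>?N\<^esub> x \<in> K"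
      using normal.inv_op_closed2[OF K_normal, of x k] x k by simp
    moreover have "p (x \<otimes>\<^bsub>?N\<^esub> k \<otimes>\<^bsub>?N\<^esub> inv\<^bsub>?N\<^esub> x) = a \<otimes>\<^bsub>A\<^esub> b \<otimes>\<^bsub>A\<^esub> inv\<^bsub>A\<^esub> a"
    proof -
      have "inv\<^bsub>?N\<^esub> x \<in> N" using group.inv_closed[OF grpN, of x] x(1) by simp
      moreover have "p (inv\<^bsub>?N\<^esub> x) = inv\<^bsub>A\<^esub> p x" using pN.hom_inv[of x] x(1) by simp
      moreover have "x \<otimes>\<^bsub>G\<^esub> k \<in> N" using x kN by simp
      ultimately show ?thesis using x k kN by (simp add: p_mult)
    qed
    ultimately show "a \<otimes>\<^bsub>A\<^esub> b \<otimes>\<^bsub>A\<^esub> inv\<^bsub>A\<^esub> a \<in> B" unfolding B_def by (metis imageI)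
  qed
  interpret B: normal B A by (rule B_normal)
  have finA: "finite (carrier A)"
    unfolding p_surj[symmetric] N_def using G(2) by simp
  have "finite (carrier (A Mod B))" using finA by (simp add: FactGroup_def RCOSETS_def)
  then obtain D :: "nat monoid" and e where D: "group D" "e \<in> iso (A Mod B) D"
    using finite_group_copy_nat[OF B.factorgroup_is_group] by blast
  define \<alpha> where "\<alpha> = e \<circ> (\<lambda>a. B #>\<^bsub>A\<^esub> a)"
  have \<alpha>: "\<alpha> \<in> epi A D"
  proof -
    have "(\<lambda>a. B #>\<^bsub>A\<^esub> a) \<in> epi A (A Mod B)"
      using B.r_coset_hom_Mod by (auto simp: epi_def FactGroup_def RCOSETS_def)
    then show ?thesis unfolding \<alpha>_def using D(2) by (intro epi_compose) (auto simp: iso_iff_mon_epi)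
  qed
  have \<alpha>_eq: "\<alpha> a = \<alpha> b \<longleftrightarrow> B #>\<^bsub>A\<^esub> a = B #>\<^bsub>A\<^esub> b" if "a \<in> carrier A" "b \<in> carrier A" for a b
  proof -
    have "inj_on e (carrier (A Mod B))" using D(2) by (simp add: iso_def bij_betw_def)
    moreover have "B #>\<^bsub>A\<^esub> a \<in> carrier (A Mod B)" "B #>\<^bsub>A\<^esub> b \<in> carrier (A Mod B)"
      using that by (auto simp: FactGroup_def RCOSETS_def)
    ultimately show ?thesis unfolding \<alpha>_def by (simp add: inj_on_eq_iff)
  qed
  define \<beta> where "\<beta> = (\<lambda>a. \<alpha> (p (SOME x. x \<in> N \<and> q x = a)))"
  have \<beta>: "\<beta> (q x) = \<alpha> (p x)" if x: "x \<in> N" for x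
  proof -
    define y where "y = (SOME y. y \<in> N \<and> q y = q x)"
    have y: "y \<in> N" "q y = q x"
      unfolding y_def using someI[of "\<lambda>y. y \<in> N \<and> q y = q x" x] x by auto
    define k where "k = y \<otimes>\<^bsub>G\<^esub> inv\<^bsub>G\<^esub> x"
    have ix: "inv\<^bsub>G\<^esub> x \<in> N" using x by simp
    have kN: "k \<in> N" unfolding k_def using y ix by simp
    have yk: "y = k \<otimes>\<^bsub>G\<^esub> x" unfolding k_def using x y by (simp add: G.m_assoc N_sub)
    have "q y = q k \<otimes>\<^bsub>A\<^esub> q x" unfolding yk by (rule q_mult[OF kN x])
    then have "q k = \<one>\<^bsub>A\<^esub>" using y q_closed[OF kN] q_closed[OF x] by simp
    then have "p k \<in> B" using kN by (auto simp: B_def K_def)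
    moreover have "p y = p k \<otimes>\<^bsub>A\<^esub> p x" unfolding yk by (rule p_mult[OF kN x])
    ultimately have "p y \<in> B #>\<^bsub>A\<^esub> p x" by (auto simp: r_coset_def)
    then have "B #>\<^bsub>A\<^esub> p x = B #>\<^bsub>A\<^esub> p y"
      by (rule A.repr_independence[OF _ p_closed[OF x] B_sub])
    then show ?thesis using \<alpha>_eq p_closed x y unfolding \<beta>_def y_def[symmetric] by simp
  qed
  have \<beta>_epi: "\<beta> \<in> epi A D"
    unfolding epi_iff_subset
  proof (intro conjI homI subsetI)
    interpret \<alpha>: group_hom A D \<alpha> using A D(1) \<alpha> by (simp add: group_hom_def group_hom_axioms_def epi_def)
    fix a assume "a \<in> carrier A"
    then obtain x where x: "x \<in> N" "q x = a" using q_surj by blast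
    then show "\<beta> a \<in> carrier D" using \<beta>[OF x(1)] p_closed[OF x(1)] by simp
    fix b assume "b \<in> carrier A"
    then obtain y where y: "y \<in> N" "q y = b" using q_surj by blast
    have "a \<otimes>\<^bsub>A\<^esub> b = q (x \<otimes>\<^bsub>G\<^esub> y)" using x y by (simp add: q_mult)
    moreover have "x \<otimes>\<^bsub>G\<^esub> y \<in> N" using x y by simp
    ultimately have "\<beta> (a \<otimes>\<^bsub>A\<^esub> b) = \<alpha> (p (x \<otimes>\<^bsub>G\<^esub> y))" using \<beta> by simp
    also have "\<dots> = \<alpha> (p x) \<otimes>\<^bsub>D\<^esub> \<alpha> (p y)"
      unfolding p_mult[OF x(1) y(1)] using p_closed[OF x(1)] p_closed[OF y(1)] by (rule \<alpha>.hom_mult)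
    also have "\<dots> = \<beta> a \<otimes>\<^bsub>D\<^esub> \<beta> b" using \<beta>[OF x(1)] \<beta>[OF y(1)] x(2) y(2) by simp
    finally show "\<beta> (a \<otimes>\<^bsub>A\<^esub> b) = \<beta> a \<otimes>\<^bsub>D\<^esub> \<beta> b" .
  next
    fix d assume "d \<in> carrier D"
    moreover have "\<alpha> ` carrier A = carrier D" using \<alpha> by (simp add: epi_def)
    ultimately obtain a where a: "a \<in> carrier A" "\<alpha> a = d" by (metis imageE)
    then obtain x where "x \<in> N" "p x = a" using p_surj by (metis imageE)
    then show "d \<in> \<beta> ` carrier A" using \<beta> a q_closed by (metis imageI)
  qed
  have "?N \<cong> diagonal_product A A \<alpha> \<beta>"
  proof (rule hom_bij_is_iso)
    let ?f = "\<lambda>x. (p x, q x)"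
    have cD: "carrier (diagonal_product A A \<alpha> \<beta>) = {(a, b). a \<in> carrier A \<and> b \<in> carrier A \<and> \<alpha> a = \<beta> b}"
      by (auto simp: diagonal_product_def)
    show "?f \<in> hom ?N (diagonal_product A A \<alpha> \<beta>)"
    proof (rule homI)
      fix x assume "x \<in> carrier ?N"
      then show "?f x \<in> carrier (diagonal_product A A \<alpha> \<beta>)" unfolding cD by (simp add: p_closed q_closed \<beta>)
    qed (simp add: p_mult q_mult diagonal_product_def DirProd_def)
    show "inj_on ?f (carrier ?N)"
    proof (rule inj_onI)
      fix x y assume "x \<in> carrier ?N" "y \<in> carrier ?N" and eq: "?f x = ?f y"
      then have x: "x \<in> N" and y: "y \<in> N" by simp_all
      define k where "k = x \<otimes>\<^bsub>G\<^esub> inv\<^bsub>G\<^esub> y"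
      have kN: "k \<in> N" unfolding k_def using x y by simp
      have xk: "x = k \<otimes>\<^bsub>G\<^esub> y" unfolding k_def using x y by (simp add: G.m_assoc N_sub)
      have "p x = p k \<otimes>\<^bsub>A\<^esub> p y" "q x = q k \<otimes>\<^bsub>A\<^esub> q y"
        unfolding xk by (rule p_mult[OF kN y] q_mult[OF kN y])+
      then have "p k = \<one>\<^bsub>A\<^esub>" "q k = \<one>\<^bsub>A\<^esub>"
        using eq p_closed[OF kN] q_closed[OF kN] p_closed[OF y] q_closed[OF y] by simp_all
      then have "k = \<one>\<^bsub>G\<^esub>" using inj[of k] kN unfolding N_def q_def c_def by simp
      then show "x = y" using xk y by (simp add: N_sub)
    qed
    show "carrier (diagonal_product A A \<alpha> \<beta>) \<subseteq> ?f ` carrier ?N"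
    proof
      fix ab assume "ab \<in> carrier (diagonal_product A A \<alpha> \<beta>)"
      then obtain a b where ab: "ab = (a, b)" "a \<in> carrier A" "b \<in> carrier A" "\<alpha> a = \<beta> b"
        unfolding cD by auto
      obtain x where x: "x \<in> N" "q x = b" using q_surj ab(3) by blast
      have "B #>\<^bsub>A\<^esub> a = B #>\<^bsub>A\<^esub> p x"
        using ab x \<beta>[OF x(1)] \<alpha>_eq[OF ab(2) p_closed[OF x(1)]] by simp
      then have "a \<in> B #>\<^bsub>A\<^esub> p x" using A.rcos_self[OF ab(2) B_sub] by simp
      then obtain k where k: "k \<in> K" "a = p k \<otimes>\<^bsub>A\<^esub> p x" by (auto simp: r_coset_def B_def)
      then have kN: "k \<in> N" "q k = \<one>\<^bsub>A\<^esub>" by (simp_all add: K_def)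
      have "p (k \<otimes>\<^bsub>G\<^esub> x) = a" using p_mult[OF kN(1) x(1)] k(2) by simp
      moreover have "q (k \<otimes>\<^bsub>G\<^esub> x) = b" using q_mult[OF kN(1) x(1)] kN(2) x(2) ab(3) by simp
      ultimately have "?f (k \<otimes>\<^bsub>G\<^esub> x) = ab" using ab(1) by simp
      moreover have "k \<otimes>\<^bsub>G\<^esub> x \<in> carrier ?N" using kN x by simp
      ultimately show "ab \<in> ?f ` carrier ?N" by blast
    qed
  qed
  then have "is_extension (diagonal_product A A \<alpha> \<beta>) (integer_mod_group 2) G"
    unfolding is_extension_def using index by (fold N_def) blast
  then show ?thesis using D(1) \<alpha> \<beta>_epi unfolding diagonal_square_by_2_def by blast
qed

subsection \<open>Finite subgroups of the orthogonal group of the plane\<close>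

text \<open>
  Multiplication with \<open>z \<in> T\<close> permutes \<open>T\<close>, so the product over \<open>T\<close> is equal to \<open>z\<^bsup>card T\<^esup>\<close> times itself.
\<close>

lemma finite_mult_closed_eq_roots_of_unity:
  fixes T :: "complex set"
  assumes "finite T" "1 \<in> T" and closed: "\<And>z w. z \<in> T \<Longrightarrow> w \<in> T \<Longrightarrow> z * w \<in> T" and nz: "0 \<notin> T"
  shows "T = {z. z ^ card T = 1}"
proof (rule card_subset_eq)
  have pos: "card T > 0" using assms(1,2) by (auto simp: card_gt_0_iff)
  show "finite {z :: complex. z ^ card T = 1}"
    using card_roots_unity_eq[OF pos] pos by (metis card.infinite less_irrefl)
  show "card T = card {z :: complex. z ^ card T = 1}" using card_roots_unity_eq[OF pos] by simp
  show "T \<subseteq> {z. z ^ card T = 1}"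
  proof
    fix z assume z: "z \<in> T"
    have inj: "inj_on ((*) z) T" using z nz by (intro inj_onI) auto
    have "(*) z ` T = T"
      using closed[OF z] by (intro card_subset_eq assms(1)) (auto simp: card_image[OF inj])
    then have "\<Prod>T = (\<Prod>w\<in>T. z * w)"
      using prod.reindex[OF inj, of "\<lambda>w. w"] by simp
    also have "\<dots> = z ^ card T * \<Prod>T" by (simp add: prod.distrib)
    finally have "\<Prod>T * (z ^ card T - 1) = 0" by (simp add: algebra_simps)
    moreover have "\<Prod>T \<noteq> 0" using nz assms(1) by (auto simp: prod_zero_iff)
    ultimately show "z \<in> {z. z ^ card T = 1}" by simp
  qed
qed

definition unit_root :: "nat \<Rightarrow> int \<Rightarrow> complex" where
  "unit_root n k = cis (2 * pi * of_int k / of_nat n)"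

lemma unit_root_add: "unit_root n (a + b) = unit_root n a * unit_root n b"
  by (simp add: unit_root_def cis_mult add_divide_distrib distrib_left)

lemma unit_root_0 [simp]: "unit_root n 0 = 1"
  by (simp add: unit_root_def)

lemma unit_root_nonzero [simp]: "unit_root n k \<noteq> 0"
  by (simp add: unit_root_def)

lemma unit_root_minus: "unit_root n (- a) = inverse (unit_root n a)"
  by (rule inverse_unique[symmetric]) (simp flip: unit_root_add)

lemma unit_root_eq_iff:
  assumes "n \<ge> 1"
  shows "unit_root n a = unit_root n b \<longleftrightarrow> int n dvd a - b"
proof -
  have "unit_root n a = unit_root n b \<longleftrightarrow> unit_root n (a - b) = 1"
    using unit_root_add[of n "a - b" b] by simp
  also have "\<dots> \<longleftrightarrow> cos (2 * pi * of_int (a - b) / of_nat n) = 1"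
    by (auto simp: unit_root_def complex_eq_iff) (metis cos_one_sin_zero)
  also have "\<dots> \<longleftrightarrow> (\<exists>i :: int. 2 * pi * real_of_int (a - b) / real n = real_of_int i * 2 * pi)"
    by (rule cos_one_2pi_int)
  also have "\<dots> \<longleftrightarrow> (\<exists>i :: int. real_of_int (a - b) = real_of_int (int n * i))"
  proof (rule iff_exI)
    fix i :: int
    have "2 * pi * x / real n = real_of_int i * 2 * pi \<longleftrightarrow> x = real n * real_of_int i" for x
    proof -
      have "2 * pi * x / real n = real_of_int i * 2 * pi \<longleftrightarrow> (2 * pi) * x = (2 * pi) * (real n * real_of_int i)"
        using assms by (simp add: divide_eq_eq mult_ac)
      also have "\<dots> \<longleftrightarrow> x = real n * real_of_int i" by (subst mult_left_cancel) simp_all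
      finally show ?thesis .
    qed
    then show "2 * pi * real_of_int (a - b) / real n = real_of_int i * 2 * pi \<longleftrightarrow>
        real_of_int (a - b) = real_of_int (int n * i)" by simp
  qed
  also have "\<dots> \<longleftrightarrow> int n dvd a - b" by (simp only: of_int_eq_iff dvd_def)
  finally show ?thesis .
qed

lemma roots_of_unity_eq_unit_root:
  assumes "n \<ge> 1" "z ^ n = 1"
  shows "\<exists>k\<in>{0..<int n}. unit_root n k = z"
proof -
  have "z \<in> (\<lambda>k. cis (2 * pi * real k / real n)) ` {..<n}"
    using bij_betw_roots_unity[of n] assms by (auto simp: bij_betw_def)
  then obtain k where "k < n" "z = cis (2 * pi * real k / real n)" by auto
  then show ?thesis by (intro bexI[of _ "int k"]) (auto simp: unit_root_def)
qed

lemma group_dihedral: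
  assumes n: "n \<ge> 1"
  shows "group (dihedral_group n)"
proof (rule groupI)
  let ?D = "dihedral_group n"
  have c: "carrier ?D = {0..<int n} \<times> UNIV" by (simp add: dihedral_group_def)
  have m: "(a, s) \<otimes>\<^bsub>?D\<^esub> (b, t) = ((if s then a - b else a + b) mod int n, s \<noteq> t)" for a b s t
    by (simp add: dihedral_group_def)
  show "\<one>\<^bsub>?D\<^esub> \<in> carrier ?D" using n by (simp add: dihedral_group_def)
  fix x assume x: "x \<in> carrier ?D"
  then obtain a s where as: "x = (a, s)" "a \<in> {0..<int n}" unfolding c by auto
  show "\<one>\<^bsub>?D\<^esub> \<otimes>\<^bsub>?D\<^esub> x = x" using as by (simp add: dihedral_group_def)
  show "\<exists>y\<in>carrier ?D. y \<otimes>\<^bsub>?D\<^esub> x = \<one>\<^bsub>?D\<^esub>"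
  proof (cases s)
    case True
    then show ?thesis using as n
      by (intro bexI[of _ "(a, True)"]) (auto simp: m c dihedral_group_def)
  next
    case False
    then show ?thesis using as n
      by (intro bexI[of _ "((- a) mod int n, False)"]) (auto simp: m c dihedral_group_def mod_simps)
  qed
  fix y assume "y \<in> carrier ?D"
  then obtain b t where bt: "y = (b, t)" unfolding c by auto
  show "x \<otimes>\<^bsub>?D\<^esub> y \<in> carrier ?D" using n by (simp add: as bt m c)
  fix z assume "z \<in> carrier ?D"
  then obtain d u where du: "z = (d, u)" unfolding c by auto
  show "x \<otimes>\<^bsub>?D\<^esub> y \<otimes>\<^bsub>?D\<^esub> z = x \<otimes>\<^bsub>?D\<^esub> (y \<otimes>\<^bsub>?D\<^esub> z)"
    by (cases s; cases t) (simp_all add: as bt du m mod_simps algebra_simps)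
qed

text \<open>
  Here \<open>(\<theta>, \<epsilon>)\<close> is a homomorphism to the semidirect product of \<open>\<complex>\<^sup>*\<close> with the group of order two acting
  by inversion, in which the orthogonal group of the plane is contained. The values of \<open>\<theta>\<close> on the rotations are
  all \<open>n\<close>-th roots of unity; dividing by the value at one reflection also makes the values on the
  reflections \<open>n\<close>-th roots of unity.
\<close>

lemma cyclic_or_dihedral_image:
  fixes N :: "'g monoid"
  assumes N: "group N" "finite (carrier N)"
    and \<theta>: "\<And>x y. x \<in> carrier N \<Longrightarrow> y \<in> carrier N \<Longrightarrow>
      \<theta> (x \<otimes>\<^bsub>N\<^esub> y) = \<theta> x * (if \<epsilon> x then inverse (\<theta> y) else \<theta> y)"
    and \<epsilon>: "\<And>x y. x \<in> carrier N \<Longrightarrow> y \<in> carrier N \<Longrightarrow> \<epsilon> (x \<otimes>\<^bsub>N\<^esub> y) \<longleftrightarrow> \<epsilon> x \<noteq> \<epsilon> y"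
    and \<theta>0: "\<And>x. x \<in> carrier N \<Longrightarrow> \<theta> x \<noteq> (0 :: complex)"
  obtains (cyclic) n p where "n \<ge> 1" "p \<in> epi N (integer_mod_group n)"
      "\<And>x. x \<in> carrier N \<Longrightarrow> p x = \<one>\<^bsub>integer_mod_group n\<^esub> \<Longrightarrow> \<theta> x = 1 \<and> \<not> \<epsilon> x"
  | (dihedral) n p where "n \<ge> 1" "p \<in> epi N (dihedral_group n)"
      "\<And>x. x \<in> carrier N \<Longrightarrow> p x = \<one>\<^bsub>dihedral_group n\<^esub> \<Longrightarrow> \<theta> x = 1 \<and> \<not> \<epsilon> x"
proof -
  interpret N: group N by fact
  define R where "R = {x \<in> carrier N. \<not> \<epsilon> x}"
  define T where "T = \<theta> ` R"
  define n where "n = card T"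
  have "\<not> \<epsilon> \<one>\<^bsub>N\<^esub>" using \<epsilon>[of "\<one>\<^bsub>N\<^esub>" "\<one>\<^bsub>N\<^esub>"] by simp
  then have oneR: "\<one>\<^bsub>N\<^esub> \<in> R" by (simp add: R_def)
  have "\<theta> \<one>\<^bsub>N\<^esub> = \<theta> \<one>\<^bsub>N\<^esub> * \<theta> \<one>\<^bsub>N\<^esub>"
    using \<theta>[of "\<one>\<^bsub>N\<^esub>" "\<one>\<^bsub>N\<^esub>"] \<open>\<not> \<epsilon> \<one>\<^bsub>N\<^esub>\<close> by simp
  then have "\<theta> \<one>\<^bsub>N\<^esub> = 1" using \<theta>0[of "\<one>\<^bsub>N\<^esub>"] by simp
  have finT: "finite T" unfolding T_def R_def using N(2) by simp
  have oneT: "1 \<in> T" using oneR \<open>\<theta> \<one>\<^bsub>N\<^esub> = 1\<close> unfolding T_def by (metis imageI)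
  have Teq: "T = {z. z ^ n = 1}"
    unfolding n_def
  proof (rule finite_mult_closed_eq_roots_of_unity[OF finT oneT])
    show "0 \<notin> T" using \<theta>0 by (auto simp: T_def R_def)
    fix z w assume "z \<in> T" "w \<in> T"
    then obtain x y where xy: "x \<in> R" "y \<in> R" "z = \<theta> x" "w = \<theta> y" by (auto simp: T_def)
    then have "x \<otimes>\<^bsub>N\<^esub> y \<in> R" "\<theta> (x \<otimes>\<^bsub>N\<^esub> y) = z * w" by (auto simp: R_def \<epsilon> \<theta>)
    then show "z * w \<in> T" unfolding T_def by (metis imageI)
  qed
  have n: "n \<ge> 1" using finT oneT unfolding n_def by (metis One_nat_def Suc_leI card_gt_0_iff empty_iff)
  define lg where "lg = (\<lambda>z. SOME k. k \<in> {0..<int n} \<and> unit_root n k = z)"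
  have lg: "lg z \<in> {0..<int n}" "unit_root n (lg z) = z" if "z \<in> T" for z
  proof -
    have "z ^ n = 1" using that Teq by simp
    then have "\<exists>k. k \<in> {0..<int n} \<and> unit_root n k = z"
      using roots_of_unity_eq_unit_root[OF n, of z] by blast
    then have "lg z \<in> {0..<int n} \<and> unit_root n (lg z) = z" unfolding lg_def by (rule someI_ex)
    then show "lg z \<in> {0..<int n}" "unit_root n (lg z) = z" by simp_all
  qed
  have lg_eq: "lg z = k mod int n" if "z = unit_root n k" "z \<in> T" for z k
  proof (rule eq_if_cong_in_range)
    have "unit_root n (lg z) = unit_root n k" using lg(2)[OF that(2)] that(1) by simp
    then have "int n dvd lg z - k" by (simp add: unit_root_eq_iff[OF n])
    then show "int n dvd lg z - k mod int n" by (simp flip: mod_eq_dvd_iff)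
    show "lg z \<in> {0..<int n}" by (rule lg(1)[OF that(2)])
    show "k mod int n \<in> {0..<int n}" using n by simp
  qed
  have unit_T: "unit_root n k \<in> T" for k
  proof -
    have "unit_root n k ^ n = unit_root n (int n * k)"
      by (simp add: unit_root_def DeMoivre)
    also have "\<dots> = unit_root n 0" unfolding unit_root_eq_iff[OF n] by simp
    finally show ?thesis by (simp add: Teq)
  qed
  have T_ex: "\<exists>x\<in>R. \<theta> x = unit_root n k" for k using unit_T[of k] unfolding T_def by auto
  show ?thesis
  proof (cases "\<exists>r\<in>carrier N. \<epsilon> r")
    case False
    then have R: "R = carrier N" by (auto simp: R_def)
    define p where "p = (\<lambda>x. lg (\<theta> x))"
    have xT: "\<theta> x \<in> T" if "x \<in> carrier N" for x using that by (simp add: T_def R)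
    have "p \<in> epi N (integer_mod_group n)"
      unfolding epi_iff_subset
    proof (intro conjI homI subsetI)
      fix x assume x: "x \<in> carrier N"
      then show "p x \<in> carrier (integer_mod_group n)" using lg(1)[OF xT[OF x]] n by (simp add: p_def carrier_cyclic)
      fix y assume y: "y \<in> carrier N"
      have "\<theta> (x \<otimes>\<^bsub>N\<^esub> y) = unit_root n (p x + p y)"
        using lg(2)[OF xT[OF x]] lg(2)[OF xT[OF y]] False x y by (simp add: \<theta> unit_root_add p_def)
      from lg_eq[OF this] xT[of "x \<otimes>\<^bsub>N\<^esub> y"] x y show "p (x \<otimes>\<^bsub>N\<^esub> y) = p x \<otimes>\<^bsub>integer_mod_group n\<^esub> p y"
        by (simp add: p_def)
    next
      fix k assume k: "k \<in> carrier (integer_mod_group n)"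
      obtain x where x: "x \<in> R" "\<theta> x = unit_root n k" using T_ex by blast
      then have "p x = k" using lg_eq[OF x(2)] xT[of x] k n by (simp add: p_def R carrier_cyclic)
      then show "k \<in> p ` carrier N" using x R by blast
    qed
    moreover have "\<theta> x = 1 \<and> \<not> \<epsilon> x" if "x \<in> carrier N" "p x = \<one>\<^bsub>integer_mod_group n\<^esub>" for x
      using lg(2)[OF xT[OF that(1)]] that False by (auto simp: p_def)
    ultimately show ?thesis using cyclic n by blast
  next
    case True
    then obtain r where r: "r \<in> carrier N" "\<epsilon> r" by blast
    define \<psi> where "\<psi> = (\<lambda>x. if \<epsilon> x then \<theta> x / \<theta> r else \<theta> x)"
    have \<psi>T: "\<psi> x \<in> T" if x: "x \<in> carrier N" for x
    proof (cases "\<epsilon> x")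
      case True
      define y where "y = x \<otimes>\<^bsub>N\<^esub> inv\<^bsub>N\<^esub> r"
      have y: "y \<in> carrier N" and xy: "x = y \<otimes>\<^bsub>N\<^esub> r" using x r by (simp_all add: y_def N.m_assoc)
      have "\<not> \<epsilon> y" using \<epsilon>[OF y r(1)] True r(2) by (simp flip: xy)
      then have "\<theta> x = \<theta> y * \<theta> r" unfolding xy using \<theta>[OF y r(1)] by simp
      then have "\<psi> x = \<theta> y" using True \<theta>0[OF r(1)] by (simp add: \<psi>_def)
      then show ?thesis using y \<open>\<not> \<epsilon> y\<close> by (simp add: T_def R_def)
    next
      case False
      then show ?thesis using x by (simp add: T_def R_def \<psi>_def)
    qed
    have \<psi>_mult: "\<psi> (x \<otimes>\<^bsub>N\<^esub> y) = \<psi> x * (if \<epsilon> x then inverse (\<psi> y) else \<psi> y)"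
      if "x \<in> carrier N" "y \<in> carrier N" for x y
      using that \<theta>0[OF r(1)] \<theta>0[OF that(1)] \<theta>0[OF that(2)] by (simp add: \<psi>_def \<theta> \<epsilon> field_simps)
    define p where "p = (\<lambda>x. (lg (\<psi> x), \<epsilon> x))"
    have "p \<in> epi N (dihedral_group n)"
      unfolding epi_iff_subset
    proof (intro conjI homI subsetI)
      fix x assume x: "x \<in> carrier N"
      then show "p x \<in> carrier (dihedral_group n)" using lg(1)[OF \<psi>T[OF x]] by (simp add: p_def dihedral_group_def)
      fix y assume y: "y \<in> carrier N"
      have "\<psi> (x \<otimes>\<^bsub>N\<^esub> y) = unit_root n (if \<epsilon> x then lg (\<psi> x) - lg (\<psi> y) else lg (\<psi> x) + lg (\<psi> y))"
        using lg(2)[OF \<psi>T[OF x]] lg(2)[OF \<psi>T[OF y]] x y unit_root_add[of n "lg (\<psi> x)" "- lg (\<psi> y)"]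
        by (simp add: \<psi>_mult unit_root_add unit_root_minus)
      from lg_eq[OF this] \<psi>T[of "x \<otimes>\<^bsub>N\<^esub> y"] x y show "p (x \<otimes>\<^bsub>N\<^esub> y) = p x \<otimes>\<^bsub>dihedral_group n\<^esub> p y"
        by (simp add: p_def dihedral_group_def \<epsilon>)
    next
      fix ks assume ks: "ks \<in> carrier (dihedral_group n)"
      then obtain k s where k: "ks = (k, s)" "k \<in> {0..<int n}" by (auto simp: dihedral_group_def)
      obtain x where x: "x \<in> R" "\<theta> x = unit_root n k" using T_ex by blast
      define y where "y = (if s then x \<otimes>\<^bsub>N\<^esub> r else x)"
      have y: "y \<in> carrier N" "\<epsilon> y = s" using x r by (auto simp: y_def R_def \<epsilon>)
      have "\<psi> y = unit_root n k"
        using x r \<theta>0[OF r(1)] by (auto simp: y_def \<psi>_def R_def \<epsilon> \<theta>)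
      from lg_eq[OF this \<psi>T[OF y(1)]] k y have "p y = ks" by (simp add: p_def)
      then show "ks \<in> p ` carrier N" using y by blast
    qed
    moreover have "\<theta> x = 1 \<and> \<not> \<epsilon> x" if "x \<in> carrier N" "p x = \<one>\<^bsub>dihedral_group n\<^esub>" for x
      using lg(2)[OF \<psi>T[OF that(1)]] that by (auto simp: p_def dihedral_group_def \<psi>_def)
    ultimately show ?thesis using dihedral n by blast
  qed
qed

subsection \<open>The rank of an infinite cyclic group\<close>

text \<open>
  If \<open>h\<close> is the isomorphism to \<open>\<int>\<close>, any two elements \<open>x\<close> and \<open>y\<close> satisfy the relation with coefficients \<open>h y\<close> and \<open>- h x\<close>.
\<close>

lemma group_rank_eq_1_if_iso_int:
  assumes A: "comm_group A" and iso: "A \<cong> integer_group"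
  shows "group_rank A = 1"
proof -
  interpret A: comm_group A by fact
  obtain h where h: "h \<in> iso A integer_group" using iso by (auto simp: is_iso_def)
  have hom: "h \<in> hom A integer_group" and bij: "bij_betw h (carrier A) UNIV"
    using h by (auto simp: iso_def integer_group_def)
  interpret h: group_hom A integer_group h
    using hom A.group_axioms by (simp add: group_hom_def group_hom_axioms_def)
  have h_mult: "h (x \<otimes>\<^bsub>A\<^esub> y) = h x + h y" if "x \<in> carrier A" "y \<in> carrier A" for x y
    using hom_mult[OF hom that] by simp
  have h_one: "h \<one>\<^bsub>A\<^esub> = 0" using h.hom_one by simp
  have h_pow: "h (x [^]\<^bsub>A\<^esub> k) = k * h x" if "x \<in> carrier A" for x and k :: int
    using h.hom_int_pow[OF that] by (simp add: mult.commute)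
  have h_inj: "x = y" if "x \<in> carrier A" "y \<in> carrier A" "h x = h y" for x y
    using bij that by (auto simp: bij_betw_def inj_on_def)
  have h_prod: "h (finprod A (\<lambda>s. s [^]\<^bsub>A\<^esub> c s) S) = (\<Sum>s\<in>S. c s * h s)"
    if "finite S" "S \<subseteq> carrier A" for S and c :: "'a \<Rightarrow> int"
    using that
  proof (induction S)
    case (insert x S)
    then have "finprod A (\<lambda>s. s [^]\<^bsub>A\<^esub> c s) (insert x S)
        = x [^]\<^bsub>A\<^esub> c x \<otimes>\<^bsub>A\<^esub> finprod A (\<lambda>s. s [^]\<^bsub>A\<^esub> c s) S"
      by (intro A.finprod_insert) auto
    moreover have "finprod A (\<lambda>s. s [^]\<^bsub>A\<^esub> c s) S \<in> carrier A"
      using insert by (intro A.finprod_closed) auto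
    ultimately show ?case using insert by (simp add: h_mult h_pow)
  qed (simp add: h_one)
  have prod_one: "finprod A (\<lambda>s. s [^]\<^bsub>A\<^esub> c s) S = \<one>\<^bsub>A\<^esub> \<longleftrightarrow> (\<Sum>s\<in>S. c s * h s) = 0"
    if "finite S" "S \<subseteq> carrier A" for S and c :: "'a \<Rightarrow> int"
  proof -
    have "finprod A (\<lambda>s. s [^]\<^bsub>A\<^esub> c s) S \<in> carrier A"
      using that by (intro A.finprod_closed) auto
    then show ?thesis using h_prod[OF that] h_one h_inj[OF _ A.one_closed] by metis
  qed
  have le: "card S \<le> 1" if "int_independent A S" for S
  proof (rule ccontr)
    assume "\<not> card S \<le> 1"
    have S: "S \<subseteq> carrier A" "finite S" and ind: "\<And>c s. (\<Sum>s\<in>S. c s * h s) = 0 \<Longrightarrow> s \<in> S \<Longrightarrow> c s = 0"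
      using that prod_one unfolding int_independent_def by blast+
    obtain x y where xy: "x \<in> S" "y \<in> S" "x \<noteq> y"
      using \<open>\<not> card S \<le> 1\<close> S(2) by (metis card_le_Suc0_iff_eq One_nat_def)
    have sum2: "(\<Sum>s\<in>S. (if s = x then a else if s = y then b else 0) * h s) = a * h x + b * h y" for a b
    proof -
      have "(\<Sum>s\<in>S. (if s = x then a else if s = y then b else 0) * h s)
          = (\<Sum>s\<in>{x, y}. (if s = x then a else if s = y then b else 0) * h s)"
        using S xy by (intro sum.mono_neutral_right) auto
      also have "\<dots> = a * h x + b * h y" using xy by simp
      finally show ?thesis .
    qed
    have "h y = 0" using ind[OF sum2[of "h y" "- h x", THEN trans] xy(1)] by simp
    have "(1 :: int) = 0" using ind[OF sum2[of 0 1, THEN trans] xy(2)] xy(3) \<open>h y = 0\<close> by simp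
    then show False by simp
  qed
  obtain g where g: "g \<in> carrier A" "h g = 1" using bij by (metis UNIV_I bij_betw_imp_surj_on imageE)
  have "int_independent A {g}"
    unfolding int_independent_def using g prod_one[of "{g}"] by auto
  then have "enat (card {g}) \<le> group_rank A"
    unfolding group_rank_def by (intro SUP_upper) auto
  moreover have "group_rank A \<le> 1"
    unfolding group_rank_def using le by (intro SUP_least) (auto simp: one_enat_def)
  ultimately show ?thesis by (simp add: one_enat_def antisym)
qed

section \<open>The quadric as a product of two lines\<close>

text \<open>
  In these coordinates the quadric is \<open>a d = b c\<close>, which the Segre embedding parametrises by \<open>a = s\<^sub>0 t\<^sub>0\<close>, \<open>b = s\<^sub>1 t\<^sub>0\<close>,
  \<open>c = s\<^sub>0 t\<^sub>1\<close> and \<open>d = s\<^sub>1 t\<^sub>1\<close>.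
\<close>

definition coord_a :: "complex^4 \<Rightarrow> complex" where "coord_a v = v$1 - v$3"
definition coord_b :: "complex^4 \<Rightarrow> complex" where "coord_b v = v$4 - v$2"
definition coord_c :: "complex^4 \<Rightarrow> complex" where "coord_c v = v$4 + v$2"
definition coord_d :: "complex^4 \<Rightarrow> complex" where "coord_d v = v$1 + v$3"

lemmas coord_defs = coord_a_def coord_b_def coord_c_def coord_d_def

definition of_coords :: "complex \<Rightarrow> complex \<Rightarrow> complex \<Rightarrow> complex \<Rightarrow> complex^4" where
  "of_coords a b c d = (\<chi> i. if i = 1 then (a + d) / 2 else if i = 2 then (c - b) / 2
     else if i = 3 then (d - a) / 2 else (b + c) / 2)"

lemma of_coords_nth [simp]:
  "of_coords a b c d $ 1 = (a + d) / 2" "of_coords a b c d $ 2 = (c - b) / 2"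
  "of_coords a b c d $ 3 = (d - a) / 2" "of_coords a b c d $ 4 = (b + c) / 2"
  by (simp_all add: of_coords_def)

lemma coords_of_coords [simp]:
  "coord_a (of_coords a b c d) = a" "coord_b (of_coords a b c d) = b"
  "coord_c (of_coords a b c d) = c" "coord_d (of_coords a b c d) = d"
  by (simp_all add: coord_defs field_simps)

lemma vec4_eq_iff: "v = w \<longleftrightarrow> v$1 = w$1 \<and> v$2 = w$2 \<and> v$3 = w$3 \<and> v$4 = w$4"
  for v w :: "complex^4"
  unfolding vec_eq_iff forall_4 ..

lemma of_coords_coords [simp]: "of_coords (coord_a v) (coord_b v) (coord_c v) (coord_d v) = v"
  unfolding vec4_eq_iff by (simp add: coord_defs)

lemma of_coords_eq_iff:
  "of_coords a b c d = of_coords a' b' c' d' \<longleftrightarrow> a = a' \<and> b = b' \<and> c = c' \<and> d = d'"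
  by (metis coords_of_coords)

lemma coords_scale [simp]:
  "coord_a (k *s v) = k * coord_a v" "coord_b (k *s v) = k * coord_b v"
  "coord_c (k *s v) = k * coord_c v" "coord_d (k *s v) = k * coord_d v"
  by (simp_all add: coord_defs algebra_simps)

lemma of_coords_scale: "k *s of_coords a b c d = of_coords (k * a) (k * b) (k * c) (k * d)"
  unfolding vec4_eq_iff by (simp add: algebra_simps)

lemma of_coords_eq_0_iff: "of_coords a b c d = 0 \<longleftrightarrow> a = 0 \<and> b = 0 \<and> c = 0 \<and> d = 0"
  using of_coords_eq_iff[of a b c d 0 0 0 0] by (simp add: vec4_eq_iff)

lemma quadric_coords:
  "(v$1)\<^sup>2 + (v$2)\<^sup>2 - (v$3)\<^sup>2 - (v$4)\<^sup>2 = coord_a v * coord_d v - coord_b v * coord_c v"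
  for v :: "complex^4"
  by (simp add: coord_defs power2_eq_square algebra_simps)

definition segre :: "complex \<times> complex \<Rightarrow> complex \<times> complex \<Rightarrow> complex^4" where
  "segre s t = of_coords (fst s * fst t) (snd s * fst t) (fst s * snd t) (snd s * snd t)"

definition pt :: "complex \<times> complex \<Rightarrow> complex \<times> complex \<Rightarrow> (complex^4) set" where
  "pt s t = proj_pt (segre s t)"

definition scale2 :: "complex \<Rightarrow> complex \<times> complex \<Rightarrow> complex \<times> complex" where
  "scale2 c s = (c * fst s, c * snd s)"

definition parallel :: "complex \<times> complex \<Rightarrow> complex \<times> complex \<Rightarrow> bool" where
  "parallel s s' \<longleftrightarrow> fst s * snd s' = snd s * fst s'"

lemma proj_pt_eq_iff: "proj_pt v = proj_pt w \<longleftrightarrow> (\<exists>c. c \<noteq> 0 \<and> w = c *s v)"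
proof
  assume "proj_pt v = proj_pt w"
  moreover have "w \<in> proj_pt w" unfolding proj_pt_def by (auto intro!: exI[of _ 1])
  ultimately show "\<exists>c. c \<noteq> 0 \<and> w = c *s v" by (auto simp: proj_pt_def)
next
  assume "\<exists>c. c \<noteq> 0 \<and> w = c *s v"
  then obtain c where c: "c \<noteq> 0" "w = c *s v" by blast
  have "\<exists>c'. k *s v = c' *s w \<and> c' \<noteq> 0" if "k \<noteq> 0" for k
    using c that by (intro exI[of _ "k / c"]) (simp add: vector_smult_assoc)
  moreover have "\<exists>c'. k *s w = c' *s v \<and> c' \<noteq> 0" if "k \<noteq> 0" for k
    using c that by (intro exI[of _ "k * c"]) (simp add: vector_smult_assoc)
  ultimately show "proj_pt v = proj_pt w" unfolding proj_pt_def by blast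
qed

lemma mem_proj_pt: "x \<in> proj_pt v \<longleftrightarrow> (\<exists>c. c \<noteq> 0 \<and> x = c *s v)"
  by (auto simp: proj_pt_def)

lemma segre_scale: "segre (scale2 c s) t = c *s segre s t" "segre s (scale2 c t) = c *s segre s t"
  by (simp_all add: segre_def scale2_def of_coords_scale mult_ac)

lemma segre_eq_0_iff: "segre s t = 0 \<longleftrightarrow> s = (0, 0) \<or> t = (0, 0)"
  by (cases s; cases t) (auto simp: segre_def of_coords_eq_0_iff)

lemma parallel_iff:
  assumes "s \<noteq> (0, 0)" "s' \<noteq> (0, 0)"
  shows "parallel s s' \<longleftrightarrow> (\<exists>c. c \<noteq> 0 \<and> s' = scale2 c s)"
proof
  assume p: "parallel s s'"
  obtain a b a' b' where s: "s = (a, b)" "s' = (a', b')" by (metis surj_pair)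
  have p: "a * b' = b * a'" using p by (simp add: parallel_def s)
  show "\<exists>c. c \<noteq> 0 \<and> s' = scale2 c s"
  proof (cases "a = 0")
    case True
    then have "b \<noteq> 0" "a' = 0" "b' \<noteq> 0" using assms p s by auto
    then show ?thesis using True by (intro exI[of _ "b' / b"]) (simp add: s scale2_def)
  next
    case False
    then have "a' \<noteq> 0" using assms p s by auto
    then show ?thesis using False p by (intro exI[of _ "a' / a"]) (simp add: s scale2_def field_simps)
  qed
qed (auto simp: parallel_def scale2_def)

lemma scale2_eq_0_iff [simp]: "scale2 c s = (0, 0) \<longleftrightarrow> c = 0 \<or> s = (0, 0)"
  by (cases s) (auto simp: scale2_def)

lemma pt_eq_iff:
  assumes "s \<noteq> (0, 0)" "t \<noteq> (0, 0)" "s' \<noteq> (0, 0)" "t' \<noteq> (0, 0)"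
  shows "pt s t = pt s' t' \<longleftrightarrow> parallel s s' \<and> parallel t t'"
proof
  assume "pt s t = pt s' t'"
  then obtain c where c: "segre s' t' = c *s segre s t" by (auto simp: pt_def proj_pt_eq_iff)
  obtain a b a' b' where s: "s = (a, b)" "s' = (a', b')" by (metis surj_pair)
  obtain e f e' f' where t: "t = (e, f)" "t' = (e', f')" by (metis surj_pair)
  have eq: "a' * e' = c * (a * e)" "b' * e' = c * (b * e)" "a' * f' = c * (a * f)" "b' * f' = c * (b * f)"
    using c by (simp_all add: s t segre_def of_coords_scale of_coords_eq_iff)
  have "(a * b' - b * a') * e' = 0" "(a * b' - b * a') * f' = 0"
    using eq by (simp_all add: algebra_simps)
  moreover have "(e * f' - f * e') * a' = 0" "(e * f' - f * e') * b' = 0"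
  proof -
    have "(e * f' - f * e') * z = e * (z * f') - f * (z * e')" for z by (simp add: algebra_simps)
    then show "(e * f' - f * e') * a' = 0" "(e * f' - f * e') * b' = 0" by (simp_all add: eq)
  qed
  ultimately show "parallel s s' \<and> parallel t t'"
    using assms by (auto simp: s t parallel_def)
next
  assume "parallel s s' \<and> parallel t t'"
  then obtain c c' where c: "c \<noteq> 0" "c' \<noteq> 0" "s' = scale2 c s" "t' = scale2 c' t"
    using assms by (auto simp: parallel_iff)
  then show "pt s t = pt s' t'"
    unfolding pt_def proj_pt_eq_iff
    by (intro exI[of _ "c * c'"]) (simp add: segre_scale vector_smult_assoc)
qed

lemma pt_in_Q22: "s \<noteq> (0, 0) \<Longrightarrow> t \<noteq> (0, 0) \<Longrightarrow> pt s t \<in> Q22"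
  unfolding Q22_def pt_def quadric_coords
  by (intro CollectI exI[of _ "segre s t"] conjI refl) (simp_all add: segre_eq_0_iff, simp add: segre_def)

text \<open>
  The factors of a point with coordinates \<open>(a, b, c, d)\<close> are \<open>(a : b) = (c : d)\<close> and \<open>(a : c) = (b : d)\<close>. At each point at least one of
  the two expressions is defined.
\<close>

lemma Q22_cases:
  assumes "q \<in> Q22"
  obtains s t where "s \<noteq> (0, 0)" "t \<noteq> (0, 0)" "q = pt s t"
proof -
  obtain v where v: "q = proj_pt v" "v \<noteq> 0" "coord_a v * coord_d v = coord_b v * coord_c v"
    using assms unfolding Q22_def quadric_coords by auto
  define a b c d where "a = coord_a v" and "b = coord_b v" and "c = coord_c v" and "d = coord_d v"
  have veq: "v = of_coords a b c d" by (simp add: a_def b_def c_def d_def)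
  have ad: "a * d = b * c" using v by (simp add: a_def b_def c_def d_def)
  have nz: "\<not> (a = 0 \<and> b = 0 \<and> c = 0 \<and> d = 0)" using v(2) unfolding veq of_coords_eq_0_iff .
  consider "a \<noteq> 0" | "a = 0" "b \<noteq> 0" | "a = 0" "b = 0" by blast
  then show ?thesis
  proof cases
    case 1
    then have "segre (a, b) (1, c / a) = v" using ad by (simp add: segre_def veq of_coords_eq_iff field_simps)
    then show ?thesis using that[of "(a, b)" "(1, c / a)"] 1 v by (simp add: pt_def)
  next
    case 2
    then have "segre (a, b) (1, d / b) = v" using ad by (simp add: segre_def veq of_coords_eq_iff field_simps)
    then show ?thesis using that[of "(a, b)" "(1, d / b)"] 2 v by (simp add: pt_def)
  next
    case 3
    then have "segre (c, d) (0, 1) = v" by (simp add: segre_def veq)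
    then show ?thesis using that[of "(c, d)" "(0, 1)"] 3 v nz by (simp add: pt_def)
  qed
qed

section \<open>Forms on the quadric are bihomogeneous polynomials\<close>

lemma real_form_coords:
  "real_form 1 coord_a" "real_form 1 coord_b" "real_form 1 coord_c" "real_form 1 coord_d"
  unfolding coord_defs[abs_def]
  by (intro real_form_minus real_form_add real_form_coord)+

lemma bihom_1_1:
  "bihom 1 1 [:[:p, q:], [:r, u:]:] s t =
    of_real p * (fst s * fst t) + of_real q * (snd s * fst t) + of_real r * (fst s * snd t) + of_real u * (snd s * snd t)"
  by (simp add: bihom_def algebra_simps)

lemma bidegree_le_1_1: "bidegree_le 1 1 [:[:p, q:], [:r, u:]:]"
  by (auto simp: bidegree_le_def coeff_pCons split: nat.splits)

lemma real_form_segre: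
  assumes "real_form d F"
  shows "\<exists>P. bidegree_le d d P \<and> (\<forall>s t. F (segre s t) = bihom d d P s t)"
  using assms
proof (rule real_form_induct)
  fix d
  show "\<exists>P. bidegree_le d d P \<and> (\<forall>s t. 0 = bihom d d P s t)"
    by (intro exI[of _ 0]) (simp add: bidegree_le_zero)
next
  show "\<exists>P. bidegree_le 0 0 P \<and> (\<forall>s t. 1 = bihom 0 0 P s t)"
    using bidegree_le_const[of 0 0 1] bihom_const00[of 1] by (intro exI[of _ "[:[:1:]:]"]) simp
next
  fix i :: 4
  have ex: "\<exists>p q r u. \<forall>s t. segre s t $ i = bihom 1 1 [:[:p, q:], [:r, u:]:] s t"
  proof -
    consider "i = 1" | "i = 2" | "i = 3" | "i = 4" using exhaust_4 by blast
    then show ?thesis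
    proof cases
      case 1
      show ?thesis unfolding bihom_1_1
        by (rule exI[of _ "1/2"], rule exI[of _ "0"], rule exI[of _ "0"], rule exI[of _ "1/2"])
          (auto simp: \<open>i = 1\<close> segre_def field_simps)
    next
      case 2
      show ?thesis unfolding bihom_1_1
        by (rule exI[of _ "0"], rule exI[of _ "-1/2"], rule exI[of _ "1/2"], rule exI[of _ "0"])
          (auto simp: \<open>i = 2\<close> segre_def field_simps)
    next
      case 3
      show ?thesis unfolding bihom_1_1
        by (rule exI[of _ "-1/2"], rule exI[of _ "0"], rule exI[of _ "0"], rule exI[of _ "1/2"])
          (auto simp: \<open>i = 3\<close> segre_def field_simps)
    next
      case 4
      show ?thesis unfolding bihom_1_1
        by (rule exI[of _ "0"], rule exI[of _ "1/2"], rule exI[of _ "1/2"], rule exI[of _ "0"])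
          (auto simp: \<open>i = 4\<close> segre_def field_simps)
    qed
  qed
  then show "\<exists>P. bidegree_le 1 1 P \<and> (\<forall>s t. segre s t $ i = bihom 1 1 P s t)"
    using bidegree_le_1_1 by blast
next
  fix d e F G
  assume "\<exists>P. bidegree_le d d P \<and> (\<forall>s t. F (segre s t) = bihom d d P s t)"
    "\<exists>P. bidegree_le e e P \<and> (\<forall>s t. G (segre s t) = bihom e e P s t)"
  then show "\<exists>P. bidegree_le (d + e) (d + e) P \<and> (\<forall>s t. F (segre s t) * G (segre s t) = bihom (d + e) (d + e) P s t)"
    using bidegree_le_mult bihom_mult by metis
next
  fix d F G
  assume "\<exists>P. bidegree_le d d P \<and> (\<forall>s t. F (segre s t) = bihom d d P s t)"
    "\<exists>P. bidegree_le d d P \<and> (\<forall>s t. G (segre s t) = bihom d d P s t)"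
  then show "\<exists>P. bidegree_le d d P \<and> (\<forall>s t. F (segre s t) + G (segre s t) = bihom d d P s t)"
    using bidegree_le_add bihom_add by metis
next
  fix d r F
  assume "\<exists>P. bidegree_le d d P \<and> (\<forall>s t. F (segre s t) = bihom d d P s t)"
  then show "\<exists>P. bidegree_le d d P \<and> (\<forall>s t. of_real r * F (segre s t) = bihom d d P s t)"
    using bidegree_le_scale bihom_scale by metis
qed

lemma real_form_sum:
  assumes "finite S" "\<And>i. i \<in> S \<Longrightarrow> real_form d (F i)"
  shows "real_form d (\<lambda>x. \<Sum>i\<in>S. F i x)"
  using assms by (induction S) (auto simp: real_form_zero intro: real_form_add)

lemma bihom_is_real_form:
  "\<exists>F. real_form d F \<and> (\<forall>s t. F (segre s t) = bihom d d P s t)"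
proof -
  \<comment> \<open>The monomial of degrees \<open>k\<close> in \<open>s\<^sub>1\<close> and \<open>l\<close> in \<open>t\<^sub>1\<close> contains \<open>s\<^sub>1 t\<^sub>1\<close> with the exponent \<open>min k l\<close>,
    \<open>s\<^sub>0 t\<^sub>0\<close> with the exponent \<open>d - max k l\<close>, and the rest consists of factors \<open>s\<^sub>0 t\<^sub>1\<close> or \<open>s\<^sub>1 t\<^sub>0\<close>.\<close>
  define M where "M = (\<lambda>l k x. if k \<le> l then coord_a x ^ (d - l) * (coord_c x ^ (l - k) * coord_d x ^ k)
    else coord_a x ^ (d - k) * (coord_b x ^ (k - l) * coord_d x ^ l))"
  have M_form: "real_form d (M l k)" if "l \<le> d" "k \<le> d" for l k
  proof (cases "k \<le> l")
    case True
    have "real_form (1 * (d - l) + (1 * (l - k) + 1 * k))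
        (\<lambda>x. coord_a x ^ (d - l) * (coord_c x ^ (l - k) * coord_d x ^ k))"
      by (intro real_form_mult real_form_power real_form_coords)
    then show ?thesis using True that by (simp add: M_def[abs_def])
  next
    case False
    have "real_form (1 * (d - k) + (1 * (k - l) + 1 * l))
        (\<lambda>x. coord_a x ^ (d - k) * (coord_b x ^ (k - l) * coord_d x ^ l))"
      by (intro real_form_mult real_form_power real_form_coords)
    then show ?thesis using False that by (simp add: M_def[abs_def])
  qed
  have M_segre: "M l k (segre s t) = (fst s ^ (d - k) * snd s ^ k) * (fst t ^ (d - l) * snd t ^ l)"
    if "l \<le> d" "k \<le> d" for l k s t
  proof (cases "k \<le> l")
    case True
    have "fst s ^ (d - k) = fst s ^ (d - l) * fst s ^ (l - k)" "snd t ^ l = snd t ^ (l - k) * snd t ^ k"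
      using True that by (simp_all flip: power_add)
    then show ?thesis using True by (simp add: M_def segre_def power_mult_distrib mult_ac)
  next
    case False
    then have "k = (k - l) + l" "d - l = (d - k) + (k - l)" using that by simp_all
    then have "snd s ^ k = snd s ^ (k - l) * snd s ^ l" "fst t ^ (d - l) = fst t ^ (d - k) * fst t ^ (k - l)"
      by (metis power_add)+
    then show ?thesis using False by (simp add: M_def segre_def power_mult_distrib mult_ac)
  qed
  define F where "F = (\<lambda>x. \<Sum>l\<le>d. \<Sum>k\<le>d. of_real (coeff (coeff P l) k) * M l k x)"
  have "real_form d F"
    unfolding F_def by (intro real_form_sum real_form_scale M_form) auto
  moreover have "F (segre s t) = bihom d d P s t" for s t
    unfolding F_def bihom_def by (intro sum.cong refl) (simp add: M_segre)
  ultimately show ?thesis by blast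
qed

text \<open>The polynomial in the affine coordinates \<open>s\<^sub>1/s\<^sub>0\<close> and \<open>t\<^sub>1/t\<^sub>0\<close> to which a form restricts.\<close>

definition dehom :: "(complex^4 \<Rightarrow> complex) \<Rightarrow> real poly poly" where
  "dehom F = (THE P. \<forall>x y. eval2 P x y = F (segre (1, x) (1, y)))"

lemma dehom_eqI:
  assumes "\<And>x y. eval2 P x y = F (segre (1, x) (1, y))"
  shows "dehom F = P"
  unfolding dehom_def using assms by (intro the_equality) (auto intro: eval2_eqI)

lemma dehom_form:
  assumes "real_form d F"
  shows "bidegree_le d d (dehom F)" "F (segre s t) = bihom d d (dehom F) s t"
proof -
  obtain P where P: "bidegree_le d d P" "\<And>s t. F (segre s t) = bihom d d P s t"
    using real_form_segre[OF assms] by blast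
  then have "dehom F = P" by (intro dehom_eqI) (simp add: eval2_bihom)
  with P show "bidegree_le d d (dehom F)" "F (segre s t) = bihom d d (dehom F) s t" by simp_all
qed

lemma eval2_dehom: "real_form d F \<Longrightarrow> eval2 (dehom F) x y = F (segre (1, x) (1, y))"
  using dehom_form[of d F] by (simp add: eval2_bihom)

lemma dehom_mult: "real_form d F \<Longrightarrow> real_form e G \<Longrightarrow> dehom (\<lambda>x. F x * G x) = dehom F * dehom G"
  by (rule dehom_eqI) (simp add: eval2_dehom)

lemma nonvanishing_at_proj_pt:
  assumes "real_form d F"
  shows "nonvanishing_at F (proj_pt v) \<longleftrightarrow> F v \<noteq> 0"
proof
  have "v \<in> proj_pt v" unfolding mem_proj_pt by (intro exI[of _ 1]) simp
  then show "nonvanishing_at F (proj_pt v) \<Longrightarrow> F v \<noteq> 0" by (simp add: nonvanishing_at_def)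
  show "F v \<noteq> 0 \<Longrightarrow> nonvanishing_at F (proj_pt v)"
    by (auto simp: nonvanishing_at_def mem_proj_pt real_form_homogeneous[OF assms])
qed

lemma nonvanishing_at_pt:
  assumes "real_form d F"
  shows "nonvanishing_at F (pt s t) \<longleftrightarrow> F (segre s t) \<noteq> 0"
  unfolding pt_def by (rule nonvanishing_at_proj_pt[OF assms])

lemma ex_nonvanishing_iff:
  assumes "real_form d F"
  shows "(\<exists>p\<in>Q22. nonvanishing_at F p) \<longleftrightarrow> dehom F \<noteq> 0"
proof
  assume "\<exists>p\<in>Q22. nonvanishing_at F p"
  then obtain s t where "F (segre s t) \<noteq> 0"
    using nonvanishing_at_pt[OF assms] by (metis Q22_cases)
  then show "dehom F \<noteq> 0" using dehom_form[OF assms] by auto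
next
  assume "dehom F \<noteq> 0"
  then obtain x y where "eval2 (dehom F) x y \<noteq> 0" by (rule eval2_nonzero)
  then have "nonvanishing_at F (pt (1, x) (1, y))"
    by (simp add: eval2_dehom[OF assms] nonvanishing_at_pt[OF assms])
  then show "\<exists>p\<in>Q22. nonvanishing_at F p" by (rule bexI) (simp add: pt_in_Q22)
qed

lemma fractions_iff:
  "(F, G) \<in> fractions \<longleftrightarrow> (\<exists>d. real_form d F \<and> real_form d G) \<and> dehom F \<noteq> 0 \<and> dehom G \<noteq> 0"
  unfolding fractions_def using ex_nonvanishing_iff by auto

section \<open>The function field\<close>

definition fraction_value ::
  "(complex^4 \<Rightarrow> complex) \<times> (complex^4 \<Rightarrow> complex) \<Rightarrow> real poly poly fract" where
  "fraction_value FG = Fract (dehom (fst FG)) (dehom (snd FG))"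

lemma form_eq_on_Q22_iff:
  assumes "real_form d F" "real_form d G"
  shows "(\<forall>p\<in>Q22. \<forall>x\<in>p. F x = G x) \<longleftrightarrow> dehom F = dehom G"
proof
  assume eq: "\<forall>p\<in>Q22. \<forall>x\<in>p. F x = G x"
  have "eval2 (dehom F) x y = eval2 (dehom G) x y" for x y
  proof -
    have "segre (1, x) (1, y) \<in> pt (1, x) (1, y)" unfolding pt_def mem_proj_pt by (intro exI[of _ 1]) simp
    then show ?thesis using eq pt_in_Q22[of "(1, x)" "(1, y)"] by (simp add: eval2_dehom[OF assms(1)] eval2_dehom[OF assms(2)])
  qed
  then show "dehom F = dehom G" by (rule eval2_eqI)
next
  assume eq: "dehom F = dehom G"
  show "\<forall>p\<in>Q22. \<forall>x\<in>p. F x = G x"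
  proof (intro ballI)
    fix p x assume "p \<in> Q22" "x \<in> p"
    then obtain s t c where "x = c *s segre s t" by (metis Q22_cases mem_proj_pt pt_def)
    then show "F x = G x"
      using dehom_form(2)[OF assms(1), of s t] dehom_form(2)[OF assms(2), of s t] eq
      by (simp add: real_form_homogeneous[OF assms(1)] real_form_homogeneous[OF assms(2)])
  qed
qed

lemma fraction_rel_iff:
  "(FG, FG') \<in> fraction_rel \<longleftrightarrow> FG \<in> fractions \<and> FG' \<in> fractions \<and> fraction_value FG = fraction_value FG'"
proof -
  obtain F G F' G' where FG: "FG = (F, G)" "FG' = (F', G')" by (metis surj_pair)
  have "(\<forall>p\<in>Q22. \<forall>x\<in>p. F x * G' x = F' x * G x) \<longleftrightarrow> fraction_value FG = fraction_value FG'"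
    if fr: "FG \<in> fractions" "FG' \<in> fractions"
  proof -
    obtain d e where d: "real_form d F" "real_form d G" "real_form e F'" "real_form e G'"
      and nz: "dehom G \<noteq> 0" "dehom G' \<noteq> 0"
      using fr by (auto simp: FG fractions_iff)
    have "real_form (d + e) (\<lambda>x. F x * G' x)" "real_form (d + e) (\<lambda>x. F' x * G x)"
      using real_form_mult[OF d(1,4)] real_form_mult[OF d(3,2)] by (simp_all add: add.commute)
    then have "(\<forall>p\<in>Q22. \<forall>x\<in>p. F x * G' x = F' x * G x) \<longleftrightarrow> dehom F * dehom G' = dehom F' * dehom G"
      by (subst form_eq_on_Q22_iff) (simp_all add: dehom_mult[OF d(1,4)] dehom_mult[OF d(3,2)])
    also have "\<dots> \<longleftrightarrow> fraction_value FG = fraction_value FG'"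
      using nz by (simp add: FG fraction_value_def eq_fract)
    finally show ?thesis .
  qed
  then show ?thesis unfolding FG fraction_rel_def by auto
qed

text \<open>
  The nonzero rational functions correspond to the nonzero elements of the field of fractions of \<open>\<real>[x, y]\<close>.
\<close>

definition ratfun :: "real poly poly fract \<Rightarrow> ratfun" where
  "ratfun k = {FG \<in> fractions. fraction_value FG = k}"

lemma fraction_value_nonzero: "FG \<in> fractions \<Longrightarrow> fraction_value FG \<noteq> 0"
  by (cases FG) (auto simp: fraction_value_def fractions_iff Zero_fract_def eq_fract)

lemma fraction_exists:
  assumes "P \<noteq> 0" "Q \<noteq> 0" "bidegree_le d d P" "bidegree_le d d Q"
  obtains F G where "real_form d F" "real_form d G" "dehom F = P" "dehom G = Q" "(F, G) \<in> fractions"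
proof -
  obtain F G where FG: "real_form d F" "\<And>s t. F (segre s t) = bihom d d P s t"
    "real_form d G" "\<And>s t. G (segre s t) = bihom d d Q s t"
    using bihom_is_real_form by metis
  then have "dehom F = P" "dehom G = Q"
    using assms by (auto intro!: dehom_eqI simp: eval2_bihom)
  then show ?thesis using that FG assms by (auto simp: fractions_iff)
qed

lemma bidegree_le_exists:
  obtains d where "bidegree_le d d P" "bidegree_le d d Q"
proof
  let ?d = "max (max (degx P) (degree P)) (max (degx Q) (degree Q))"
  show "bidegree_le ?d ?d P" "bidegree_le ?d ?d Q" by (auto simp: bidegree_le_iff)
qed

lemma ratfun_nonempty:
  assumes "k \<noteq> 0"
  shows "ratfun k \<noteq> {}"
proof -
  obtain P Q where PQ: "k = Fract P Q" "Q \<noteq> 0" by (cases k) auto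
  then have "P \<noteq> 0" using assms by (auto simp: Zero_fract_def eq_fract)
  obtain d where "bidegree_le d d P" "bidegree_le d d Q" by (rule bidegree_le_exists)
  with \<open>P \<noteq> 0\<close> PQ obtain F G where "(F, G) \<in> fractions" "dehom F = P" "dehom G = Q"
    by (metis fraction_exists)
  then show ?thesis using PQ by (auto simp: ratfun_def fraction_value_def)
qed

lemma fraction_rel_Image: "FG \<in> fractions \<Longrightarrow> fraction_rel `` {FG} = ratfun (fraction_value FG)"
  by (auto simp: fraction_rel_iff ratfun_def)

lemma carrier_ratfun_group: "carrier ratfun_group = ratfun ` {k. k \<noteq> 0}"
proof
  show "carrier ratfun_group \<subseteq> ratfun ` {k. k \<noteq> 0}"
    by (auto simp: ratfun_group_def fraction_rel_Image fraction_value_nonzero elim!: quotientE)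
  show "ratfun ` {k. k \<noteq> 0} \<subseteq> carrier ratfun_group"
  proof clarify
    fix k :: "real poly poly fract" assume "k \<noteq> 0"
    then obtain FG where "FG \<in> ratfun k" using ratfun_nonempty by blast
    then have "FG \<in> fractions" "fraction_rel `` {FG} = ratfun k"
      by (auto simp: ratfun_def fraction_rel_Image)
    then show "ratfun k \<in> carrier ratfun_group" by (auto simp: ratfun_group_def quotient_def)
  qed
qed

lemma ratfun_inj: "k \<noteq> 0 \<Longrightarrow> ratfun k = ratfun k' \<longleftrightarrow> k = k'"
  using ratfun_nonempty[of k] by (auto simp: ratfun_def)

lemma fraction_mult:
  assumes "(F, G) \<in> fractions" "(F', G') \<in> fractions"
  shows "(\<lambda>x. F x * F' x, \<lambda>x. G x * G' x) \<in> fractions"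
    "fraction_value (\<lambda>x. F x * F' x, \<lambda>x. G x * G' x) = fraction_value (F, G) * fraction_value (F', G')"
proof -
  obtain d e where d: "real_form d F" "real_form d G" "real_form e F'" "real_form e G'"
    using assms by (auto simp: fractions_iff)
  show "(\<lambda>x. F x * F' x, \<lambda>x. G x * G' x) \<in> fractions"
    using assms d real_form_mult[OF d(1,3)] real_form_mult[OF d(2,4)]
    by (auto simp: fractions_iff dehom_mult[OF d(1,3)] dehom_mult[OF d(2,4)])
  show "fraction_value (\<lambda>x. F x * F' x, \<lambda>x. G x * G' x) = fraction_value (F, G) * fraction_value (F', G')"
    by (simp add: fraction_value_def dehom_mult[OF d(1,3)] dehom_mult[OF d(2,4)])
qed

lemma ratfun_mult:
  assumes "k \<noteq> 0" "k' \<noteq> 0"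
  shows "ratfun k \<otimes>\<^bsub>ratfun_group\<^esub> ratfun k' = ratfun (k * k')"
proof -
  let ?S = "{(\<lambda>x. F x * F' x, \<lambda>x. G x * G' x) | F G F' G'. (F, G) \<in> ratfun k \<and> (F', G') \<in> ratfun k'}"
  have S: "?S \<subseteq> ratfun (k * k')"
  proof
    fix X assume "X \<in> ?S"
    then obtain F G F' G' where X: "X = (\<lambda>x. F x * F' x, \<lambda>x. G x * G' x)"
      "(F, G) \<in> ratfun k" "(F', G') \<in> ratfun k'" by blast
    then show "X \<in> ratfun (k * k')" using fraction_mult[of F G F' G'] by (simp add: ratfun_def)
  qed
  have "?S \<noteq> {}"
  proof -
    obtain F G F' G' where "(F, G) \<in> ratfun k" "(F', G') \<in> ratfun k'"
      using ratfun_nonempty[OF assms(1)] ratfun_nonempty[OF assms(2)] by (metis equals0I surj_pair)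
    then show ?thesis by blast
  qed
  have "fraction_rel `` ?S = ratfun (k * k')"
  proof -
    have "fraction_rel `` {X} = ratfun (k * k')" if "X \<in> ?S" for X
    proof -
      have "X \<in> ratfun (k * k')" using S that by blast
      then show ?thesis using fraction_rel_Image[of X] by (simp add: ratfun_def)
    qed
    then have "(\<Union>X\<in>?S. fraction_rel `` {X}) = ratfun (k * k')" using \<open>?S \<noteq> {}\<close> by blast
    then show ?thesis by (metis Image_eq_UN)
  qed
  then show ?thesis by (simp add: ratfun_group_def)
qed

lemma ratfun_one: "\<one>\<^bsub>ratfun_group\<^esub> = ratfun 1"
proof -
  have one: "dehom (\<lambda>_. 1) = 1" by (rule dehom_eqI) simp
  have "(\<lambda>_. 1, \<lambda>_. 1) \<in> fractions"
    using real_form_const[of 1] by (auto simp: fractions_iff one)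
  then show ?thesis
    by (simp add: ratfun_group_def fraction_rel_Image fraction_value_def one One_fract_def)
qed

lemma comm_group_ratfun_group: "comm_group ratfun_group"
proof (rule comm_groupI)
  fix A assume "A \<in> carrier ratfun_group"
  then obtain k where k: "k \<noteq> 0" "A = ratfun k" by (auto simp: carrier_ratfun_group)
  then show "\<exists>B\<in>carrier ratfun_group. B \<otimes>\<^bsub>ratfun_group\<^esub> A = \<one>\<^bsub>ratfun_group\<^esub>"
    by (intro bexI[of _ "ratfun (inverse k)"]) (auto simp: carrier_ratfun_group ratfun_mult ratfun_one)
qed (auto simp: carrier_ratfun_group ratfun_mult ratfun_one mult_ac)

text \<open>
  The units of the local ring at \<open>pt s t\<close>, as elements of the field of fractions. The two degrees may differ, which
  makes the definition applicable to polynomials of any bidegree.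
\<close>

definition unit_at :: "complex \<times> complex \<Rightarrow> complex \<times> complex \<Rightarrow> real poly poly fract set" where
  "unit_at s t = {k. \<exists>m n P Q. bidegree_le m n P \<and> bidegree_le m n Q \<and>
     bihom m n P s t \<noteq> 0 \<and> bihom m n Q s t \<noteq> 0 \<and> k = Fract P Q}"

lemma unit_atI:
  "bidegree_le m n P \<Longrightarrow> bidegree_le m n Q \<Longrightarrow> bihom m n P s t \<noteq> 0 \<Longrightarrow> bihom m n Q s t \<noteq> 0 \<Longrightarrow>
    Fract P Q \<in> unit_at s t"
  unfolding unit_at_def by blast

lemma unit_at_mult:
  assumes "k \<in> unit_at s t" "k' \<in> unit_at s t"
  shows "k * k' \<in> unit_at s t"
proof -
  obtain m n P Q where 1: "bidegree_le m n P" "bidegree_le m n Q" "bihom m n P s t \<noteq> 0" "bihom m n Q s t \<noteq> 0" "k = Fract P Q"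
    using assms(1) by (auto simp: unit_at_def)
  obtain m' n' P' Q' where 2: "bidegree_le m' n' P'" "bidegree_le m' n' Q'" "bihom m' n' P' s t \<noteq> 0" "bihom m' n' Q' s t \<noteq> 0" "k' = Fract P' Q'"
    using assms(2) by (auto simp: unit_at_def)
  have "Fract (P * P') (Q * Q') \<in> unit_at s t"
    using 1 2 by (intro unit_atI[of "m + m'" "n + n'"] bidegree_le_mult) (simp_all add: bihom_mult)
  then show ?thesis by (simp add: 1 2)
qed

lemma unit_at_inverse:
  assumes "k \<in> unit_at s t"
  shows "inverse k \<in> unit_at s t"
proof -
  obtain m n P Q where "bidegree_le m n P" "bidegree_le m n Q" "bihom m n P s t \<noteq> 0" "bihom m n Q s t \<noteq> 0" "k = Fract P Q"
    using assms by (auto simp: unit_at_def)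
  then show ?thesis using unit_atI[of m n Q P s t] by simp
qed

lemma unit_at_one: "1 \<in> unit_at s t"
  unfolding One_fract_def using bidegree_le_const[of 0 0 1] bihom_const00[of 1]
  by (intro unit_atI[of 0 0]) (simp_all add: one_pCons)

lemma unit_at_divide: "k \<in> unit_at s t \<Longrightarrow> k' \<in> unit_at s t \<Longrightarrow> k / k' \<in> unit_at s t"
  using unit_at_mult[OF _ unit_at_inverse] by (simp add: divide_inverse)

lemma unit_at_nonzero:
  assumes "k \<in> unit_at s t"
  shows "k \<noteq> 0"
proof -
  obtain m n P Q where "bihom m n P s t \<noteq> 0" "bihom m n Q s t \<noteq> 0" and k: "k = Fract P Q"
    using assms by (auto simp: unit_at_def)
  then have "P \<noteq> 0" "Q \<noteq> 0" by auto
  then show ?thesis unfolding k Zero_fract_def by (simp add: eq_fract)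
qed

lemma unit_at_power_int: "k \<in> unit_at s t \<Longrightarrow> k powi i \<in> unit_at s t"
proof -
  assume k: "k \<in> unit_at s t"
  have pow: "k ^ n \<in> unit_at s t" for n by (induction n) (auto intro: unit_at_one unit_at_mult k)
  then show ?thesis by (auto simp: power_int_def power_inverse intro: unit_at_inverse)
qed

lemma bihom_linear_x:
  "bidegree_le 1 0 [:[:a, b:]:]" "bihom 1 0 [:[:a, b:]:] s t = of_real a * fst s + of_real b * snd s"
  by (auto simp: bidegree_le_def bihom_def coeff_pCons split: nat.splits)

lemma bihom_linear_y:
  "bidegree_le 0 1 [:[:a:], [:b:]:]" "bihom 0 1 [:[:a:], [:b:]:] s t = of_real a * fst t + of_real b * snd t"
  by (auto simp: bidegree_le_def bihom_def coeff_pCons split: nat.splits)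

text \<open>
  A numerator and a denominator of the same bidegree \<open>(m, n)\<close> can be brought to a bidegree \<open>(d, d)\<close> by multiplying both of them
  with coordinate functions that do not vanish at the point.
\<close>

lemma unit_at_square:
  assumes "k \<in> unit_at s t" "s \<noteq> (0, 0)" "t \<noteq> (0, 0)"
  obtains d P Q where "bidegree_le d d P" "bidegree_le d d Q" "bihom d d P s t \<noteq> 0" "bihom d d Q s t \<noteq> 0" "k = Fract P Q"
proof -
  obtain m n P Q where 1: "bidegree_le m n P" "bidegree_le m n Q" "bihom m n P s t \<noteq> 0" "bihom m n Q s t \<noteq> 0" "k = Fract P Q"
    using assms(1) by (auto simp: unit_at_def)
  obtain X where X: "bidegree_le 1 0 X" "bihom 1 0 X s t \<noteq> 0"
  proof (cases "fst s = 0")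
    case True
    then have "snd s \<noteq> 0" using assms(2) by (cases s) auto
    then show ?thesis using that bihom_linear_x(1)[of 0 1] bihom_linear_x(2)[of 0 1 s t] by auto
  qed (use that bihom_linear_x(1)[of 1 0] bihom_linear_x(2)[of 1 0 s t] in auto)
  obtain Y where Y: "bidegree_le 0 1 Y" "bihom 0 1 Y s t \<noteq> 0"
  proof (cases "fst t = 0")
    case True
    then have "snd t \<noteq> 0" using assms(3) by (cases t) auto
    then show ?thesis using that bihom_linear_y(1)[of 0 1] bihom_linear_y(2)[of 0 1 s t] by auto
  qed (use that bihom_linear_y(1)[of 1 0] bihom_linear_y(2)[of 1 0 s t] in auto)
  have Xp: "bidegree_le i 0 (X ^ i) \<and> bihom i 0 (X ^ i) s t \<noteq> 0"
    and Yp: "bidegree_le 0 i (Y ^ i) \<and> bihom 0 i (Y ^ i) s t \<noteq> 0" for i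
    using bihom_power[OF X(1), of i] bihom_power[OF Y(1), of i] X(2) Y(2) by simp_all
  define d Z where "d = max m n" and "Z = X ^ (d - m) * Y ^ (d - n)"
  have Z: "bidegree_le (d - m) (d - n) Z" "bihom (d - m) (d - n) Z s t \<noteq> 0"
    using bidegree_le_mult[of "d - m" 0 "X ^ (d - m)" 0 "d - n" "Y ^ (d - n)"]
      bihom_mult[of "d - m" 0 "X ^ (d - m)" 0 "d - n" "Y ^ (d - n)"] Xp Yp by (simp_all add: Z_def)
  have d: "m + (d - m) = d" "n + (d - n) = d" by (simp_all add: d_def)
  have "Z \<noteq> 0" using Z by auto
  show ?thesis
  proof (rule that[of d "P * Z" "Q * Z"])
    show "bidegree_le d d (P * Z)" "bidegree_le d d (Q * Z)"
      using bidegree_le_mult[OF 1(1) Z(1)] bidegree_le_mult[OF 1(2) Z(1)] by (simp_all add: d)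
    show "bihom d d (P * Z) s t \<noteq> 0" "bihom d d (Q * Z) s t \<noteq> 0"
      using bihom_mult[OF 1(1) Z(1), of s t] bihom_mult[OF 1(2) Z(1), of s t] 1 Z by (simp_all add: d)
    show "k = Fract (P * Z) (Q * Z)"
      using \<open>Z \<noteq> 0\<close> mult_fract_cancel[of Z P Q] by (simp add: 1 mult.commute)
  qed
qed

lemma local_units_pt:
  assumes "s \<noteq> (0, 0)" "t \<noteq> (0, 0)"
  shows "local_units (pt s t) = ratfun ` unit_at s t"
proof
  show "local_units (pt s t) \<subseteq> ratfun ` unit_at s t"
  proof
    fix A assume "A \<in> local_units (pt s t)"
    then obtain F G k where A: "A = ratfun k" "(F, G) \<in> A" "nonvanishing_at F (pt s t)" "nonvanishing_at G (pt s t)"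
      by (auto simp: local_units_def carrier_ratfun_group)
    then have fr: "(F, G) \<in> fractions" and k: "k = Fract (dehom F) (dehom G)"
      by (auto simp: ratfun_def fraction_value_def)
    then obtain d where d: "real_form d F" "real_form d G" by (auto simp: fractions_iff)
    have "k \<in> unit_at s t" unfolding k
      using A(3,4) by (intro unit_atI[of d d] dehom_form d)
        (simp_all add: nonvanishing_at_pt[OF d(1)] nonvanishing_at_pt[OF d(2)] dehom_form(2)[OF d(1)] dehom_form(2)[OF d(2)])
    then show "A \<in> ratfun ` unit_at s t" using A by blast
  qed
  show "ratfun ` unit_at s t \<subseteq> local_units (pt s t)"
  proof clarify
    fix k assume k: "k \<in> unit_at s t"
    then obtain d P Q where PQ: "bidegree_le d d P" "bidegree_le d d Q" "bihom d d P s t \<noteq> 0" "bihom d d Q s t \<noteq> 0" "k = Fract P Q"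
      using assms by (rule unit_at_square)
    then have "P \<noteq> 0" "Q \<noteq> 0" by auto
    then obtain F G where FG: "real_form d F" "real_form d G" "dehom F = P" "dehom G = Q" "(F, G) \<in> fractions"
      using PQ by (metis fraction_exists)
    have "(F, G) \<in> ratfun k" using FG PQ by (simp add: ratfun_def fraction_value_def)
    moreover have "nonvanishing_at F (pt s t)" "nonvanishing_at G (pt s t)"
      using FG PQ by (simp_all add: nonvanishing_at_pt[OF FG(1)] nonvanishing_at_pt[OF FG(2)]
          dehom_form(2)[OF FG(1)] dehom_form(2)[OF FG(2)])
    moreover have "ratfun k \<in> carrier ratfun_group" using unit_at_nonzero[OF k] by (auto simp: carrier_ratfun_group)
    ultimately show "ratfun k \<in> local_units (pt s t)" by (auto simp: local_units_def)
  qed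
qed

section \<open>The automorphism group of the quadric\<close>

subsection \<open>Pairs of projective transformations of the line\<close>

text \<open>The quadruple \<open>(a, b, c, d)\<close> stands for the matrix with rows \<open>(a, b)\<close> and \<open>(c, d)\<close>.\<close>

type_synonym mat2 = "real \<times> real \<times> real \<times> real"

definition mapp :: "mat2 \<Rightarrow> complex \<times> complex \<Rightarrow> complex \<times> complex" where
  "mapp M s = (case M of (a, b, c, d) \<Rightarrow>
     (of_real a * fst s + of_real b * snd s, of_real c * fst s + of_real d * snd s))"

definition mmul :: "mat2 \<Rightarrow> mat2 \<Rightarrow> mat2" where
  "mmul M N = (case M of (a, b, c, d) \<Rightarrow> case N of (e, f, g, h) \<Rightarrow>
     (a * e + b * g, a * f + b * h, c * e + d * g, c * f + d * h))"

definition mdet :: "mat2 \<Rightarrow> real" where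
  "mdet M = (case M of (a, b, c, d) \<Rightarrow> a * d - b * c)"

definition madj :: "mat2 \<Rightarrow> mat2" where
  "madj M = (case M of (a, b, c, d) \<Rightarrow> (d, - b, - c, a))"

definition mscale :: "real \<Rightarrow> mat2 \<Rightarrow> mat2" where
  "mscale k M = (case M of (a, b, c, d) \<Rightarrow> (k * a, k * b, k * c, k * d))"

lemma mat_simps [simp]:
  "mapp (a, b, c, d) s = (of_real a * fst s + of_real b * snd s, of_real c * fst s + of_real d * snd s)"
  "mmul (a, b, c, d) (e, f, g, h) = (a * e + b * g, a * f + b * h, c * e + d * g, c * f + d * h)"
  "mdet (a, b, c, d) = a * d - b * c"
  "madj (a, b, c, d) = (d, - b, - c, a)"
  "mscale k (a, b, c, d) = (k * a, k * b, k * c, k * d)"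
  by (simp_all add: mapp_def mmul_def mdet_def madj_def mscale_def)

lemma mapp_mmul: "mapp (mmul M N) s = mapp M (mapp N s)"
  by (cases M rule: prod_cases4; cases N rule: prod_cases4) (simp add: algebra_simps)

lemma mdet_mmul: "mdet (mmul M N) = mdet M * mdet N"
  by (cases M rule: prod_cases4; cases N rule: prod_cases4) (simp add: algebra_simps)

lemma mdet_madj [simp]: "mdet (madj M) = mdet M"
  by (cases M rule: prod_cases4) (simp add: algebra_simps)

lemma mdet_mscale: "mdet (mscale k M) = k\<^sup>2 * mdet M"
  by (cases M rule: prod_cases4) (simp add: algebra_simps power2_eq_square)

lemma mmul_madj: "mmul M (madj M) = (mdet M, 0, 0, mdet M)" "mmul (madj M) M = (mdet M, 0, 0, mdet M)"
  by (cases M rule: prod_cases4; simp add: algebra_simps)+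

lemma mapp_mscale: "mapp (mscale k M) s = scale2 (of_real k) (mapp M s)"
  by (cases M rule: prod_cases4) (simp add: scale2_def algebra_simps)

lemma mapp_scale2: "mapp M (scale2 c s) = scale2 c (mapp M s)"
  by (cases M rule: prod_cases4) (simp add: scale2_def algebra_simps)

lemma mapp_scalar: "mapp (k, 0, 0, k) s = scale2 (of_real k) s"
  by (simp add: scale2_def)

lemma mmul_scalar: "mmul (k, 0, 0, k) M = mscale k M" "mmul M (k, 0, 0, k) = mscale k M"
  by (cases M rule: prod_cases4; simp)+

lemma mscale_mscale: "mscale k (mscale l M) = mscale (k * l) M"
  by (cases M rule: prod_cases4) simp

lemma mscale_1 [simp]: "mscale 1 M = M"
  by (cases M rule: prod_cases4) simp

lemma mmul_assoc: "mmul (mmul A B) C = mmul A (mmul B C)"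
  by (cases A rule: prod_cases4; cases B rule: prod_cases4; cases C rule: prod_cases4) (simp add: algebra_simps)

lemma mapp_nonzero:
  assumes "mdet M \<noteq> 0" "s \<noteq> (0, 0)"
  shows "mapp M s \<noteq> (0, 0)"
proof
  assume "mapp M s = (0, 0)"
  then have "mapp (madj M) (mapp M s) = (0, 0)" by (cases M rule: prod_cases4) simp
  then have "scale2 (of_real (mdet M)) s = (0, 0)"
    by (simp only: mapp_mmul[symmetric] mmul_madj mapp_scalar)
  then show False using assms by simp
qed

lemma parallel_mapp: "parallel s s' \<Longrightarrow> parallel (mapp M s) (mapp M s')"
proof (cases M rule: prod_cases4)
  case (fields a b c d)
  assume "parallel s s'"
  then have *: "fst s * snd s' - snd s * fst s' = 0" by (simp add: parallel_def)
  have "fst (mapp M s) * snd (mapp M s') - snd (mapp M s) * fst (mapp M s')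
      = of_real (a * d - b * c) * (fst s * snd s' - snd s * fst s')"
    by (simp add: fields algebra_simps)
  with * show ?thesis by (simp add: parallel_def)
qed

lemma parallel_mapp_iff:
  assumes "mdet M \<noteq> 0"
  shows "parallel (mapp M s) (mapp M s') \<longleftrightarrow> parallel s s'"
proof
  assume "parallel (mapp M s) (mapp M s')"
  from parallel_mapp[OF this, of "madj M"]
  have "parallel (scale2 (of_real (mdet M)) s) (scale2 (of_real (mdet M)) s')"
    by (simp only: mapp_mmul[symmetric] mmul_madj mapp_scalar)
  then show "parallel s s'" using assms by (simp add: parallel_def scale2_def)
qed (rule parallel_mapp)

lemma parallel_trans:
  assumes "parallel a c" "parallel b c" "c \<noteq> (0, 0)"
  shows "parallel a b"
proof -
  let ?D = "fst a * snd b - snd a * fst b"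
  have "fst a * snd c - snd a * fst c = 0" "fst b * snd c - snd b * fst c = 0"
    using assms(1,2) by (simp_all add: parallel_def)
  moreover have "?D * fst c = fst b * (fst a * snd c - snd a * fst c) - fst a * (fst b * snd c - snd b * fst c)"
    "?D * snd c = snd b * (fst a * snd c - snd a * fst c) - snd a * (fst b * snd c - snd b * fst c)"
    by (simp_all add: algebra_simps)
  ultimately have "?D * fst c = 0" "?D * snd c = 0" by simp_all
  moreover have "fst c \<noteq> 0 \<or> snd c \<noteq> 0" using assms(3) by (cases c) auto
  ultimately have "?D = 0" by auto
  then show ?thesis by (simp add: parallel_def)
qed

lemma parallel_scale2 [simp]: "parallel (scale2 c s) s" "parallel s (scale2 c s)"
  by (simp_all add: parallel_def scale2_def)

lemma mdet_nonzero_if_injective: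
  assumes "\<And>s. s \<noteq> (0, 0) \<Longrightarrow> mapp M s \<noteq> (0, 0)"
  shows "mdet M \<noteq> 0"
proof
  assume det: "mdet M = 0"
  obtain a b c d where M: "M = (a, b, c, d)" by (cases M rule: prod_cases4) auto
  have "complex_of_real (a * d - b * c) = 0" using det M by simp
  then have k: "of_real a * complex_of_real d = of_real b * of_real c" by simp
  show False
  proof (cases "a = 0 \<and> b = 0")
    case True
    then show ?thesis using assms[of "(of_real d, - of_real c)"] assms[of "(1, 0)"] M
      by (cases "c = 0 \<and> d = 0") auto
  next
    case False
    then show ?thesis using assms[of "(of_real b, - of_real a)"] k M by (auto simp: mult.commute)
  qed
qed

text \<open>
  The vectors \<open>(1, 0)\<close>, \<open>(0, 1)\<close> and \<open>(1, 1)\<close> are eigenvectors.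
\<close>

lemma scalar_if_parallel:
  assumes "\<And>s. s \<noteq> (0, 0) \<Longrightarrow> parallel (mapp M s) s"
  shows "\<exists>k. M = (k, 0, 0, k)"
proof -
  obtain a b c d where M: "M = (a, b, c, d)" by (cases M rule: prod_cases4) auto
  have "c = 0" "b = 0" using assms[of "(1, 0)"] assms[of "(0, 1)"] by (simp_all add: M parallel_def)
  moreover have "a = d" using assms[of "(1, 1)"] calculation by (simp add: M parallel_def)
  ultimately show ?thesis using M by simp
qed

lemma mscale_if_parallel:
  assumes det: "mdet M \<noteq> 0" "mdet M' \<noteq> 0"
    and par: "\<And>s. s \<noteq> (0, 0) \<Longrightarrow> parallel (mapp M' s) (mapp M s)"
  obtains k where "k \<noteq> 0" "M' = mscale k M"
proof -
  have "parallel (mapp (mmul M' (madj M)) s) s" if s: "s \<noteq> (0, 0)" for s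
  proof -
    have "mapp (madj M) s \<noteq> (0, 0)" using det s by (simp add: mapp_nonzero)
    from par[OF this] have "parallel (mapp (mmul M' (madj M)) s) (scale2 (of_real (mdet M)) s)"
      by (simp only: mapp_mmul[symmetric] mmul_madj mapp_scalar)
    then show ?thesis using det by (simp add: parallel_def scale2_def)
  qed
  from scalar_if_parallel[OF this] obtain x where x: "mmul M' (madj M) = (x, 0, 0, x)" by blast
  have "mscale x M = mmul (mmul M' (madj M)) M" by (simp add: x mmul_scalar)
  also have "\<dots> = mscale (mdet M) M'" by (simp add: mmul_assoc mmul_madj mmul_scalar)
  finally have eq: "mscale x M = mscale (mdet M) M'" .
  have "mscale (x / mdet M) M = mscale (1 / mdet M) (mscale x M)" by (simp add: mscale_mscale)
  also have "\<dots> = M'" using det by (simp add: eq mscale_mscale)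
  finally have M': "M' = mscale (x / mdet M) M" by simp
  moreover have "x / mdet M \<noteq> 0"
    using det(2) unfolding M' mdet_mscale by auto
  ultimately show ?thesis using that by blast
qed

text \<open>
  The linear map that induces \<open>(s, t) \<mapsto> (M s, N t)\<close> on the quadric or, if \<open>\<epsilon>\<close> holds, \<open>(s, t) \<mapsto> (M t, N s)\<close>.
\<close>

definition lin_map :: "bool \<Rightarrow> mat2 \<Rightarrow> mat2 \<Rightarrow> complex^4 \<Rightarrow> complex^4" where
  "lin_map \<epsilon> M N v = (case M of (m1, m2, m3, m4) \<Rightarrow> case N of (n1, n2, n3, n4) \<Rightarrow>
     let b = (if \<epsilon> then coord_c v else coord_b v); c = (if \<epsilon> then coord_b v else coord_c v) in
     of_coords
       (of_real (m1 * n1) * coord_a v + of_real (m2 * n1) * b + of_real (m1 * n2) * c + of_real (m2 * n2) * coord_d v)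
       (of_real (m3 * n1) * coord_a v + of_real (m4 * n1) * b + of_real (m3 * n2) * c + of_real (m4 * n2) * coord_d v)
       (of_real (m1 * n3) * coord_a v + of_real (m2 * n3) * b + of_real (m1 * n4) * c + of_real (m2 * n4) * coord_d v)
       (of_real (m3 * n3) * coord_a v + of_real (m4 * n3) * b + of_real (m3 * n4) * c + of_real (m4 * n4) * coord_d v))"

lemma lin_map_segre:
  "lin_map \<epsilon> M N (segre s t) = (if \<epsilon> then segre (mapp M t) (mapp N s) else segre (mapp M s) (mapp N t))"
  by (cases M rule: prod_cases4; cases N rule: prod_cases4; cases \<epsilon>)
    (simp_all add: lin_map_def segre_def algebra_simps)

lemma lin_map_scale: "lin_map \<epsilon> M N (c *s v) = c *s lin_map \<epsilon> M N v"
  by (cases M rule: prod_cases4; cases N rule: prod_cases4)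
    (auto simp: lin_map_def Let_def of_coords_scale of_coords_eq_iff algebra_simps)

lemma real_form_half: "real_form d F \<Longrightarrow> real_form d (\<lambda>x. F x / 2)"
  using real_form_scale[of d F "1/2"] by simp

lemma real_form_lin_map: "real_form 1 (\<lambda>x. lin_map \<epsilon> M N x $ i)"
proof -
  obtain m1 m2 m3 m4 n1 n2 n3 n4 where MN: "M = (m1, m2, m3, m4)" "N = (n1, n2, n3, n4)"
    by (cases M rule: prod_cases4; cases N rule: prod_cases4) auto
  have b: "real_form 1 (\<lambda>v. if \<epsilon> then coord_c v else coord_b v)"
    and c: "real_form 1 (\<lambda>v. if \<epsilon> then coord_b v else coord_c v)"
    using real_form_coords by (cases \<epsilon>; simp)+
  have comb: "real_form 1 (\<lambda>v. of_real p * coord_a v + of_real q * (if \<epsilon> then coord_c v else coord_b v)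
      + of_real r * (if \<epsilon> then coord_b v else coord_c v) + of_real u * coord_d v)" for p q r u
    by (intro real_form_add real_form_scale real_form_coords b c)
  consider "i = 1" | "i = 2" | "i = 3" | "i = 4" using exhaust_4 by blast
  then show ?thesis
    by cases (simp_all only: MN lin_map_def Let_def prod.case of_coords_nth,
      (intro real_form_half real_form_add[OF comb comb] real_form_minus[OF comb comb])+)
qed

definition aut :: "bool \<Rightarrow> mat2 \<Rightarrow> mat2 \<Rightarrow> (complex^4) set \<Rightarrow> (complex^4) set" where
  "aut \<epsilon> M N = (\<lambda>q\<in>Q22. lin_map \<epsilon> M N ` q)"

lemma lin_map_proj_pt: "lin_map \<epsilon> M N ` proj_pt v = proj_pt (lin_map \<epsilon> M N v)"
  by (simp add: proj_pt_def setcompr_eq_image image_image lin_map_scale)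

lemma aut_pt:
  assumes "s \<noteq> (0, 0)" "t \<noteq> (0, 0)"
  shows "aut \<epsilon> M N (pt s t) = (if \<epsilon> then pt (mapp M t) (mapp N s) else pt (mapp M s) (mapp N t))"
  using pt_in_Q22[OF assms] by (simp add: aut_def) (simp add: pt_def lin_map_proj_pt lin_map_segre)

lemma eq_aut_if:
  assumes "f \<in> extensional Q22"
    and "\<And>s t. s \<noteq> (0, 0) \<Longrightarrow> t \<noteq> (0, 0) \<Longrightarrow>
      f (pt s t) = (if \<epsilon> then pt (mapp M t) (mapp N s) else pt (mapp M s) (mapp N t))"
  shows "f = aut \<epsilon> M N"
proof (rule extensionalityI[OF assms(1)])
  show "aut \<epsilon> M N \<in> extensional Q22" by (simp add: aut_def)
  fix q assume "q \<in> Q22"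
  then show "f q = aut \<epsilon> M N q" by (rule Q22_cases) (simp add: assms(2) aut_pt)
qed

lemma aut_in_Q22:
  assumes "mdet M \<noteq> 0" "mdet N \<noteq> 0" "q \<in> Q22"
  shows "aut \<epsilon> M N q \<in> Q22"
proof -
  obtain s t where "s \<noteq> (0, 0)" "t \<noteq> (0, 0)" "q = pt s t" using assms(3) by (rule Q22_cases)
  then show ?thesis using assms(1,2) by (simp add: aut_pt pt_in_Q22 mapp_nonzero)
qed

lemma aut_extensional: "aut \<epsilon> M N \<in> extensional Q22"
  by (simp add: aut_def)

lemma aut_compose:
  assumes "mdet M' \<noteq> 0" "mdet N' \<noteq> 0"
  shows "compose Q22 (aut \<epsilon> M N) (aut \<epsilon>' M' N') =
    aut (\<epsilon> \<noteq> \<epsilon>') (mmul M (if \<epsilon> then N' else M')) (mmul N (if \<epsilon> then M' else N'))"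
proof (rule eq_aut_if)
  show "compose Q22 (aut \<epsilon> M N) (aut \<epsilon>' M' N') \<in> extensional Q22" by (rule compose_extensional)
  fix s t :: "complex \<times> complex" assume st: "s \<noteq> (0, 0)" "t \<noteq> (0, 0)"
  have "mapp M' s \<noteq> (0, 0)" "mapp M' t \<noteq> (0, 0)" "mapp N' s \<noteq> (0, 0)" "mapp N' t \<noteq> (0, 0)"
    using assms st by (simp_all add: mapp_nonzero)
  then show "compose Q22 (aut \<epsilon> M N) (aut \<epsilon>' M' N') (pt s t) =
      (if \<epsilon> \<noteq> \<epsilon>' then pt (mapp (mmul M (if \<epsilon> then N' else M')) t) (mapp (mmul N (if \<epsilon> then M' else N')) s)
       else pt (mapp (mmul M (if \<epsilon> then N' else M')) s) (mapp (mmul N (if \<epsilon> then M' else N')) t))"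
    using st pt_in_Q22[OF st] by (simp add: compose_eq aut_pt mapp_mmul)
qed

lemma aut_scalar:
  assumes "k \<noteq> 0" "l \<noteq> 0"
  shows "aut False (k, 0, 0, k) (l, 0, 0, l) = (\<lambda>q\<in>Q22. q)"
proof (rule eq_aut_if[symmetric])
  fix s t :: "complex \<times> complex" assume st: "s \<noteq> (0, 0)" "t \<noteq> (0, 0)"
  then have "pt s t = pt (scale2 (of_real k) s) (scale2 (of_real l) t)"
    using assms by (subst pt_eq_iff) auto
  then show "(\<lambda>q\<in>Q22. q) (pt s t) = (if False then pt (mapp (k, 0, 0, k) t) (mapp (l, 0, 0, l) s)
      else pt (mapp (k, 0, 0, k) s) (mapp (l, 0, 0, l) t))"
    using pt_in_Q22[OF st] by (simp add: scale2_def)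
qed simp

lemma aut_inverse:
  fixes \<epsilon> :: bool
  assumes det: "mdet M \<noteq> 0" "mdet N \<noteq> 0"
  defines "M' \<equiv> madj (if \<epsilon> then N else M)" and "N' \<equiv> madj (if \<epsilon> then M else N)"
  shows "compose Q22 (aut \<epsilon> M N) (aut \<epsilon> M' N') = (\<lambda>q\<in>Q22. q)"
    "compose Q22 (aut \<epsilon> M' N') (aut \<epsilon> M N) = (\<lambda>q\<in>Q22. q)"
  using det by (auto simp: aut_compose M'_def N'_def mmul_madj aut_scalar)

lemma aut_Bij:
  assumes det: "mdet M \<noteq> 0" "mdet N \<noteq> 0"
  shows "aut \<epsilon> M N \<in> Bij Q22"
    and "restrict (inv_into Q22 (aut \<epsilon> M N)) Q22 = aut \<epsilon> (madj (if \<epsilon> then N else M)) (madj (if \<epsilon> then M else N))"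
proof -
  let ?g = "aut \<epsilon> (madj (if \<epsilon> then N else M)) (madj (if \<epsilon> then M else N))"
  have inv: "?g (aut \<epsilon> M N q) = q" "aut \<epsilon> M N (?g q) = q" if "q \<in> Q22" for q
    using fun_cong[OF aut_inverse(1)[OF det, of \<epsilon>], of q] fun_cong[OF aut_inverse(2)[OF det, of \<epsilon>], of q] that
    by (simp_all add: compose_eq)
  have bij: "bij_betw (aut \<epsilon> M N) Q22 Q22"
    using det by (intro bij_betw_byWitness[where f' = ?g] ballI inv) (auto intro: aut_in_Q22)
  then show "aut \<epsilon> M N \<in> Bij Q22" by (simp add: Bij_def aut_extensional)
  show "restrict (inv_into Q22 (aut \<epsilon> M N)) Q22 = ?g"
  proof (rule extensionalityI[OF restrict_extensional aut_extensional])
    fix q assume q: "q \<in> Q22"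
    then have "?g q \<in> Q22" using det by (auto intro: aut_in_Q22)
    with inv(2)[OF q] have "inv_into Q22 (aut \<epsilon> M N) q = ?g q"
      using bij by (metis bij_betw_def inv_into_f_f)
    then show "restrict (inv_into Q22 (aut \<epsilon> M N)) Q22 q = ?g q" using q by simp
  qed
qed

lemma regular_aut:
  assumes det: "mdet M \<noteq> 0" "mdet N \<noteq> 0"
  shows "regular_map (aut \<epsilon> M N)"
  unfolding regular_map_def
proof (intro conjI ballI)
  show "aut \<epsilon> M N \<in> Q22 \<rightarrow> Q22" using aut_in_Q22[OF det] by auto
  fix p assume "p \<in> Q22"
  then obtain s t where st: "s \<noteq> (0, 0)" "t \<noteq> (0, 0)" and p: "p = pt s t" by (rule Q22_cases)
  let ?F = "\<lambda>i x. lin_map \<epsilon> M N x $ i"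
  have "lin_map \<epsilon> M N (segre s t) \<noteq> 0"
    using det st by (auto simp: lin_map_segre segre_eq_0_iff mapp_nonzero)
  then obtain i where "lin_map \<epsilon> M N (segre s t) $ i \<noteq> 0" by (metis vec_eq_iff zero_index)
  then have "nonvanishing_at (?F i) p"
    unfolding p by (simp add: nonvanishing_at_pt[OF real_form_lin_map])
  moreover have "aut \<epsilon> M N q = proj_pt (\<chi> i. ?F i x)" if "q \<in> Q22" "x \<in> q" for q x
  proof -
    obtain v where v: "q = proj_pt v" using \<open>q \<in> Q22\<close> by (auto simp: Q22_def)
    then obtain c where "c \<noteq> 0" "x = c *s v" using \<open>x \<in> q\<close> by (auto simp: mem_proj_pt)
    then have "q = proj_pt x" unfolding v proj_pt_eq_iff by blast
    then show ?thesis using that by (simp add: aut_def lin_map_proj_pt)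
  qed
  ultimately show "\<exists>d F. (\<forall>i. real_form d (F i)) \<and> (\<exists>i. nonvanishing_at (F i) p) \<and>
      (\<forall>q\<in>Q22. \<forall>x\<in>q. (\<exists>i. F i x \<noteq> 0) \<longrightarrow> aut \<epsilon> M N q = proj_pt (\<chi> i. F i x))"
    using real_form_lin_map by (intro exI[of _ 1] exI[of _ ?F]) blast
qed

subsection \<open>Regular maps are given by bihomogeneous polynomials\<close>

text \<open>
  The pairs in \<open>\<F>\<close> are local expressions of one map to the projective line. If \<open>(P, Q)\<close> is one of them divided by its greatest common
  divisor, all of them are multiples of \<open>(P, Q)\<close>, because \<open>P\<close> and \<open>Q\<close> are coprime. So all of them vanish where \<open>P\<close> and \<open>Q\<close> do, and this
  does not happen anywhere.
\<close>

lemma coprime_representatives: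
  fixes \<F> :: "(nat \<times> real poly poly \<times> real poly poly) set"
  assumes bid: "\<And>d A B. (d, A, B) \<in> \<F> \<Longrightarrow> bidegree_le d d A \<and> bidegree_le d d B"
    and compat: "\<And>d A B d' A' B'. (d, A, B) \<in> \<F> \<Longrightarrow> (d', A', B') \<in> \<F> \<Longrightarrow> A * B' = B * A'"
    and cover: "\<And>s t. s \<noteq> (0, 0) \<Longrightarrow> t \<noteq> (0, 0) \<Longrightarrow>
      \<exists>d A B. (d, A, B) \<in> \<F> \<and> (bihom d d A s t \<noteq> 0 \<or> bihom d d B s t \<noteq> 0)"
  obtains i j P Q where "bidegree_le i j P" "bidegree_le i j Q"
    "\<And>s t. s \<noteq> (0, 0) \<Longrightarrow> t \<noteq> (0, 0) \<Longrightarrow> (bihom i j P s t, bihom i j Q s t) \<noteq> (0, 0)"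
    "\<And>d A B s t. (d, A, B) \<in> \<F> \<Longrightarrow> bihom d d A s t * bihom i j Q s t = bihom d d B s t * bihom i j P s t"
proof -
  obtain d0 A0 B0 where 0: "(d0, A0, B0) \<in> \<F>" "bihom d0 d0 A0 (1, 0) (1, 0) \<noteq> 0 \<or> bihom d0 d0 B0 (1, 0) (1, 0) \<noteq> 0"
    using cover[of "(1, 0)" "(1, 0)"] by auto
  then have "A0 \<noteq> 0 \<or> B0 \<noteq> 0" by auto
  note 0 = 0(1) this
  define g where "g = gcd A0 B0"
  have g0: "g \<noteq> 0" using 0 by (simp add: g_def)
  obtain P Q where PQ: "A0 = P * g" "B0 = Q * g" "coprime P Q"
    using gcd_coprime_exists[of A0 B0] g0 unfolding g_def by blast
  have PQ0: "P \<noteq> 0 \<or> Q \<noteq> 0" using 0 PQ by auto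
  define i j where "i = max (degx P) (degx Q)" and "j = max (degree P) (degree Q)"
  have bPQ: "bidegree_le i j P" "bidegree_le i j Q" by (auto simp: bidegree_le_iff i_def j_def)
  have factor: "\<exists>h. A = P * h \<and> B = Q * h" if "(d, A, B) \<in> \<F>" for d A B
  proof -
    have "A * (Q * g) = B * (P * g)" using compat[OF that 0(1)] by (simp add: PQ)
    then have "(A * Q) * g = (B * P) * g" by (simp only: mult.assoc)
    then have AQ: "A * Q = B * P" using g0 by simp
    show ?thesis
    proof (cases "P = 0")
      case True
      then have "Q dvd 1" using PQ(3) by simp
      then have "Q dvd B" by (rule unit_imp_dvd)
      moreover have "A = 0" using AQ True PQ0 by simp
      ultimately show ?thesis using True by (auto elim!: dvdE)
    next
      case False
      have "P dvd A * Q" using AQ by simp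
      then have "P dvd A" using PQ(3) by (simp add: coprime_dvd_mult_left_iff)
      then obtain h where h: "A = P * h" by (rule dvdE)
      with AQ have "P * (h * Q) = P * B" by (simp add: mult_ac)
      then show ?thesis using False h by (auto simp: mult.commute)
    qed
  qed
  have bihom_factor: "\<exists>c. bihom d d A s t = bihom i j P s t * c \<and> bihom d d B s t = bihom i j Q s t * c"
    if F: "(d, A, B) \<in> \<F>" for d A B s t
  proof -
    obtain h where h: "A = P * h" "B = Q * h" using factor[OF F] by blast
    show ?thesis
    proof (cases "h = 0")
      case True
      then show ?thesis using h by (intro exI[of _ 0]) simp
    next
      case False
      have deg: "degx X + degx h \<le> d \<and> degree X + degree h \<le> d" if "X = P \<or> X = Q" "X \<noteq> 0" for X
        using bid[OF F] that False by (auto simp: h bidegree_le_iff degx_mult degree_mult_eq)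
      obtain Y where "Y = P \<or> Y = Q" "Y \<noteq> 0" using PQ0 by blast
      from deg[OF this] have "degx h \<le> d" "degree h \<le> d" by simp_all
      moreover have "degx 0 = 0" by (simp add: degx_def)
      ultimately have "degx X + degx h \<le> d \<and> degree X + degree h \<le> d" if "X = P \<or> X = Q" for X
        using deg[OF that] by (cases "X = 0") simp_all
      then have le: "i + degx h \<le> d" "j + degree h \<le> d" by (simp_all add: i_def j_def max_def)
      have bh: "bidegree_le (d - i) (d - j) h" using le by (auto simp: bidegree_le_iff)
      have d: "i + (d - i) = d" "j + (d - j) = d" using le by simp_all
      have "bihom d d A s t = bihom i j P s t * bihom (d - i) (d - j) h s t"
        "bihom d d B s t = bihom i j Q s t * bihom (d - i) (d - j) h s t"
        using bihom_mult[OF bPQ(1) bh, of s t] bihom_mult[OF bPQ(2) bh, of s t] by (simp_all only: d h)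
      then show ?thesis by blast
    qed
  qed
  show ?thesis
  proof (rule that[OF bPQ])
    fix s t :: "complex \<times> complex" assume "s \<noteq> (0, 0)" "t \<noteq> (0, 0)"
    then obtain d A B where F: "(d, A, B) \<in> \<F>" "bihom d d A s t \<noteq> 0 \<or> bihom d d B s t \<noteq> 0"
      using cover by blast
    with bihom_factor[OF F(1), of s t] show "(bihom i j P s t, bihom i j Q s t) \<noteq> (0, 0)" by auto
  next
    fix d A B s t assume "(d, A, B) \<in> \<F>"
    from bihom_factor[OF this, of s t]
    show "bihom d d A s t * bihom i j Q s t = bihom d d B s t * bihom i j P s t" by auto
  qed
qed

text \<open>
  Let \<open>(a : b : c : e)\<close> be the value of a local expression of the map in the coordinates of the Segre embedding. The component in the first
  factor is \<open>(a : b) = (c : e)\<close> and the one in the second factor is \<open>(a : c) = (b : e)\<close>. Each is determined by two pairs, at least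
  one of which is defined at a given point.
\<close>

lemma regular_map_bihom:
  assumes "regular_map f"
  obtains i j k l P Q R S where
    "\<And>s t. s \<noteq> (0, 0) \<Longrightarrow> t \<noteq> (0, 0) \<Longrightarrow>
      (bihom i j P s t, bihom i j Q s t) \<noteq> (0, 0) \<and> (bihom k l R s t, bihom k l S s t) \<noteq> (0, 0) \<and>
      f (pt s t) = pt (bihom i j P s t, bihom i j Q s t) (bihom k l R s t, bihom k l S s t)"
    "bidegree_le i j P" "bidegree_le i j Q" "bidegree_le k l R" "bidegree_le k l S"
proof -
  have fQ: "f q \<in> Q22" if "q \<in> Q22" for q using assms that by (auto simp: regular_map_def)
  define \<G> where "\<G> = {(d, F :: 4 \<Rightarrow> complex^4 \<Rightarrow> complex). (\<forall>i. real_form d (F i)) \<and>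
    (\<forall>q\<in>Q22. \<forall>x\<in>q. (\<exists>i. F i x \<noteq> 0) \<longrightarrow> f q = proj_pt (\<chi> i. F i x))}"
  define V where "V = (\<lambda>(F :: 4 \<Rightarrow> complex^4 \<Rightarrow> complex) x. (\<chi> i. F i x) :: complex^4)"
  have mem: "segre s t \<in> pt s t" for s t unfolding pt_def mem_proj_pt by (intro exI[of _ 1]) simp
  have fV: "f (pt s t) = proj_pt (V F (segre s t))"
    if "(d, F) \<in> \<G>" "V F (segre s t) \<noteq> 0" "s \<noteq> (0, 0)" "t \<noteq> (0, 0)" for d F s t
  proof -
    have "\<exists>i. F i (segre s t) \<noteq> 0" using that(2) by (auto simp: V_def vec_eq_iff)
    then show ?thesis using that(1) mem[of s t] pt_in_Q22[OF that(3,4)] by (auto simp: \<G>_def V_def)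
  qed
  have cover: "\<exists>d F. (d, F) \<in> \<G> \<and> V F (segre s t) \<noteq> 0" if st: "s \<noteq> (0, 0)" "t \<noteq> (0, 0)" for s t
  proof -
    obtain d and F :: "4 \<Rightarrow> complex^4 \<Rightarrow> complex" and i where F: "\<forall>i. real_form d (F i)" "nonvanishing_at (F i) (pt s t)"
      "\<forall>q\<in>Q22. \<forall>x\<in>q. (\<exists>i. F i x \<noteq> 0) \<longrightarrow> f q = proj_pt (\<chi> i. F i x)"
      using assms pt_in_Q22[OF st] unfolding regular_map_def by blast
    then have "F i (segre s t) \<noteq> 0" using mem[of s t] by (simp add: nonvanishing_at_def)
    then have "V F (segre s t) \<noteq> 0" by (auto simp: V_def vec_eq_iff)
    moreover have "(d, F) \<in> \<G>" using F by (simp add: \<G>_def)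
    ultimately show ?thesis by blast
  qed
  have forms: "real_form d (\<lambda>x. coord_a (V F x))" "real_form d (\<lambda>x. coord_b (V F x))"
    "real_form d (\<lambda>x. coord_c (V F x))" "real_form d (\<lambda>x. coord_d (V F x))" if "(d, F) \<in> \<G>" for d F
    using that by (auto simp: \<G>_def V_def coord_defs intro!: real_form_add real_form_minus)
  have compat: "coord_a (V F x) * coord_b (V F' x) = coord_b (V F x) * coord_a (V F' x)"
    "coord_a (V F x) * coord_d (V F' x) = coord_b (V F x) * coord_c (V F' x)"
    "coord_c (V F x) * coord_b (V F' x) = coord_d (V F x) * coord_a (V F' x)"
    "coord_c (V F x) * coord_d (V F' x) = coord_d (V F x) * coord_c (V F' x)"
    "coord_a (V F x) * coord_c (V F' x) = coord_c (V F x) * coord_a (V F' x)"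
    "coord_a (V F x) * coord_d (V F' x) = coord_c (V F x) * coord_b (V F' x)"
    "coord_b (V F x) * coord_c (V F' x) = coord_d (V F x) * coord_a (V F' x)"
    "coord_b (V F x) * coord_d (V F' x) = coord_d (V F x) * coord_b (V F' x)"
    if FF: "(d, F) \<in> \<G>" "(d', F') \<in> \<G>" and x: "x = segre s t" and st: "s \<noteq> (0, 0)" "t \<noteq> (0, 0)" for d F d' F' s t x
  proof -
    have "coord_a (V F x) * coord_b (V F' x) = coord_b (V F x) * coord_a (V F' x) \<and>
      coord_a (V F x) * coord_d (V F' x) = coord_b (V F x) * coord_c (V F' x) \<and>
      coord_c (V F x) * coord_b (V F' x) = coord_d (V F x) * coord_a (V F' x) \<and>
      coord_c (V F x) * coord_d (V F' x) = coord_d (V F x) * coord_c (V F' x) \<and>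
      coord_a (V F x) * coord_c (V F' x) = coord_c (V F x) * coord_a (V F' x) \<and>
      coord_a (V F x) * coord_d (V F' x) = coord_c (V F x) * coord_b (V F' x) \<and>
      coord_b (V F x) * coord_c (V F' x) = coord_d (V F x) * coord_a (V F' x) \<and>
      coord_b (V F x) * coord_d (V F' x) = coord_d (V F x) * coord_b (V F' x)"
    proof (cases "V F x = 0 \<or> V F' x = 0")
      case True
      then show ?thesis by (auto simp: coord_defs)
    next
      case False
      then have 1: "f (pt s t) = proj_pt (V F x)" "f (pt s t) = proj_pt (V F' x)"
        using fV[OF FF(1) _ st] fV[OF FF(2) _ st] x by simp_all
      then obtain \<sigma> \<tau> where "proj_pt (V F x) = pt \<sigma> \<tau>" "proj_pt (V F' x) = pt \<sigma> \<tau>"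
        using fQ[OF pt_in_Q22[OF st]] by (metis Q22_cases)
      then obtain c c' where "V F x = c *s segre \<sigma> \<tau>" "V F' x = c' *s segre \<sigma> \<tau>"
        by (metis pt_def proj_pt_eq_iff)
      then show ?thesis by (simp add: segre_def mult_ac)
    qed
    then show "coord_a (V F x) * coord_b (V F' x) = coord_b (V F x) * coord_a (V F' x)"
      "coord_a (V F x) * coord_d (V F' x) = coord_b (V F x) * coord_c (V F' x)"
      "coord_c (V F x) * coord_b (V F' x) = coord_d (V F x) * coord_a (V F' x)"
      "coord_c (V F x) * coord_d (V F' x) = coord_d (V F x) * coord_c (V F' x)"
      "coord_a (V F x) * coord_c (V F' x) = coord_c (V F x) * coord_a (V F' x)"
      "coord_a (V F x) * coord_d (V F' x) = coord_c (V F x) * coord_b (V F' x)"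
      "coord_b (V F x) * coord_c (V F' x) = coord_d (V F x) * coord_a (V F' x)"
      "coord_b (V F x) * coord_d (V F' x) = coord_d (V F x) * coord_b (V F' x)" by blast+
  qed
  define a b c e where "a = (\<lambda>F. dehom (\<lambda>x. coord_a (V F x)))" and "b = (\<lambda>F. dehom (\<lambda>x. coord_b (V F x)))"
    and "c = (\<lambda>F. dehom (\<lambda>x. coord_c (V F x)))" and "e = (\<lambda>F. dehom (\<lambda>x. coord_d (V F x)))"
  note abce = a_def b_def c_def e_def
  have bids: "bidegree_le d d (a F)" "bidegree_le d d (b F)" "bidegree_le d d (c F)" "bidegree_le d d (e F)"
    if "(d, F) \<in> \<G>" for d F
    unfolding abce using forms[OF that] by (auto intro: dehom_form)
  have vals: "bihom d d (a F) s t = coord_a (V F (segre s t))" "bihom d d (b F) s t = coord_b (V F (segre s t))"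
    "bihom d d (c F) s t = coord_c (V F (segre s t))" "bihom d d (e F) s t = coord_d (V F (segre s t))"
    if "(d, F) \<in> \<G>" for d F s t
    unfolding abce using forms[OF that] by (simp_all add: dehom_form(2)[symmetric])
  have evals: "eval2 (a F) x y = coord_a (V F (segre (1, x) (1, y)))" "eval2 (b F) x y = coord_b (V F (segre (1, x) (1, y)))"
    "eval2 (c F) x y = coord_c (V F (segre (1, x) (1, y)))" "eval2 (e F) x y = coord_d (V F (segre (1, x) (1, y)))"
    if "(d, F) \<in> \<G>" for d F x y
    using bids[OF that] by (simp_all add: eval2_bihom vals[OF that])
  have nz: "bihom d d (a F) s t \<noteq> 0 \<or> bihom d d (b F) s t \<noteq> 0 \<or> bihom d d (c F) s t \<noteq> 0 \<or> bihom d d (e F) s t \<noteq> 0"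
    if "(d, F) \<in> \<G>" "V F (segre s t) \<noteq> 0" for d F s t
    unfolding vals[OF that(1)] using that(2) by (metis of_coords_coords of_coords_eq_0_iff)
  define \<F>1 where "\<F>1 = {(d, a F, b F) | d F. (d, F) \<in> \<G>} \<union> {(d, c F, e F) | d F. (d, F) \<in> \<G>}"
  define \<F>2 where "\<F>2 = {(d, a F, c F) | d F. (d, F) \<in> \<G>} \<union> {(d, b F, e F) | d F. (d, F) \<in> \<G>}"
  have poly_prop: "a F * b F' = b F * a F'" "a F * e F' = b F * c F'" "c F * b F' = e F * a F'" "c F * e F' = e F * c F'"
    "a F * c F' = c F * a F'" "a F * e F' = c F * b F'" "b F * c F' = e F * a F'" "b F * e F' = e F * b F'"
    if FF: "(d, F) \<in> \<G>" "(d', F') \<in> \<G>" for d F d' F'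
    by (rule eval2_eqI; simp add: evals[OF FF(1)] evals[OF FF(2)] compat[OF FF refl])+
  obtain i j P Q where PQ: "bidegree_le i j P" "bidegree_le i j Q"
    "\<And>s t. s \<noteq> (0, 0) \<Longrightarrow> t \<noteq> (0, 0) \<Longrightarrow> (bihom i j P s t, bihom i j Q s t) \<noteq> (0, 0)"
    "\<And>d A B s t. (d, A, B) \<in> \<F>1 \<Longrightarrow> bihom d d A s t * bihom i j Q s t = bihom d d B s t * bihom i j P s t"
  proof (rule coprime_representatives[of \<F>1])
    show "bidegree_le d d A \<and> bidegree_le d d B" if "(d, A, B) \<in> \<F>1" for d A B
      using that bids by (auto simp: \<F>1_def)
    show "A * B' = B * A'" if "(d, A, B) \<in> \<F>1" "(d', A', B') \<in> \<F>1" for d A B d' A' B'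
      using that unfolding \<F>1_def by (auto intro: poly_prop)
    show "\<exists>d A B. (d, A, B) \<in> \<F>1 \<and> (bihom d d A s t \<noteq> 0 \<or> bihom d d B s t \<noteq> 0)"
      if st: "s \<noteq> (0, 0)" "t \<noteq> (0, 0)" for s t
    proof -
      obtain d F where F: "(d, F) \<in> \<G>" "V F (segre s t) \<noteq> 0" using cover[OF st] by blast
      then have "(d, a F, b F) \<in> \<F>1" "(d, c F, e F) \<in> \<F>1" by (auto simp: \<F>1_def)
      then show ?thesis using nz[OF F] by blast
    qed
  qed blast
  obtain k l R S where RS: "bidegree_le k l R" "bidegree_le k l S"
    "\<And>s t. s \<noteq> (0, 0) \<Longrightarrow> t \<noteq> (0, 0) \<Longrightarrow> (bihom k l R s t, bihom k l S s t) \<noteq> (0, 0)"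
    "\<And>d A B s t. (d, A, B) \<in> \<F>2 \<Longrightarrow> bihom d d A s t * bihom k l S s t = bihom d d B s t * bihom k l R s t"
  proof (rule coprime_representatives[of \<F>2])
    show "bidegree_le d d A \<and> bidegree_le d d B" if "(d, A, B) \<in> \<F>2" for d A B
      using that bids by (auto simp: \<F>2_def)
    show "A * B' = B * A'" if "(d, A, B) \<in> \<F>2" "(d', A', B') \<in> \<F>2" for d A B d' A' B'
      using that unfolding \<F>2_def by (auto intro: poly_prop)
    show "\<exists>d A B. (d, A, B) \<in> \<F>2 \<and> (bihom d d A s t \<noteq> 0 \<or> bihom d d B s t \<noteq> 0)"
      if st: "s \<noteq> (0, 0)" "t \<noteq> (0, 0)" for s t
    proof -
      obtain d F where F: "(d, F) \<in> \<G>" "V F (segre s t) \<noteq> 0" using cover[OF st] by blast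
      then have "(d, a F, c F) \<in> \<F>2" "(d, b F, e F) \<in> \<F>2" by (auto simp: \<F>2_def)
      then show ?thesis using nz[OF F] by blast
    qed
  qed blast
  show ?thesis
  proof (rule that[OF _ PQ(1,2) RS(1,2)])
    fix s t :: "complex \<times> complex" assume st: "s \<noteq> (0, 0)" "t \<noteq> (0, 0)"
    obtain d F where F: "(d, F) \<in> \<G>" "V F (segre s t) \<noteq> 0" using cover[OF st] by blast
    define v where "v = V F (segre s t)"
    have fv: "f (pt s t) = proj_pt v" using fV[OF F st] by (simp add: v_def)
    then have "proj_pt v \<in> Q22" using fQ[OF pt_in_Q22[OF st]] by simp
    then obtain \<sigma> \<tau> where st': "\<sigma> \<noteq> (0, 0)" "\<tau> \<noteq> (0, 0)" "proj_pt v = pt \<sigma> \<tau>" by (rule Q22_cases)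
    then obtain z where z: "z \<noteq> 0" "v = z *s segre \<sigma> \<tau>" by (metis pt_def proj_pt_eq_iff)
    have "(d, a F, b F) \<in> \<F>1" "(d, c F, e F) \<in> \<F>1" "(d, a F, c F) \<in> \<F>2" "(d, b F, e F) \<in> \<F>2"
      using F by (auto simp: \<F>1_def \<F>2_def)
    note eqs = PQ(4)[OF this(1), of s t] PQ(4)[OF this(2), of s t] RS(4)[OF this(3), of s t] RS(4)[OF this(4), of s t]
    have eqs': "fst \<sigma> * fst \<tau> * bihom i j Q s t = snd \<sigma> * fst \<tau> * bihom i j P s t"
      "fst \<sigma> * snd \<tau> * bihom i j Q s t = snd \<sigma> * snd \<tau> * bihom i j P s t"
      "fst \<sigma> * fst \<tau> * bihom k l S s t = fst \<sigma> * snd \<tau> * bihom k l R s t"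
      "snd \<sigma> * fst \<tau> * bihom k l S s t = snd \<sigma> * snd \<tau> * bihom k l R s t"
      using eqs z unfolding vals[OF F(1)] v_def[symmetric] by (simp_all add: segre_def mult.assoc)
    have "parallel \<sigma> (bihom i j P s t, bihom i j Q s t)"
      using eqs'(1,2) st'(2) unfolding parallel_def by (cases \<tau>) (auto simp: mult_ac)
    moreover have "parallel \<tau> (bihom k l R s t, bihom k l S s t)"
      using eqs'(3,4) st'(1) unfolding parallel_def by (cases \<sigma>) (auto simp: mult_ac)
    ultimately have "pt \<sigma> \<tau> = pt (bihom i j P s t, bihom i j Q s t) (bihom k l R s t, bihom k l S s t)"
      using st' PQ(3)[OF st] RS(3)[OF st] by (subst pt_eq_iff) auto
    then show "(bihom i j P s t, bihom i j Q s t) \<noteq> (0, 0) \<and> (bihom k l R s t, bihom k l S s t) \<noteq> (0, 0) \<and>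
      f (pt s t) = pt (bihom i j P s t, bihom i j Q s t) (bihom k l R s t, bihom k l S s t)"
      using fv st' PQ(3)[OF st] RS(3)[OF st] by simp
  qed
qed

subsection \<open>Binary forms\<close>

text \<open>Homogeneous functions of degree \<open>e\<close> that are polynomial on both charts of the line.\<close>

definition binary_form :: "nat \<Rightarrow> (complex \<times> complex \<Rightarrow> complex) \<Rightarrow> bool" where
  "binary_form e F \<longleftrightarrow> (\<exists>p. \<forall>x. F (1, x) = poly p x) \<and> (\<exists>q. \<forall>y. F (y, 1) = poly q y) \<and>
     (\<forall>c s. F (scale2 c s) = c ^ e * F s)"

lemma binary_form_const: "binary_form 0 (\<lambda>_. c)"
  unfolding binary_form_def by (auto intro!: exI[of _ "[:c:]"])

lemma binary_form_zero: "binary_form e (\<lambda>_. 0)"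
  unfolding binary_form_def by (auto intro!: exI[of _ 0])

lemma binary_form_fst: "binary_form 1 fst" and binary_form_snd: "binary_form 1 snd"
  unfolding binary_form_def by (auto simp: scale2_def intro: exI[of _ "[:1:]"] exI[of _ "[:0, 1:]"])

lemma binary_form_add: "binary_form e F \<Longrightarrow> binary_form e G \<Longrightarrow> binary_form e (\<lambda>s. F s + G s)"
  unfolding binary_form_def by (metis (no_types, lifting) distrib_left poly_add)

lemma binary_form_mult: "binary_form d F \<Longrightarrow> binary_form e G \<Longrightarrow> binary_form (d + e) (\<lambda>s. F s * G s)"
  unfolding binary_form_def
proof (elim conjE exE, intro conjI)
  fix p q p' q' assume "\<forall>x. F (1, x) = poly p x" "\<forall>y. F (y, 1) = poly q y" "\<forall>c s. F (scale2 c s) = c ^ d * F s"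
    "\<forall>x. G (1, x) = poly p' x" "\<forall>y. G (y, 1) = poly q' y" "\<forall>c s. G (scale2 c s) = c ^ e * G s"
  then show "\<exists>p. \<forall>x. F (1, x) * G (1, x) = poly p x" "\<exists>q. \<forall>y. F (y, 1) * G (y, 1) = poly q y"
    "\<forall>c s. F (scale2 c s) * G (scale2 c s) = c ^ (d + e) * (F s * G s)"
    by (auto intro: exI[of _ "p * p'"] exI[of _ "q * q'"] simp: power_add)
qed

lemma binary_form_power: "binary_form e F \<Longrightarrow> binary_form (n * e) (\<lambda>s. F s ^ n)"
  by (induction n) (auto simp: binary_form_const intro: binary_form_mult)

lemma binary_form_sum:
  "finite A \<Longrightarrow> (\<And>a. a \<in> A \<Longrightarrow> binary_form e (F a)) \<Longrightarrow> binary_form e (\<lambda>s. \<Sum>a\<in>A. F a s)"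
  by (induction A rule: finite_induct) (auto intro: binary_form_zero binary_form_add)

lemma binary_form_bihom:
  assumes "binary_form e F0" "binary_form e F1" "binary_form e' G0" "binary_form e' G1"
  shows "binary_form (i * e + j * e') (\<lambda>s. bihom i j P (F0 s, F1 s) (G0 s, G1 s))"
  unfolding bihom_def
proof (intro binary_form_sum finite_atMost)
  fix l k assume "l \<in> {..j}" "k \<in> {..i}"
  then have "i * e + j * e' = 0 + ((i - k) * e + k * e) + ((j - l) * e' + l * e')"
    by (simp flip: add_mult_distrib)
  moreover have "binary_form (0 + ((i - k) * e + k * e) + ((j - l) * e' + l * e'))
     (\<lambda>s. of_real (coeff (coeff P l) k) * (F0 s ^ (i - k) * F1 s ^ k) * (G0 s ^ (j - l) * G1 s ^ l))"
    by (intro binary_form_mult binary_form_const binary_form_power assms)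
  ultimately show "binary_form (i * e + j * e') (\<lambda>s. of_real (coeff (coeff P l) k) *
      (fst (F0 s, F1 s) ^ (i - k) * snd (F0 s, F1 s) ^ k) * (fst (G0 s, G1 s) ^ (j - l) * snd (G0 s, G1 s) ^ l))"
    by simp
qed

text \<open>
  A polynomial without zeros is constant, and homogeneity carries this to the other chart.
\<close>

lemma binary_form_chart:
  assumes "binary_form e F" and "\<And>x. F (1, x) \<noteq> 0"
  obtains c where "c \<noteq> 0" "\<And>x. F (1, x) = c" "\<And>y. F (y, 1) = c * y ^ e"
proof -
  obtain p q where p: "\<And>x. F (1, x) = poly p x" and q: "\<And>y. F (y, 1) = poly q y"
    and h: "\<And>c s. F (scale2 c s) = c ^ e * F s"
    using assms(1) unfolding binary_form_def by blast
  have "constant (poly p)" using fundamental_theorem_of_algebra[of p] assms(2) p by auto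
  then have c: "F (1, x) = F (1, 0)" for x unfolding p by (auto simp: constant_def)
  have off: "poly q y = F (1, 0) * y ^ e" if "y \<noteq> 0" for y
    using h[of y "(1, 1 / y)"] that c[of "1 / y"] q[of y] by (simp add: scale2_def mult.commute)
  have "poly q 0 = F (1, 0) * 0 ^ e"
    by (rule continuous_eq_at_0[of _ _ "{0}"]) (auto intro!: continuous_intros off)
  then have "poly q y = F (1, 0) * y ^ e" for y using off by (cases "y = 0") auto
  then show ?thesis using that[of "F (1, 0)"] c assms(2) q by metis
qed

lemma binary_form_no_zero:
  assumes "binary_form e F" and "\<And>s. s \<noteq> (0, 0) \<Longrightarrow> F s \<noteq> 0"
  shows "e = 0"
proof -
  obtain c where "\<And>y. F (y, 1) = c * y ^ e"
    by (rule binary_form_chart[OF assms(1)]) (use assms(2) in auto)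
  then have "c * 0 ^ e \<noteq> 0" using assms(2)[of "(0, 1)"] by simp
  then show ?thesis by (cases e) auto
qed

text \<open>
  A pair of forms that represents the identity of the projective line is \<open>A = c s\<^sub>0\<^sup>e\<close> and \<open>B = c s\<^sub>0\<^bsup>e-1\<^esup> s\<^sub>1\<close>, since \<open>A\<close> does not vanish where
  \<open>s\<^sub>0 = 1\<close>. If \<open>e > 1\<close>, both vanish at \<open>s\<^sub>0 = 0\<close>.
\<close>

lemma binary_form_identity:
  assumes A: "binary_form e A" and B: "binary_form e B"
    and nz: "\<And>s. s \<noteq> (0, 0) \<Longrightarrow> (A s, B s) \<noteq> (0, 0)"
    and par: "\<And>s. s \<noteq> (0, 0) \<Longrightarrow> parallel (A s, B s) s"
  shows "e = 1"
proof -
  have eq: "A s * snd s = B s * fst s" if "s \<noteq> (0, 0)" for s using par[OF that] by (simp add: parallel_def)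
  have "A (1, x) \<noteq> 0" for x using eq[of "(1, x)"] nz[of "(1, x)"] by auto
  then obtain c where c: "c \<noteq> 0" "\<And>y. A (y, 1) = c * y ^ e" by (rule binary_form_chart[OF A]) blast
  have "A (0, 1) = 0" using eq[of "(0, 1)"] by simp
  then have "e \<noteq> 0" using c by (metis mult_cancel_left1 power_0 mult_eq_0_iff)
  then obtain n where n: "e = Suc n" by (cases e) auto
  obtain r where r: "\<And>y. B (y, 1) = poly r y" using B unfolding binary_form_def by blast
  have "poly r 0 = c * 0 ^ n"
  proof (rule continuous_eq_at_0[of _ _ "{0}"])
    fix y :: complex assume "y \<notin> {0}"
    then show "poly r y = c * y ^ n" using eq[of "(y, 1)"] c(2)[of y] r[of y] n by simp
  qed (auto intro!: continuous_intros)
  moreover have "B (0, 1) \<noteq> 0" using nz[of "(0, 1)"] \<open>A (0, 1) = 0\<close> by simp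
  ultimately have "n = 0" using r by (cases n) auto
  then show ?thesis using n by simp
qed

subsection \<open>Classification of the automorphisms\<close>

lemma nat_matrix_inverse:
  fixes i j k l i' j' k' l' :: nat
  assumes "i * i' + j * k' = 1" "i * j' + j * l' = 0" "k * i' + l * k' = 0" "k * j' + l * l' = 1"
  shows "(i = 1 \<and> j = 0 \<and> k = 0 \<and> l = 1) \<or> (i = 0 \<and> j = 1 \<and> k = 1 \<and> l = 0)"
proof (cases "i * i' = 1")
  case True
  then show ?thesis using assms by auto
next
  case False
  have "x = 0 \<and> y = 1" if "x + y = 1" "x \<noteq> 1" for x y :: nat using that by arith
  from this[OF assms(1) False] have "j * k' = 1" "i * i' = 0" by simp_all
  then show ?thesis using assms by auto
qed

text \<open>
  The bidegrees of the two components of an automorphism form a matrix of natural numbers, which is multiplicative under composition.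
  The matrix of an automorphism therefore has an inverse with entries in the natural numbers, so it is a permutation matrix, and the
  components are linear in one of the two factors.
\<close>

theorem carrier_Aut_Q22:
  "carrier Aut_Q22 = {aut \<epsilon> M N | \<epsilon> M N. mdet M \<noteq> 0 \<and> mdet N \<noteq> 0}"
proof
  show "{aut \<epsilon> M N | \<epsilon> M N. mdet M \<noteq> 0 \<and> mdet N \<noteq> 0} \<subseteq> carrier Aut_Q22"
    by (auto simp: Aut_Q22_def aut_Bij regular_aut)
  show "carrier Aut_Q22 \<subseteq> {aut \<epsilon> M N | \<epsilon> M N. mdet M \<noteq> 0 \<and> mdet N \<noteq> 0}"
  proof
    fix f assume "f \<in> carrier Aut_Q22"
    then have f: "f \<in> Bij Q22" "regular_map f" and g: "regular_map (restrict (inv_into Q22 f) Q22)"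
      by (auto simp: Aut_Q22_def)
    define h where "h = restrict (inv_into Q22 f) Q22"
    obtain i j k l P Q R S where F:
      "\<And>s t. s \<noteq> (0, 0) \<Longrightarrow> t \<noteq> (0, 0) \<Longrightarrow>
        (bihom i j P s t, bihom i j Q s t) \<noteq> (0, 0) \<and> (bihom k l R s t, bihom k l S s t) \<noteq> (0, 0) \<and>
        f (pt s t) = pt (bihom i j P s t, bihom i j Q s t) (bihom k l R s t, bihom k l S s t)"
      "bidegree_le i j P" "bidegree_le i j Q" "bidegree_le k l R" "bidegree_le k l S"
      using f(2) by (rule regular_map_bihom) (rule that; assumption)
    obtain i' j' k' l' P' Q' R' S' where G:
      "\<And>s t. s \<noteq> (0, 0) \<Longrightarrow> t \<noteq> (0, 0) \<Longrightarrow>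
        (bihom i' j' P' s t, bihom i' j' Q' s t) \<noteq> (0, 0) \<and> (bihom k' l' R' s t, bihom k' l' S' s t) \<noteq> (0, 0) \<and>
        h (pt s t) = pt (bihom i' j' P' s t, bihom i' j' Q' s t) (bihom k' l' R' s t, bihom k' l' S' s t)"
      using g unfolding h_def[symmetric] by (rule regular_map_bihom) (rule that; assumption)
    define \<sigma> \<tau> where "\<sigma> = (\<lambda>s t. (bihom i' j' P' s t, bihom i' j' Q' s t))"
      and "\<tau> = (\<lambda>s t. (bihom k' l' R' s t, bihom k' l' S' s t))"
    define A B C D where "A = (\<lambda>s t. bihom i j P (\<sigma> s t) (\<tau> s t))" and "B = (\<lambda>s t. bihom i j Q (\<sigma> s t) (\<tau> s t))"
      and "C = (\<lambda>s t. bihom k l R (\<sigma> s t) (\<tau> s t))" and "D = (\<lambda>s t. bihom k l S (\<sigma> s t) (\<tau> s t))"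
    have id: "(A s t, B s t) \<noteq> (0, 0)" "(C s t, D s t) \<noteq> (0, 0)" "parallel (A s t, B s t) s" "parallel (C s t, D s t) t"
      if st: "s \<noteq> (0, 0)" "t \<noteq> (0, 0)" for s t
    proof -
      have \<sigma>\<tau>: "\<sigma> s t \<noteq> (0, 0)" "\<tau> s t \<noteq> (0, 0)" "h (pt s t) = pt (\<sigma> s t) (\<tau> s t)"
        using G[OF st] by (simp_all add: \<sigma>_def \<tau>_def)
      have "f (h (pt s t)) = pt s t"
        using f(1) pt_in_Q22[OF st] by (simp add: h_def Bij_def bij_betw_def f_inv_into_f)
      then have "pt (A s t, B s t) (C s t, D s t) = pt s t"
        and nz: "(A s t, B s t) \<noteq> (0, 0)" "(C s t, D s t) \<noteq> (0, 0)"
        using F(1)[OF \<sigma>\<tau>(1,2)] \<sigma>\<tau>(3) by (simp_all add: A_def B_def C_def D_def)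
      then show "(A s t, B s t) \<noteq> (0, 0)" "(C s t, D s t) \<noteq> (0, 0)" "parallel (A s t, B s t) s" "parallel (C s t, D s t) t"
        using st by (simp_all add: pt_eq_iff)
    qed
    \<comment> \<open>The degrees in \<open>s\<close> and in \<open>t\<close> of the two components of \<open>f \<circ> h\<close> are the entries of the product of the two matrices of bidegrees.
      As \<open>f \<circ> h\<close> is the identity, this product is the unit matrix.\<close>
    have comp_s: "binary_form (m * i' + n * k') (\<lambda>s. bihom m n X (\<sigma> s t) (\<tau> s t))" for m n X t
    proof -
      have "binary_form (a * 1 + b * 0) (\<lambda>s. bihom a b Y (fst s, snd s) (fst t, snd t))" for a b Y
        by (intro binary_form_bihom binary_form_fst binary_form_snd binary_form_const)
      then have "binary_form a (\<lambda>s. bihom a b Y s t)" for a b Y by simp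
      then show ?thesis unfolding \<sigma>_def \<tau>_def by (intro binary_form_bihom)
    qed
    have comp_t: "binary_form (m * j' + n * l') (\<lambda>t. bihom m n X (\<sigma> s t) (\<tau> s t))" for m n X s
    proof -
      have "binary_form (a * 0 + b * 1) (\<lambda>t. bihom a b Y (fst s, snd s) (fst t, snd t))" for a b Y
        by (intro binary_form_bihom binary_form_fst binary_form_snd binary_form_const)
      then have "binary_form b (\<lambda>t. bihom a b Y s t)" for a b Y by simp
      then show ?thesis unfolding \<sigma>_def \<tau>_def by (intro binary_form_bihom)
    qed
    have "i * i' + j * k' = 1"
    proof (rule binary_form_identity)
      show "binary_form (i * i' + j * k') (\<lambda>s. A s (1, 1))" "binary_form (i * i' + j * k') (\<lambda>s. B s (1, 1))"
        unfolding A_def B_def by (rule comp_s)+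
    qed (use id in auto)
    moreover have "k * j' + l * l' = 1"
    proof (rule binary_form_identity)
      show "binary_form (k * j' + l * l') (\<lambda>t. C (1, 1) t)" "binary_form (k * j' + l * l') (\<lambda>t. D (1, 1) t)"
        unfolding C_def D_def by (rule comp_t)+
    qed (use id in auto)
    moreover have "i * j' + j * l' = 0"
    proof (rule binary_form_no_zero)
      show "binary_form (i * j' + j * l') (\<lambda>t. A (1, 1) t)" unfolding A_def by (rule comp_t)
      show "A (1, 1) t \<noteq> 0" if "t \<noteq> (0, 0)" for t
        using id(1)[of "(1, 1)" t] id(3)[of "(1, 1)" t] that by (auto simp: parallel_def)
    qed
    moreover have "k * i' + l * k' = 0"
    proof (rule binary_form_no_zero)
      show "binary_form (k * i' + l * k') (\<lambda>s. C s (1, 1))" unfolding C_def by (rule comp_s)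
      show "C s (1, 1) \<noteq> 0" if "s \<noteq> (0, 0)" for s
        using id(2)[of s "(1, 1)"] id(4)[of s "(1, 1)"] that by (auto simp: parallel_def)
    qed
    ultimately have cases: "(i = 1 \<and> j = 0 \<and> k = 0 \<and> l = 1) \<or> (i = 0 \<and> j = 1 \<and> k = 1 \<and> l = 0)"
      by (intro nat_matrix_inverse)
    have ext: "f \<in> extensional Q22" using f(1) by (simp add: Bij_def)
    have lin_x: "bihom 1 0 X s t = of_real (coeff (coeff X 0) 0) * fst s + of_real (coeff (coeff X 0) 1) * snd s" for X s t
      by (simp add: bihom_def)
    have lin_y: "bihom 0 1 X s t = of_real (coeff (coeff X 0) 0) * fst t + of_real (coeff (coeff X 1) 0) * snd t" for X s t
      by (simp add: bihom_def)
    define mx my where "mx = (\<lambda>(X :: real poly poly) (Y :: real poly poly). (coeff (coeff X 0) 0, coeff (coeff X 0) 1, coeff (coeff Y 0) 0, coeff (coeff Y 0) 1))"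
      and "my = (\<lambda>(X :: real poly poly) (Y :: real poly poly). (coeff (coeff X 0) 0, coeff (coeff X 1) 0, coeff (coeff Y 0) 0, coeff (coeff Y 1) 0))"
    have mx: "(bihom 1 0 X s t, bihom 1 0 Y s t) = mapp (mx X Y) s"
      and my: "(bihom 0 1 X s t, bihom 0 1 Y s t) = mapp (my X Y) t" for X Y s t
      by (simp_all only: lin_x lin_y mx_def my_def mat_simps)
    from cases show "f \<in> {aut \<epsilon> M N | \<epsilon> M N. mdet M \<noteq> 0 \<and> mdet N \<noteq> 0}"
    proof
      assume c: "i = 1 \<and> j = 0 \<and> k = 0 \<and> l = 1"
      have *: "mapp (mx P Q) s \<noteq> (0, 0) \<and> mapp (my R S) t \<noteq> (0, 0) \<and> f (pt s t) = pt (mapp (mx P Q) s) (mapp (my R S) t)"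
        if "s \<noteq> (0, 0)" "t \<noteq> (0, 0)" for s t
        using F(1)[OF that] c by (simp only: mx my simp_thms)
      have nz: "mapp (mx P Q) s \<noteq> (0, 0)" "mapp (my R S) s \<noteq> (0, 0)" if "s \<noteq> (0, 0)" for s
        using *[of s s] that by simp_all
      have "mdet (mx P Q) \<noteq> 0" by (rule mdet_nonzero_if_injective, rule nz(1))
      moreover have "mdet (my R S) \<noteq> 0" by (rule mdet_nonzero_if_injective, rule nz(2))
      moreover have "f = aut False (mx P Q) (my R S)" using ext * by (intro eq_aut_if) auto
      ultimately show ?thesis by blast
    next
      assume c: "i = 0 \<and> j = 1 \<and> k = 1 \<and> l = 0"
      have *: "mapp (my P Q) t \<noteq> (0, 0) \<and> mapp (mx R S) s \<noteq> (0, 0) \<and> f (pt s t) = pt (mapp (my P Q) t) (mapp (mx R S) s)"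
        if "s \<noteq> (0, 0)" "t \<noteq> (0, 0)" for s t
        using F(1)[OF that] c by (simp only: mx my simp_thms)
      have nz: "mapp (my P Q) s \<noteq> (0, 0)" "mapp (mx R S) s \<noteq> (0, 0)" if "s \<noteq> (0, 0)" for s
        using *[of s s] that by simp_all
      have "mdet (my P Q) \<noteq> 0" by (rule mdet_nonzero_if_injective, rule nz(1))
      moreover have "mdet (mx R S) \<noteq> 0" by (rule mdet_nonzero_if_injective, rule nz(2))
      moreover have "f = aut True (my P Q) (mx R S)" using ext * by (intro eq_aut_if) auto
      ultimately show ?thesis by blast
    qed
  qed
qed

lemma aut_in_carrier: "mdet M \<noteq> 0 \<Longrightarrow> mdet N \<noteq> 0 \<Longrightarrow> aut \<epsilon> M N \<in> carrier Aut_Q22"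
  unfolding carrier_Aut_Q22 by blast

lemma carrier_Aut_cases:
  assumes "f \<in> carrier Aut_Q22"
  obtains \<epsilon> M N where "f = aut \<epsilon> M N" "mdet M \<noteq> 0" "mdet N \<noteq> 0"
  using assms unfolding carrier_Aut_Q22 by blast

lemma mult_Aut_Q22:
  assumes "f \<in> carrier Aut_Q22" "g \<in> carrier Aut_Q22"
  shows "f \<otimes>\<^bsub>Aut_Q22\<^esub> g = compose Q22 f g"
  using assms by (auto simp: Aut_Q22_def BijGroup_def)

lemma one_Aut_Q22: "\<one>\<^bsub>Aut_Q22\<^esub> = (\<lambda>q\<in>Q22. q)"
  by (simp add: Aut_Q22_def BijGroup_def)

lemma aut_mult:
  assumes "mdet M \<noteq> 0" "mdet N \<noteq> 0" "mdet M' \<noteq> 0" "mdet N' \<noteq> 0"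
  shows "aut \<epsilon> M N \<otimes>\<^bsub>Aut_Q22\<^esub> aut \<epsilon>' M' N' =
    aut (\<epsilon> \<noteq> \<epsilon>') (mmul M (if \<epsilon> then N' else M')) (mmul N (if \<epsilon> then M' else N'))"
  using assms by (simp add: mult_Aut_Q22 aut_in_carrier aut_compose)

lemma group_Aut_Q22: "group Aut_Q22"
proof (rule groupI)
  show "\<one>\<^bsub>Aut_Q22\<^esub> \<in> carrier Aut_Q22"
    using aut_in_carrier[of "(1, 0, 0, 1)" "(1, 0, 0, 1)" False] by (simp add: one_Aut_Q22 aut_scalar)
  fix f assume f: "f \<in> carrier Aut_Q22"
  then obtain \<epsilon> M N where M: "f = aut \<epsilon> M N" "mdet M \<noteq> 0" "mdet N \<noteq> 0" by (rule carrier_Aut_cases)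
  show "\<one>\<^bsub>Aut_Q22\<^esub> \<otimes>\<^bsub>Aut_Q22\<^esub> f = f"
  proof -
    have "aut False (1, 0, 0, 1) (1, 0, 0, 1) \<otimes>\<^bsub>Aut_Q22\<^esub> aut \<epsilon> M N = aut \<epsilon> M N"
      using M by (subst aut_mult) (simp_all add: mmul_scalar)
    then show ?thesis by (simp add: M one_Aut_Q22 aut_scalar)
  qed
  show "\<exists>g\<in>carrier Aut_Q22. g \<otimes>\<^bsub>Aut_Q22\<^esub> f = \<one>\<^bsub>Aut_Q22\<^esub>"
    using M aut_inverse(2)[OF M(2,3), of \<epsilon>]
    by (intro bexI[of _ "aut \<epsilon> (madj (if \<epsilon> then N else M)) (madj (if \<epsilon> then M else N))"])
      (auto simp: mult_Aut_Q22 one_Aut_Q22 aut_in_carrier)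
  fix g assume g: "g \<in> carrier Aut_Q22"
  then obtain \<epsilon>' M' N' where M': "g = aut \<epsilon>' M' N'" "mdet M' \<noteq> 0" "mdet N' \<noteq> 0" by (rule carrier_Aut_cases)
  show "f \<otimes>\<^bsub>Aut_Q22\<^esub> g \<in> carrier Aut_Q22"
    using M M' by (auto simp: aut_mult mdet_mmul intro!: aut_in_carrier)
  fix h assume "h \<in> carrier Aut_Q22"
  then obtain \<epsilon>'' M'' N'' where M'': "h = aut \<epsilon>'' M'' N''" "mdet M'' \<noteq> 0" "mdet N'' \<noteq> 0" by (rule carrier_Aut_cases)
  show "f \<otimes>\<^bsub>Aut_Q22\<^esub> g \<otimes>\<^bsub>Aut_Q22\<^esub> h = f \<otimes>\<^bsub>Aut_Q22\<^esub> (g \<otimes>\<^bsub>Aut_Q22\<^esub> h)"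
    using M M' M'' by (cases \<epsilon>; cases \<epsilon>') (simp_all add: aut_mult mdet_mmul mmul_assoc)
qed

definition swaps :: "((complex^4) set \<Rightarrow> (complex^4) set) \<Rightarrow> bool" where
  "swaps f \<longleftrightarrow> (\<exists>M N. mdet M \<noteq> 0 \<and> mdet N \<noteq> 0 \<and> f = aut True M N)"

text \<open>
  The first component of \<open>aut False M N\<close> varies with \<open>s\<close>, the one of \<open>aut True M N\<close> does not.
\<close>

lemma swaps_aut [simp]:
  assumes "mdet M \<noteq> 0" "mdet N \<noteq> 0"
  shows "swaps (aut \<epsilon> M N) \<longleftrightarrow> \<epsilon>"
proof -
  have no_swap: False if "aut False M N = aut True M' N'" "mdet M' \<noteq> 0" "mdet N' \<noteq> 0" for M' N'
  proof -
    have "parallel (mapp M s) (mapp M' t)" if st: "s \<noteq> (0, 0)" "t \<noteq> (0, 0)" for s t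
    proof -
      have "pt (mapp M s) (mapp N t) = pt (mapp M' t) (mapp N' s)"
        using fun_cong[OF \<open>aut False M N = aut True M' N'\<close>, of "pt s t"] st by (simp add: aut_pt del: mat_simps)
      then show ?thesis using st assms that \<open>mdet M' \<noteq> 0\<close> \<open>mdet N' \<noteq> 0\<close> by (simp add: pt_eq_iff mapp_nonzero del: mat_simps)
    qed
    note par = this
    have nz: "mapp M' (1, 0) \<noteq> (0, 0)" using that by (intro mapp_nonzero) auto
    have "parallel (mapp M (1, 0)) (mapp M (0, 1))"
      by (rule parallel_trans[OF par par nz]) simp_all
    then have "parallel (1, 0) (0, 1)" using assms(1) by (simp add: parallel_mapp_iff del: mat_simps)
    then show False by (simp add: parallel_def)
  qed
  have "swaps (aut True M N)"
    unfolding swaps_def by (rule exI[of _ M], rule exI[of _ N]) (simp add: assms)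
  moreover have "\<not> swaps (aut False M N)"
    unfolding swaps_def by (rule notI, elim exE conjE) (rule no_swap)
  ultimately show ?thesis by (cases \<epsilon>) simp_all
qed

lemma swaps_mult:
  assumes "f \<in> carrier Aut_Q22" "g \<in> carrier Aut_Q22"
  shows "swaps (f \<otimes>\<^bsub>Aut_Q22\<^esub> g) \<longleftrightarrow> swaps f \<noteq> swaps g"
proof -
  obtain \<epsilon> M N \<epsilon>' M' N' where "f = aut \<epsilon> M N" "mdet M \<noteq> 0" "mdet N \<noteq> 0"
    "g = aut \<epsilon>' M' N'" "mdet M' \<noteq> 0" "mdet N' \<noteq> 0"
    using assms by (metis carrier_Aut_cases)
  then show ?thesis by (cases \<epsilon>) (simp_all add: aut_mult mdet_mmul)
qed

section \<open>Cartier divisors\<close>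

definition coset_at :: "(complex^4) set \<Rightarrow> real poly poly fract \<Rightarrow> ratfun set" where
  "coset_at p k = local_units p #>\<^bsub>ratfun_group\<^esub> ratfun k"

lemma coset_at_pt:
  assumes "s \<noteq> (0, 0)" "t \<noteq> (0, 0)" "k \<noteq> 0"
  shows "coset_at (pt s t) k = (\<lambda>u. ratfun (u * k)) ` unit_at s t"
  unfolding coset_at_def r_coset_def local_units_pt[OF assms(1,2)]
  using assms(3) unit_at_nonzero by (auto simp: ratfun_mult)

lemma coset_at_eq_iff:
  assumes "s \<noteq> (0, 0)" "t \<noteq> (0, 0)" "k \<noteq> 0" "k' \<noteq> 0"
  shows "coset_at (pt s t) k = coset_at (pt s t) k' \<longleftrightarrow> k / k' \<in> unit_at s t"
proof
  assume "coset_at (pt s t) k = coset_at (pt s t) k'"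
  moreover have "ratfun (1 * k) \<in> coset_at (pt s t) k"
    unfolding coset_at_pt[OF assms(1-3)] using unit_at_one by (rule imageI)
  ultimately obtain u where u: "u \<in> unit_at s t" "ratfun k = ratfun (u * k')"
    unfolding coset_at_pt[OF assms(1,2,4)] by auto
  then have "k = u * k'" using ratfun_inj[OF assms(3)] by simp
  then show "k / k' \<in> unit_at s t" using u assms by simp
next
  assume u: "k / k' \<in> unit_at s t"
  have sub: "coset_at (pt s t) a \<subseteq> coset_at (pt s t) b" if ab: "a / b \<in> unit_at s t" "a \<noteq> 0" "b \<noteq> 0" for a b
  proof
    fix A assume "A \<in> coset_at (pt s t) a"
    then obtain u where u: "u \<in> unit_at s t" "A = ratfun (u * a)"
      unfolding coset_at_pt[OF assms(1,2) ab(2)] by auto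
    then have "A = ratfun (u * (a / b) * b)" using that by simp
    then show "A \<in> coset_at (pt s t) b"
      unfolding coset_at_pt[OF assms(1,2) ab(3)] using unit_at_mult[OF u(1) ab(1)] by blast
  qed
  show "coset_at (pt s t) k = coset_at (pt s t) k'"
    using sub[OF u] sub[of k' k] unit_at_inverse[OF u] assms by auto
qed

lemma coset_at_one:
  assumes "p \<in> Q22"
  shows "coset_at p 1 = local_units p"
proof -
  obtain s t where st: "s \<noteq> (0, 0)" "t \<noteq> (0, 0)" "p = pt s t" using assms by (rule Q22_cases)
  then show ?thesis by (simp add: coset_at_pt local_units_pt)
qed

lemma subgroup_local_units:
  assumes "p \<in> Q22"
  shows "subgroup (local_units p) ratfun_group"
proof -
  interpret R: comm_group ratfun_group by (rule comm_group_ratfun_group)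
  obtain s t where st: "s \<noteq> (0, 0)" "t \<noteq> (0, 0)" "p = pt s t" using assms by (rule Q22_cases)
  have U: "local_units p = ratfun ` unit_at s t" using st by (simp add: local_units_pt)
  show ?thesis
  proof (rule R.subgroupI)
    show "local_units p \<subseteq> carrier ratfun_group"
      unfolding U carrier_ratfun_group using unit_at_nonzero by blast
    show "local_units p \<noteq> {}" unfolding U using unit_at_one by blast
    fix A assume "A \<in> local_units p"
    then obtain k where k: "k \<in> unit_at s t" "A = ratfun k" unfolding U by blast
    have "k \<noteq> 0" using k unit_at_nonzero by blast
    have "inv\<^bsub>ratfun_group\<^esub> A = ratfun (inverse k)"
      using \<open>k \<noteq> 0\<close> by (intro R.inv_equality) (auto simp: k ratfun_mult ratfun_one carrier_ratfun_group)
    then show "inv\<^bsub>ratfun_group\<^esub> A \<in> local_units p" unfolding U using unit_at_inverse[OF k(1)] by blast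
    fix B assume "B \<in> local_units p"
    then obtain l where l: "l \<in> unit_at s t" "B = ratfun l" unfolding U by blast
    have "A \<otimes>\<^bsub>ratfun_group\<^esub> B = ratfun (k * l)"
      using k l unit_at_nonzero by (metis ratfun_mult)
    then show "A \<otimes>\<^bsub>ratfun_group\<^esub> B \<in> local_units p" unfolding U using unit_at_mult[OF k(1) l(1)] by blast
  qed
qed

lemma coset_at_mult:
  assumes "p \<in> Q22" "k \<noteq> 0" "k' \<noteq> 0"
  shows "coset_at p k <#>\<^bsub>ratfun_group\<^esub> coset_at p k' = coset_at p (k * k')"
proof -
  interpret R: comm_group ratfun_group by (rule comm_group_ratfun_group)
  interpret normal "local_units p" ratfun_group
    by (rule R.subgroup_imp_normal[OF subgroup_local_units[OF assms(1)]])
  show ?thesis unfolding coset_at_def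
    using assms rcos_sum[of "ratfun k" "ratfun k'"] by (simp add: carrier_ratfun_group ratfun_mult)
qed

lemma rcosets_local_units: "rcosets\<^bsub>ratfun_group\<^esub> (local_units p) = coset_at p ` {k. k \<noteq> 0}"
  by (auto simp: RCOSETS_def carrier_ratfun_group coset_at_def)

text \<open>The divisor with local equation \<open>\<kappa> p\<close> at the point \<open>p\<close>.\<close>

definition divisor_of :: "((complex^4) set \<Rightarrow> real poly poly fract) \<Rightarrow> (complex^4) set \<Rightarrow> ratfun set" where
  "divisor_of \<kappa> = (\<lambda>p\<in>Q22. coset_at p (\<kappa> p))"

definition local_equations :: "((complex^4) set \<Rightarrow> real poly poly fract) \<Rightarrow> bool" where
  "local_equations \<kappa> \<longleftrightarrow> (\<forall>p\<in>Q22. \<kappa> p \<noteq> 0) \<and>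
     (\<forall>p\<in>Q22. \<exists>d H. real_form d H \<and> nonvanishing_at H p \<and>
       (\<exists>k. k \<noteq> 0 \<and> (\<forall>q\<in>Q22. nonvanishing_at H q \<longrightarrow> coset_at q (\<kappa> q) = coset_at q k)))"

lemma carrier_cartier_group: "carrier cartier_group = divisor_of ` {\<kappa>. local_equations \<kappa>}"
proof
  show "carrier cartier_group \<subseteq> divisor_of ` {\<kappa>. local_equations \<kappa>}"
  proof
    fix L assume L: "L \<in> carrier cartier_group"
    then have PiE: "L \<in> (\<Pi>\<^sub>E p\<in>Q22. coset_at p ` {k. k \<noteq> 0})"
      by (simp add: cartier_group_def rcosets_local_units)
    then have ext: "L \<in> extensional Q22" by (simp add: PiE_def)
    have ex: "\<forall>p\<in>Q22. \<exists>k. k \<noteq> 0 \<and> L p = coset_at p k" using PiE_mem[OF PiE] by blast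
    obtain \<kappa> where \<kappa>: "\<And>p. p \<in> Q22 \<Longrightarrow> \<kappa> p \<noteq> 0 \<and> L p = coset_at p (\<kappa> p)"
      using bchoice[OF ex] by blast
    have "L = divisor_of \<kappa>"
      by (rule extensionalityI[OF ext]) (auto simp: divisor_of_def \<kappa>)
    moreover have "local_equations \<kappa>"
      unfolding local_equations_def
    proof (intro conjI ballI)
      fix p assume p: "p \<in> Q22"
      then obtain d H A where H: "real_form d H" "nonvanishing_at H p" "A \<in> carrier ratfun_group"
        "\<forall>q\<in>Q22. nonvanishing_at H q \<longrightarrow> L q = local_units q #>\<^bsub>ratfun_group\<^esub> A"
        using L by (auto simp: cartier_group_def)
      then obtain k where k: "k \<noteq> 0" "A = ratfun k" by (auto simp: carrier_ratfun_group)
      with H have "\<forall>q\<in>Q22. nonvanishing_at H q \<longrightarrow> coset_at q (\<kappa> q) = coset_at q k"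
        using \<kappa> by (simp add: coset_at_def)
      with H k show "\<exists>d H. real_form d H \<and> nonvanishing_at H p \<and>
          (\<exists>k. k \<noteq> 0 \<and> (\<forall>q\<in>Q22. nonvanishing_at H q \<longrightarrow> coset_at q (\<kappa> q) = coset_at q k))" by blast
    qed (simp add: \<kappa>)
    ultimately show "L \<in> divisor_of ` {\<kappa>. local_equations \<kappa>}" by blast
  qed
  show "divisor_of ` {\<kappa>. local_equations \<kappa>} \<subseteq> carrier cartier_group"
  proof clarify
    fix \<kappa> assume \<kappa>: "local_equations \<kappa>"
    have "\<exists>d H. real_form d H \<and> nonvanishing_at H p \<and> (\<exists>A\<in>carrier ratfun_group. \<forall>q\<in>Q22. nonvanishing_at H q \<longrightarrow>
             divisor_of \<kappa> q = local_units q #>\<^bsub>ratfun_group\<^esub> A)" if "p \<in> Q22" for p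
    proof -
      obtain d H k where H: "real_form d H" "nonvanishing_at H p" "k \<noteq> 0"
        "\<forall>q\<in>Q22. nonvanishing_at H q \<longrightarrow> coset_at q (\<kappa> q) = coset_at q k"
        using \<kappa> \<open>p \<in> Q22\<close> unfolding local_equations_def by blast
      then have "\<forall>q\<in>Q22. nonvanishing_at H q \<longrightarrow> divisor_of \<kappa> q = local_units q #>\<^bsub>ratfun_group\<^esub> ratfun k"
        by (simp add: divisor_of_def coset_at_def)
      moreover have "ratfun k \<in> carrier ratfun_group" using H by (simp add: carrier_ratfun_group)
      ultimately show ?thesis using H by blast
    qed
    moreover have "divisor_of \<kappa> \<in> (\<Pi>\<^sub>E p\<in>Q22. rcosets\<^bsub>ratfun_group\<^esub> (local_units p))"
      using \<kappa> by (auto simp: divisor_of_def local_equations_def rcosets_local_units)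
    ultimately show "divisor_of \<kappa> \<in> carrier cartier_group" by (simp add: cartier_group_def)
  qed
qed

lemma divisor_of_mult:
  assumes "\<forall>p\<in>Q22. \<kappa> p \<noteq> 0" "\<forall>p\<in>Q22. \<kappa>' p \<noteq> 0"
  shows "divisor_of \<kappa> \<otimes>\<^bsub>cartier_group\<^esub> divisor_of \<kappa>' = divisor_of (\<lambda>p. \<kappa> p * \<kappa>' p)"
  by (rule ext) (use assms in \<open>simp add: cartier_group_def divisor_of_def coset_at_mult\<close>)

lemma nonvanishing_at_mult:
  "p \<in> Q22 \<Longrightarrow> nonvanishing_at (\<lambda>x. F x * G x) p \<longleftrightarrow> nonvanishing_at F p \<and> nonvanishing_at G p"
  by (auto simp: nonvanishing_at_def)

lemma local_equations_const: "k \<noteq> 0 \<Longrightarrow> local_equations (\<lambda>_. k)"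
  unfolding local_equations_def using real_form_const[of 1]
  by (auto intro!: exI[of _ "0"] exI[of _ "\<lambda>_. 1"] exI[of _ k] simp: nonvanishing_at_def)

lemma local_equations_mult:
  assumes "local_equations \<kappa>" "local_equations \<kappa>'"
  shows "local_equations (\<lambda>p. \<kappa> p * \<kappa>' p)"
proof -
  have nz: "\<kappa> p \<noteq> 0" "\<kappa>' p \<noteq> 0" if "p \<in> Q22" for p using assms that by (auto simp: local_equations_def)
  show ?thesis
    unfolding local_equations_def
  proof (intro conjI ballI)
    fix p assume p: "p \<in> Q22"
    show "\<kappa> p * \<kappa>' p \<noteq> 0" using nz[OF p] by simp
    obtain d H k where H: "real_form d H" "nonvanishing_at H p" "k \<noteq> 0"
      "\<forall>q\<in>Q22. nonvanishing_at H q \<longrightarrow> coset_at q (\<kappa> q) = coset_at q k"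
      using assms(1) p unfolding local_equations_def by blast
    obtain d' H' k' where H': "real_form d' H'" "nonvanishing_at H' p" "k' \<noteq> 0"
      "\<forall>q\<in>Q22. nonvanishing_at H' q \<longrightarrow> coset_at q (\<kappa>' q) = coset_at q k'"
      using assms(2) p unfolding local_equations_def by blast
    have "coset_at q (\<kappa> q * \<kappa>' q) = coset_at q (k * k')"
      if "q \<in> Q22" "nonvanishing_at (\<lambda>x. H x * H' x) q" for q
    proof -
      have "coset_at q (\<kappa> q) = coset_at q k" "coset_at q (\<kappa>' q) = coset_at q k'"
        using that H H' by (simp_all add: nonvanishing_at_mult)
      then show ?thesis
        using coset_at_mult[OF that(1), of "\<kappa> q" "\<kappa>' q"] coset_at_mult[OF that(1), of k k'] nz[OF that(1)] H(3) H'(3) by simp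
    qed
    then show "\<exists>d H. real_form d H \<and> nonvanishing_at H p \<and>
       (\<exists>k. k \<noteq> 0 \<and> (\<forall>q\<in>Q22. nonvanishing_at H q \<longrightarrow> coset_at q (\<kappa> q * \<kappa>' q) = coset_at q k))"
      using real_form_mult[OF H(1) H'(1)] H H' p
      by (intro exI[of _ "d + d'"] exI[of _ "\<lambda>x. H x * H' x"] conjI exI[of _ "k * k'"])
        (auto simp: nonvanishing_at_mult)
  qed
qed

lemma coset_at_inverse_cong:
  assumes "p \<in> Q22" "k \<noteq> 0" "k' \<noteq> 0" "coset_at p k = coset_at p k'"
  shows "coset_at p (inverse k) = coset_at p (inverse k')"
proof -
  obtain s t where st: "s \<noteq> (0, 0)" "t \<noteq> (0, 0)" "p = pt s t" using assms(1) by (rule Q22_cases)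
  then have "k / k' \<in> unit_at s t" using assms by (simp add: coset_at_eq_iff)
  from unit_at_inverse[OF this] have "inverse k / inverse k' \<in> unit_at s t"
    using assms by (simp add: field_simps)
  then show ?thesis using st assms by (simp add: coset_at_eq_iff)
qed

lemma local_equations_inverse:
  assumes "local_equations \<kappa>"
  shows "local_equations (\<lambda>p. inverse (\<kappa> p))"
proof -
  have nz: "\<kappa> p \<noteq> 0" if "p \<in> Q22" for p using assms that by (auto simp: local_equations_def)
  show ?thesis
    unfolding local_equations_def
  proof (intro conjI ballI)
    fix p assume p: "p \<in> Q22"
    show "inverse (\<kappa> p) \<noteq> 0" using nz[OF p] by simp
    obtain d H k where H: "real_form d H" "nonvanishing_at H p" "k \<noteq> 0"
      "\<forall>q\<in>Q22. nonvanishing_at H q \<longrightarrow> coset_at q (\<kappa> q) = coset_at q k"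
      using assms(1) p unfolding local_equations_def by blast
    then have "\<forall>q\<in>Q22. nonvanishing_at H q \<longrightarrow> coset_at q (inverse (\<kappa> q)) = coset_at q (inverse k)"
      using coset_at_inverse_cong nz by blast
    then show "\<exists>d H. real_form d H \<and> nonvanishing_at H p \<and>
       (\<exists>k. k \<noteq> 0 \<and> (\<forall>q\<in>Q22. nonvanishing_at H q \<longrightarrow> coset_at q (inverse (\<kappa> q)) = coset_at q k))"
      using H by (intro exI[of _ d] exI[of _ H] conjI exI[of _ "inverse k"]) auto
  qed
qed

lemma one_cartier_group: "\<one>\<^bsub>cartier_group\<^esub> = divisor_of (\<lambda>_. 1)"
  by (rule ext) (simp add: cartier_group_def divisor_of_def coset_at_one)

lemma divisor_of_cong: "(\<And>p. p \<in> Q22 \<Longrightarrow> coset_at p (\<kappa> p) = coset_at p (\<kappa>' p)) \<Longrightarrow> divisor_of \<kappa> = divisor_of \<kappa>'"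
  by (rule ext) (simp add: divisor_of_def)

lemma divisor_of_eqD: "divisor_of \<kappa> = divisor_of \<kappa>' \<Longrightarrow> p \<in> Q22 \<Longrightarrow> coset_at p (\<kappa> p) = coset_at p (\<kappa>' p)"
  by (drule fun_cong[of _ _ p]) (simp add: divisor_of_def)

lemma local_equations_nonzero: "local_equations \<kappa> \<Longrightarrow> \<forall>p\<in>Q22. \<kappa> p \<noteq> 0"
  by (simp add: local_equations_def)

lemma comm_group_cartier_group: "comm_group cartier_group"
proof (rule comm_groupI)
  show "\<one>\<^bsub>cartier_group\<^esub> \<in> carrier cartier_group"
    unfolding one_cartier_group carrier_cartier_group using local_equations_const[of 1] by auto
  fix L assume "L \<in> carrier cartier_group"
  then obtain \<kappa> where L: "L = divisor_of \<kappa>" "local_equations \<kappa>" by (auto simp: carrier_cartier_group)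
  note L0 = local_equations_nonzero[OF L(2)]
  show "\<one>\<^bsub>cartier_group\<^esub> \<otimes>\<^bsub>cartier_group\<^esub> L = L"
    using L0 by (simp add: L one_cartier_group divisor_of_mult)
  show "\<exists>M\<in>carrier cartier_group. M \<otimes>\<^bsub>cartier_group\<^esub> L = \<one>\<^bsub>cartier_group\<^esub>"
  proof (rule bexI)
    have "divisor_of (\<lambda>p. inverse (\<kappa> p) * \<kappa> p) = divisor_of (\<lambda>_. 1)"
      by (rule divisor_of_cong) (use L0 in simp)
    then show "divisor_of (\<lambda>p. inverse (\<kappa> p)) \<otimes>\<^bsub>cartier_group\<^esub> L = \<one>\<^bsub>cartier_group\<^esub>"
      using L0 by (simp add: L one_cartier_group divisor_of_mult)
    show "divisor_of (\<lambda>p. inverse (\<kappa> p)) \<in> carrier cartier_group"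
      unfolding carrier_cartier_group using local_equations_inverse[OF L(2)] by blast
  qed
  fix M assume "M \<in> carrier cartier_group"
  then obtain \<mu> where M: "M = divisor_of \<mu>" "local_equations \<mu>" by (auto simp: carrier_cartier_group)
  note M0 = local_equations_nonzero[OF M(2)]
  show "L \<otimes>\<^bsub>cartier_group\<^esub> M \<in> carrier cartier_group"
    using L0 M0 local_equations_mult[OF L(2) M(2)] by (auto simp: L(1) M(1) divisor_of_mult carrier_cartier_group)
  show "L \<otimes>\<^bsub>cartier_group\<^esub> M = M \<otimes>\<^bsub>cartier_group\<^esub> L"
    using L0 M0 by (simp add: L M divisor_of_mult mult.commute)
  fix N assume "N \<in> carrier cartier_group"
  then obtain \<nu> where N: "N = divisor_of \<nu>" "local_equations \<nu>" by (auto simp: carrier_cartier_group)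
  note N0 = local_equations_nonzero[OF N(2)]
  show "L \<otimes>\<^bsub>cartier_group\<^esub> M \<otimes>\<^bsub>cartier_group\<^esub> N = L \<otimes>\<^bsub>cartier_group\<^esub> (M \<otimes>\<^bsub>cartier_group\<^esub> N)"
    using L0 M0 N0 by (simp add: L M N divisor_of_mult mult.assoc)
qed

lemma principal_divisors_eq: "principal_divisors = {divisor_of (\<lambda>_. k) | k. k \<noteq> 0}"
  unfolding principal_divisors_def divisor_of_def coset_at_def carrier_ratfun_group by auto

lemma subgroup_principal_divisors: "subgroup principal_divisors cartier_group"
proof -
  interpret C: comm_group cartier_group by (rule comm_group_cartier_group)
  show ?thesis
  proof (rule C.subgroupI)
    show "principal_divisors \<subseteq> carrier cartier_group"
      unfolding principal_divisors_eq carrier_cartier_group using local_equations_const by blast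
    show "principal_divisors \<noteq> {}" unfolding principal_divisors_eq by (auto intro: exI[of _ 1])
    fix L assume "L \<in> principal_divisors"
    then obtain k where k: "k \<noteq> 0" "L = divisor_of (\<lambda>_. k)" by (auto simp: principal_divisors_eq)
    have "inv\<^bsub>cartier_group\<^esub> L = divisor_of (\<lambda>_. inverse k)"
      using k local_equations_const[of k] local_equations_const[of "inverse k"]
      by (intro C.inv_equality) (auto simp: divisor_of_mult one_cartier_group carrier_cartier_group)
    then show "inv\<^bsub>cartier_group\<^esub> L \<in> principal_divisors" using k unfolding principal_divisors_eq by auto
    fix M assume "M \<in> principal_divisors"
    then obtain l where l: "l \<noteq> 0" "M = divisor_of (\<lambda>_. l)" by (auto simp: principal_divisors_eq)
    have "L \<otimes>\<^bsub>cartier_group\<^esub> M = divisor_of (\<lambda>_. k * l)" using k l by (simp add: divisor_of_mult)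
    then show "L \<otimes>\<^bsub>cartier_group\<^esub> M \<in> principal_divisors"
      using k l unfolding principal_divisors_eq by (auto intro: exI[of _ "k * l"])
  qed
qed

section \<open>The Picard group\<close>

text \<open>
  The linear forms \<open>a s\<^sub>0 + b s\<^sub>1\<close> and \<open>a t\<^sub>0 + b t\<^sub>1\<close>, divided by \<open>s\<^sub>0\<close> and \<open>t\<^sub>0\<close>.
\<close>

definition lin_x :: "real \<Rightarrow> real \<Rightarrow> real poly poly fract" where
  "lin_x a b = Fract [:[:a, b:]:] 1"

definition lin_y :: "real \<Rightarrow> real \<Rightarrow> real poly poly fract" where
  "lin_y a b = Fract [:[:a:], [:b:]:] 1"

lemma lin_1_0 [simp]: "lin_x 1 0 = 1" "lin_y 1 0 = 1"
  by (simp_all add: lin_x_def lin_y_def One_fract_def one_pCons)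

lemma lin_nonzero: "a \<noteq> 0 \<or> b \<noteq> 0 \<Longrightarrow> lin_x a b \<noteq> 0" "a \<noteq> 0 \<or> b \<noteq> 0 \<Longrightarrow> lin_y a b \<noteq> 0"
  by (auto simp: lin_x_def lin_y_def Zero_fract_def eq_fract)

definition lval :: "real \<Rightarrow> real \<Rightarrow> complex \<times> complex \<Rightarrow> complex" where
  "lval a b s = of_real a * fst s + of_real b * snd s"

lemma lin_x_unit: "lval a b s \<noteq> 0 \<Longrightarrow> lval a' b' s \<noteq> 0 \<Longrightarrow> lin_x a b / lin_x a' b' \<in> unit_at s t"
  using unit_atI[of 1 0 "[:[:a, b:]:]" "[:[:a', b':]:]" s t]
  by (simp add: lin_x_def lval_def bihom_linear_x[unfolded One_nat_def])

lemma lin_y_unit: "lval a b t \<noteq> 0 \<Longrightarrow> lval a' b' t \<noteq> 0 \<Longrightarrow> lin_y a b / lin_y a' b' \<in> unit_at s t"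
  using unit_atI[of 0 1 "[:[:a:], [:b:]:]" "[:[:a':], [:b':]:]" s t]
  by (simp add: lin_y_def lval_def bihom_linear_y[unfolded One_nat_def])

lemma lval_nonzero_exists:
  assumes "s \<noteq> (0, 0)"
  shows "\<exists>a b. lval a b s \<noteq> 0"
proof -
  have "lval 1 0 s \<noteq> 0 \<or> lval 0 1 s \<noteq> 0" using assms by (cases s) (auto simp: lval_def)
  then show ?thesis by blast
qed

text \<open>
  Local equations of the lines \<open>s\<^sub>0 = 0\<close> and \<open>t\<^sub>0 = 0\<close>: at the points of the line its equation divided by
  the other coordinate, and \<open>1\<close> elsewhere.
\<close>

definition line_x :: "(complex^4) set \<Rightarrow> real poly poly fract" where
  "line_x p = (if \<exists>v\<in>p. coord_a v = 0 \<and> coord_c v = 0 then 1 / lin_x 0 1 else 1)"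

definition line_y :: "(complex^4) set \<Rightarrow> real poly poly fract" where
  "line_y p = (if \<exists>v\<in>p. coord_a v = 0 \<and> coord_b v = 0 then 1 / lin_y 0 1 else 1)"

lemma line_x_pt:
  assumes "t \<noteq> (0, 0)"
  shows "line_x (pt s t) = (if fst s = 0 then 1 / lin_x 0 1 else 1)"
proof -
  have "(\<exists>v\<in>pt s t. coord_a v = 0 \<and> coord_c v = 0) \<longleftrightarrow> fst s = 0"
  proof
    assume "fst s = 0"
    moreover have "segre s t \<in> pt s t" unfolding pt_def mem_proj_pt by (intro exI[of _ 1]) simp
    ultimately show "\<exists>v\<in>pt s t. coord_a v = 0 \<and> coord_c v = 0"
      by (intro bexI[of _ "segre s t"]) (simp_all add: segre_def)
  qed (use assms in \<open>cases t; auto simp: pt_def mem_proj_pt segre_def\<close>)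
  then show ?thesis by (simp add: line_x_def)
qed

lemma line_y_pt:
  assumes "s \<noteq> (0, 0)"
  shows "line_y (pt s t) = (if fst t = 0 then 1 / lin_y 0 1 else 1)"
proof -
  have "(\<exists>v\<in>pt s t. coord_a v = 0 \<and> coord_b v = 0) \<longleftrightarrow> fst t = 0"
  proof
    assume "fst t = 0"
    moreover have "segre s t \<in> pt s t" unfolding pt_def mem_proj_pt by (intro exI[of _ 1]) simp
    ultimately show "\<exists>v\<in>pt s t. coord_a v = 0 \<and> coord_b v = 0"
      by (intro bexI[of _ "segre s t"]) (simp_all add: segre_def)
  qed (use assms in \<open>cases s; auto simp: pt_def mem_proj_pt segre_def\<close>)
  then show ?thesis by (simp add: line_y_def)
qed

lemma line_nonzero: "line_x p \<noteq> 0" "line_y p \<noteq> 0"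
  using lin_nonzero[of 0 1] by (auto simp: line_x_def line_y_def)

text \<open>
  The quotient of \<open>s\<^sub>0\<close> by any linear form that does not vanish at the point is a local equation of the line \<open>s\<^sub>0 = 0\<close>.
\<close>

lemma line_x_coset:
  assumes "s \<noteq> (0, 0)" "t \<noteq> (0, 0)" "lval a b s \<noteq> 0"
  shows "coset_at (pt s t) (line_x (pt s t)) = coset_at (pt s t) (1 / lin_x a b)"
proof -
  have nz: "lin_x a b \<noteq> 0" using assms(3) by (intro lin_nonzero) (auto simp: lval_def)
  have "line_x (pt s t) / (1 / lin_x a b) \<in> unit_at s t"
  proof (cases "fst s = 0")
    case True
    then have "lval 0 1 s \<noteq> 0" using assms(1) by (cases s) (simp add: lval_def)
    then show ?thesis using lin_x_unit[OF assms(3), of 0 1] True assms(2) by (simp add: line_x_pt)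
  next
    case False
    then have "lval 1 0 s \<noteq> 0" by (simp add: lval_def)
    then show ?thesis using lin_x_unit[OF assms(3), of 1 0] False assms(2) by (simp add: line_x_pt)
  qed
  then show ?thesis using assms(1,2) nz line_nonzero by (simp add: coset_at_eq_iff)
qed

lemma line_y_coset:
  assumes "s \<noteq> (0, 0)" "t \<noteq> (0, 0)" "lval a b t \<noteq> 0"
  shows "coset_at (pt s t) (line_y (pt s t)) = coset_at (pt s t) (1 / lin_y a b)"
proof -
  have nz: "lin_y a b \<noteq> 0" using assms(3) by (intro lin_nonzero) (auto simp: lval_def)
  have "line_y (pt s t) / (1 / lin_y a b) \<in> unit_at s t"
  proof (cases "fst t = 0")
    case True
    then have "lval 0 1 t \<noteq> 0" using assms(2) by (cases t) (simp add: lval_def)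
    then show ?thesis using lin_y_unit[OF assms(3), of 0 1] True assms(1) by (simp add: line_y_pt)
  next
    case False
    then have "lval 1 0 t \<noteq> 0" by (simp add: lval_def)
    then show ?thesis using lin_y_unit[OF assms(3), of 1 0] False assms(1) by (simp add: line_y_pt)
  qed
  then show ?thesis using assms(1,2) nz line_nonzero by (simp add: coset_at_eq_iff)
qed

lemma bilinear_form:
  "\<exists>H. real_form 1 H \<and> (\<forall>s t. H (segre s t) = lval a b s * lval c d t)"
proof -
  let ?H = "\<lambda>v. of_real (a * c) * coord_a v + of_real (b * c) * coord_b v
    + of_real (a * d) * coord_c v + of_real (b * d) * coord_d v"
  have "real_form 1 ?H" by (intro real_form_add real_form_scale real_form_coords)
  moreover have "?H (segre s t) = lval a b s * lval c d t" for s t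
    by (simp add: segre_def lval_def algebra_simps)
  ultimately show ?thesis by blast
qed

lemma local_equations_lines: "local_equations line_x" "local_equations line_y"
proof -
  have main: "(\<exists>d H. real_form d H \<and> nonvanishing_at H p \<and>
       (\<exists>k. k \<noteq> 0 \<and> (\<forall>q\<in>Q22. nonvanishing_at H q \<longrightarrow> coset_at q (line_x q) = coset_at q k))) \<and>
     (\<exists>d H. real_form d H \<and> nonvanishing_at H p \<and>
       (\<exists>k. k \<noteq> 0 \<and> (\<forall>q\<in>Q22. nonvanishing_at H q \<longrightarrow> coset_at q (line_y q) = coset_at q k)))"
    if "p \<in> Q22" for p
  proof -
    obtain s t where st: "s \<noteq> (0, 0)" "t \<noteq> (0, 0)" and p: "p = pt s t" using \<open>p \<in> Q22\<close> by (rule Q22_cases)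
    obtain a b c d where ab: "lval a b s \<noteq> 0" and cd: "lval c d t \<noteq> 0"
      using lval_nonzero_exists st by metis
    obtain H where H: "real_form 1 H" "\<And>s t. H (segre s t) = lval a b s * lval c d t"
      using bilinear_form by metis
    have nz: "lin_x a b \<noteq> 0" "lin_y c d \<noteq> 0" using ab cd by (auto intro!: lin_nonzero simp: lval_def)
    have Hp: "nonvanishing_at H p" using ab cd by (simp add: p nonvanishing_at_pt[OF H(1)] H(2))
    have "coset_at q (line_x q) = coset_at q (1 / lin_x a b) \<and> coset_at q (line_y q) = coset_at q (1 / lin_y c d)"
      if "q \<in> Q22" "nonvanishing_at H q" for q
    proof -
      obtain s' t' where st': "s' \<noteq> (0, 0)" "t' \<noteq> (0, 0)" and q: "q = pt s' t'" using \<open>q \<in> Q22\<close> by (rule Q22_cases)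
      have "lval a b s' \<noteq> 0" "lval c d t' \<noteq> 0"
        using \<open>nonvanishing_at H q\<close> by (simp_all add: q nonvanishing_at_pt[OF H(1)] H(2))
      then show ?thesis unfolding q by (simp add: line_x_coset[OF st'] line_y_coset[OF st'])
    qed
    moreover have "1 / lin_x a b \<noteq> 0" "1 / lin_y c d \<noteq> 0" using nz by auto
    ultimately show ?thesis using H(1) Hp by blast
  qed
  show "local_equations line_x"
    unfolding local_equations_def
    by (intro conjI ballI line_nonzero) (rule conjunct1[OF main])
  show "local_equations line_y"
    unfolding local_equations_def
    by (intro conjI ballI line_nonzero) (rule conjunct2[OF main])
qed

subsection \<open>Every divisor is a combination of the two lines\<close>

text \<open>
  A prime factor of \<open>V\<close> divides the form \<open>h\<close>, so it does not vanish where \<open>h\<close> does not.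
\<close>

lemma bihom_nonzero_if_primes_divide:
  assumes h: "bidegree_le d e h" "bihom d e h s t \<noteq> 0" and "V \<noteq> 0"
    and "\<And>\<pi>. prime \<pi> \<Longrightarrow> \<pi> dvd V \<Longrightarrow> \<pi> dvd h"
  shows "bihom (degx V) (degree V) V s t \<noteq> 0"
  using assms(3,4)
proof (induction V rule: prime_divisors_induct)
  case (unit x)
  then obtain y where "1 = x * y" by (auto elim: dvdE)
  then have "eval2 x a b * eval2 y a b = 1" for a b by (metis eval2_simps(2,4))
  then have "eval2 x a b \<noteq> 0" for a b by (metis mult_zero_left zero_neq_one)
  then obtain r where "r \<noteq> 0" "x = [:[:r:]:]" by (rule eval2_no_zero_imp_constant)
  then show ?case using bihom_const00[of r s t] by (simp add: degx_def)
next
  case (factor p x)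
  then have nz: "p \<noteq> 0" "x \<noteq> 0" by auto
  have "p dvd h" using factor by auto
  then obtain h' where h': "h = p * h'" by (rule dvdE)
  have "h \<noteq> 0" using h by auto
  then have "h' \<noteq> 0" using h' by auto
  have le: "degx p + degx h' \<le> d" "degree p + degree h' \<le> e"
    using h(1) nz \<open>h' \<noteq> 0\<close> by (simp_all add: h' bidegree_le_iff degx_mult degree_mult_eq)
  have "bihom (degx p + (d - degx p)) (degree p + (e - degree p)) (p * h') s t
      = bihom (degx p) (degree p) p s t * bihom (d - degx p) (e - degree p) h' s t"
    using le by (intro bihom_mult bidegree_le_degx) (auto simp: bidegree_le_iff)
  then have "bihom (degx p) (degree p) p s t \<noteq> 0" using h(2) le by (simp add: h')
  moreover have "bihom (degx x) (degree x) x s t \<noteq> 0" using factor nz by auto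
  ultimately show ?case
    using bihom_mult[OF bidegree_le_degx[of p] bidegree_le_degx[of x], of s t] nz
    by (simp add: degx_mult degree_mult_eq)
qed simp

text \<open>
  As a rational function, \<open>V\<close> has poles of the orders \<open>degx V\<close> and \<open>degree V\<close> along the lines at infinity of the two factors.
\<close>

lemma normalized_equation_unit:
  assumes st: "s \<noteq> (0, 0)" "t \<noteq> (0, 0)" and V: "bihom (degx V) (degree V) V s t \<noteq> 0"
  shows "Fract V 1 * line_x (pt s t) ^ degx V * line_y (pt s t) ^ degree V \<in> unit_at s t"
proof -
  define X where "X = (if fst s = 0 then [:[:0, 1:]:] else [:[:1, 0:]:] :: real poly poly)"
  define Y where "Y = (if fst t = 0 then [:[:0:], [:1:]:] else [:[:1:], [:0:]:] :: real poly poly)"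
  have X: "bidegree_le 1 0 X" "bihom 1 0 X s t \<noteq> 0"
    using st(1) bihom_linear_x(1)[of 0 1] bihom_linear_x(1)[of 1 0] bihom_linear_x(2)[of 0 1 s t] bihom_linear_x(2)[of 1 0 s t]
    by (cases s; auto simp: X_def)+
  have Y: "bidegree_le 0 1 Y" "bihom 0 1 Y s t \<noteq> 0"
    using st(2) bihom_linear_y(1)[of 0 1] bihom_linear_y(1)[of 1 0] bihom_linear_y(2)[of 0 1 s t] bihom_linear_y(2)[of 1 0 s t]
    by (cases t; auto simp: Y_def)+
  have lines: "line_x (pt s t) = Fract 1 X" "line_y (pt s t) = Fract 1 Y"
    using st by (auto simp: line_x_pt line_y_pt X_def Y_def lin_x_def lin_y_def One_fract_def one_pCons)
  have pow: "Fract 1 Z ^ n = Fract 1 (Z ^ n)" for Z :: "real poly poly" and n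
    by (induction n) (simp_all add: One_fract_def)
  have XY: "bidegree_le (degx V) (degree V) (X ^ degx V * Y ^ degree V)"
    "bihom (degx V) (degree V) (X ^ degx V * Y ^ degree V) s t \<noteq> 0"
  proof -
    have "bidegree_le (degx V * 1) (degx V * 0) (X ^ degx V)" "bidegree_le (degree V * 0) (degree V * 1) (Y ^ degree V)"
      by (intro bihom_power X Y)+
    from bidegree_le_mult[OF this] bihom_mult[OF this, of s t] X Y
    show "bidegree_le (degx V) (degree V) (X ^ degx V * Y ^ degree V)"
      "bihom (degx V) (degree V) (X ^ degx V * Y ^ degree V) s t \<noteq> 0"
      using bihom_power(2)[OF X(1), of "degx V" s t] bihom_power(2)[OF Y(1), of "degree V" s t] by simp_all
  qed
  have "Fract V (X ^ degx V * Y ^ degree V) \<in> unit_at s t"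
    by (rule unit_atI[OF bidegree_le_degx XY(1) V XY(2)])
  then show ?thesis by (simp add: lines pow)
qed

lemma unit_at_cross:
  assumes "Fract A B \<in> unit_at s t" "B \<noteq> 0"
  obtains m n V W where "bidegree_le m n V" "bidegree_le m n W" "bihom m n V s t \<noteq> 0" "bihom m n W s t \<noteq> 0" "A * W = V * B"
proof -
  obtain m n V W where V: "bidegree_le m n V" "bidegree_le m n W" "bihom m n V s t \<noteq> 0" "bihom m n W s t \<noteq> 0" "Fract A B = Fract V W"
    using assms(1) by (auto simp: unit_at_def)
  then have "W \<noteq> 0" by auto
  with V assms(2) show ?thesis using that[OF V(1-4)] by (simp add: eq_fract)
qed

lemma bihom_at_infinity_y:
  "bihom m n P (1, x) (0, 1) = (\<Sum>k\<le>m. of_real (coeff (coeff P n) k) * x ^ k)"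
proof -
  have "bihom m n P (1, x) (0, 1) = (\<Sum>l\<le>n. if l = n then (\<Sum>k\<le>m. of_real (coeff (coeff P l) k) * x ^ k) else 0)"
    unfolding bihom_def by (intro sum.cong refl) (auto simp: power_0_left)
  also have "\<dots> = (\<Sum>k\<le>m. of_real (coeff (coeff P n) k) * x ^ k)" by (subst sum.delta) auto
  finally show ?thesis .
qed

lemma finite_zeros_at_infinity_y:
  assumes "P \<noteq> 0" "degx P \<le> m"
  shows "finite {x. bihom m (degree P) P (1, x) (0, 1) = 0}"
proof -
  have "degree (coeff P (degree P)) \<le> m" using degree_coeff_le_degx[of P "degree P"] assms(2) by simp
  then have "bihom m (degree P) P (1, x) (0, 1) = cpoly (coeff P (degree P)) x" for x
    by (simp add: bihom_at_infinity_y cpoly_sum_le)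
  moreover have "coeff P (degree P) \<noteq> 0" using assms(1) by simp
  ultimately show ?thesis using finite_zeros_cpoly by simp
qed

text \<open>
  Finitely many of the open sets on which a divisor is given by one equation cover the quadric: their complex points are open in the
  usual topology, in which the quadric is compact.
\<close>

lemma finite_cover:
  assumes form: "\<And>p. p \<in> Q22 \<Longrightarrow> real_form (d p) (H p) \<and> nonvanishing_at (H p) p"
  obtains C where "finite C" "C \<subseteq> Q22" "\<And>q. q \<in> Q22 \<Longrightarrow> \<exists>p\<in>C. nonvanishing_at (H p) q"
proof -
  define S where "S = sphere 0 1 \<inter> {x :: complex^4. coord_a x * coord_d x - coord_b x * coord_c x = 0}"
  have "continuous_on UNIV (\<lambda>x. coord_a x * coord_d x - coord_b x * coord_c x)"
    by (intro real_form_continuous[of "1 + 1"] real_form_minus real_form_mult real_form_coords)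
  then have "closed {x :: complex^4. coord_a x * coord_d x - coord_b x * coord_c x = 0}"
    by (intro closed_Collect_eq continuous_on_const)
  then have compact: "compact S" unfolding S_def by (intro compact_Int_closed compact_sphere)
  have S_Q22: "proj_pt x \<in> Q22" if "x \<in> S" for x
  proof -
    have "x \<noteq> 0" using that by (auto simp: S_def)
    then show ?thesis using that unfolding Q22_def quadric_coords S_def by blast
  qed
  have "S \<subseteq> (\<Union>c\<in>S. {x. H (proj_pt c) x \<noteq> 0})"
    using form[OF S_Q22] nonvanishing_at_proj_pt by blast
  moreover have "open {x. H (proj_pt c) x \<noteq> 0}" if "c \<in> S" for c
  proof -
    have "continuous_on UNIV (H (proj_pt c))" using form[OF S_Q22[OF that]] real_form_continuous by blast
    then show ?thesis by (intro open_Collect_neq continuous_on_const)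
  qed
  ultimately obtain C where C: "C \<subseteq> S" "finite C" "S \<subseteq> (\<Union>c\<in>C. {x. H (proj_pt c) x \<noteq> 0})"
    using compactE_image[OF compact, of S "\<lambda>c. {x. H (proj_pt c) x \<noteq> 0}"] by metis
  show ?thesis
  proof (rule that[of "proj_pt ` C"])
    show "finite (proj_pt ` C)" using C by simp
    show "proj_pt ` C \<subseteq> Q22" using C S_Q22 by blast
    fix q assume "q \<in> Q22"
    then obtain v where v: "q = proj_pt v" "v \<noteq> 0" "coord_a v * coord_d v - coord_b v * coord_c v = 0"
      unfolding Q22_def quadric_coords by blast
    define x where "x = (1 / norm v) *\<^sub>R v"
    have xv: "x = complex_of_real (1 / norm v) *s v"
      unfolding x_def vec_eq_iff vector_scaleR_component vector_smult_component
      by (intro allI) (rule scaleR_conv_of_real)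
    have "norm x = 1" using v(2) by (simp add: x_def)
    moreover have "coord_a x * coord_d x - coord_b x * coord_c x = 0"
      using v(3) unfolding xv coords_scale by (simp add: algebra_simps)
    ultimately have "x \<in> S" by (simp add: S_def)
    then obtain c where c: "c \<in> C" "H (proj_pt c) x \<noteq> 0" using C(3) by blast
    have "q = proj_pt x"
      unfolding v(1) proj_pt_eq_iff using v(2) xv by (intro exI[of _ "complex_of_real (1 / norm v)"]) auto
    moreover have "real_form (d (proj_pt c)) (H (proj_pt c))" using form[OF S_Q22] c(1) C(1) by blast
    ultimately have "nonvanishing_at (H (proj_pt c)) q" using c(2) by (simp add: nonvanishing_at_proj_pt)
    then show "\<exists>p\<in>proj_pt ` C. nonvanishing_at (H p) q" using c(1) by blast
  qed
qed

lemma degx_eq_if_nonzero_at_infinity: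
  assumes "bidegree_le m n V" "bihom m n V (0, b) t \<noteq> 0"
  shows "degx V = m"
  using assms bihom_infinity_x_vanishes[of V m n b t] by (fastforce simp: bidegree_le_iff)

lemma degree_eq_if_nonzero_at_infinity:
  assumes "bidegree_le m n V" "bihom m n V s (0, b) \<noteq> 0"
  shows "degree V = n"
  using assms bihom_infinity_y_vanishes[of V n m s b] by (fastforce simp: bidegree_le_iff)

lemma eq_Pair_zero: "fst s = 0 \<Longrightarrow> s = (0, snd s)"
  by (cases s) simp

text \<open>
  On the open set \<open>h c \<noteq> 0\<close> the divisor has the equation \<open>A c\<close>. A prime that divides neither \<open>h c\<close> nor \<open>h c'\<close>
  has zeros in the intersection of the two open sets, where \<open>A c / A c'\<close> is a unit, so its multiplicity in \<open>A c\<close> and in \<open>A c'\<close> is the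
  same. These common multiplicities define \<open>R\<close>. After cancellation numerator and denominator of \<open>A c / R\<close> only contain primes that
  divide \<open>h c\<close>, and these are units where \<open>h c \<noteq> 0\<close>. The primes do not see the lines at infinity. The multiplicities
  \<open>i\<close> and \<open>j\<close> of these lines come from the degrees, which are the same for all \<open>A c\<close> whose open set meets the line.
\<close>

lemma glue_equations:
  fixes C :: "'c set" and h A :: "'c \<Rightarrow> real poly poly" and d :: "'c \<Rightarrow> nat"
  assumes fin: "finite C"
    and bid: "\<And>c. c \<in> C \<Longrightarrow> bidegree_le (d c) (d c) (h c)" and A0: "\<And>c. c \<in> C \<Longrightarrow> A c \<noteq> 0"
    and h0: "\<And>c. c \<in> C \<Longrightarrow> h c \<noteq> 0"
    and cover: "\<And>s t. s \<noteq> (0, 0) \<Longrightarrow> t \<noteq> (0, 0) \<Longrightarrow> \<exists>c\<in>C. bihom (d c) (d c) (h c) s t \<noteq> 0"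
    and unit: "\<And>c c' s t. c \<in> C \<Longrightarrow> c' \<in> C \<Longrightarrow> s \<noteq> (0, 0) \<Longrightarrow> t \<noteq> (0, 0) \<Longrightarrow>
      bihom (d c) (d c) (h c) s t \<noteq> 0 \<Longrightarrow> bihom (d c') (d c') (h c') s t \<noteq> 0 \<Longrightarrow>
      Fract (A c) (A c') \<in> unit_at s t"
  obtains R i j where "R \<noteq> 0"
    "\<And>c s t. c \<in> C \<Longrightarrow> s \<noteq> (0, 0) \<Longrightarrow> t \<noteq> (0, 0) \<Longrightarrow> bihom (d c) (d c) (h c) s t \<noteq> 0 \<Longrightarrow>
      Fract (A c) R / (line_x (pt s t) powi i * line_y (pt s t) powi j) \<in> unit_at s t"
proof -
  have eval_h: "eval2 (h c) x y = bihom (d c) (d c) (h c) (1, x) (1, y)" if "c \<in> C" for c x y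
    by (rule eval2_bihom[OF bid[OF that]])
  have mult_eq: "multiplicity \<pi> (A c) = multiplicity \<pi> (A c')"
    if \<pi>: "prime \<pi>" and c: "c \<in> C" "c' \<in> C" and nd: "\<not> \<pi> dvd h c" "\<not> \<pi> dvd h c'" for \<pi> c c'
  proof -
    have "\<not> \<pi> dvd h c * h c'" using nd \<pi> by (simp add: prime_dvd_mult_iff)
    then obtain x y where xy: "eval2 \<pi> x y = 0" "eval2 (h c * h c') x y \<noteq> 0"
      using prime_has_zero_off[OF \<pi>] by metis
    then have "Fract (A c) (A c') \<in> unit_at (1, x) (1, y)"
      using c by (intro unit) (auto simp: eval_h)
    then obtain m n V W where V: "bidegree_le m n V" "bidegree_le m n W" "bihom m n V (1, x) (1, y) \<noteq> 0"
      "bihom m n W (1, x) (1, y) \<noteq> 0" "A c * W = V * A c'"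
      using A0[OF c(2)] by (rule unit_at_cross)
    have "\<not> \<pi> dvd V" "\<not> \<pi> dvd W"
      using V xy(1) by (auto elim!: dvdE simp flip: eval2_bihom)
    then have "multiplicity \<pi> V = 0" "multiplicity \<pi> W = 0" by (simp_all add: not_dvd_imp_multiplicity_0)
    moreover have "multiplicity \<pi> (A c * W) = multiplicity \<pi> (V * A c')" by (simp add: V(5))
    moreover have "V \<noteq> 0" "W \<noteq> 0" using V(3,4) by auto
    ultimately show ?thesis using \<pi> A0[OF c(1)] A0[OF c(2)] by (simp add: prime_elem_multiplicity_mult_distrib)
  qed
  have sel_ex: "\<exists>c\<in>C. \<not> \<pi> dvd h c" if \<pi>: "prime \<pi>" for \<pi>
  proof -
    have "\<not> \<pi> dvd 1" using \<pi> by auto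
    then obtain x y where xy: "eval2 \<pi> x y = 0" by (rule prime_has_zero_off[OF \<pi>])
    obtain c where c: "c \<in> C" "bihom (d c) (d c) (h c) (1, x) (1, y) \<noteq> 0" using cover[of "(1, x)" "(1, y)"] by auto
    then have "eval2 (h c) x y \<noteq> 0" by (simp add: eval_h)
    then have "\<not> \<pi> dvd h c" using xy by (auto elim!: dvdE)
    with c show ?thesis by blast
  qed
  define sel where "sel = (\<lambda>\<pi>. SOME c. c \<in> C \<and> \<not> \<pi> dvd h c)"
  have sel: "sel \<pi> \<in> C" "\<not> \<pi> dvd h (sel \<pi>)" if "prime \<pi>" for \<pi>
    using someI_ex[of "\<lambda>c. c \<in> C \<and> \<not> \<pi> dvd h c"] sel_ex[OF that] unfolding sel_def by blast+
  define PF n R where "PF = prime_factors (\<Prod>c\<in>C. A c)" and "n = (\<lambda>\<pi>. multiplicity \<pi> (A (sel \<pi>)))"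
    and "R = (\<Prod>\<pi>\<in>PF. \<pi> ^ n \<pi>)"
  have PF_prime: "prime \<pi>" if "\<pi> \<in> PF" for \<pi> using that by (simp add: PF_def in_prime_factors_iff)
  have "finite PF" by (simp add: PF_def)
  have "0 \<notin> PF" using PF_prime[of 0] by auto
  have R0: "R \<noteq> 0" unfolding R_def using \<open>0 \<notin> PF\<close> \<open>finite PF\<close> by (auto simp: prod_zero_iff)
  have mult_R: "multiplicity \<pi> R = n \<pi>" if \<pi>: "prime \<pi>" for \<pi>
  proof -
    have "multiplicity \<pi> R = (\<Sum>\<rho>\<in>PF. multiplicity \<pi> (\<rho> ^ n \<rho>))"
      unfolding R_def using \<pi> \<open>0 \<notin> PF\<close> \<open>finite PF\<close> by (intro prime_elem_multiplicity_prod_distrib) auto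
    also have "\<dots> = (\<Sum>\<rho>\<in>PF. if \<rho> = \<pi> then n \<rho> else 0)"
    proof (rule sum.cong[OF refl])
      fix \<rho> assume "\<rho> \<in> PF"
      then have \<rho>: "prime \<rho>" by (rule PF_prime)
      then have "multiplicity \<pi> (\<rho> ^ n \<rho>) = n \<rho> * multiplicity \<pi> \<rho>"
        using \<pi> by (intro prime_elem_multiplicity_power_distrib) auto
      also have "multiplicity \<pi> \<rho> = (if \<rho> = \<pi> then 1 else 0)"
        using \<pi> \<rho> by (auto simp: prime_multiplicity_other multiplicity_self)
      finally show "multiplicity \<pi> (\<rho> ^ n \<rho>) = (if \<rho> = \<pi> then n \<rho> else 0)" by simp
    qed
    also have "\<dots> = (if \<pi> \<in> PF then n \<pi> else 0)" using \<open>finite PF\<close> by (subst sum.delta) auto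
    also have "\<dots> = n \<pi>"
    proof (cases "\<pi> \<in> PF")
      case False
      have "(\<Prod>c\<in>C. A c) \<noteq> 0" using fin A0 by (simp add: prod_zero_iff)
      moreover have "A (sel \<pi>) dvd (\<Prod>c\<in>C. A c)" using fin sel(1)[OF \<pi>] by (rule dvd_prodI)
      ultimately have "\<not> \<pi> dvd A (sel \<pi>)" using False \<pi> unfolding PF_def in_prime_factors_iff by (meson dvd_trans)
      then show ?thesis using False by (simp add: n_def not_dvd_imp_multiplicity_0)
    qed simp
    finally show ?thesis .
  qed
  have mult_AR: "multiplicity \<pi> (A c) = multiplicity \<pi> R" if "prime \<pi>" "c \<in> C" "\<not> \<pi> dvd h c" for \<pi> c
    using mult_eq[OF that(1,2) sel(1)[OF that(1)] that(3) sel(2)[OF that(1)]] mult_R[OF that(1)] by (simp add: n_def)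
  have degx_AR: "degx (A c) = degx (A c')"
    if c: "c \<in> C" "c' \<in> C" and dc: "degx (h c) = d c" "degx (h c') = d c'" for c c'
  proof -
    have "finite ({y. bihom (degx (h c)) (d c) (h c) (0, 1) (1, y) = 0} \<union> {y. bihom (degx (h c')) (d c') (h c') (0, 1) (1, y) = 0})"
      using c bid h0 by (intro finite_UnI finite_zeros_at_infinity_x) (auto simp: bidegree_le_iff)
    then obtain y where "y \<notin> {y. bihom (degx (h c)) (d c) (h c) (0, 1) (1, y) = 0} \<union> {y. bihom (degx (h c')) (d c') (h c') (0, 1) (1, y) = 0}"
      by (rule avoid_finite)
    then have "Fract (A c) (A c') \<in> unit_at (0, 1) (1, y)"
      using c dc by (intro unit) auto
    then obtain m n V W where V: "bidegree_le m n V" "bidegree_le m n W" "bihom m n V (0, 1) (1, y) \<noteq> 0"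
      "bihom m n W (0, 1) (1, y) \<noteq> 0" "A c * W = V * A c'"
      using A0[OF c(2)] by (rule unit_at_cross)
    then have "degx V = m" "degx W = m" using degx_eq_if_nonzero_at_infinity by blast+
    moreover have "V \<noteq> 0" "W \<noteq> 0" using V(3,4) by auto
    moreover have "degx (A c * W) = degx (V * A c')" by (simp add: V(5))
    ultimately show ?thesis using A0[OF c(1)] A0[OF c(2)] by (simp add: degx_mult)
  qed
  have degree_AR: "degree (A c) = degree (A c')"
    if c: "c \<in> C" "c' \<in> C" and dc: "degree (h c) = d c" "degree (h c') = d c'" for c c'
  proof -
    have "finite ({x. bihom (d c) (degree (h c)) (h c) (1, x) (0, 1) = 0} \<union> {x. bihom (d c') (degree (h c')) (h c') (1, x) (0, 1) = 0})"
      using c bid h0 by (intro finite_UnI finite_zeros_at_infinity_y) (auto simp: bidegree_le_iff)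
    then obtain x where "x \<notin> {x. bihom (d c) (degree (h c)) (h c) (1, x) (0, 1) = 0} \<union> {x. bihom (d c') (degree (h c')) (h c') (1, x) (0, 1) = 0}"
      by (rule avoid_finite)
    then have "Fract (A c) (A c') \<in> unit_at (1, x) (0, 1)"
      using c dc by (intro unit) auto
    then obtain m n V W where V: "bidegree_le m n V" "bidegree_le m n W" "bihom m n V (1, x) (0, 1) \<noteq> 0"
      "bihom m n W (1, x) (0, 1) \<noteq> 0" "A c * W = V * A c'"
      using A0[OF c(2)] by (rule unit_at_cross)
    then have "degree V = n" "degree W = n" using degree_eq_if_nonzero_at_infinity by blast+
    moreover have "V \<noteq> 0" "W \<noteq> 0" using V(3,4) by auto
    moreover have "degree (A c * W) = degree (V * A c')" by (simp add: V(5))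
    ultimately show ?thesis using A0[OF c(1)] A0[OF c(2)] by (simp add: degree_mult_eq)
  qed
  obtain cx where cx: "cx \<in> C" "bihom (d cx) (d cx) (h cx) (0, 1) (1, 0) \<noteq> 0" using cover[of "(0, 1)" "(1, 0)"] by auto
  then have dx: "degx (h cx) = d cx" using bid degx_eq_if_nonzero_at_infinity by blast
  obtain cy where cy: "cy \<in> C" "bihom (d cy) (d cy) (h cy) (1, 0) (0, 1) \<noteq> 0" using cover[of "(1, 0)" "(0, 1)"] by auto
  then have dy: "degree (h cy) = d cy" using bid degree_eq_if_nonzero_at_infinity by blast
  define i j where "i = int (degx R) - int (degx (A cx))" and "j = int (degree R) - int (degree (A cy))"
  show ?thesis
  proof (rule that[of R i j, OF R0])
    fix c s t assume c: "c \<in> C" and st: "s \<noteq> (0, 0)" "t \<noteq> (0, 0)" and hc: "bihom (d c) (d c) (h c) s t \<noteq> 0"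
    define g where "g = gcd (A c) R"
    have g0: "g \<noteq> 0" using R0 by (simp add: g_def)
    obtain V W where VW: "A c = V * g" "R = W * g" "coprime V W"
      using gcd_coprime_exists[of "A c" R] g0 unfolding g_def by blast
    have nz: "V \<noteq> 0" "W \<noteq> 0" using A0[OF c] R0 VW by auto
    have mult_VW: "multiplicity \<pi> V = multiplicity \<pi> W" if "prime \<pi>" "\<not> \<pi> dvd h c" for \<pi>
    proof -
      have "multiplicity \<pi> V + multiplicity \<pi> g = multiplicity \<pi> W + multiplicity \<pi> g"
        using mult_AR[OF that(1) c that(2)] that(1) nz g0 by (simp add: VW prime_elem_multiplicity_mult_distrib)
      then show ?thesis by simp
    qed
    have dvd_iff: "\<pi> dvd V \<longleftrightarrow> \<pi> dvd W" if "prime \<pi>" "\<not> \<pi> dvd h c" for \<pi>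
      using mult_VW[OF that] that(1) nz prime_multiplicity_gt_zero_iff[of \<pi> V] prime_multiplicity_gt_zero_iff[of \<pi> W] by auto
    have "\<pi> dvd h c" if "prime \<pi>" "\<pi> dvd V \<or> \<pi> dvd W" for \<pi>
    proof (rule ccontr)
      assume "\<not> \<pi> dvd h c"
      then have "\<pi> dvd V" "\<pi> dvd W" using dvd_iff that by blast+
      then have "is_unit \<pi>" using VW(3) by (rule coprime_common_divisor[rotated])
      then show False using that(1) by auto
    qed
    then have bV: "bihom (degx V) (degree V) V s t \<noteq> 0" and bW: "bihom (degx W) (degree W) W s t \<noteq> 0"
      using bihom_nonzero_if_primes_divide[OF bid[OF c] hc] nz by blast+
    define x y where "x = line_x (pt s t)" and "y = line_y (pt s t)"
    have xy: "x \<noteq> 0" "y \<noteq> 0" by (simp_all add: x_def y_def line_nonzero)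
    have u: "(Fract V 1 * x ^ degx V * y ^ degree V) / (Fract W 1 * x ^ degx W * y ^ degree W) \<in> unit_at s t"
      unfolding x_def y_def by (intro unit_at_divide normalized_equation_unit st bV bW)
    have deg: "degx (A c) = degx V + degx g" "degx R = degx W + degx g"
      "degree (A c) = degree V + degree g" "degree R = degree W + degree g"
      unfolding VW using nz g0 by (simp_all add: degx_mult degree_mult_eq)
    have xi: "x ^ degx V * x powi i = x ^ degx W"
    proof (cases "fst s = 0")
      case True
      then have "bihom (d c) (d c) (h c) (0, snd s) t \<noteq> 0" using hc by (simp flip: eq_Pair_zero)
      then have "degx (h c) = d c" using bid[OF c] degx_eq_if_nonzero_at_infinity by blast
      then have "i = int (degx W) - int (degx V)"
        using degx_AR[OF c cx(1) _ dx] deg by (simp add: i_def)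
      then show ?thesis using xy by (simp add: power_int_diff)
    qed (simp add: x_def line_x_pt st)
    have yj: "y ^ degree V * y powi j = y ^ degree W"
    proof (cases "fst t = 0")
      case True
      then have "bihom (d c) (d c) (h c) s (0, snd t) \<noteq> 0" using hc by (simp flip: eq_Pair_zero)
      then have "degree (h c) = d c" using bid[OF c] degree_eq_if_nonzero_at_infinity by blast
      then have "j = int (degree W) - int (degree V)"
        using degree_AR[OF c cy(1) _ dy] deg by (simp add: j_def)
      then show ?thesis using xy by (simp add: power_int_diff)
    qed (simp add: y_def line_y_pt st)
    have cancel: "F / G / (a * b) = (F * u * v) / (G * (u * a) * (v * b))"
      if "u \<noteq> 0" "v \<noteq> 0" "a \<noteq> 0" "b \<noteq> 0" "G \<noteq> 0" for F G u v a b :: "real poly poly fract"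
      using that by (simp add: field_simps)
    have W1: "Fract W 1 \<noteq> 0" using nz by (simp add: Zero_fract_def eq_fract)
    have "Fract (A c) R = Fract V 1 / Fract W 1"
      using nz g0 by (simp add: VW eq_fract)
    also have "\<dots> / (x powi i * y powi j) = (Fract V 1 * x ^ degx V * y ^ degree V) / (Fract W 1 * x ^ degx W * y ^ degree W)"
      unfolding xi[symmetric] yj[symmetric] using xy by (intro cancel W1) simp_all
    finally show "Fract (A c) R / (line_x (pt s t) powi i * line_y (pt s t) powi j) \<in> unit_at s t"
      using u by (simp add: x_def y_def)
  qed
qed

theorem divisor_equivalent_to_lines:
  assumes \<kappa>: "local_equations \<kappa>"
  obtains k i j where "k \<noteq> 0" "\<And>p. p \<in> Q22 \<Longrightarrow> coset_at p (\<kappa> p) = coset_at p (k * (line_x p powi i * line_y p powi j))"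
proof -
  have \<kappa>0: "\<kappa> p \<noteq> 0" if "p \<in> Q22" for p using \<kappa> that by (simp add: local_equations_def)
  have "\<forall>p\<in>Q22. \<exists>X. real_form (fst X) (fst (snd X)) \<and> nonvanishing_at (fst (snd X)) p \<and> snd (snd X) \<noteq> 0 \<and>
      (\<forall>q\<in>Q22. nonvanishing_at (fst (snd X)) q \<longrightarrow> coset_at q (\<kappa> q) = coset_at q (snd (snd X)))"
    using \<kappa> unfolding local_equations_def by simp
  from bchoice[OF this] obtain X where X: "\<And>p. p \<in> Q22 \<Longrightarrow>
      real_form (fst (X p)) (fst (snd (X p))) \<and> nonvanishing_at (fst (snd (X p))) p \<and> snd (snd (X p)) \<noteq> 0 \<and>
      (\<forall>q\<in>Q22. nonvanishing_at (fst (snd (X p))) q \<longrightarrow> coset_at q (\<kappa> q) = coset_at q (snd (snd (X p))))"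
    by blast
  define d H k where "d = (\<lambda>p. fst (X p))" and "H = (\<lambda>p. fst (snd (X p)))" and "k = (\<lambda>p. snd (snd (X p)))"
  have form: "real_form (d p) (H p) \<and> nonvanishing_at (H p) p" if "p \<in> Q22" for p
    using X[OF that] by (simp add: d_def H_def)
  have k0: "k p \<noteq> 0" if "p \<in> Q22" for p using X[OF that] by (simp add: k_def)
  have eqn: "coset_at q (\<kappa> q) = coset_at q (k p)" if "p \<in> Q22" "q \<in> Q22" "nonvanishing_at (H p) q" for p q
    using X[OF that(1)] that(2,3) by (simp add: H_def k_def)
  obtain C where C: "finite C" "C \<subseteq> Q22" "\<And>q. q \<in> Q22 \<Longrightarrow> \<exists>p\<in>C. nonvanishing_at (H p) q"
    using finite_cover[OF form] by blast
  define h where "h = (\<lambda>p. dehom (H p))"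
  have nonvan: "nonvanishing_at (H c) (pt s t) \<longleftrightarrow> bihom (d c) (d c) (h c) s t \<noteq> 0" if "c \<in> C" for c s t
    using form[of c] that C(2) nonvanishing_at_pt[of "d c" "H c" s t] dehom_form(2)[of "d c" "H c" s t] by (auto simp: h_def)
  have "\<exists>F G. k c = Fract F G \<and> F \<noteq> 0 \<and> G \<noteq> 0" if "c \<in> C" for c
  proof -
    obtain F G where "k c = Fract F G" "G \<noteq> 0" by (cases "k c") auto
    moreover have "k c \<noteq> 0" using k0 that C(2) by blast
    ultimately show ?thesis by (auto simp: Zero_fract_def eq_fract)
  qed
  then obtain F G where FG: "\<And>c. c \<in> C \<Longrightarrow> k c = Fract (F c) (G c) \<and> F c \<noteq> 0 \<and> G c \<noteq> 0" by metis
  \<comment> \<open>\<open>T\<close> is a common denominator.\<close>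
  define T A where "T = (\<Prod>c\<in>C. G c)" and "A = (\<lambda>c. F c * (\<Prod>c'\<in>C - {c}. G c'))"
  have T0: "T \<noteq> 0" using C(1) FG by (auto simp: T_def prod_zero_iff)
  have A0: "A c \<noteq> 0" if "c \<in> C" for c using C(1) FG that by (auto simp: A_def prod_zero_iff)
  have kA: "k c = Fract (A c) T" if "c \<in> C" for c
  proof -
    have "T = G c * (\<Prod>c'\<in>C - {c}. G c')" unfolding T_def using C(1) that by (rule prod.remove)
    then have "F c * T = A c * G c" by (simp add: A_def mult_ac)
    then show ?thesis using FG[OF that] T0 by (simp add: eq_fract)
  qed
  obtain R i j where R: "R \<noteq> 0" "\<And>c s t. c \<in> C \<Longrightarrow> s \<noteq> (0, 0) \<Longrightarrow> t \<noteq> (0, 0) \<Longrightarrow> bihom (d c) (d c) (h c) s t \<noteq> 0 \<Longrightarrow>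
      Fract (A c) R / (line_x (pt s t) powi i * line_y (pt s t) powi j) \<in> unit_at s t"
  proof (rule glue_equations[of C d h A])
    show "bidegree_le (d c) (d c) (h c)" if "c \<in> C" for c
      unfolding h_def using form that C(2) by (blast intro: dehom_form)
    show "h c \<noteq> 0" if "c \<in> C" for c
      unfolding h_def using form[of c] that C(2) ex_nonvanishing_iff by blast
    show "\<exists>c\<in>C. bihom (d c) (d c) (h c) s t \<noteq> 0" if "s \<noteq> (0, 0)" "t \<noteq> (0, 0)" for s t
      using C(3)[OF pt_in_Q22[OF that]] nonvan by blast
    fix c c' s t assume c: "c \<in> C" "c' \<in> C" and st: "s \<noteq> (0, 0)" "t \<noteq> (0, 0)"
      and "bihom (d c) (d c) (h c) s t \<noteq> 0" "bihom (d c') (d c') (h c') s t \<noteq> 0"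
    then have "coset_at (pt s t) (k c) = coset_at (pt s t) (k c')"
      using eqn[of c "pt s t"] eqn[of c' "pt s t"] nonvan C(2) pt_in_Q22[OF st] by (metis subsetD)
    then have "k c / k c' \<in> unit_at s t" using st k0 c C(2) by (subst (asm) coset_at_eq_iff) auto
    moreover have "k c / k c' = Fract (A c) (A c')" using A0 c T0 by (simp add: kA eq_fract)
    ultimately show "Fract (A c) (A c') \<in> unit_at s t" by simp
  qed (use C A0 in auto)
  show ?thesis
  proof (rule that[of "Fract R T" i j])
    show RT: "Fract R T \<noteq> 0" using R(1) T0 by (simp add: Zero_fract_def eq_fract)
    fix p assume p: "p \<in> Q22"
    then obtain s t where st: "s \<noteq> (0, 0)" "t \<noteq> (0, 0)" and pst: "p = pt s t" by (rule Q22_cases)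
    obtain c where c: "c \<in> C" "nonvanishing_at (H c) p" using C(3)[OF p] by blast
    then have "coset_at p (\<kappa> p) = coset_at p (k c)" using eqn p C(2) by blast
    moreover have "coset_at p (k c) = coset_at p (Fract R T * (line_x p powi i * line_y p powi j))"
    proof -
      have "Fract (A c) R / (line_x p powi i * line_y p powi j) \<in> unit_at s t"
        using R(2)[OF c(1) st] c(2) nonvan[OF c(1)] by (simp add: pst)
      moreover have "Fract (A c) R = k c / Fract R T" using c A0 T0 R(1) by (simp add: kA eq_fract)
      ultimately have "k c / (Fract R T * (line_x p powi i * line_y p powi j)) \<in> unit_at s t" by simp
      then show ?thesis unfolding pst
        using st k0 c C(2) RT line_nonzero by (subst coset_at_eq_iff) auto
    qed
    ultimately show "coset_at p (\<kappa> p) = coset_at p (Fract R T * (line_x p powi i * line_y p powi j))" by simp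
  qed
qed

subsection \<open>The two lines are independent\<close>

lemma degx_power: "P \<noteq> 0 \<Longrightarrow> degx (P ^ n) = n * degx P"
  by (induction n) (auto simp: degx_mult degx_def[of 1])

lemma unit_at_cross_power:
  assumes "Fract P Q * (1 / Fract X 1) powi i \<in> unit_at s t"
    and nz: "P \<noteq> 0" "Q \<noteq> 0" "X \<noteq> 0"
  obtains m n V W where "bidegree_le m n V" "bidegree_le m n W" "bihom m n V s t \<noteq> 0" "bihom m n W s t \<noteq> 0"
    "P * (X ^ nat (- i) * W) = V * (Q * X ^ nat i)"
proof -
  have pow: "Fract Y Z ^ l = Fract (Y ^ l) (Z ^ l)" for Y Z :: "real poly poly" and l
    by (induction l) (simp_all add: One_fract_def)
  have "(1 / Fract X 1) powi i = Fract (X ^ nat (- i)) (X ^ nat i)"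
    by (simp add: power_int_def One_fract_def pow)
  then have "Fract (P * X ^ nat (- i)) (Q * X ^ nat i) \<in> unit_at s t" using assms(1) by simp
  moreover have "Q * X ^ nat i \<noteq> 0" using nz by simp
  ultimately obtain m n V W where "bidegree_le m n V" "bidegree_le m n W" "bihom m n V s t \<noteq> 0" "bihom m n W s t \<noteq> 0"
    "P * X ^ nat (- i) * W = V * (Q * X ^ nat i)" by (rule unit_at_cross)
  then show ?thesis using that by (simp add: mult.assoc)
qed

text \<open>
  A function whose divisor is a combination of the lines at infinity has neither zeros nor poles on the affine part, so it is constant. Then its
  orders \<open>i\<close> and \<open>j\<close> along the two lines are zero; each is determined at one point of the line.
\<close>

theorem lines_independent:
  assumes "k \<noteq> 0"
    and unit: "\<And>s t. s \<noteq> (0, 0) \<Longrightarrow> t \<noteq> (0, 0) \<Longrightarrow>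
      k * (line_x (pt s t) powi i * line_y (pt s t) powi j) \<in> unit_at s t"
  shows "i = 0 \<and> j = 0"
proof -
  obtain P0 Q0 where k0: "k = Fract P0 Q0" "Q0 \<noteq> 0" by (cases k) auto
  then have "P0 \<noteq> 0" using assms(1) by (auto simp: Zero_fract_def eq_fract)
  define g where "g = gcd P0 Q0"
  have g0: "g \<noteq> 0" using \<open>Q0 \<noteq> 0\<close> by (simp add: g_def)
  obtain P Q where PQ: "P0 = P * g" "Q0 = Q * g" "coprime P Q"
    using gcd_coprime_exists[of P0 Q0] g0 unfolding g_def by blast
  have nz: "P \<noteq> 0" "Q \<noteq> 0" using \<open>P0 \<noteq> 0\<close> \<open>Q0 \<noteq> 0\<close> PQ by auto
  have k: "k = Fract P Q" using k0 nz g0 by (simp add: PQ eq_fract)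
  have "eval2 P x y \<noteq> 0 \<and> eval2 Q x y \<noteq> 0" for x y
  proof -
    have "Fract P Q \<in> unit_at (1, x) (1, y)"
      using unit[of "(1, x)" "(1, y)"] by (simp add: line_x_pt line_y_pt k)
    then obtain m n V W where V: "bidegree_le m n V" "bidegree_le m n W" "bihom m n V (1, x) (1, y) \<noteq> 0"
      "bihom m n W (1, x) (1, y) \<noteq> 0" "P * W = V * Q"
      using nz(2) by (rule unit_at_cross)
    have "P dvd V * Q" "Q dvd P * W" using V(5) by (metis dvd_triv_left, metis dvd_triv_right)
    then have "P dvd V" "Q dvd W"
      using PQ(3) by (simp_all add: coprime_dvd_mult_left_iff coprime_dvd_mult_right_iff coprime_commute)
    moreover have "eval2 V x y \<noteq> 0" "eval2 W x y \<noteq> 0" using V by (simp_all add: eval2_bihom)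
    ultimately show ?thesis by (auto elim!: dvdE)
  qed
  then obtain a b where "P = [:[:a:]:]" "Q = [:[:b:]:]" "a \<noteq> 0" "b \<noteq> 0"
    using eval2_no_zero_imp_constant by metis
  then have deg: "degx P = 0" "degx Q = 0" "degree P = 0" "degree Q = 0" by (simp_all add: degx_def)
  have X: "[:[:0, 1:]:] \<noteq> (0 :: real poly poly)" "degx [:[:0, 1:]:] = 1" by (simp_all add: degx_def)
  have Y: "[:[:0:], [:1:]:] \<noteq> (0 :: real poly poly)" "degree [:[:0:], [:1 :: real:]:] = 1" by simp_all
  have "Fract P Q * (1 / Fract [:[:0, 1:]:] 1) powi i \<in> unit_at (0, 1) (1, 0)"
    using unit[of "(0, 1)" "(1, 0)"] by (simp add: line_x_pt line_y_pt k lin_x_def)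
  then obtain m n V W where V: "bidegree_le m n V" "bidegree_le m n W" "bihom m n V (0, 1) (1, 0) \<noteq> 0"
    "bihom m n W (0, 1) (1, 0) \<noteq> 0" "P * ([:[:0, 1:]:] ^ nat (- i) * W) = V * (Q * [:[:0, 1:]:] ^ nat i)"
    using nz X(1) by (rule unit_at_cross_power)
  have VW: "V \<noteq> 0" "W \<noteq> 0" "degx V = m" "degx W = m"
    using V degx_eq_if_nonzero_at_infinity by auto
  have "degx (P * ([:[:0, 1:]:] ^ nat (- i) * W)) = nat (- i) + m"
    using nz VW X by (simp add: degx_mult degx_power deg)
  moreover have "degx (V * (Q * [:[:0, 1:]:] ^ nat i)) = m + nat i"
    using nz VW X by (simp add: degx_mult degx_power deg)
  ultimately have i: "i = 0" using V(5) by simp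
  have "Fract P Q * (1 / Fract [:[:0:], [:1:]:] 1) powi j \<in> unit_at (1, 0) (0, 1)"
    using unit[of "(1, 0)" "(0, 1)"] by (simp add: line_x_pt line_y_pt k lin_y_def)
  then obtain m' n' V' W' where V': "bidegree_le m' n' V'" "bidegree_le m' n' W'" "bihom m' n' V' (1, 0) (0, 1) \<noteq> 0"
    "bihom m' n' W' (1, 0) (0, 1) \<noteq> 0" "P * ([:[:0:], [:1:]:] ^ nat (- j) * W') = V' * (Q * [:[:0:], [:1:]:] ^ nat j)"
    using nz Y(1) by (rule unit_at_cross_power)
  have VW': "V' \<noteq> 0" "W' \<noteq> 0" "degree V' = n'" "degree W' = n'"
    using V' degree_eq_if_nonzero_at_infinity by auto
  have "degree (P * ([:[:0:], [:1:]:] ^ nat (- j) * W')) = nat (- j) + n'"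
    using nz VW' Y by (simp add: degree_mult_eq degree_power_eq deg)
  moreover have "degree (V' * (Q * [:[:0:], [:1:]:] ^ nat j)) = n' + nat j"
    using nz VW' Y by (simp add: degree_mult_eq degree_power_eq deg)
  ultimately have "j = 0" using V'(5) by simp
  with i show ?thesis by simp
qed

subsection \<open>Divisor classes\<close>

definition divisor_class :: "((complex^4) set \<Rightarrow> real poly poly fract) \<Rightarrow> ((complex^4) set \<Rightarrow> ratfun set) set" where
  "divisor_class \<kappa> = principal_divisors #>\<^bsub>cartier_group\<^esub> divisor_of \<kappa>"

lemma divisor_of_eq_iff: "divisor_of \<kappa> = divisor_of \<kappa>' \<longleftrightarrow> (\<forall>p\<in>Q22. coset_at p (\<kappa> p) = coset_at p (\<kappa>' p))"
  by (intro iffI ballI divisor_of_cong) (blast dest: divisor_of_eqD)+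

lemma divisor_class_eq_iff:
  assumes "local_equations \<kappa>" "local_equations \<kappa>'"
  shows "divisor_class \<kappa> = divisor_class \<kappa>' \<longleftrightarrow>
    (\<exists>k. k \<noteq> 0 \<and> (\<forall>p\<in>Q22. coset_at p (\<kappa> p) = coset_at p (k * \<kappa>' p)))"
proof -
  interpret C: comm_group cartier_group by (rule comm_group_cartier_group)
  have mem: "divisor_of \<kappa> \<in> carrier cartier_group" "divisor_of \<kappa>' \<in> carrier cartier_group"
    using assms by (auto simp: carrier_cartier_group)
  have "divisor_class \<kappa> = divisor_class \<kappa>' \<longleftrightarrow> divisor_of \<kappa> \<in> principal_divisors #>\<^bsub>cartier_group\<^esub> divisor_of \<kappa>'"
    unfolding divisor_class_def
    using C.rcos_self[OF mem(1) subgroup_principal_divisors] C.repr_independence[OF _ mem(2) subgroup_principal_divisors]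
    by blast
  also have "\<dots> \<longleftrightarrow> (\<exists>k. k \<noteq> 0 \<and> divisor_of \<kappa> = divisor_of (\<lambda>p. k * \<kappa>' p))"
    using local_equations_nonzero[OF assms(2)]
    unfolding r_coset_def principal_divisors_eq by (auto simp: divisor_of_mult)
  also have "\<dots> \<longleftrightarrow> (\<exists>k. k \<noteq> 0 \<and> (\<forall>p\<in>Q22. coset_at p (\<kappa> p) = coset_at p (k * \<kappa>' p)))"
    by (simp only: divisor_of_eq_iff)
  finally show ?thesis .
qed

lemma carrier_Pic_Q22: "carrier Pic_Q22 = divisor_class ` {\<kappa>. local_equations \<kappa>}"
  by (auto simp: Pic_Q22_def FactGroup_def RCOSETS_def carrier_cartier_group divisor_class_def)

lemma mult_Pic_Q22:
  assumes "local_equations \<kappa>" "local_equations \<kappa>'"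
  shows "divisor_class \<kappa> \<otimes>\<^bsub>Pic_Q22\<^esub> divisor_class \<kappa>' = divisor_class (\<lambda>p. \<kappa> p * \<kappa>' p)"
proof -
  interpret C: comm_group cartier_group by (rule comm_group_cartier_group)
  interpret normal principal_divisors cartier_group
    by (rule C.subgroup_imp_normal[OF subgroup_principal_divisors])
  have mem: "divisor_of \<kappa> \<in> carrier cartier_group" "divisor_of \<kappa>' \<in> carrier cartier_group"
    using assms by (auto simp: carrier_cartier_group)
  show ?thesis
    using rcos_sum[OF mem] divisor_of_mult[of \<kappa> \<kappa>'] local_equations_nonzero[OF assms(1)] local_equations_nonzero[OF assms(2)]
    by (simp add: Pic_Q22_def FactGroup_def divisor_class_def)
qed

lemma comm_group_Pic_Q22: "comm_group Pic_Q22"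
  unfolding Pic_Q22_def
  by (rule comm_group.abelian_FactGroup[OF comm_group_cartier_group subgroup_principal_divisors])

lemma local_equations_powi:
  assumes "local_equations \<kappa>"
  shows "local_equations (\<lambda>p. \<kappa> p powi i)"
proof -
  have pow: "local_equations (\<lambda>p. \<kappa> p ^ n)" for n
    by (induction n) (auto intro: local_equations_mult[OF assms] local_equations_const)
  show ?thesis
  proof (cases "i \<ge> 0")
    case True
    then show ?thesis using pow[of "nat i"] by (simp add: power_int_def)
  next
    case False
    then show ?thesis using local_equations_inverse[OF pow[of "nat (- i)"]] by (simp add: power_int_def power_inverse)
  qed
qed

definition lines_equation :: "int \<Rightarrow> int \<Rightarrow> (complex^4) set \<Rightarrow> real poly poly fract" where
  "lines_equation i j p = line_x p powi i * line_y p powi j"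

lemma local_equations_lines_equation: "local_equations (lines_equation i j)"
  unfolding lines_equation_def[abs_def]
  by (intro local_equations_mult local_equations_powi local_equations_lines)

lemma lines_equation_nonzero: "lines_equation i j p \<noteq> 0"
  by (simp add: lines_equation_def line_nonzero)

definition line_class :: "int \<Rightarrow> int \<Rightarrow> ((complex^4) set \<Rightarrow> ratfun set) set" where
  "line_class i j = divisor_class (lines_equation i j)"

lemma carrier_Pic_line_class: "carrier Pic_Q22 = {line_class i j | i j. True}"
proof
  show "{line_class i j | i j. True} \<subseteq> carrier Pic_Q22"
    unfolding carrier_Pic_Q22 line_class_def using local_equations_lines_equation by blast
  show "carrier Pic_Q22 \<subseteq> {line_class i j | i j. True}"
  proof
    fix c assume "c \<in> carrier Pic_Q22"
    then obtain \<kappa> where \<kappa>: "local_equations \<kappa>" "c = divisor_class \<kappa>" by (auto simp: carrier_Pic_Q22)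
    obtain k i j where "k \<noteq> 0" "\<And>p. p \<in> Q22 \<Longrightarrow> coset_at p (\<kappa> p) = coset_at p (k * (line_x p powi i * line_y p powi j))"
      using divisor_equivalent_to_lines[OF \<kappa>(1)] by blast
    then have "c = line_class i j"
      unfolding \<kappa>(2) line_class_def divisor_class_eq_iff[OF \<kappa>(1) local_equations_lines_equation]
      by (auto simp: lines_equation_def)
    then show "c \<in> {line_class i j | i j. True}" by blast
  qed
qed

lemma line_class_mult: "line_class i j \<otimes>\<^bsub>Pic_Q22\<^esub> line_class i' j' = line_class (i + i') (j + j')"
proof -
  have "lines_equation i j p * lines_equation i' j' p = lines_equation (i + i') (j + j') p" for p
    by (simp add: lines_equation_def power_int_add line_nonzero mult_ac)
  then show ?thesis
    unfolding line_class_def by (simp add: mult_Pic_Q22 local_equations_lines_equation)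
qed

lemma line_class_eq_iff: "line_class i j = line_class i' j' \<longleftrightarrow> i = i' \<and> j = j'"
proof
  assume "line_class i j = line_class i' j'"
  then obtain k where k: "k \<noteq> 0" "\<forall>p\<in>Q22. coset_at p (lines_equation i j p) = coset_at p (k * lines_equation i' j' p)"
    unfolding line_class_def divisor_class_eq_iff[OF local_equations_lines_equation local_equations_lines_equation] by blast
  have "inverse k * (line_x (pt s t) powi (i - i') * line_y (pt s t) powi (j - j')) \<in> unit_at s t"
    if st: "s \<noteq> (0, 0)" "t \<noteq> (0, 0)" for s t
  proof -
    have "lines_equation i j (pt s t) / (k * lines_equation i' j' (pt s t)) \<in> unit_at s t"
      using k pt_in_Q22[OF st] st lines_equation_nonzero by (subst coset_at_eq_iff[symmetric]) auto
    then show ?thesis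
      using k(1) line_nonzero by (simp add: lines_equation_def power_int_diff field_simps)
  qed
  from lines_independent[OF _ this] k(1) show "i = i' \<and> j = j'" by simp
qed simp

lemma line_class_one: "\<one>\<^bsub>Pic_Q22\<^esub> = line_class 0 0"
proof -
  interpret P: comm_group Pic_Q22 by (rule comm_group_Pic_Q22)
  have "line_class 0 0 \<in> carrier Pic_Q22" unfolding carrier_Pic_line_class by blast
  moreover have "line_class 0 0 \<otimes>\<^bsub>Pic_Q22\<^esub> line_class 0 0 = line_class 0 0" by (simp add: line_class_mult)
  ultimately show ?thesis using P.r_cancel_one' by metis
qed

section \<open>The action of automorphisms on divisor classes\<close>

definition pull_form :: "bool \<Rightarrow> mat2 \<Rightarrow> mat2 \<Rightarrow> (complex^4 \<Rightarrow> complex) \<Rightarrow> complex^4 \<Rightarrow> complex" where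
  "pull_form \<epsilon> M N F = (\<lambda>x. F (lin_map \<epsilon> M N x))"

lemma real_form_pull: "real_form d F \<Longrightarrow> real_form d (pull_form \<epsilon> M N F)"
  unfolding pull_form_def by (rule real_form_subst[OF _ real_form_lin_map])

lemma nonvanishing_pull:
  "p \<in> Q22 \<Longrightarrow> nonvanishing_at (pull_form \<epsilon> M N F) p \<longleftrightarrow> nonvanishing_at F (aut \<epsilon> M N p)"
  by (auto simp: nonvanishing_at_def pull_form_def aut_def)

lemma aut_surj:
  assumes "mdet M \<noteq> 0" "mdet N \<noteq> 0" "p \<in> Q22"
  obtains q where "q \<in> Q22" "aut \<epsilon> M N q = p"
proof -
  have "aut \<epsilon> M N ` Q22 = Q22" using aut_Bij(1)[OF assms(1,2), of \<epsilon>] by (auto simp: Bij_def bij_betw_def)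
  then have "p \<in> aut \<epsilon> M N ` Q22" using assms(3) by simp
  then show ?thesis using that by (auto elim!: imageE)
qed

lemma fractions_pull:
  assumes det: "mdet M \<noteq> 0" "mdet N \<noteq> 0" and "(F, G) \<in> fractions"
  shows "(pull_form \<epsilon> M N F, pull_form \<epsilon> M N G) \<in> fractions"
proof -
  have "\<exists>q\<in>Q22. nonvanishing_at (pull_form \<epsilon> M N F) q" if ex: "\<exists>p\<in>Q22. nonvanishing_at F p" for F
  proof -
    obtain p where p: "p \<in> Q22" "nonvanishing_at F p" using ex by blast
    obtain q where "q \<in> Q22" "aut \<epsilon> M N q = p" using aut_surj[OF det p(1)] .
    then show ?thesis using p by (auto simp: nonvanishing_pull intro!: bexI[of _ q])
  qed
  moreover obtain d where "real_form d F" "real_form d G" "\<exists>p\<in>Q22. nonvanishing_at F p" "\<exists>p\<in>Q22. nonvanishing_at G p"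
    using assms(3) by (auto simp: fractions_def)
  ultimately show ?thesis unfolding fractions_def mem_Collect_eq prod.case
    using real_form_pull by (intro exI[of _ d] conjI) simp_all
qed

definition pull_fraction :: "bool \<Rightarrow> mat2 \<Rightarrow> mat2 \<Rightarrow>
  (complex^4 \<Rightarrow> complex) \<times> (complex^4 \<Rightarrow> complex) \<Rightarrow> (complex^4 \<Rightarrow> complex) \<times> (complex^4 \<Rightarrow> complex)" where
  "pull_fraction \<epsilon> M N FG = (pull_form \<epsilon> M N (fst FG), pull_form \<epsilon> M N (snd FG))"

lemma value_eq_iff:
  assumes "(F, G) \<in> fractions" "(F', G') \<in> fractions"
  shows "fraction_value (F, G) = fraction_value (F', G') \<longleftrightarrow> (\<forall>p\<in>Q22. \<forall>x\<in>p. F x * G' x = F' x * G x)"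
  using assms fraction_rel_iff[of "(F, G)" "(F', G')"] by (auto simp: fraction_rel_def)

lemma value_pull_cong:
  assumes det: "mdet M \<noteq> 0" "mdet N \<noteq> 0" and fr: "FG \<in> fractions" "FG' \<in> fractions"
    and eq: "fraction_value FG = fraction_value FG'"
  shows "fraction_value (pull_fraction \<epsilon> M N FG) = fraction_value (pull_fraction \<epsilon> M N FG')"
proof -
  obtain F G F' G' where FG: "FG = (F, G)" "FG' = (F', G')" by (metis surj_pair)
  have *: "F x * G' x = F' x * G x" if "p \<in> Q22" "x \<in> p" for p x
    using eq fr that unfolding FG by (simp add: value_eq_iff)
  have "F (lin_map \<epsilon> M N x) * G' (lin_map \<epsilon> M N x) = F' (lin_map \<epsilon> M N x) * G (lin_map \<epsilon> M N x)"
    if "p \<in> Q22" "x \<in> p" for p x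
    using *[OF aut_in_Q22[OF det that(1)], of "lin_map \<epsilon> M N x" \<epsilon>] that by (simp add: aut_def)
  then show ?thesis
    using fractions_pull[OF det] fr unfolding FG pull_fraction_def fst_conv snd_conv
    by (subst value_eq_iff) (auto simp: pull_form_def)
qed

text \<open>
  By \<open>value_pull_cong\<close> the result does not depend on the fraction that is chosen. The value at \<open>0\<close> is arbitrary.
\<close>

definition pull_value :: "bool \<Rightarrow> mat2 \<Rightarrow> mat2 \<Rightarrow> real poly poly fract \<Rightarrow> real poly poly fract" where
  "pull_value \<epsilon> M N k = fraction_value (pull_fraction \<epsilon> M N (SOME FG. FG \<in> ratfun k))"

lemma pull_value_eq:
  assumes det: "mdet M \<noteq> 0" "mdet N \<noteq> 0" and "FG \<in> ratfun k"
  shows "fraction_value (pull_fraction \<epsilon> M N FG) = pull_value \<epsilon> M N k"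
proof -
  have "(SOME FG. FG \<in> ratfun k) \<in> ratfun k" using assms(3) by (rule someI)
  then show ?thesis unfolding pull_value_def
    using assms(3) by (intro value_pull_cong det) (auto simp: ratfun_def)
qed

lemma pull_in_fractions:
  assumes "mdet M \<noteq> 0" "mdet N \<noteq> 0" "FG \<in> ratfun k"
  shows "pull_fraction \<epsilon> M N FG \<in> fractions"
  using fractions_pull[OF assms(1,2), of "fst FG" "snd FG"] assms(3) by (simp add: pull_fraction_def ratfun_def)

lemma pull_in_ratfun:
  assumes "mdet M \<noteq> 0" "mdet N \<noteq> 0" "FG \<in> ratfun k"
  shows "pull_fraction \<epsilon> M N FG \<in> ratfun (pull_value \<epsilon> M N k)"
  using pull_value_eq[OF assms] pull_in_fractions[OF assms] by (simp add: ratfun_def)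

lemma pull_value_nonzero:
  assumes "mdet M \<noteq> 0" "mdet N \<noteq> 0" "k \<noteq> 0"
  shows "pull_value \<epsilon> M N k \<noteq> 0"
proof -
  obtain FG where FG: "FG \<in> ratfun k" using ratfun_nonempty[OF assms(3)] by blast
  then show ?thesis
    using pull_value_eq[OF assms(1,2) FG, of \<epsilon>] fraction_value_nonzero[OF pull_in_fractions[OF assms(1,2) FG], of \<epsilon>] by simp
qed

lemma pull_value_mult:
  assumes det: "mdet M \<noteq> 0" "mdet N \<noteq> 0" and nz: "k \<noteq> 0" "k' \<noteq> 0"
  shows "pull_value \<epsilon> M N (k * k') = pull_value \<epsilon> M N k * pull_value \<epsilon> M N k'"
proof -
  obtain F G F' G' where FG: "(F, G) \<in> ratfun k" "(F', G') \<in> ratfun k'"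
    using ratfun_nonempty nz by (metis equals0I surj_pair)
  then have fr: "(F, G) \<in> fractions" "(F', G') \<in> fractions" by (auto simp: ratfun_def)
  have "(\<lambda>x. F x * F' x, \<lambda>x. G x * G' x) \<in> ratfun (k * k')"
    using FG fraction_mult[OF fr] by (auto simp: ratfun_def)
  from pull_value_eq[OF det this, of \<epsilon>] pull_value_eq[OF det FG(1), of \<epsilon>] pull_value_eq[OF det FG(2), of \<epsilon>]
    fraction_mult(2)[OF fractions_pull[OF det fr(1), of \<epsilon>] fractions_pull[OF det fr(2), of \<epsilon>]]
  show ?thesis by (simp add: pull_fraction_def pull_form_def)
qed

lemma pull_value_1:
  assumes det: "mdet M \<noteq> 0" "mdet N \<noteq> 0"
  shows "pull_value \<epsilon> M N 1 = 1"
  using pull_value_mult[OF det, of 1 1 \<epsilon>] pull_value_nonzero[OF det, of 1 \<epsilon>] by simp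

lemma pull_value_inverse:
  assumes det: "mdet M \<noteq> 0" "mdet N \<noteq> 0" and "k \<noteq> 0"
  shows "pull_value \<epsilon> M N (inverse k) = inverse (pull_value \<epsilon> M N k)"
proof (rule inverse_unique[symmetric])
  show "pull_value \<epsilon> M N k * pull_value \<epsilon> M N (inverse k) = 1"
    using pull_value_mult[OF det, of k "inverse k" \<epsilon>] assms by (simp add: pull_value_1)
qed

lemma pull_value_powi:
  assumes det: "mdet M \<noteq> 0" "mdet N \<noteq> 0" and "k \<noteq> 0"
  shows "pull_value \<epsilon> M N (k powi i) = pull_value \<epsilon> M N k powi i"
proof -
  have pow: "pull_value \<epsilon> M N (l ^ n) = pull_value \<epsilon> M N l ^ n" if "l \<noteq> 0" for l n
    using that by (induction n) (simp_all add: pull_value_1[OF det] pull_value_mult[OF det])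
  show ?thesis using assms(3) by (simp add: power_int_def pow pull_value_inverse[OF det])
qed

lemma pullback_ratfun_eq:
  assumes det: "mdet M \<noteq> 0" "mdet N \<noteq> 0" and "k \<noteq> 0"
  shows "pullback_ratfun (aut \<epsilon> M N) (ratfun k) = ratfun (pull_value \<epsilon> M N k)"
proof -
  have crit: "(\<forall>p\<in>Q22. \<forall>x\<in>p. \<forall>y\<in>aut \<epsilon> M N p. F' x * G y = F y * G' x) \<longleftrightarrow>
      fraction_value (F', G') = pull_value \<epsilon> M N k"
    if FG: "(F, G) \<in> ratfun k" and FG': "(F', G') \<in> fractions" for F G F' G'
  proof -
    have fr: "(F, G) \<in> fractions" using FG by (simp add: ratfun_def)
    then obtain d where d: "real_form d F" "real_form d G" by (auto simp: fractions_iff)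
    have "(\<forall>p\<in>Q22. \<forall>x\<in>p. \<forall>y\<in>aut \<epsilon> M N p. F' x * G y = F y * G' x) \<longleftrightarrow>
      (\<forall>p\<in>Q22. \<forall>x\<in>p. F' x * pull_form \<epsilon> M N G x = pull_form \<epsilon> M N F x * G' x)"
    proof (intro ball_cong refl iffI ballI)
      fix p x assume p: "p \<in> Q22" "x \<in> p"
      show "F' x * pull_form \<epsilon> M N G x = pull_form \<epsilon> M N F x * G' x"
        if "\<forall>y\<in>aut \<epsilon> M N p. F' x * G y = F y * G' x"
        using that p by (auto simp: aut_def pull_form_def)
      fix y assume eq: "F' x * pull_form \<epsilon> M N G x = pull_form \<epsilon> M N F x * G' x" and y: "y \<in> aut \<epsilon> M N p"
      obtain x' where x': "x' \<in> p" "y = lin_map \<epsilon> M N x'" using y p by (auto simp: aut_def)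
      obtain v where "p = proj_pt v" using p by (auto simp: Q22_def)
      then obtain a b where ab: "a \<noteq> 0" "b \<noteq> 0" "x = a *s v" "x' = b *s v" using p x' by (auto simp: mem_proj_pt)
      have "x' = (b / a) *s x" using ab by (simp add: vector_smult_assoc)
      then have "y = (b / a) *s lin_map \<epsilon> M N x" by (simp add: x' lin_map_scale)
      then have "F y = (b / a) ^ d * pull_form \<epsilon> M N F x" "G y = (b / a) ^ d * pull_form \<epsilon> M N G x"
        by (simp_all add: real_form_homogeneous[OF d(1)] real_form_homogeneous[OF d(2)] pull_form_def)
      then show "F' x * G y = F y * G' x" using eq by (simp add: mult_ac)
    qed
    also have "\<dots> \<longleftrightarrow> fraction_value (F', G') = fraction_value (pull_fraction \<epsilon> M N (F, G))"
      using value_eq_iff[OF FG' fractions_pull[OF det fr, of \<epsilon>]] by (simp add: pull_fraction_def)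
    finally show ?thesis by (simp add: pull_value_eq[OF det FG])
  qed
  obtain F0 G0 where "(F0, G0) \<in> ratfun k" using ratfun_nonempty[OF assms(3)] by (metis equals0I surj_pair)
  then show ?thesis unfolding pullback_ratfun_def ratfun_def[of "pull_value \<epsilon> M N k"] using crit by blast
qed

lemma lin_map_inverse:
  assumes "p \<in> Q22" "x \<in> p"
  shows "lin_map \<epsilon> (madj (if \<epsilon> then N else M)) (madj (if \<epsilon> then M else N)) (lin_map \<epsilon> M N x) = of_real (mdet M * mdet N) *s x"
proof -
  obtain s t where "p = pt s t" using assms(1) by (rule Q22_cases)
  then obtain c where x: "x = c *s segre s t" using assms(2) by (auto simp: pt_def mem_proj_pt)
  have eq: "mapp (madj A) (mapp A u) = scale2 (of_real (mdet A)) u" for A u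
    by (simp only: mapp_mmul[symmetric] mmul_madj mapp_scalar)
  show ?thesis
    by (cases \<epsilon>) (simp_all add: x lin_map_scale lin_map_segre eq segre_scale vector_smult_assoc mult_ac)
qed

lemma pull_value_inverse_map:
  assumes det: "mdet M \<noteq> 0" "mdet N \<noteq> 0" and "k \<noteq> 0"
  shows "pull_value \<epsilon> M N (pull_value \<epsilon> (madj (if \<epsilon> then N else M)) (madj (if \<epsilon> then M else N)) k) = k"
proof -
  let ?M = "madj (if \<epsilon> then N else M)" and ?N = "madj (if \<epsilon> then M else N)"
  have det': "mdet ?M \<noteq> 0" "mdet ?N \<noteq> 0" using det by simp_all
  obtain F G where FG: "(F, G) \<in> ratfun k" using ratfun_nonempty[OF assms(3)] by (metis equals0I surj_pair)
  then have fr: "(F, G) \<in> fractions" and val: "fraction_value (F, G) = k" by (auto simp: ratfun_def)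
  obtain d where d: "real_form d F" "real_form d G" using fr by (auto simp: fractions_iff)
  let ?FG = "pull_fraction \<epsilon> M N (pull_fraction \<epsilon> ?M ?N (F, G))"
  have in1: "pull_fraction \<epsilon> ?M ?N (F, G) \<in> ratfun (pull_value \<epsilon> ?M ?N k)" by (rule pull_in_ratfun[OF det' FG])
  have "fraction_value ?FG = pull_value \<epsilon> M N (pull_value \<epsilon> ?M ?N k)" by (rule pull_value_eq[OF det in1])
  moreover have "fraction_value ?FG = fraction_value (F, G)"
  proof -
    have fr2: "?FG \<in> fractions" by (rule pull_in_fractions[OF det in1])
    have FGeq: "?FG = (\<lambda>x. F (lin_map \<epsilon> ?M ?N (lin_map \<epsilon> M N x)), \<lambda>x. G (lin_map \<epsilon> ?M ?N (lin_map \<epsilon> M N x)))"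
      by (simp add: pull_fraction_def pull_form_def)
    show ?thesis unfolding FGeq
    proof (subst value_eq_iff[OF fr2[unfolded FGeq] fr], intro ballI)
      fix p x assume "p \<in> Q22" "x \<in> p"
      then show "F (lin_map \<epsilon> ?M ?N (lin_map \<epsilon> M N x)) * G x = F x * G (lin_map \<epsilon> ?M ?N (lin_map \<epsilon> M N x))"
        unfolding lin_map_inverse[OF \<open>p \<in> Q22\<close> \<open>x \<in> p\<close>]
        by (simp only: real_form_homogeneous[OF d(1)] real_form_homogeneous[OF d(2)] mult_ac)
    qed
  qed
  ultimately show ?thesis using val by simp
qed

lemma pull_local_unit:
  assumes det: "mdet M \<noteq> 0" "mdet N \<noteq> 0" and p: "p \<in> Q22" and k: "k \<noteq> 0" "ratfun k \<in> local_units (aut \<epsilon> M N p)"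
  shows "ratfun (pull_value \<epsilon> M N k) \<in> local_units p"
proof -
  obtain F G where FG: "(F, G) \<in> ratfun k" "nonvanishing_at F (aut \<epsilon> M N p)" "nonvanishing_at G (aut \<epsilon> M N p)"
    using k(2) by (auto simp: local_units_def)
  have "(pull_form \<epsilon> M N F, pull_form \<epsilon> M N G) \<in> ratfun (pull_value \<epsilon> M N k)"
    using pull_in_ratfun[OF det FG(1), of \<epsilon>] by (simp add: pull_fraction_def)
  moreover have "nonvanishing_at (pull_form \<epsilon> M N F) p" "nonvanishing_at (pull_form \<epsilon> M N G) p"
    using FG p by (simp_all add: nonvanishing_pull)
  moreover have "ratfun (pull_value \<epsilon> M N k) \<in> carrier ratfun_group"
    using pull_value_nonzero[OF det k(1)] by (auto simp: carrier_ratfun_group)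
  ultimately show ?thesis by (auto simp: local_units_def)
qed

lemma coset_at_alt:
  assumes "k \<noteq> 0"
  shows "coset_at p k = {ratfun (u * k) | u. u \<noteq> 0 \<and> ratfun u \<in> local_units p}"
proof (intro equalityI subsetI)
  fix B assume "B \<in> coset_at p k"
  then obtain A where A: "A \<in> local_units p" "B = A \<otimes>\<^bsub>ratfun_group\<^esub> ratfun k"
    by (auto simp: coset_at_def r_coset_def)
  then obtain u where "u \<noteq> 0" "A = ratfun u" by (auto simp: local_units_def carrier_ratfun_group)
  then show "B \<in> {ratfun (u * k) | u. u \<noteq> 0 \<and> ratfun u \<in> local_units p}"
    using A assms by (intro CollectI exI[of _ u]) (simp add: ratfun_mult)
next
  fix B assume "B \<in> {ratfun (u * k) | u. u \<noteq> 0 \<and> ratfun u \<in> local_units p}"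
  then obtain u where u: "u \<noteq> 0" "ratfun u \<in> local_units p" "B = ratfun (u * k)" by (elim CollectE exE conjE)
  then have "B = ratfun u \<otimes>\<^bsub>ratfun_group\<^esub> ratfun k" using assms by (simp add: ratfun_mult)
  then show "B \<in> coset_at p k" unfolding coset_at_def r_coset_def using u(2) by auto
qed

lemma pullback_coset:
  assumes det: "mdet M \<noteq> 0" "mdet N \<noteq> 0" and p: "p \<in> Q22" and k: "k \<noteq> 0"
  shows "pullback_ratfun (aut \<epsilon> M N) ` coset_at (aut \<epsilon> M N p) k = coset_at p (pull_value \<epsilon> M N k)"
proof -
  let ?q = "aut \<epsilon> M N p"
  let ?M = "madj (if \<epsilon> then N else M)" and ?N = "madj (if \<epsilon> then M else N)"
  have det': "mdet ?M \<noteq> 0" "mdet ?N \<noteq> 0" using det by simp_all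
  have q: "?q \<in> Q22" by (rule aut_in_Q22[OF det p])
  have back_p: "aut \<epsilon> ?M ?N ?q = p"
    using fun_cong[OF aut_inverse(2)[OF det, of \<epsilon>], of p] p by (simp add: compose_eq)
  have k': "pull_value \<epsilon> M N k \<noteq> 0" by (rule pull_value_nonzero[OF det k])
  show ?thesis
    unfolding coset_at_alt[OF k] coset_at_alt[OF k']
  proof (intro equalityI subsetI)
    fix B assume "B \<in> pullback_ratfun (aut \<epsilon> M N) ` {ratfun (u * k) |u. u \<noteq> 0 \<and> ratfun u \<in> local_units ?q}"
    then obtain u where u: "u \<noteq> 0" "ratfun u \<in> local_units ?q" "B = pullback_ratfun (aut \<epsilon> M N) (ratfun (u * k))" by blast
    then have "B = ratfun (pull_value \<epsilon> M N u * pull_value \<epsilon> M N k)"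
      using k by (simp add: pullback_ratfun_eq[OF det] pull_value_mult[OF det])
    then show "B \<in> {ratfun (u * pull_value \<epsilon> M N k) |u. u \<noteq> 0 \<and> ratfun u \<in> local_units p}"
      using pull_local_unit[OF det p u(1,2)] pull_value_nonzero[OF det u(1)] by blast
  next
    fix B assume "B \<in> {ratfun (u * pull_value \<epsilon> M N k) |u. u \<noteq> 0 \<and> ratfun u \<in> local_units p}"
    then obtain v where v: "v \<noteq> 0" "ratfun v \<in> local_units p" "B = ratfun (v * pull_value \<epsilon> M N k)" by blast
    define u where "u = pull_value \<epsilon> ?M ?N v"
    have u: "u \<noteq> 0" "ratfun u \<in> local_units ?q" "pull_value \<epsilon> M N u = v"
      unfolding u_def using pull_value_nonzero[OF det' v(1)] pull_local_unit[OF det' q v(1), of \<epsilon>] v(2) back_p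
        pull_value_inverse_map[OF det v(1)] by simp_all
    have "B = pullback_ratfun (aut \<epsilon> M N) (ratfun (u * k))"
      using u k v by (simp add: pullback_ratfun_eq[OF det] pull_value_mult[OF det])
    then show "B \<in> pullback_ratfun (aut \<epsilon> M N) ` {ratfun (u * k) |u. u \<noteq> 0 \<and> ratfun u \<in> local_units ?q}"
      using u by blast
  qed
qed

lemma pullback_divisor_of:
  assumes det: "mdet M \<noteq> 0" "mdet N \<noteq> 0" and "\<forall>p\<in>Q22. \<kappa> p \<noteq> 0"
  shows "pullback_divisor (aut \<epsilon> M N) (divisor_of \<kappa>) = divisor_of (\<lambda>p. pull_value \<epsilon> M N (\<kappa> (aut \<epsilon> M N p)))"
proof (rule ext)
  fix p
  show "pullback_divisor (aut \<epsilon> M N) (divisor_of \<kappa>) p = divisor_of (\<lambda>p. pull_value \<epsilon> M N (\<kappa> (aut \<epsilon> M N p))) p"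
  proof (cases "p \<in> Q22")
    case True
    then have "aut \<epsilon> M N p \<in> Q22" by (rule aut_in_Q22[OF det])
    then show ?thesis
      using True assms(3) pullback_coset[OF det True, of "\<kappa> (aut \<epsilon> M N p)" \<epsilon>] by (simp add: pullback_divisor_def divisor_of_def)
  qed (simp add: pullback_divisor_def divisor_of_def)
qed

subsection \<open>The action on the two classes of lines\<close>

text \<open>
  The factor \<open>Z\<close> is what becomes of the coordinate of the other factor: a quotient of two linear forms in \<open>s\<close> is represented by
  forms on the quadric only after multiplication with a linear form in \<open>t\<close>.
\<close>

lemma pull_value_Fract:
  assumes det: "mdet M \<noteq> 0" "mdet N \<noteq> 0" and "real_form d F" "real_form d G"
    and nz: "dehom F \<noteq> 0" "dehom G \<noteq> 0"
    and pulled: "dehom (pull_form \<epsilon> M N F) = P * Z" "dehom (pull_form \<epsilon> M N G) = Q * Z" "Z \<noteq> 0"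
  shows "pull_value \<epsilon> M N (Fract (dehom F) (dehom G)) = Fract P Q"
proof -
  have "(F, G) \<in> ratfun (Fract (dehom F) (dehom G))"
    using assms by (auto simp: ratfun_def fraction_value_def fractions_iff)
  from pull_value_eq[OF det this, of \<epsilon>] show ?thesis
    using mult_fract_cancel[OF pulled(3), of P Q] by (simp add: pull_fraction_def fraction_value_def pulled mult.commute)
qed

lemma lval_mapp: "lval a b (mapp (m1, m2, m3, m4) s) = lval (a * m1 + b * m3) (a * m2 + b * m4) s"
  by (simp add: lval_def algebra_simps)

lemma eval2_linear [simp]:
  "eval2 [:[:a, b:]:] x y = lval a b (1, x)" "eval2 [:[:a:], [:b:]:] x y = lval a b (1, y)"
  by (simp_all add: lval_def algebra_simps)

lemma bilinear_form_dehom: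
  obtains H where "real_form 1 H" "\<And>s t. H (segre s t) = lval a b s * lval c d t"
    "dehom H = [:[:a, b:]:] * [:[:c:], [:d:]:]"
proof -
  obtain H where H: "real_form 1 H" "\<And>s t. H (segre s t) = lval a b s * lval c d t" using bilinear_form by metis
  have "dehom H = [:[:a, b:]:] * [:[:c:], [:d:]:]"
    by (rule dehom_eqI) (simp only: eval2_simps(4) eval2_linear H(2))
  with H that show ?thesis by blast
qed

lemma lin_quotients:
  "lin_x a b / lin_x a' b' = Fract [:[:a, b:]:] [:[:a', b':]:]"
  "lin_y a b / lin_y a' b' = Fract [:[:a:], [:b:]:] [:[:a':], [:b':]:]"
  by (simp_all add: lin_x_def lin_y_def)

lemma pull_value_bilinear:
  assumes det: "mdet M \<noteq> 0" "mdet N \<noteq> 0" and MN: "M = (m1, m2, m3, m4)" "N = (n1, n2, n3, n4)"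
    and nz: "a \<noteq> 0 \<or> b \<noteq> 0" "a' \<noteq> 0 \<or> b' \<noteq> 0"
  shows "pull_value False M N (lin_x a b / lin_x a' b') =
      lin_x (a * m1 + b * m3) (a * m2 + b * m4) / lin_x (a' * m1 + b' * m3) (a' * m2 + b' * m4)" (is ?A)
    and "pull_value False M N (lin_y a b / lin_y a' b') =
      lin_y (a * n1 + b * n3) (a * n2 + b * n4) / lin_y (a' * n1 + b' * n3) (a' * n2 + b' * n4)" (is ?B)
    and "pull_value True M N (lin_x a b / lin_x a' b') =
      lin_y (a * m1 + b * m3) (a * m2 + b * m4) / lin_y (a' * m1 + b' * m3) (a' * m2 + b' * m4)" (is ?C)
    and "pull_value True M N (lin_y a b / lin_y a' b') =
      lin_x (a * n1 + b * n3) (a * n2 + b * n4) / lin_x (a' * n1 + b' * n3) (a' * n2 + b' * n4)" (is ?D)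
proof -
  have m12: "m1 \<noteq> 0 \<or> m2 \<noteq> 0" and n12: "n1 \<noteq> 0 \<or> n2 \<noteq> 0" using det MN by auto
  have one: "[:[:1, 0:]:] = (1 :: real poly poly)" "[:[:1:], [:0:]:] = (1 :: real poly poly)" by (simp_all add: one_pCons)
  obtain F where F: "real_form 1 F" "\<And>s t. F (segre s t) = lval a b s * lval 1 0 t" "dehom F = [:[:a, b:]:] * [:[:1:], [:0:]:]"
    using bilinear_form_dehom[of a b 1 0] by blast
  obtain G where G: "real_form 1 G" "\<And>s t. G (segre s t) = lval a' b' s * lval 1 0 t" "dehom G = [:[:a', b':]:] * [:[:1:], [:0:]:]"
    using bilinear_form_dehom[of a' b' 1 0] by blast
  obtain F' where F': "real_form 1 F'" "\<And>s t. F' (segre s t) = lval 1 0 s * lval a b t" "dehom F' = [:[:1, 0:]:] * [:[:a:], [:b:]:]"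
    using bilinear_form_dehom[of 1 0 a b] by blast
  obtain G' where G': "real_form 1 G'" "\<And>s t. G' (segre s t) = lval 1 0 s * lval a' b' t" "dehom G' = [:[:1, 0:]:] * [:[:a':], [:b':]:]"
    using bilinear_form_dehom[of 1 0 a' b'] by blast
  have deh: "dehom F = [:[:a, b:]:]" "dehom G = [:[:a', b':]:]" "dehom F' = [:[:a:], [:b:]:]" "dehom G' = [:[:a':], [:b':]:]"
    using F(3) G(3) F'(3) G'(3) by (simp_all only: one mult_1_left mult_1_right)
  have nzd: "dehom F \<noteq> 0" "dehom G \<noteq> 0" "dehom F' \<noteq> 0" "dehom G' \<noteq> 0"
    unfolding deh using nz by auto
  have pulled: "dehom (pull_form False M N F) = [:[:a * m1 + b * m3, a * m2 + b * m4:]:] * [:[:n1:], [:n2:]:]"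
    "dehom (pull_form False M N G) = [:[:a' * m1 + b' * m3, a' * m2 + b' * m4:]:] * [:[:n1:], [:n2:]:]"
    "dehom (pull_form False M N F') = [:[:a * n1 + b * n3:], [:a * n2 + b * n4:]:] * [:[:m1, m2:]:]"
    "dehom (pull_form False M N G') = [:[:a' * n1 + b' * n3:], [:a' * n2 + b' * n4:]:] * [:[:m1, m2:]:]"
    "dehom (pull_form True M N F) = [:[:a * m1 + b * m3:], [:a * m2 + b * m4:]:] * [:[:n1, n2:]:]"
    "dehom (pull_form True M N G) = [:[:a' * m1 + b' * m3:], [:a' * m2 + b' * m4:]:] * [:[:n1, n2:]:]"
    "dehom (pull_form True M N F') = [:[:a * n1 + b * n3, a * n2 + b * n4:]:] * [:[:m1:], [:m2:]:]"
    "dehom (pull_form True M N G') = [:[:a' * n1 + b' * n3, a' * n2 + b' * n4:]:] * [:[:m1:], [:m2:]:]"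
    by (rule dehom_eqI, simp only: eval2_simps(4) eval2_linear pull_form_def lin_map_segre F(2) G(2) F'(2) G'(2) MN lval_mapp if_False if_True,
      simp add: mult.commute)+
  have Z: "[:[:n1:], [:n2:]:] \<noteq> 0" "[:[:m1, m2:]:] \<noteq> 0" "[:[:n1, n2:]:] \<noteq> 0" "[:[:m1:], [:m2:]:] \<noteq> 0"
    using m12 n12 by auto
  show ?A unfolding lin_quotients using pull_value_Fract[OF det F(1) G(1) nzd(1,2) pulled(1,2) Z(1)] unfolding deh .
  show ?B unfolding lin_quotients using pull_value_Fract[OF det F'(1) G'(1) nzd(3,4) pulled(3,4) Z(2)] unfolding deh .
  show ?C unfolding lin_quotients using pull_value_Fract[OF det F(1) G(1) nzd(1,2) pulled(5,6) Z(3)] unfolding deh .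
  show ?D unfolding lin_quotients using pull_value_Fract[OF det F'(1) G'(1) nzd(3,4) pulled(7,8) Z(4)] unfolding deh .
qed

text \<open>
  The preimage of the line \<open>s\<^sub>0 = 0\<close> is the line \<open>m\<^sub>1 s\<^sub>0 + m\<^sub>2 s\<^sub>1 = 0\<close>, or \<open>m\<^sub>1 t\<^sub>0 + m\<^sub>2 t\<^sub>1 = 0\<close> after an exchange. Its equation is that of a line
  at infinity multiplied with a rational function that is the same at all points.
\<close>

lemma pull_lines:
  assumes det: "mdet M \<noteq> 0" "mdet N \<noteq> 0" and MN: "M = (m1, m2, m3, m4)" "N = (n1, n2, n3, n4)" and p: "p \<in> Q22"
  shows "coset_at p (pull_value False M N (line_x (aut False M N p))) = coset_at p (lin_x m1 m2 * line_x p)"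
    "coset_at p (pull_value False M N (line_y (aut False M N p))) = coset_at p (lin_y n1 n2 * line_y p)"
    "coset_at p (pull_value True M N (line_x (aut True M N p))) = coset_at p (lin_y m1 m2 * line_y p)"
    "coset_at p (pull_value True M N (line_y (aut True M N p))) = coset_at p (lin_x n1 n2 * line_x p)"
proof -
  obtain s t where st: "s \<noteq> (0, 0)" "t \<noteq> (0, 0)" and pst: "p = pt s t" using p by (rule Q22_cases)
  have nzm: "m1 \<noteq> 0 \<or> m2 \<noteq> 0" "n1 \<noteq> 0 \<or> n2 \<noteq> 0" using det MN by auto
  have nz_map: "mapp M s \<noteq> (0, 0)" "mapp M t \<noteq> (0, 0)" "mapp N s \<noteq> (0, 0)" "mapp N t \<noteq> (0, 0)"
    using st det by (simp_all add: mapp_nonzero)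
  have transfer: "coset_at p (pull_value \<epsilon> M N l) = coset_at p (e * l')"
    if "coset_at (aut \<epsilon> M N p) l = coset_at (aut \<epsilon> M N p) (1 / w)" "l \<noteq> 0" "w \<noteq> 0"
      "pull_value \<epsilon> M N (1 / w) = e / w'" "e \<noteq> 0" "w' \<noteq> 0" "l' \<noteq> 0" "coset_at p l' = coset_at p (1 / w')" for \<epsilon> l w e w' l'
  proof -
    have "coset_at p (pull_value \<epsilon> M N l) = coset_at p (pull_value \<epsilon> M N (1 / w))"
      using pullback_coset[OF det p, of l \<epsilon>] pullback_coset[OF det p, of "1 / w" \<epsilon>] that by simp
    also have "\<dots> = coset_at p (e * (1 / w'))" by (simp add: that)
    also have "\<dots> = coset_at p (e * l')"
      using coset_at_mult[OF p, of e "1 / w'"] coset_at_mult[OF p, of e l'] that by simp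
    finally show ?thesis .
  qed
  have lval_nz: "a \<noteq> 0 \<or> b \<noteq> 0" if "lval a b u \<noteq> 0" for a b u using that by (auto simp: lval_def)
  obtain a b where ab: "lval a b (mapp M s) \<noteq> 0" using lval_nonzero_exists[OF nz_map(1)] by blast
  have ab': "lval (a * m1 + b * m3) (a * m2 + b * m4) s \<noteq> 0" using ab unfolding MN lval_mapp .
  show "coset_at p (pull_value False M N (line_x (aut False M N p))) = coset_at p (lin_x m1 m2 * line_x p)"
  proof (rule transfer)
    show "coset_at (aut False M N p) (line_x (aut False M N p)) = coset_at (aut False M N p) (1 / lin_x a b)"
      using line_x_coset[OF nz_map(1,4) ab] by (simp add: pst aut_pt st)
    show "pull_value False M N (1 / lin_x a b) = lin_x m1 m2 / lin_x (a * m1 + b * m3) (a * m2 + b * m4)"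
      using pull_value_bilinear(1)[OF det MN, of 1 0 a b] lval_nz[OF ab] by simp
    show "coset_at p (line_x p) = coset_at p (1 / lin_x (a * m1 + b * m3) (a * m2 + b * m4))"
      unfolding pst by (rule line_x_coset[OF st ab'])
  qed (use line_nonzero lin_nonzero nzm lval_nz[OF ab] lval_nz[OF ab'] in blast)+
  obtain a b where ab: "lval a b (mapp N t) \<noteq> 0" using lval_nonzero_exists[OF nz_map(4)] by blast
  have ab': "lval (a * n1 + b * n3) (a * n2 + b * n4) t \<noteq> 0" using ab unfolding MN lval_mapp .
  show "coset_at p (pull_value False M N (line_y (aut False M N p))) = coset_at p (lin_y n1 n2 * line_y p)"
  proof (rule transfer)
    show "coset_at (aut False M N p) (line_y (aut False M N p)) = coset_at (aut False M N p) (1 / lin_y a b)"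
      using line_y_coset[OF nz_map(1,4) ab] by (simp add: pst aut_pt st)
    show "pull_value False M N (1 / lin_y a b) = lin_y n1 n2 / lin_y (a * n1 + b * n3) (a * n2 + b * n4)"
      using pull_value_bilinear(2)[OF det MN, of 1 0 a b] lval_nz[OF ab] by simp
    show "coset_at p (line_y p) = coset_at p (1 / lin_y (a * n1 + b * n3) (a * n2 + b * n4))"
      unfolding pst by (rule line_y_coset[OF st ab'])
  qed (use line_nonzero lin_nonzero nzm lval_nz[OF ab] lval_nz[OF ab'] in blast)+
  obtain a b where ab: "lval a b (mapp M t) \<noteq> 0" using lval_nonzero_exists[OF nz_map(2)] by blast
  have ab': "lval (a * m1 + b * m3) (a * m2 + b * m4) t \<noteq> 0" using ab unfolding MN lval_mapp .
  show "coset_at p (pull_value True M N (line_x (aut True M N p))) = coset_at p (lin_y m1 m2 * line_y p)"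
  proof (rule transfer)
    show "coset_at (aut True M N p) (line_x (aut True M N p)) = coset_at (aut True M N p) (1 / lin_x a b)"
      using line_x_coset[OF nz_map(2,3) ab] by (simp add: pst aut_pt st)
    show "pull_value True M N (1 / lin_x a b) = lin_y m1 m2 / lin_y (a * m1 + b * m3) (a * m2 + b * m4)"
      using pull_value_bilinear(3)[OF det MN, of 1 0 a b] lval_nz[OF ab] by simp
    show "coset_at p (line_y p) = coset_at p (1 / lin_y (a * m1 + b * m3) (a * m2 + b * m4))"
      unfolding pst by (rule line_y_coset[OF st ab'])
  qed (use line_nonzero lin_nonzero nzm lval_nz[OF ab] lval_nz[OF ab'] in blast)+
  obtain a b where ab: "lval a b (mapp N s) \<noteq> 0" using lval_nonzero_exists[OF nz_map(3)] by blast
  have ab': "lval (a * n1 + b * n3) (a * n2 + b * n4) s \<noteq> 0" using ab unfolding MN lval_mapp .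
  show "coset_at p (pull_value True M N (line_y (aut True M N p))) = coset_at p (lin_x n1 n2 * line_x p)"
  proof (rule transfer)
    show "coset_at (aut True M N p) (line_y (aut True M N p)) = coset_at (aut True M N p) (1 / lin_y a b)"
      using line_y_coset[OF nz_map(2,3) ab] by (simp add: pst aut_pt st)
    show "pull_value True M N (1 / lin_y a b) = lin_x n1 n2 / lin_x (a * n1 + b * n3) (a * n2 + b * n4)"
      using pull_value_bilinear(4)[OF det MN, of 1 0 a b] lval_nz[OF ab] by simp
    show "coset_at p (line_x p) = coset_at p (1 / lin_x (a * n1 + b * n3) (a * n2 + b * n4))"
      unfolding pst by (rule line_x_coset[OF st ab'])
  qed (use line_nonzero lin_nonzero nzm lval_nz[OF ab] lval_nz[OF ab'] in blast)+
qed

lemma coset_at_powi_cong: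
  assumes "p \<in> Q22" "k \<noteq> 0" "k' \<noteq> 0" "coset_at p k = coset_at p k'"
  shows "coset_at p (k powi i) = coset_at p (k' powi i)"
proof -
  obtain s t where st: "s \<noteq> (0, 0)" "t \<noteq> (0, 0)" "p = pt s t" using assms(1) by (rule Q22_cases)
  then have "k / k' \<in> unit_at s t" using assms by (simp add: coset_at_eq_iff)
  from unit_at_power_int[OF this, of i] have "k powi i / k' powi i \<in> unit_at s t"
    by (simp add: power_int_divide_distrib)
  then show ?thesis using st assms by (simp add: coset_at_eq_iff)
qed

lemma coset_at_mult_cong:
  assumes "p \<in> Q22" "a \<noteq> 0" "a' \<noteq> 0" "b \<noteq> 0" "b' \<noteq> 0"
    "coset_at p a = coset_at p a'" "coset_at p b = coset_at p b'"
  shows "coset_at p (a * b) = coset_at p (a' * b')"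
  using coset_at_mult[OF assms(1,2,4)] coset_at_mult[OF assms(1,3,5)] assms by simp

lemma pull_lines_equation:
  assumes det: "mdet M \<noteq> 0" "mdet N \<noteq> 0"
  obtains e where "e \<noteq> 0" "\<And>p. p \<in> Q22 \<Longrightarrow> coset_at p (pull_value \<epsilon> M N (lines_equation i j (aut \<epsilon> M N p)))
    = coset_at p (e * (if \<epsilon> then lines_equation j i p else lines_equation i j p))"
proof -
  obtain m1 m2 m3 m4 n1 n2 n3 n4 where MN: "M = (m1, m2, m3, m4)" "N = (n1, n2, n3, n4)"
    by (cases M rule: prod_cases4; cases N rule: prod_cases4) auto
  have nzm: "m1 \<noteq> 0 \<or> m2 \<noteq> 0" "n1 \<noteq> 0 \<or> n2 \<noteq> 0" using det MN by auto
  have split: "pull_value \<epsilon> M N (lines_equation i j q) = pull_value \<epsilon> M N (line_x q) powi i * pull_value \<epsilon> M N (line_y q) powi j" for q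
    by (simp add: lines_equation_def pull_value_mult[OF det] pull_value_powi[OF det] line_nonzero)
  note nz = pull_value_nonzero[OF det line_nonzero(1)] pull_value_nonzero[OF det line_nonzero(2)] line_nonzero
    lin_nonzero(1)[OF nzm(1)] lin_nonzero(2)[OF nzm(1)] lin_nonzero(1)[OF nzm(2)] lin_nonzero(2)[OF nzm(2)]
  show ?thesis
  proof (cases \<epsilon>)
    case False
    show ?thesis
    proof (rule that[of "lin_x m1 m2 powi i * lin_y n1 n2 powi j"])
      show "lin_x m1 m2 powi i * lin_y n1 n2 powi j \<noteq> 0" using nz by simp
      fix p assume p: "p \<in> Q22"
      have "coset_at p (pull_value \<epsilon> M N (lines_equation i j (aut \<epsilon> M N p)))
          = coset_at p ((lin_x m1 m2 * line_x p) powi i * (lin_y n1 n2 * line_y p) powi j)"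
        unfolding split using False pull_lines(1,2)[OF det MN p] nz
        by (intro coset_at_mult_cong coset_at_powi_cong p) auto
      also have "(lin_x m1 m2 * line_x p) powi i * (lin_y n1 n2 * line_y p) powi j
          = lin_x m1 m2 powi i * lin_y n1 n2 powi j * lines_equation i j p"
        by (simp add: lines_equation_def power_int_mult_distrib mult_ac)
      finally show "coset_at p (pull_value \<epsilon> M N (lines_equation i j (aut \<epsilon> M N p)))
        = coset_at p (lin_x m1 m2 powi i * lin_y n1 n2 powi j * (if \<epsilon> then lines_equation j i p else lines_equation i j p))"
        using False by simp
    qed
  next
    case True
    show ?thesis
    proof (rule that[of "lin_y m1 m2 powi i * lin_x n1 n2 powi j"])
      show "lin_y m1 m2 powi i * lin_x n1 n2 powi j \<noteq> 0" using nz by simp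
      fix p assume p: "p \<in> Q22"
      have "coset_at p (pull_value \<epsilon> M N (lines_equation i j (aut \<epsilon> M N p)))
          = coset_at p ((lin_y m1 m2 * line_y p) powi i * (lin_x n1 n2 * line_x p) powi j)"
        unfolding split using True pull_lines(3,4)[OF det MN p] nz
        by (intro coset_at_mult_cong coset_at_powi_cong p) auto
      also have "(lin_y m1 m2 * line_y p) powi i * (lin_x n1 n2 * line_x p) powi j
          = lin_y m1 m2 powi i * lin_x n1 n2 powi j * lines_equation j i p"
        by (simp add: lines_equation_def power_int_mult_distrib mult_ac)
      finally show "coset_at p (pull_value \<epsilon> M N (lines_equation i j (aut \<epsilon> M N p)))
        = coset_at p (lin_y m1 m2 powi i * lin_x n1 n2 powi j * (if \<epsilon> then lines_equation j i p else lines_equation i j p))"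
        using True by simp
    qed
  qed
qed

lemma line_class_alt: "line_class i j = {divisor_of (\<lambda>p. k * lines_equation i j p) | k. k \<noteq> 0}"
proof -
  have "line_class i j = (\<lambda>h. h \<otimes>\<^bsub>cartier_group\<^esub> divisor_of (lines_equation i j)) ` principal_divisors"
    by (auto simp: line_class_def divisor_class_def r_coset_def)
  also have "\<dots> = (\<lambda>k. divisor_of (\<lambda>_. k) \<otimes>\<^bsub>cartier_group\<^esub> divisor_of (lines_equation i j)) ` {k. k \<noteq> 0}"
    unfolding principal_divisors_eq by (auto simp: image_iff)
  also have "\<dots> = (\<lambda>k. divisor_of (\<lambda>p. k * lines_equation i j p)) ` {k. k \<noteq> 0}"
    by (intro image_cong refl) (simp add: divisor_of_mult lines_equation_nonzero)
  finally show ?thesis by auto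
qed

text \<open>
  By \<open>pull_lines_equation\<close> the divisors in \<open>line_class i j\<close> are pulled back into the class on the right. All divisors of this class arise, since
  pulling back permutes the rational functions.
\<close>

lemma pullback_line_class:
  assumes det: "mdet M \<noteq> 0" "mdet N \<noteq> 0"
  shows "pullback_divisor (aut \<epsilon> M N) ` line_class i j = (if \<epsilon> then line_class j i else line_class i j)"
proof -
  let ?E = "\<lambda>p. if \<epsilon> then lines_equation j i p else lines_equation i j p"
  obtain e where e: "e \<noteq> 0" "\<And>p. p \<in> Q22 \<Longrightarrow> coset_at p (pull_value \<epsilon> M N (lines_equation i j (aut \<epsilon> M N p))) = coset_at p (e * ?E p)"
    using pull_lines_equation[OF det] by blast
  have E0: "?E p \<noteq> 0" for p by (simp add: lines_equation_nonzero)
  have pull: "pullback_divisor (aut \<epsilon> M N) (divisor_of (\<lambda>p. k * lines_equation i j p)) = divisor_of (\<lambda>p. (pull_value \<epsilon> M N k * e) * ?E p)"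
    if k: "k \<noteq> 0" for k
  proof -
    have nz: "pull_value \<epsilon> M N k \<noteq> 0" by (rule pull_value_nonzero[OF det k])
    have "pullback_divisor (aut \<epsilon> M N) (divisor_of (\<lambda>p. k * lines_equation i j p))
        = divisor_of (\<lambda>p. pull_value \<epsilon> M N (k * lines_equation i j (aut \<epsilon> M N p)))"
      using k lines_equation_nonzero by (intro pullback_divisor_of det) simp
    also have "\<dots> = divisor_of (\<lambda>p. pull_value \<epsilon> M N k * (e * ?E p))"
    proof (rule divisor_of_cong)
      fix p assume p: "p \<in> Q22"
      have "coset_at p (pull_value \<epsilon> M N k * pull_value \<epsilon> M N (lines_equation i j (aut \<epsilon> M N p)))
          = coset_at p (pull_value \<epsilon> M N k * (e * ?E p))"
        using pull_value_nonzero[OF det lines_equation_nonzero] nz e(1) E0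
        by (intro coset_at_mult_cong[OF p] e(2)[OF p] refl) auto
      then show "coset_at p (pull_value \<epsilon> M N (k * lines_equation i j (aut \<epsilon> M N p))) = coset_at p (pull_value \<epsilon> M N k * (e * ?E p))"
        using k by (simp only: pull_value_mult[OF det k lines_equation_nonzero])
    qed
    finally show ?thesis by (simp only: mult.assoc)
  qed
  have target: "(if \<epsilon> then line_class j i else line_class i j) = {divisor_of (\<lambda>p. k * ?E p) | k. k \<noteq> 0}"
    by (simp add: line_class_alt)
  show ?thesis
    unfolding target unfolding line_class_alt[of i j]
  proof (intro equalityI subsetI)
    fix L assume "L \<in> pullback_divisor (aut \<epsilon> M N) ` {divisor_of (\<lambda>p. k * lines_equation i j p) | k. k \<noteq> 0}"
    then obtain k where k: "k \<noteq> 0" "L = divisor_of (\<lambda>p. (pull_value \<epsilon> M N k * e) * ?E p)" using pull by auto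
    then show "L \<in> {divisor_of (\<lambda>p. k * ?E p) | k. k \<noteq> 0}"
      using e(1) pull_value_nonzero[OF det k(1), of \<epsilon>] by (intro CollectI exI[of _ "pull_value \<epsilon> M N k * e"]) simp
  next
    fix L assume "L \<in> {divisor_of (\<lambda>p. k * ?E p) | k. k \<noteq> 0}"
    then obtain l where l: "l \<noteq> 0" "L = divisor_of (\<lambda>p. l * ?E p)" by blast
    define k where "k = pull_value \<epsilon> (madj (if \<epsilon> then N else M)) (madj (if \<epsilon> then M else N)) (l / e)"
    have "l / e \<noteq> 0" using l e by simp
    then have k: "k \<noteq> 0" "pull_value \<epsilon> M N k = l / e"
      unfolding k_def using det by (simp_all add: pull_value_nonzero pull_value_inverse_map del: divide_eq_0_iff)
    then have "L = pullback_divisor (aut \<epsilon> M N) (divisor_of (\<lambda>p. k * lines_equation i j p))"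
      using pull[OF k(1)] l e(1) by simp
    then show "L \<in> pullback_divisor (aut \<epsilon> M N) ` {divisor_of (\<lambda>p. k * lines_equation i j p) | k. k \<noteq> 0}"
      using k(1) by blast
  qed
qed

subsection \<open>The invariant classes\<close>

lemma carrier_Pic_invariants:
  assumes "G \<subseteq> carrier Aut_Q22"
  shows "carrier (Pic_invariants G) = {line_class i j | i j. (\<exists>g\<in>G. swaps g) \<longrightarrow> i = j}"
proof -
  have inv: "(\<forall>g\<in>G. pullback_divisor g ` line_class i j = line_class i j) \<longleftrightarrow> ((\<exists>g\<in>G. swaps g) \<longrightarrow> i = j)" for i j
  proof -
    have "pullback_divisor g ` line_class i j = line_class i j \<longleftrightarrow> (swaps g \<longrightarrow> i = j)" if "g \<in> G" for g
    proof -
      have g_mem: "g \<in> carrier Aut_Q22" using assms that by blast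
      obtain \<epsilon> M N where "g = aut \<epsilon> M N" "mdet M \<noteq> 0" "mdet N \<noteq> 0" using g_mem by (auto elim: carrier_Aut_cases)
      then show ?thesis by (auto simp: pullback_line_class line_class_eq_iff)
    qed
    then show ?thesis by auto
  qed
  have "carrier (Pic_invariants G) = {c \<in> {line_class i j | i j. True}. \<forall>g\<in>G. pullback_divisor g ` c = c}"
    by (simp add: Pic_invariants_def carrier_Pic_line_class)
  also have "\<dots> = {line_class i j | i j. \<forall>g\<in>G. pullback_divisor g ` line_class i j = line_class i j}" by blast
  finally show ?thesis by (simp only: inv)
qed

lemma Pic_invariants_simps [simp]:
  "monoid.mult (Pic_invariants G) = monoid.mult Pic_Q22" "one (Pic_invariants G) = one Pic_Q22"
  by (simp_all add: Pic_invariants_def)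

lemma comm_group_Pic_invariants:
  assumes "G \<subseteq> carrier Aut_Q22"
  shows "comm_group (Pic_invariants G)"
proof (rule comm_groupI)
  note c = carrier_Pic_invariants[OF assms]
  show "\<one>\<^bsub>Pic_invariants G\<^esub> \<in> carrier (Pic_invariants G)" unfolding c by (auto simp: line_class_one)
  fix x assume "x \<in> carrier (Pic_invariants G)"
  then obtain i j where x: "x = line_class i j" "(\<exists>g\<in>G. swaps g) \<longrightarrow> i = j" unfolding c by blast
  show "\<one>\<^bsub>Pic_invariants G\<^esub> \<otimes>\<^bsub>Pic_invariants G\<^esub> x = x" by (simp add: x line_class_one line_class_mult)
  show "\<exists>y\<in>carrier (Pic_invariants G). y \<otimes>\<^bsub>Pic_invariants G\<^esub> x = \<one>\<^bsub>Pic_invariants G\<^esub>"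
  proof (rule bexI[of _ "line_class (- i) (- j)"])
    show "line_class (- i) (- j) \<in> carrier (Pic_invariants G)" unfolding c using x(2) by auto
  qed (simp add: x line_class_one line_class_mult)
  fix y assume "y \<in> carrier (Pic_invariants G)"
  then obtain i' j' where y: "y = line_class i' j'" "(\<exists>g\<in>G. swaps g) \<longrightarrow> i' = j'" unfolding c by blast
  show "x \<otimes>\<^bsub>Pic_invariants G\<^esub> y \<in> carrier (Pic_invariants G)" unfolding c using x y by (auto simp: line_class_mult)
  show "x \<otimes>\<^bsub>Pic_invariants G\<^esub> y = y \<otimes>\<^bsub>Pic_invariants G\<^esub> x" by (simp add: x y line_class_mult add.commute)
  fix z assume "z \<in> carrier (Pic_invariants G)"
  then obtain i'' j'' where z: "z = line_class i'' j''" unfolding c by blast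
  show "x \<otimes>\<^bsub>Pic_invariants G\<^esub> y \<otimes>\<^bsub>Pic_invariants G\<^esub> z = x \<otimes>\<^bsub>Pic_invariants G\<^esub> (y \<otimes>\<^bsub>Pic_invariants G\<^esub> z)"
    by (simp add: x y z line_class_mult add.assoc)
qed

lemma Pic_invariants_iso_int_if_swaps:
  assumes "G \<subseteq> carrier Aut_Q22" "\<exists>g\<in>G. swaps g"
  shows "Pic_invariants G \<cong> integer_group"
proof -
  have c: "carrier (Pic_invariants G) = {line_class i i | i. True}"
    unfolding carrier_Pic_invariants[OF assms(1)] using assms(2) by auto
  have "integer_group \<cong> Pic_invariants G"
  proof (rule hom_bij_is_iso[of "\<lambda>i. line_class i i"])
    show "(\<lambda>i. line_class i i) \<in> hom integer_group (Pic_invariants G)"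
      by (rule homI) (auto simp: c line_class_mult)
    show "inj_on (\<lambda>i. line_class i i) (carrier integer_group)" by (auto simp: inj_on_def line_class_eq_iff)
    show "carrier (Pic_invariants G) \<subseteq> (\<lambda>i. line_class i i) ` carrier integer_group"
      unfolding c by (auto simp: integer_group_def)
  qed
  then show ?thesis by (rule group.iso_sym[OF group_integer_group])
qed

lemma swaps_if_Pic_invariants_iso_int:
  assumes G: "G \<subseteq> carrier Aut_Q22" and iso: "Pic_invariants G \<cong> integer_group"
  shows "\<exists>g\<in>G. swaps g"
proof (rule ccontr)
  assume ns: "\<not> (\<exists>g\<in>G. swaps g)"
  then have c: "line_class i j \<in> carrier (Pic_invariants G)" for i j
    unfolding carrier_Pic_invariants[OF G] by blast
  interpret P: comm_group "Pic_invariants G" by (rule comm_group_Pic_invariants[OF G])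
  obtain h where h: "h \<in> iso (Pic_invariants G) integer_group" using iso by (auto simp: is_iso_def)
  then have hom: "h \<in> hom (Pic_invariants G) integer_group" and inj: "inj_on h (carrier (Pic_invariants G))"
    by (auto simp: iso_def bij_betw_def)
  interpret h: group_hom "Pic_invariants G" integer_group h
    using hom P.group_axioms by (simp add: group_hom_def group_hom_axioms_def)
  define f where "f = (\<lambda>i j. h (line_class i j))"
  have f_add: "f (i + i') (j + j') = f i j + f i' j'" for i j i' j'
    using hom_mult[OF hom c[of i j] c[of i' j']] by (simp add: f_def line_class_mult)
  have f_inj: "i = i' \<and> j = j'" if "f i j = f i' j'" for i j i' j'
  proof -
    have "line_class i j = line_class i' j'"
      by (rule inj_onD[OF inj _ c c]) (use that in \<open>simp add: f_def\<close>)
    then show ?thesis by (simp add: line_class_eq_iff)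
  qed
  have f0: "f 0 0 = 0" using f_add[of 0 0 0 0] by simp
  have fn: "f (int n * i) (int n * j) = int n * f i j" for n i j
  proof (induction n)
    case (Suc n)
    then show ?case using f_add[of i "int n * i" j "int n * j"] by (simp add: algebra_simps)
  qed (simp add: f0)
  have neg: "f (- i) (- j) = - f i j" for i j using f_add[of i "- i" j "- j"] f0 by simp
  have f_mult: "f (n * i) (n * j) = n * f i j" for n i j
  proof (cases n rule: int_cases2)
    case (nonneg m)
    then show ?thesis using fn by simp
  next
    case (nonpos m)
    then show ?thesis using fn[of m i j] neg[of "int m * i" "int m * j"] by simp
  qed
  \<comment> \<open>A homomorphism from \<open>\<int>\<^sup>2\<close> to \<open>\<int>\<close> maps \<open>(b, - a)\<close> to \<open>0\<close> if it maps the generators to \<open>a\<close> and \<open>b\<close>.\<close>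
  define a b where "a = f 1 0" and "b = f 0 1"
  have "f b 0 = b * a" "f 0 (- a) = - (a * b)"
    using f_mult[of b 1 0] f_mult[of "- a" 0 1] by (simp_all add: a_def b_def)
  then have "f b (- a) = f 0 0"
    using f_add[of b 0 0 "- a"] f0 by (simp add: mult.commute)
  from f_inj[OF this] have "a = 0" by simp
  then have "f 1 0 = f 0 0" using f0 by (simp add: a_def)
  from f_inj[OF this] show False by simp
qed

section \<open>Finite groups of automorphisms\<close>

subsection \<open>Finite groups of projective transformations of the real line\<close>

definition norm_form :: "mat2 \<Rightarrow> complex \<times> complex \<Rightarrow> complex" where
  "norm_form M v = ((fst (mapp M v))\<^sup>2 + (snd (mapp M v))\<^sup>2) / of_real \<bar>mdet M\<bar>"

lemma norm_form_mscale: "k \<noteq> 0 \<Longrightarrow> norm_form (mscale k M) v = norm_form M v"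
  by (simp add: norm_form_def mapp_mscale mdet_mscale scale2_def abs_mult power_mult_distrib flip: distrib_left)

lemma norm_form_mmul:
  assumes "mdet N \<noteq> 0"
  shows "norm_form M (mapp N v) = of_real \<bar>mdet N\<bar> * norm_form (mmul M N) v"
  using assms by (simp add: norm_form_def mapp_mmul mdet_mmul abs_mult)

text \<open>
  The sum of the forms \<open>|M v|\<^sup>2 / |det M|\<close> over the group is positive definite and invariant up to scalars. It has two complex conjugate zeros
  \<open>\<tau>\<close> and \<open>cnj \<tau>\<close> on the projective line, which every member of the group fixes or, if \<open>\<epsilon>\<close> holds, exchanges. If the matrix \<open>M\<close> maps \<open>(\<tau>, 1)\<close> to \<open>e (\<tau>, 1)\<close> or
  to \<open>e (cnj \<tau>, 1)\<close>, another choice of the matrix changes \<open>e\<close> by a real factor and does not change \<open>e / cnj e\<close>. So this quotient, or in the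
  second case its inverse, depends on the projective transformation only. Taking the inverse makes \<open>\<theta>\<close> a crossed homomorphism.
\<close>

lemma orthogonal_representation:
  fixes N :: "'g monoid" and m :: "'g \<Rightarrow> mat2"
  assumes N: "group N" "finite (carrier N)"
    and det: "\<And>x. x \<in> carrier N \<Longrightarrow> mdet (m x) \<noteq> 0"
    and mult: "\<And>x y. x \<in> carrier N \<Longrightarrow> y \<in> carrier N \<Longrightarrow> \<exists>k. k \<noteq> 0 \<and> m (x \<otimes>\<^bsub>N\<^esub> y) = mscale k (mmul (m x) (m y))"
  obtains \<theta> :: "'g \<Rightarrow> complex" and \<epsilon> :: "'g \<Rightarrow> bool" where
    "\<And>x y. x \<in> carrier N \<Longrightarrow> y \<in> carrier N \<Longrightarrow> \<theta> (x \<otimes>\<^bsub>N\<^esub> y) = \<theta> x * (if \<epsilon> x then inverse (\<theta> y) else \<theta> y)"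
    "\<And>x y. x \<in> carrier N \<Longrightarrow> y \<in> carrier N \<Longrightarrow> \<epsilon> (x \<otimes>\<^bsub>N\<^esub> y) \<longleftrightarrow> \<epsilon> x \<noteq> \<epsilon> y"
    "\<And>x. x \<in> carrier N \<Longrightarrow> \<theta> x \<noteq> 0"
    "\<And>x. x \<in> carrier N \<Longrightarrow> \<theta> x = 1 \<Longrightarrow> \<not> \<epsilon> x \<Longrightarrow> \<exists>k. m x = (k, 0, 0, k)"
proof -
  interpret N: group N by fact
  define S where "S = (\<lambda>v. \<Sum>g\<in>carrier N. norm_form (m g) v)"
  have S_inv: "S (mapp (m h) v) = of_real \<bar>mdet (m h)\<bar> * S v" if h: "h \<in> carrier N" for h v
  proof -
    have "norm_form (m g) (mapp (m h) v) = of_real \<bar>mdet (m h)\<bar> * norm_form (m (g \<otimes>\<^bsub>N\<^esub> h)) v" if g: "g \<in> carrier N" for g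
    proof -
      obtain k where "k \<noteq> 0" "m (g \<otimes>\<^bsub>N\<^esub> h) = mscale k (mmul (m g) (m h))" using mult[OF g h] by blast
      then show ?thesis by (simp add: norm_form_mscale norm_form_mmul[OF det[OF h]])
    qed
    then have "S (mapp (m h) v) = of_real \<bar>mdet (m h)\<bar> * (\<Sum>g\<in>carrier N. norm_form (m (g \<otimes>\<^bsub>N\<^esub> h)) v)"
      unfolding S_def sum_distrib_left by (intro sum.cong) auto
    also have "(\<Sum>g\<in>carrier N. norm_form (m (g \<otimes>\<^bsub>N\<^esub> h)) v) = S v"
      unfolding S_def
    proof (rule sum.reindex_bij_betw)
      show "bij_betw (\<lambda>g. g \<otimes>\<^bsub>N\<^esub> h) (carrier N) (carrier N)"
        by (rule bij_betw_byWitness[where f' = "\<lambda>g. g \<otimes>\<^bsub>N\<^esub> inv\<^bsub>N\<^esub> h"]) (use h in \<open>auto simp: N.m_assoc\<close>)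
    qed
    finally show ?thesis .
  qed
  define a b c d where "a = (\<lambda>g. fst (m g))" and "b = (\<lambda>g. fst (snd (m g)))"
    and "c = (\<lambda>g. fst (snd (snd (m g))))" and "d = (\<lambda>g. snd (snd (snd (m g))))"
  have m_eq: "m g = (a g, b g, c g, d g)" for g by (simp add: a_def b_def c_def d_def)
  define A B C where "A = (\<Sum>g\<in>carrier N. ((a g)\<^sup>2 + (c g)\<^sup>2) / \<bar>mdet (m g)\<bar>)"
    and "B = (\<Sum>g\<in>carrier N. (a g * b g + c g * d g) / \<bar>mdet (m g)\<bar>)"
    and "C = (\<Sum>g\<in>carrier N. ((b g)\<^sup>2 + (d g)\<^sup>2) / \<bar>mdet (m g)\<bar>)"
  have S_eq: "S (x, y) = of_real A * x\<^sup>2 + 2 * of_real B * (x * y) + of_real C * y\<^sup>2" for x y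
  proof -
    have "norm_form (m g) (x, y) = of_real (((a g)\<^sup>2 + (c g)\<^sup>2) / \<bar>mdet (m g)\<bar>) * x\<^sup>2
        + 2 * of_real ((a g * b g + c g * d g) / \<bar>mdet (m g)\<bar>) * (x * y)
        + of_real (((b g)\<^sup>2 + (d g)\<^sup>2) / \<bar>mdet (m g)\<bar>) * y\<^sup>2" for g
      by (simp add: norm_form_def m_eq add_divide_distrib[symmetric] power2_eq_square algebra_simps del: of_real_divide)
        (simp add: add_divide_distrib algebra_simps)
    then show ?thesis
      unfolding S_def A_def B_def C_def by (simp only: sum.distrib sum_distrib_left sum_distrib_right of_real_sum)
  qed
  have pos: "0 < A * x\<^sup>2 + 2 * B * (x * y) + C * y\<^sup>2" if xy: "x \<noteq> 0 \<or> y \<noteq> 0" for x y :: real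
  proof -
    have "A * x\<^sup>2 + 2 * B * (x * y) + C * y\<^sup>2
        = (\<Sum>g\<in>carrier N. ((a g * x + b g * y)\<^sup>2 + (c g * x + d g * y)\<^sup>2) / \<bar>mdet (m g)\<bar>)"
    proof -
      have "((a g * x + b g * y)\<^sup>2 + (c g * x + d g * y)\<^sup>2) / \<bar>mdet (m g)\<bar>
          = ((a g)\<^sup>2 + (c g)\<^sup>2) / \<bar>mdet (m g)\<bar> * x\<^sup>2 + 2 * ((a g * b g + c g * d g) / \<bar>mdet (m g)\<bar>) * (x * y)
            + ((b g)\<^sup>2 + (d g)\<^sup>2) / \<bar>mdet (m g)\<bar> * y\<^sup>2" for g
        by (simp add: add_divide_distrib power2_eq_square algebra_simps)
      then show ?thesis unfolding A_def B_def C_def by (simp only: sum.distrib sum_distrib_left sum_distrib_right)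
    qed
    also have "\<dots> > 0"
    proof (rule sum_pos)
      show "carrier N \<noteq> {}" using N.one_closed by blast
      fix g assume g: "g \<in> carrier N"
      have dg: "a g * d g - b g * c g \<noteq> 0" using det[OF g] by (simp add: m_eq)
      have "a g * x + b g * y \<noteq> 0 \<or> c g * x + d g * y \<noteq> 0"
      proof (rule ccontr)
        assume "\<not> ?thesis"
        then have zero: "a g * x + b g * y = 0" "c g * x + d g * y = 0" by auto
        have "(a g * d g - b g * c g) * x = d g * (a g * x + b g * y) - b g * (c g * x + d g * y)"
          "(a g * d g - b g * c g) * y = a g * (c g * x + d g * y) - c g * (a g * x + b g * y)"
          by (simp_all add: algebra_simps)
        then have "(a g * d g - b g * c g) * x = 0" "(a g * d g - b g * c g) * y = 0" unfolding zero by simp_all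
        then show False using dg xy by simp
      qed
      then have "(a g * x + b g * y)\<^sup>2 + (c g * x + d g * y)\<^sup>2 > 0"
        by (simp add: sum_power2_gt_zero_iff)
      then show "((a g * x + b g * y)\<^sup>2 + (c g * x + d g * y)\<^sup>2) / \<bar>mdet (m g)\<bar> > 0"
        using det[OF g] by simp
    qed (rule N(2))
    finally show ?thesis .
  qed
  have A: "A > 0" using pos[of 1 0] by simp
  have "0 < A * (A * C - B\<^sup>2)" using pos[of B "- A"] A by (simp add: power2_eq_square algebra_simps)
  then have disc: "A * C - B\<^sup>2 > 0" using A by (simp add: zero_less_mult_iff)
  \<comment> \<open>The zero of \<open>A x\<^sup>2 + 2 B x + C\<close> in the upper half-plane.\<close>
  define \<tau> where "\<tau> = Complex (- B / A) (sqrt (A * C - B\<^sup>2) / A)"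
  have Im: "Im \<tau> > 0" using disc A by (simp add: \<tau>_def)
  have \<tau>_neq: "\<tau> \<noteq> cnj \<tau>" using Im by (auto simp: complex_eq_iff)
  have roots: "S (x, y) = of_real A * ((x - \<tau> * y) * (x - cnj \<tau> * y))" for x y
  proof -
    have sum: "\<tau> + cnj \<tau> = of_real (- 2 * B / A)" by (simp add: \<tau>_def complex_eq_iff)
    have "Re (\<tau> * cnj \<tau>) = (B\<^sup>2 + (sqrt (A * C - B\<^sup>2))\<^sup>2) / A\<^sup>2"
      by (simp add: \<tau>_def power2_eq_square add_divide_distrib)
    also have "\<dots> = C / A" using disc A by (simp add: power2_eq_square)
    finally have prod: "\<tau> * cnj \<tau> = of_real (C / A)" by (simp add: complex_eq_iff)
    have "of_real A * ((x - \<tau> * y) * (x - cnj \<tau> * y)) = of_real A * (x\<^sup>2 - (\<tau> + cnj \<tau>) * (x * y) + (\<tau> * cnj \<tau>) * y\<^sup>2)"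
      by (simp add: power2_eq_square algebra_simps)
    also have "\<dots> = S (x, y)" unfolding sum prod S_eq using A by (simp add: algebra_simps)
    finally show ?thesis by simp
  qed
  define \<epsilon> where "\<epsilon> = (\<lambda>g. fst (mapp (m g) (\<tau>, 1)) = cnj \<tau> * snd (mapp (m g) (\<tau>, 1)))"
  define e where "e = (\<lambda>g. snd (mapp (m g) (\<tau>, 1)))"
  have act: "mapp (m g) (\<tau>, 1) = scale2 (e g) (if \<epsilon> g then cnj \<tau> else \<tau>, 1)" and e0: "e g \<noteq> 0" if g: "g \<in> carrier N" for g
  proof -
    obtain x y where xy: "mapp (m g) (\<tau>, 1) = (x, y)" by (metis surj_pair)
    have "S (x, y) = 0" using S_inv[OF g, of "(\<tau>, 1)"] by (simp add: roots xy)
    then have alt: "x = \<tau> * y \<or> x = cnj \<tau> * y" using A by (simp add: roots)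
    then show "mapp (m g) (\<tau>, 1) = scale2 (e g) (if \<epsilon> g then cnj \<tau> else \<tau>, 1)"
      by (auto simp: \<epsilon>_def e_def xy scale2_def mult.commute)
    have "(x, y) \<noteq> (0, 0)" using mapp_nonzero[OF det[OF g], of "(\<tau>, 1)"] by (simp add: xy)
    then show "e g \<noteq> 0" using alt by (auto simp: e_def xy)
  qed
  have mapp_cnj: "mapp (m g) (cnj x, cnj y) = (cnj (fst (mapp (m g) (x, y))), cnj (snd (mapp (m g) (x, y))))" for g x y
    by (simp add: m_eq)
  have act': "mapp (m g) (cnj \<tau>, 1) = scale2 (cnj (e g)) (if \<epsilon> g then \<tau> else cnj \<tau>, 1)" if g: "g \<in> carrier N" for g
    using mapp_cnj[of g \<tau> 1] act[OF g] by (simp add: scale2_def)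
  have comp: "\<exists>k. k \<noteq> 0 \<and> e (x \<otimes>\<^bsub>N\<^esub> y) = of_real k * (e y * (if \<epsilon> y then cnj (e x) else e x)) \<and> (\<epsilon> (x \<otimes>\<^bsub>N\<^esub> y) \<longleftrightarrow> \<epsilon> x \<noteq> \<epsilon> y)"
    if x: "x \<in> carrier N" and y: "y \<in> carrier N" for x y
  proof -
    obtain k where k: "k \<noteq> 0" "m (x \<otimes>\<^bsub>N\<^esub> y) = mscale k (mmul (m x) (m y))" using mult[OF x y] by blast
    have xy: "x \<otimes>\<^bsub>N\<^esub> y \<in> carrier N" using x y by simp
    have "mapp (m (x \<otimes>\<^bsub>N\<^esub> y)) (\<tau>, 1) = scale2 (of_real k) (mapp (m x) (mapp (m y) (\<tau>, 1)))"
      by (simp only: k(2) mapp_mscale mapp_mmul)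
    also have "mapp (m x) (mapp (m y) (\<tau>, 1)) = scale2 (e y) (mapp (m x) (if \<epsilon> y then cnj \<tau> else \<tau>, 1))"
      by (simp only: act[OF y] mapp_scale2)
    also have "mapp (m x) (if \<epsilon> y then cnj \<tau> else \<tau>, 1)
        = scale2 (if \<epsilon> y then cnj (e x) else e x) (if \<epsilon> x \<noteq> \<epsilon> y then cnj \<tau> else \<tau>, 1)"
      using act[OF x] act'[OF x] by (cases "\<epsilon> y"; cases "\<epsilon> x") simp_all
    finally have eq: "scale2 (e (x \<otimes>\<^bsub>N\<^esub> y)) (if \<epsilon> (x \<otimes>\<^bsub>N\<^esub> y) then cnj \<tau> else \<tau>, 1)
        = scale2 (of_real k) (scale2 (e y) (scale2 (if \<epsilon> y then cnj (e x) else e x) (if \<epsilon> x \<noteq> \<epsilon> y then cnj \<tau> else \<tau>, 1)))"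
      unfolding act[OF xy] .
    then have e: "e (x \<otimes>\<^bsub>N\<^esub> y) = of_real k * (e y * (if \<epsilon> y then cnj (e x) else e x))" by (simp add: scale2_def)
    moreover have "e (x \<otimes>\<^bsub>N\<^esub> y) * (if \<epsilon> (x \<otimes>\<^bsub>N\<^esub> y) then cnj \<tau> else \<tau>) = e (x \<otimes>\<^bsub>N\<^esub> y) * (if \<epsilon> x \<noteq> \<epsilon> y then cnj \<tau> else \<tau>)"
      using eq unfolding e by (simp add: scale2_def mult.assoc)
    then have "(if \<epsilon> (x \<otimes>\<^bsub>N\<^esub> y) then cnj \<tau> else \<tau>) = (if \<epsilon> x \<noteq> \<epsilon> y then cnj \<tau> else \<tau>)" using e0[OF xy] by (simp only: mult_cancel_left simp_thms)
    then have "\<epsilon> (x \<otimes>\<^bsub>N\<^esub> y) \<longleftrightarrow> \<epsilon> x \<noteq> \<epsilon> y" using \<tau>_neq by (auto split: if_splits)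
    ultimately show ?thesis using k(1) by blast
  qed
  define \<theta> where "\<theta> = (\<lambda>g. if \<epsilon> g then cnj (e g) / e g else e g / cnj (e g))"
  show ?thesis
  proof (rule that[of \<theta> \<epsilon>])
    fix x y assume x: "x \<in> carrier N" and y: "y \<in> carrier N"
    obtain k where k: "k \<noteq> 0" "e (x \<otimes>\<^bsub>N\<^esub> y) = of_real k * (e y * (if \<epsilon> y then cnj (e x) else e x))"
      "\<epsilon> (x \<otimes>\<^bsub>N\<^esub> y) \<longleftrightarrow> \<epsilon> x \<noteq> \<epsilon> y" using comp[OF x y] by blast
    show "\<epsilon> (x \<otimes>\<^bsub>N\<^esub> y) \<longleftrightarrow> \<epsilon> x \<noteq> \<epsilon> y" by (rule k(3))
    show "\<theta> (x \<otimes>\<^bsub>N\<^esub> y) = \<theta> x * (if \<epsilon> x then inverse (\<theta> y) else \<theta> y)"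
      using k e0[OF x] e0[OF y] by (cases "\<epsilon> x"; cases "\<epsilon> y") (simp_all add: \<theta>_def field_simps)
  next
    fix x assume x: "x \<in> carrier N"
    show "\<theta> x \<noteq> 0" using e0[OF x] by (simp add: \<theta>_def)
    assume "\<theta> x = 1" "\<not> \<epsilon> x"
    then have "e x = cnj (e x)" using e0[OF x] by (simp add: \<theta>_def)
    then have r: "e x = of_real (Re (e x))" by (simp add: complex_eq_iff)
    define r where "r = Re (e x)"
    have er: "e x = of_real r" using r by (simp add: r_def)
    have eqs: "of_real (a x) * \<tau> + of_real (b x) = of_real r * \<tau>" "of_real (c x) * \<tau> + of_real (d x) = of_real r"
      using act[OF x] \<open>\<not> \<epsilon> x\<close> er by (simp_all add: m_eq scale2_def)
    have "c x * Im \<tau> = 0" "a x * Im \<tau> = r * Im \<tau>"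
      using arg_cong[OF eqs(2), of Im] arg_cong[OF eqs(1), of Im] by simp_all
    then have ca: "c x = 0" "a x = r" using Im by simp_all
    \<comment> \<open>A real matrix with the eigenvector \<open>(\<tau>, 1)\<close> and a real eigenvalue is scalar, as the conjugate eigenvector has the same eigenvalue.\<close>
    then have "d x = r" "b x = 0" using eqs by (auto simp: complex_eq_iff)
    then show "\<exists>k. m x = (k, 0, 0, k)" using ca by (auto simp: m_eq)
  qed
qed

subsection \<open>The groups that exchange the two rulings\<close>

lemma aut_eq_parallel:
  assumes "aut \<epsilon> M N = aut \<epsilon> M' N'" and det: "mdet M \<noteq> 0" "mdet N \<noteq> 0" "mdet M' \<noteq> 0" "mdet N' \<noteq> 0" and s: "s \<noteq> (0, 0)"
  shows "parallel (mapp M s) (mapp M' s)" "parallel (mapp N s) (mapp N' s)"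
proof -
  have "pt (mapp M s) (mapp N s) = pt (mapp M' s) (mapp N' s)"
    using fun_cong[OF assms(1), of "pt s s"] s by (simp add: aut_pt)
  then show "parallel (mapp M s) (mapp M' s)" "parallel (mapp N s) (mapp N' s)"
    using det s by (simp_all add: pt_eq_iff mapp_nonzero)
qed

text \<open>
  The kernel \<open>K\<close> of the action on the two factors has index two. If \<open>x \<in> K\<close> is the pair \<open>(m x, n x)\<close>, the first component of \<open>w x w\<^sup>-\<^sup>1\<close> is conjugate
  to \<open>n x\<close>. So an element is trivial if \<open>m\<close> is trivial on it and on its conjugate, and Goursat's lemma applies to the cyclic or dihedral image of \<open>K\<close>
  in the first factor.
\<close>

lemma family_if_swaps:
  assumes G: "subgroup G Aut_Q22" "finite G" and w: "w \<in> G" "swaps w"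
  shows "(\<exists>n D. cyclic_family n D (Aut_Q22\<lparr>carrier := G\<rparr>)) \<or> (\<exists>n D. dihedral_family n D (Aut_Q22\<lparr>carrier := G\<rparr>))"
proof -
  define E where "E = Aut_Q22\<lparr>carrier := G\<rparr>"
  have E: "carrier E = G" "monoid.mult E = monoid.mult Aut_Q22" "one E = one Aut_Q22" by (simp_all add: E_def)
  have grpE: "group E" unfolding E_def by (rule subgroup.subgroup_is_group[OF G(1) group_Aut_Q22])
  interpret E: group E by (rule grpE)
  have sub: "g \<in> carrier Aut_Q22" if "g \<in> G" for g using subgroup.mem_carrier[OF G(1) that] .
  have sw: "swaps (x \<otimes>\<^bsub>E\<^esub> y) \<longleftrightarrow> swaps x \<noteq> swaps y" if "x \<in> carrier E" "y \<in> carrier E" for x y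
    using that swaps_mult sub by (simp add: E)
  have wE: "w \<in> carrier E" using w by (simp add: E)
  define K where "K = {x \<in> carrier E. \<not> swaps x}"
  interpret K: normal K E unfolding K_def by (rule index_two(1)[OF grpE, of swaps, OF sw wE w(2)])
  define N where "N = E\<lparr>carrier := K\<rparr>"
  have grpN: "group N" unfolding N_def by (rule K.subgroup_is_group[OF grpE])
  have cN: "carrier N = K" "monoid.mult N = monoid.mult Aut_Q22" by (simp_all add: N_def E)
  have finN: "finite (carrier N)" using G(2) by (simp add: cN K_def E)
  have "\<exists>M N. x = aut False M N \<and> mdet M \<noteq> 0 \<and> mdet N \<noteq> 0" if "x \<in> K" for x
  proof -
    have x: "x \<in> carrier Aut_Q22" "\<not> swaps x" using that sub by (auto simp: K_def E)
    then obtain \<epsilon> M N where aut: "x = aut \<epsilon> M N" "mdet M \<noteq> 0" "mdet N \<noteq> 0" by (auto elim: carrier_Aut_cases)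
    then have "\<not> \<epsilon>" using x(2) by simp
    then show ?thesis using aut by (intro exI[of _ M] exI[of _ N]) simp
  qed
  then obtain m n where mn: "\<And>x. x \<in> K \<Longrightarrow> x = aut False (m x) (n x) \<and> mdet (m x) \<noteq> 0 \<and> mdet (n x) \<noteq> 0" by metis
  have mn_eq: "x = aut False (m x) (n x)" and m_det: "mdet (m x) \<noteq> 0" and n_det: "mdet (n x) \<noteq> 0" if "x \<in> K" for x
    using mn[OF that] by blast+
  have m_mult: "\<exists>k. k \<noteq> 0 \<and> m (x \<otimes>\<^bsub>N\<^esub> y) = mscale k (mmul (m x) (m y))" if "x \<in> carrier N" "y \<in> carrier N" for x y
  proof -
    have xy: "x \<in> K" "y \<in> K" using that by (simp_all add: cN)
    have xyK: "x \<otimes>\<^bsub>Aut_Q22\<^esub> y \<in> K" using K.m_closed[OF xy] by (simp add: E)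
    have "aut False (m (x \<otimes>\<^bsub>Aut_Q22\<^esub> y)) (n (x \<otimes>\<^bsub>Aut_Q22\<^esub> y)) = x \<otimes>\<^bsub>Aut_Q22\<^esub> y" using mn_eq[OF xyK] by simp
    also have "\<dots> = aut False (m x) (n x) \<otimes>\<^bsub>Aut_Q22\<^esub> aut False (m y) (n y)" using mn_eq[OF xy(1)] mn_eq[OF xy(2)] by simp
    also have "\<dots> = aut False (mmul (m x) (m y)) (mmul (n x) (n y))" using xy m_det n_det by (simp add: aut_mult)
    finally have eq: "aut False (m (x \<otimes>\<^bsub>Aut_Q22\<^esub> y)) (n (x \<otimes>\<^bsub>Aut_Q22\<^esub> y)) = aut False (mmul (m x) (m y)) (mmul (n x) (n y))" .
    have dets: "mdet (mmul (m x) (m y)) \<noteq> 0" "mdet (mmul (n x) (n y)) \<noteq> 0" using xy m_det n_det by (simp_all add: mdet_mmul)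
    obtain k where "k \<noteq> 0" "m (x \<otimes>\<^bsub>Aut_Q22\<^esub> y) = mscale k (mmul (m x) (m y))"
      by (rule mscale_if_parallel[OF dets(1) m_det[OF xyK] aut_eq_parallel(1)[OF eq m_det[OF xyK] n_det[OF xyK] dets]])
    then show ?thesis by (auto simp: cN)
  qed
  have m_det': "mdet (m x) \<noteq> 0" if "x \<in> carrier N" for x
    by (rule m_det) (use that in \<open>simp only: cN\<close>)
  show ?thesis
  proof (rule orthogonal_representation[where N = N and m = m, OF grpN finN m_det' m_mult])
    fix \<theta> :: "_ \<Rightarrow> complex" and \<epsilon> assume \<theta>: "\<And>x y. x \<in> carrier N \<Longrightarrow> y \<in> carrier N \<Longrightarrow> \<theta> (x \<otimes>\<^bsub>N\<^esub> y) = \<theta> x * (if \<epsilon> x then inverse (\<theta> y) else \<theta> y)"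
    "\<And>x y. x \<in> carrier N \<Longrightarrow> y \<in> carrier N \<Longrightarrow> \<epsilon> (x \<otimes>\<^bsub>N\<^esub> y) \<longleftrightarrow> \<epsilon> x \<noteq> \<epsilon> y"
    "\<And>x. x \<in> carrier N \<Longrightarrow> \<theta> x \<noteq> 0"
    and scalar: "\<And>x. x \<in> carrier N \<Longrightarrow> \<theta> x = 1 \<Longrightarrow> \<not> \<epsilon> x \<Longrightarrow> \<exists>k. m x = (k, 0, 0, k)"
    have trivial: "x = \<one>\<^bsub>E\<^esub>"
      if x: "x \<in> carrier E" "\<not> swaps x" and mx: "\<exists>k. m x = (k, 0, 0, k)" and my: "\<exists>k. m (w \<otimes>\<^bsub>E\<^esub> x \<otimes>\<^bsub>E\<^esub> inv\<^bsub>E\<^esub> w) = (k, 0, 0, k)" for x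
    proof -
      define y where "y = w \<otimes>\<^bsub>E\<^esub> x \<otimes>\<^bsub>E\<^esub> inv\<^bsub>E\<^esub> w"
      have xK: "x \<in> K" using x unfolding K_def by simp
      have yK: "y \<in> K" unfolding y_def by (rule K.inv_op_closed2[OF wE xK])
      obtain k l where kl: "m x = (k, 0, 0, k)" "m y = (l, 0, 0, l)" using mx my by (auto simp: y_def)
      have kl0: "k \<noteq> 0" "l \<noteq> 0" using m_det[OF xK] m_det[OF yK] by (auto simp: kl)
      obtain P Q where PQ: "w = aut True P Q" "mdet P \<noteq> 0" "mdet Q \<noteq> 0" using w(2) by (auto simp: swaps_def)
      have "y \<otimes>\<^bsub>E\<^esub> w = w \<otimes>\<^bsub>E\<^esub> x" unfolding y_def using wE x(1) by (simp add: E.m_assoc)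
      then have "aut False (m y) (n y) \<otimes>\<^bsub>Aut_Q22\<^esub> aut True P Q = aut True P Q \<otimes>\<^bsub>Aut_Q22\<^esub> aut False (m x) (n x)"
        using mn_eq[OF xK] mn_eq[OF yK] PQ(1) by (simp add: E)
      then have eq: "aut True (mmul (m y) P) (mmul (n y) Q) = aut True (mmul P (n x)) (mmul Q (m x))"
        using PQ m_det[OF xK] n_det[OF xK] m_det[OF yK] n_det[OF yK] by (simp add: aut_mult)
      have par: "parallel (mapp (n x) s) s" if s: "s \<noteq> (0, 0)" for s
      proof -
        have "parallel (mapp (mmul (m y) P) s) (mapp (mmul P (n x)) s)"
          by (rule aut_eq_parallel(1)[OF eq]) (use PQ m_det[OF xK] n_det[OF xK] m_det[OF yK] n_det[OF yK] s in \<open>simp_all add: mdet_mmul\<close>)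
        then have "parallel (scale2 (of_real l) (mapp P s)) (mapp P (mapp (n x) s))" by (simp only: mapp_mmul kl mapp_scalar)
        then have "parallel (mapp P s) (mapp P (mapp (n x) s))" using kl0 by (simp add: parallel_def scale2_def)
        then have "parallel s (mapp (n x) s)" using PQ by (simp add: parallel_mapp_iff)
        then show ?thesis by (simp add: parallel_def mult.commute)
      qed
      then obtain j where j: "n x = (j, 0, 0, j)" using scalar_if_parallel by blast
      then have "j \<noteq> 0" using n_det[OF xK] by auto
      then have "x = (\<lambda>q\<in>Q22. q)" using mn_eq[OF xK] kl0 by (simp add: kl j aut_scalar)
      then show ?thesis by (simp add: E one_Aut_Q22)
    qed
    have main: "\<exists>D :: nat monoid. group D \<and> diagonal_square_by_2 A D E"
      if A: "group A" and p: "p \<in> epi N A" and ker: "\<And>x. x \<in> carrier N \<Longrightarrow> p x = \<one>\<^bsub>A\<^esub> \<Longrightarrow> \<theta> x = 1 \<and> \<not> \<epsilon> x" for A :: "'x monoid" and p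
    proof (rule diagonal_square_if_conjugate_projections[where p = p and w = w and sw = swaps])
      show "group E" "group A" "w \<in> carrier E" "swaps w" by fact+
      show "finite (carrier E)" using G(2) by (simp add: E)
      show "p \<in> epi (E\<lparr>carrier := {x \<in> carrier E. \<not> swaps x}\<rparr>) A" using p unfolding N_def K_def .
      fix x assume x: "x \<in> carrier E" "\<not> swaps x" "p x = \<one>\<^bsub>A\<^esub>" "p (w \<otimes>\<^bsub>E\<^esub> x \<otimes>\<^bsub>E\<^esub> inv\<^bsub>E\<^esub> w) = \<one>\<^bsub>A\<^esub>"
      have xK: "x \<in> K" using x(1,2) unfolding K_def by simp
      have yK: "w \<otimes>\<^bsub>E\<^esub> x \<otimes>\<^bsub>E\<^esub> inv\<^bsub>E\<^esub> w \<in> K" by (rule K.inv_op_closed2[OF wE xK])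
      have "\<theta> x = 1 \<and> \<not> \<epsilon> x" using xK x(3) by (intro ker) (simp_all only: cN)
      then have mx: "\<exists>k. m x = (k, 0, 0, k)" using xK by (intro scalar) (simp_all only: cN not_False_eq_True)
      have "\<theta> (w \<otimes>\<^bsub>E\<^esub> x \<otimes>\<^bsub>E\<^esub> inv\<^bsub>E\<^esub> w) = 1 \<and> \<not> \<epsilon> (w \<otimes>\<^bsub>E\<^esub> x \<otimes>\<^bsub>E\<^esub> inv\<^bsub>E\<^esub> w)"
        using yK x(4) by (intro ker) (simp_all only: cN)
      then have "\<exists>k. m (w \<otimes>\<^bsub>E\<^esub> x \<otimes>\<^bsub>E\<^esub> inv\<^bsub>E\<^esub> w) = (k, 0, 0, k)" using yK by (intro scalar) (simp_all only: cN not_False_eq_True)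
      then show "x = \<one>\<^bsub>E\<^esub>" by (rule trivial[OF x(1,2) mx])
    qed (rule sw)
    show ?thesis
    proof (rule cyclic_or_dihedral_image[where \<theta> = \<theta> and \<epsilon> = \<epsilon>, OF grpN finN \<theta>])
      fix k p assume k: "k \<ge> 1" "p \<in> epi N (integer_mod_group k)"
        "\<And>x. x \<in> carrier N \<Longrightarrow> p x = \<one>\<^bsub>integer_mod_group k\<^esub> \<Longrightarrow> \<theta> x = 1 \<and> \<not> \<epsilon> x"
      from main[OF group_integer_mod_group k(2,3)] obtain D :: "nat monoid"
        where "group D" "diagonal_square_by_2 (integer_mod_group k) D E" by blast
      then show ?thesis using k(1) unfolding E_def cyclic_family_def by blast
    next
      fix k p assume k: "k \<ge> 1" "p \<in> epi N (dihedral_group k)"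
        "\<And>x. x \<in> carrier N \<Longrightarrow> p x = \<one>\<^bsub>dihedral_group k\<^esub> \<Longrightarrow> \<theta> x = 1 \<and> \<not> \<epsilon> x"
      from main[OF group_dihedral[OF k(1)] k(2,3)] obtain D :: "nat monoid"
        where "group D" "diagonal_square_by_2 (dihedral_group k) D E" by blast
      then show ?thesis using k(1) unfolding E_def dihedral_family_def by blast
    qed
  qed
qed

lemma strongly_minimal_if_swaps:
  assumes "subgroup G Aut_Q22" "finite G" "\<exists>g\<in>G. swaps g"
  shows "strongly_minimal G"
proof -
  have G: "G \<subseteq> carrier Aut_Q22" using assms(1) by (rule subgroup.subset)
  have "group_rank (Pic_invariants G) = 1"
    by (intro group_rank_eq_1_if_iso_int comm_group_Pic_invariants Pic_invariants_iso_int_if_swaps G assms(3))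
  then show ?thesis using assms by (simp add: strongly_minimal_def)
qed

subsection \<open>Realisation of all diagonal products\<close>

lemma aut_mscale:
  assumes "k \<noteq> 0" "l \<noteq> 0" "mdet M \<noteq> 0" "mdet N \<noteq> 0"
  shows "aut \<epsilon> (mscale k M) (mscale l N) = aut \<epsilon> M N"
proof (rule eq_aut_if[OF aut_extensional])
  fix s t :: "complex \<times> complex" assume st: "s \<noteq> (0, 0)" "t \<noteq> (0, 0)"
  have "pt (scale2 (of_real k) u) (scale2 (of_real l) v) = pt u v" if "u \<noteq> (0, 0)" "v \<noteq> (0, 0)" for u v
    using that assms by (subst pt_eq_iff) auto
  then show "aut \<epsilon> (mscale k M) (mscale l N) (pt s t) = (if \<epsilon> then pt (mapp M t) (mapp N s) else pt (mapp M s) (mapp N t))"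
    using st assms by (simp add: aut_pt mapp_mscale mapp_nonzero)
qed

lemma group_diagonal_product:
  assumes A: "group A" and D: "group D" and h: "\<alpha> \<in> hom A D" "\<beta> \<in> hom A D"
  shows "group (diagonal_product A A \<alpha> \<beta>)"
proof -
  interpret A: group A by fact
  interpret \<alpha>: group_hom A D \<alpha> using assms by (simp add: group_hom_def group_hom_axioms_def)
  interpret \<beta>: group_hom A D \<beta> using assms by (simp add: group_hom_def group_hom_axioms_def)
  interpret AA: group "A \<times>\<times> A" by (rule DirProd_group[OF A A])
  have "subgroup {(a, b) \<in> carrier A \<times> carrier A. \<alpha> a = \<beta> b} (A \<times>\<times> A)"
  proof (rule AA.subgroupI)
    show "{(a, b) \<in> carrier A \<times> carrier A. \<alpha> a = \<beta> b} \<subseteq> carrier (A \<times>\<times> A)" by auto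
    have "(\<one>\<^bsub>A\<^esub>, \<one>\<^bsub>A\<^esub>) \<in> {(a, b) \<in> carrier A \<times> carrier A. \<alpha> a = \<beta> b}" by simp
    then show "{(a, b) \<in> carrier A \<times> carrier A. \<alpha> a = \<beta> b} \<noteq> {}" by blast
  qed (auto simp: inv_DirProd[OF A A])
  then show ?thesis unfolding diagonal_product_def by (rule subgroup.subgroup_is_group) (rule AA.is_group)
qed

text \<open>
  \<open>H\<close> consists of the pairs \<open>(\<rho> a, \<rho> b)\<close> with \<open>\<alpha> a = \<alpha> b\<close>, with and without an exchange of the factors. It is closed under products because
  the exchange preserves this condition.
\<close>

lemma diagonal_square_realised:
  fixes A :: "'a monoid" and D :: "nat monoid" and \<rho> :: "'a \<Rightarrow> mat2"
  assumes A: "group A" "finite (carrier A)" and D: "group D" and \<alpha>: "\<alpha> \<in> epi A D"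
    and det: "\<And>a. a \<in> carrier A \<Longrightarrow> mdet (\<rho> a) \<noteq> 0"
    and mult: "\<And>a b. a \<in> carrier A \<Longrightarrow> b \<in> carrier A \<Longrightarrow> \<exists>k. k \<noteq> 0 \<and> \<rho> (a \<otimes>\<^bsub>A\<^esub> b) = mscale k (mmul (\<rho> a) (\<rho> b))"
    and faithful: "\<And>a k. a \<in> carrier A \<Longrightarrow> \<rho> a = (k, 0, 0, k) \<Longrightarrow> a = \<one>\<^bsub>A\<^esub>"
  shows "\<exists>H. strongly_minimal H \<and> diagonal_square_by_2 A D (Aut_Q22\<lparr>carrier := H\<rparr>)"
proof -
  interpret A: group A by fact
  interpret Q: group Aut_Q22 by (rule group_Aut_Q22)
  have \<alpha>_hom: "\<alpha> \<in> hom A D" using \<alpha> by (simp add: epi_def)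
  interpret \<alpha>: group_hom A D \<alpha> using A D \<alpha>_hom by (simp add: group_hom_def group_hom_axioms_def)
  define \<Phi> where "\<Phi> = (\<lambda>\<epsilon> a b. aut \<epsilon> (\<rho> a) (\<rho> b))"
  have \<Phi>_mult: "\<Phi> \<epsilon> a b \<otimes>\<^bsub>Aut_Q22\<^esub> \<Phi> \<epsilon>' a' b' = \<Phi> (\<epsilon> \<noteq> \<epsilon>') (a \<otimes>\<^bsub>A\<^esub> (if \<epsilon> then b' else a')) (b \<otimes>\<^bsub>A\<^esub> (if \<epsilon> then a' else b'))"
    if c: "a \<in> carrier A" "b \<in> carrier A" "a' \<in> carrier A" "b' \<in> carrier A" for \<epsilon> a b \<epsilon>' a' b'
  proof -
    define x y where "x = (if \<epsilon> then b' else a')" and "y = (if \<epsilon> then a' else b')"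
    have xy: "x \<in> carrier A" "y \<in> carrier A" using c by (simp_all add: x_def y_def)
    obtain k l where kl: "k \<noteq> 0" "l \<noteq> 0" "\<rho> (a \<otimes>\<^bsub>A\<^esub> x) = mscale k (mmul (\<rho> a) (\<rho> x))" "\<rho> (b \<otimes>\<^bsub>A\<^esub> y) = mscale l (mmul (\<rho> b) (\<rho> y))"
      using mult[OF c(1) xy(1)] mult[OF c(2) xy(2)] by blast
    have "\<Phi> \<epsilon> a b \<otimes>\<^bsub>Aut_Q22\<^esub> \<Phi> \<epsilon>' a' b' = aut (\<epsilon> \<noteq> \<epsilon>') (mmul (\<rho> a) (\<rho> x)) (mmul (\<rho> b) (\<rho> y))"
      unfolding \<Phi>_def x_def y_def using c det by (cases \<epsilon>) (simp_all add: aut_mult)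
    also have "\<dots> = \<Phi> (\<epsilon> \<noteq> \<epsilon>') (a \<otimes>\<^bsub>A\<^esub> x) (b \<otimes>\<^bsub>A\<^esub> y)"
      unfolding \<Phi>_def kl(3,4) using kl(1,2) c xy det by (intro aut_mscale[symmetric]) (simp_all add: mdet_mmul)
    finally show ?thesis by (simp only: x_def y_def)
  qed
  have \<Phi>_closed: "\<Phi> \<epsilon> a b \<in> carrier Aut_Q22" if "a \<in> carrier A" "b \<in> carrier A" for \<epsilon> a b
    unfolding \<Phi>_def using that det by (simp add: aut_in_carrier)
  have \<Phi>_swaps: "swaps (\<Phi> \<epsilon> a b) \<longleftrightarrow> \<epsilon>" if "a \<in> carrier A" "b \<in> carrier A" for \<epsilon> a b
    unfolding \<Phi>_def using that det by simp
  have \<Phi>_one: "\<Phi> False \<one>\<^bsub>A\<^esub> \<one>\<^bsub>A\<^esub> = \<one>\<^bsub>Aut_Q22\<^esub>"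
    using \<Phi>_mult[of "\<one>\<^bsub>A\<^esub>" "\<one>\<^bsub>A\<^esub>" "\<one>\<^bsub>A\<^esub>" "\<one>\<^bsub>A\<^esub>" False False] \<Phi>_closed[of "\<one>\<^bsub>A\<^esub>" "\<one>\<^bsub>A\<^esub>" False] by simp
  have \<Phi>_ker: "a = \<one>\<^bsub>A\<^esub> \<and> b = \<one>\<^bsub>A\<^esub>" if c: "a \<in> carrier A" "b \<in> carrier A" and one: "\<Phi> False a b = \<one>\<^bsub>Aut_Q22\<^esub>" for a b
  proof -
    have eq: "aut False (\<rho> a) (\<rho> b) = aut False (1, 0, 0, 1) (1, 0, 0, 1)"
      using one by (simp add: \<Phi>_def one_Aut_Q22 aut_scalar)
    have "parallel (mapp (\<rho> a) s) s \<and> parallel (mapp (\<rho> b) s) s" if s: "s \<noteq> (0, 0)" for s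
      using aut_eq_parallel[OF eq _ _ _ _ s] c det by simp
    then obtain k l where "\<rho> a = (k, 0, 0, k)" "\<rho> b = (l, 0, 0, l)" using scalar_if_parallel by metis
    then show ?thesis using faithful c by blast
  qed
  define H where "H = {\<Phi> \<epsilon> a b | \<epsilon> a b. a \<in> carrier A \<and> b \<in> carrier A \<and> \<alpha> a = \<alpha> b}"
  have H_mem: "\<Phi> \<epsilon> a b \<in> H" if "a \<in> carrier A" "b \<in> carrier A" "\<alpha> a = \<alpha> b" for \<epsilon> a b
    using that unfolding H_def by blast
  have H_sub: "subgroup H Aut_Q22"
  proof (rule Q.subgroupI)
    show "H \<subseteq> carrier Aut_Q22" unfolding H_def using \<Phi>_closed by blast
    show "H \<noteq> {}" using H_mem[of "\<one>\<^bsub>A\<^esub>" "\<one>\<^bsub>A\<^esub>"] by auto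
    fix x assume "x \<in> H"
    then obtain \<epsilon> a b where x: "x = \<Phi> \<epsilon> a b" "a \<in> carrier A" "b \<in> carrier A" "\<alpha> a = \<alpha> b" unfolding H_def by blast
    let ?a = "inv\<^bsub>A\<^esub> (if \<epsilon> then b else a)" and ?b = "inv\<^bsub>A\<^esub> (if \<epsilon> then a else b)"
    have "\<Phi> \<epsilon> ?a ?b \<otimes>\<^bsub>Aut_Q22\<^esub> x = \<one>\<^bsub>Aut_Q22\<^esub>"
      unfolding x(1) using x by (subst \<Phi>_mult) (auto simp: \<Phi>_one)
    then have "inv\<^bsub>Aut_Q22\<^esub> x = \<Phi> \<epsilon> ?a ?b"
      using x by (intro Q.inv_equality) (auto intro: \<Phi>_closed)
    then show "inv\<^bsub>Aut_Q22\<^esub> x \<in> H" using x H_mem[of ?a ?b \<epsilon>] by (auto simp: \<alpha>.hom_inv)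
    fix y assume "y \<in> H"
    then obtain \<epsilon>' a' b' where y: "y = \<Phi> \<epsilon>' a' b'" "a' \<in> carrier A" "b' \<in> carrier A" "\<alpha> a' = \<alpha> b'" unfolding H_def by blast
    show "x \<otimes>\<^bsub>Aut_Q22\<^esub> y \<in> H"
      unfolding x(1) y(1) \<Phi>_mult[OF x(2,3) y(2,3)] using x y by (intro H_mem) auto
  qed
  have "H \<subseteq> (\<lambda>(\<epsilon>, a, b). \<Phi> \<epsilon> a b) ` (UNIV \<times> carrier A \<times> carrier A)" unfolding H_def by force
  then have H_fin: "finite H" using A(2) finite_subset by fastforce
  have w: "\<Phi> True \<one>\<^bsub>A\<^esub> \<one>\<^bsub>A\<^esub> \<in> H" "swaps (\<Phi> True \<one>\<^bsub>A\<^esub> \<one>\<^bsub>A\<^esub>)" using H_mem \<Phi>_swaps by simp_all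
  have sm: "strongly_minimal H" using strongly_minimal_if_swaps[OF H_sub H_fin] w by blast
  define E where "E = Aut_Q22\<lparr>carrier := H\<rparr>"
  have E: "carrier E = H" "monoid.mult E = monoid.mult Aut_Q22" by (simp_all add: E_def)
  have grpE: "group E" unfolding E_def by (rule subgroup.subgroup_is_group[OF H_sub group_Aut_Q22])
  have sw: "swaps (x \<otimes>\<^bsub>E\<^esub> y) \<longleftrightarrow> swaps x \<noteq> swaps y" if "x \<in> carrier E" "y \<in> carrier E" for x y
    using that swaps_mult subgroup.mem_carrier[OF H_sub] by (simp add: E)
  note index = index_two[OF grpE, of swaps, OF sw, of "\<Phi> True \<one>\<^bsub>A\<^esub> \<one>\<^bsub>A\<^esub>", unfolded E(1), OF _ _ w]
  define K where "K = {x \<in> H. \<not> swaps x}"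
  have K: "K \<lhd> E" "E Mod K \<cong> integer_mod_group 2" unfolding K_def using index by (simp_all add: E(1))
  have iso: "diagonal_product A A \<alpha> \<alpha> \<cong> E\<lparr>carrier := K\<rparr>"
  proof (rule hom_bij_is_iso[of "\<lambda>(a, b). \<Phi> False a b"])
    have cD: "carrier (diagonal_product A A \<alpha> \<alpha>) = {(a, b). a \<in> carrier A \<and> b \<in> carrier A \<and> \<alpha> a = \<alpha> b}"
      by (auto simp: diagonal_product_def)
    show "(\<lambda>(a, b). \<Phi> False a b) \<in> hom (diagonal_product A A \<alpha> \<alpha>) (E\<lparr>carrier := K\<rparr>)"
    proof (rule homI)
      fix x assume "x \<in> carrier (diagonal_product A A \<alpha> \<alpha>)"
      then show "(case x of (a, b) \<Rightarrow> \<Phi> False a b) \<in> carrier (E\<lparr>carrier := K\<rparr>)"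
        unfolding cD by (auto simp: K_def H_mem \<Phi>_swaps)
      fix y assume "y \<in> carrier (diagonal_product A A \<alpha> \<alpha>)"
      with \<open>x \<in> carrier (diagonal_product A A \<alpha> \<alpha>)\<close>
      show "(case x \<otimes>\<^bsub>diagonal_product A A \<alpha> \<alpha>\<^esub> y of (a, b) \<Rightarrow> \<Phi> False a b)
          = (case x of (a, b) \<Rightarrow> \<Phi> False a b) \<otimes>\<^bsub>E\<lparr>carrier := K\<rparr>\<^esub> (case y of (a, b) \<Rightarrow> \<Phi> False a b)"
        unfolding cD by (auto simp: E \<Phi>_mult diagonal_product_def)
    qed
    show "inj_on (\<lambda>(a, b). \<Phi> False a b) (carrier (diagonal_product A A \<alpha> \<alpha>))"
    proof (rule inj_onI)
      fix x y assume "x \<in> carrier (diagonal_product A A \<alpha> \<alpha>)" "y \<in> carrier (diagonal_product A A \<alpha> \<alpha>)"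
        and eq: "(case x of (a, b) \<Rightarrow> \<Phi> False a b) = (case y of (a, b) \<Rightarrow> \<Phi> False a b)"
      then obtain a b a' b' where ab: "x = (a, b)" "y = (a', b')" "a \<in> carrier A" "b \<in> carrier A" "a' \<in> carrier A" "b' \<in> carrier A"
        unfolding cD by auto
      have "\<Phi> False (a \<otimes>\<^bsub>A\<^esub> inv\<^bsub>A\<^esub> a') (b \<otimes>\<^bsub>A\<^esub> inv\<^bsub>A\<^esub> b') = \<Phi> False a b \<otimes>\<^bsub>Aut_Q22\<^esub> \<Phi> False (inv\<^bsub>A\<^esub> a') (inv\<^bsub>A\<^esub> b')"
        using ab by (subst \<Phi>_mult) auto
      also have "\<dots> = \<Phi> False a' b' \<otimes>\<^bsub>Aut_Q22\<^esub> \<Phi> False (inv\<^bsub>A\<^esub> a') (inv\<^bsub>A\<^esub> b')" using eq ab by simp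
      also have "\<dots> = \<one>\<^bsub>Aut_Q22\<^esub>" using ab by (subst \<Phi>_mult) (auto simp: \<Phi>_one)
      finally have "a \<otimes>\<^bsub>A\<^esub> inv\<^bsub>A\<^esub> a' = \<one>\<^bsub>A\<^esub> \<and> b \<otimes>\<^bsub>A\<^esub> inv\<^bsub>A\<^esub> b' = \<one>\<^bsub>A\<^esub>"
        using ab by (intro \<Phi>_ker) auto
      then show "x = y" using ab by (metis A.inv_equality A.inv_inv A.inv_closed)
    qed
    show "carrier (E\<lparr>carrier := K\<rparr>) \<subseteq> (\<lambda>(a, b). \<Phi> False a b) ` carrier (diagonal_product A A \<alpha> \<alpha>)"
    proof
      fix x assume "x \<in> carrier (E\<lparr>carrier := K\<rparr>)"
      then obtain \<epsilon> a b where x: "x = \<Phi> \<epsilon> a b" "a \<in> carrier A" "b \<in> carrier A" "\<alpha> a = \<alpha> b" "\<not> swaps x"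
        by (auto simp: K_def H_def)
      then have "\<not> \<epsilon>" using \<Phi>_swaps by blast
      then show "x \<in> (\<lambda>(a, b). \<Phi> False a b) ` carrier (diagonal_product A A \<alpha> \<alpha>)"
        using x unfolding cD by (intro image_eqI[of _ _ "(a, b)"]) auto
    qed
  qed
  have "E\<lparr>carrier := K\<rparr> \<cong> diagonal_product A A \<alpha> \<alpha>"
    by (rule group.iso_sym[OF group_diagonal_product[OF A(1) D \<alpha>_hom \<alpha>_hom] iso])
  then have "is_extension (diagonal_product A A \<alpha> \<alpha>) (integer_mod_group 2) E"
    unfolding is_extension_def using K by blast
  then have "diagonal_square_by_2 A D E" unfolding diagonal_square_by_2_def using \<alpha> by blast
  then show ?thesis using sm unfolding E_def by blast
qed

text \<open>The rotation by the angle \<open>x\<close>, if \<open>s\<close> holds after the reflection \<open>diag(1, -1)\<close>.\<close>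

definition isometry :: "real \<Rightarrow> bool \<Rightarrow> mat2" where
  "isometry x s = (if s then (cos x, sin x, sin x, - cos x) else (cos x, - sin x, sin x, cos x))"

lemma isometry_mult: "mmul (isometry x s) (isometry y t) = isometry (if s then x - y else x + y) (s \<noteq> t)"
  by (cases s; cases t) (simp_all add: isometry_def cos_add sin_add cos_diff sin_diff algebra_simps)

text \<open>
  Projectively, the rotation by \<open>\<pi>\<close> is the identity, so the rotation by \<open>\<pi> / n\<close> has order \<open>n\<close>.
\<close>

definition rotation :: "nat \<Rightarrow> int \<Rightarrow> bool \<Rightarrow> mat2" where
  "rotation n a s = isometry (pi * of_int a / of_nat n) s"

lemma rotation_mult: "mmul (rotation n a s) (rotation n b t) = rotation n (if s then a - b else a + b) (s \<noteq> t)"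
proof -
  have "pi * real_of_int (a + b) / real n = pi * real_of_int a / real n + pi * real_of_int b / real n"
    "pi * real_of_int (a - b) / real n = pi * real_of_int a / real n - pi * real_of_int b / real n"
    by (simp_all only: of_int_add of_int_diff add_divide_distrib diff_divide_distrib distrib_left right_diff_distrib)
  then show ?thesis unfolding rotation_def isometry_mult by (cases s) (simp_all only: if_True if_False)
qed

lemma mdet_rotation: "mdet (rotation n a s) \<noteq> 0"
proof -
  have "mdet (isometry x s) = (if s then - 1 else 1)" for x
  proof -
    have "sin x * sin x = 1 - cos x * cos x" using sin_cos_squared_add3[of x] by linarith
    then show ?thesis by (simp add: isometry_def)
  qed
  then show ?thesis by (simp add: rotation_def)
qed

lemma rotation_mod:
  assumes "n \<ge> 1"
  shows "\<exists>k. k \<noteq> 0 \<and> rotation n (a mod int n) s = mscale k (rotation n a s)"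
proof -
  define q where "q = a div int n"
  have "real_of_int (a mod int n) = real_of_int a - real n * real_of_int q"
    by (simp add: q_def minus_mult_div_eq_mod[symmetric])
  then have "pi * real_of_int (a mod int n) / real n = pi * (real_of_int a - real n * real_of_int q) / real n" by simp
  also have "\<dots> = pi * real_of_int a / real n - pi * real_of_int q"
    using assms by (simp add: right_diff_distrib diff_divide_distrib)
  finally have ang: "pi * real_of_int (a mod int n) / real n = pi * real_of_int a / real n - pi * real_of_int q" .
  have s0: "sin (pi * real_of_int q) = 0" by (rule sin_npi_int)
  define k where "k = cos (pi * real_of_int q)"
  have "k \<noteq> 0" using sin_cos_squared_add[of "pi * real_of_int q"] s0 by (auto simp: k_def)
  moreover have "isometry (y - pi * real_of_int q) s = mscale k (isometry y s)" for y
    unfolding isometry_def cos_diff sin_diff s0 k_def[symmetric] by (cases s) simp_all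
  ultimately show ?thesis unfolding rotation_def ang by blast
qed

lemma rotation_scalar:
  assumes "n \<ge> 1" "a \<in> {0..<int n}" "rotation n a s = (k, 0, 0, k)"
  shows "a = 0 \<and> \<not> s"
proof -
  define x where "x = pi * real_of_int a / real n"
  have s0: "sin x = 0" using assms(3) by (cases s) (simp_all add: rotation_def isometry_def flip: x_def)
  have "cos x \<noteq> 0" using sin_cos_squared_add[of x] s0 by auto
  then have "\<not> s" using assms(3) by (cases s) (auto simp: rotation_def isometry_def simp flip: x_def)
  moreover have "a = 0"
  proof (rule ccontr)
    assume "a \<noteq> 0"
    then have "0 < x" using assms by (simp add: x_def)
    moreover have "x < pi"
    proof -
      have "real_of_int a < real n" using assms(2) by simp
      then show ?thesis using assms(1) by (simp add: x_def divide_less_eq)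
    qed
    ultimately show False using sin_gt_zero[of x] s0 by simp
  qed
  ultimately show ?thesis by simp
qed

lemma dihedral_families_realised:
  assumes n: "n \<ge> 1" and D: "group D" and \<alpha>: "\<alpha> \<in> epi (dihedral_group n) D"
  shows "\<exists>H. strongly_minimal H \<and> dihedral_family n D (Aut_Q22\<lparr>carrier := H\<rparr>)"
proof -
  have c: "carrier (dihedral_group n) = {0..<int n} \<times> UNIV" by (simp add: dihedral_group_def)
  have "\<exists>H. strongly_minimal H \<and> diagonal_square_by_2 (dihedral_group n) D (Aut_Q22\<lparr>carrier := H\<rparr>)"
  proof (rule diagonal_square_realised[where \<rho> = "\<lambda>(a, s). rotation n a s", OF group_dihedral[OF n] _ D \<alpha>])
    show "finite (carrier (dihedral_group n))" by (simp add: c)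
    show "mdet (case x of (a, s) \<Rightarrow> rotation n a s) \<noteq> 0" for x using mdet_rotation by (auto split: prod.split)
    fix x y :: "int \<times> bool"
    obtain a s b t where xy: "x = (a, s)" "y = (b, t)" by (metis surj_pair)
    have "x \<otimes>\<^bsub>dihedral_group n\<^esub> y = ((if s then a - b else a + b) mod int n, s \<noteq> t)" by (simp add: xy dihedral_group_def)
    then show "\<exists>k. k \<noteq> 0 \<and> (case x \<otimes>\<^bsub>dihedral_group n\<^esub> y of (a, s) \<Rightarrow> rotation n a s)
        = mscale k (mmul (case x of (a, s) \<Rightarrow> rotation n a s) (case y of (a, s) \<Rightarrow> rotation n a s))"
      using rotation_mod[OF n] by (simp only: xy prod.case rotation_mult)
    fix k assume x: "x \<in> carrier (dihedral_group n)" "(case x of (a, s) \<Rightarrow> rotation n a s) = (k, 0, 0, k)"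
    then show "x = \<one>\<^bsub>dihedral_group n\<^esub>"
      using rotation_scalar[OF n, of a s k] by (simp add: xy c dihedral_group_def)
  qed
  then show ?thesis using n D by (auto simp: dihedral_family_def)
qed

lemma cyclic_families_realised:
  assumes n: "n \<ge> 1" and D: "group D" and \<alpha>: "\<alpha> \<in> epi (integer_mod_group n) D"
  shows "\<exists>H. strongly_minimal H \<and> cyclic_family n D (Aut_Q22\<lparr>carrier := H\<rparr>)"
proof -
  have "\<exists>H. strongly_minimal H \<and> diagonal_square_by_2 (integer_mod_group n) D (Aut_Q22\<lparr>carrier := H\<rparr>)"
  proof (rule diagonal_square_realised[where \<rho> = "\<lambda>a. rotation n a False", OF group_integer_mod_group _ D \<alpha>])
    show "finite (carrier (integer_mod_group n))" using n by (simp add: carrier_cyclic)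
    show "mdet (rotation n a False) \<noteq> 0" for a by (rule mdet_rotation)
    show "\<exists>k. k \<noteq> 0 \<and> rotation n (a \<otimes>\<^bsub>integer_mod_group n\<^esub> b) False = mscale k (mmul (rotation n a False) (rotation n b False))" for a b
      using rotation_mod[OF n, of "a + b" False] by (simp add: rotation_mult)
    show "a = \<one>\<^bsub>integer_mod_group n\<^esub>" if "a \<in> carrier (integer_mod_group n)" "rotation n a False = (k, 0, 0, k)" for a k
      using rotation_scalar[OF n _ that(2)] that(1) n by (simp add: carrier_cyclic)
  qed
  then show ?thesis using n D by (auto simp: cyclic_family_def)
qed

theorem proposition3p2:
  fixes E :: "'e monoid"
  shows
    "(\<forall>G. subgroup G Aut_Q22 \<and> finite G \<and> Pic_invariants G \<cong> integer_group \<longrightarrow>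
        strongly_minimal G \<and>
        ((\<exists>n D. cyclic_family n D (Aut_Q22\<lparr>carrier := G\<rparr>)) \<or>
         (\<exists>n D. dihedral_family n D (Aut_Q22\<lparr>carrier := G\<rparr>)))) \<and>
     ((\<exists>n D. cyclic_family n D E) \<longleftrightarrow> (\<exists>m k. abelian_family m k E)) \<and>
     (\<forall>n D. n \<ge> 1 \<and> group D \<and> epi (integer_mod_group n) D \<noteq> {} \<longrightarrow>
        (\<exists>H. strongly_minimal H \<and> cyclic_family n D (Aut_Q22\<lparr>carrier := H\<rparr>))) \<and>
     (\<forall>n D. n \<ge> 1 \<and> group D \<and> epi (dihedral_group n) D \<noteq> {} \<longrightarrow>
        (\<exists>H. strongly_minimal H \<and> dihedral_family n D (Aut_Q22\<lparr>carrier := H\<rparr>)))"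
proof (intro conjI allI impI)
  fix G assume G: "subgroup G Aut_Q22 \<and> finite G \<and> Pic_invariants G \<cong> integer_group"
  then have "G \<subseteq> carrier Aut_Q22" by (blast dest: subgroup.subset)
  then obtain w where w: "w \<in> G" "swaps w" using swaps_if_Pic_invariants_iso_int G by blast
  show "strongly_minimal G" using strongly_minimal_if_swaps G w by blast
  show "(\<exists>n D. cyclic_family n D (Aut_Q22\<lparr>carrier := G\<rparr>)) \<or> (\<exists>n D. dihedral_family n D (Aut_Q22\<lparr>carrier := G\<rparr>))"
    using family_if_swaps G w by blast
next
  show "(\<exists>n D. cyclic_family n D E) \<longleftrightarrow> (\<exists>m k. abelian_family m k E)" by (rule cyclic_family_iff_abelian_family)
next
  fix n and D :: "nat monoid" assume "n \<ge> 1 \<and> group D \<and> epi (integer_mod_group n) D \<noteq> {}"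
  then show "\<exists>H. strongly_minimal H \<and> cyclic_family n D (Aut_Q22\<lparr>carrier := H\<rparr>)"
    using cyclic_families_realised by blast
next
  fix n and D :: "nat monoid" assume "n \<ge> 1 \<and> group D \<and> epi (dihedral_group n) D \<noteq> {}"
  then show "\<exists>H. strongly_minimal H \<and> dihedral_family n D (Aut_Q22\<lparr>carrier := H\<rparr>)"
    using dihedral_families_realised by blast
qed

end
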